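(* Let $(\mathcal C,\otimes,\mathbf 1,c)$ be a braided finite tensor category over an algebraically closed field $\Bbbk$, and let $(\mathcal M,\triangleright,e)$ be a nonzero, exact, indecomposable, braided finite left $\mathcal C$-module category. If $\mathcal M$ is nondegenerate, then $\mathcal M$ is weakly factorizable and, as a result, has trivial symmetric center.
   Context: Conventions: $\Bbbk$ is an algebraically closed field; categories are $\Bbbk$-linear abelian, functors are $\Bbbk$-linear and right exact; monoidal and module categories are written as if strict. A finite tensor category is a finite $\Bbbk$-linear abelian rigid monoidal category with $\otimes$ bilinear and $\mathrm{End}(\mathbf 1)\cong\Bbbk$; $X^*$ is the left dual, with $\mathrm{ev}^L_X:X^*\otimes X\to\mathbf 1$, $\mathrm{coev}^L_X:\mathbf 1\to X\otimes X^*$. A braiding is a natural isomorphism $c_{X,Y}:X\otimes Y\to Y\otimes X$ with $c_{X\otimes Y,Z}=(c_{X,Z}\otimes \mathrm{id}_Y)(\mathrm{id}_X\otimes c_{Y,Z})$ and $c_{X,Y\otimes Z}=(\mathrm{id}_Y\otimes c_{X,Z})(c_{X,Y}\otimes\mathrm{id}_Z)$. A (finite) left $\mathcal C$-module category $(\mathcal M,\triangleright)$ is a finite abelian category with an action bifunctor $\triangleright$, bilinear on morphisms, such that $(-\triangleright M)$ is exact for each $M$. It is exact if $P\triangleright M$ is projective for all projective $P\in\mathcal C$ and all $M\in\mathcal M$. It is braided if equipped with a natural isomorphism $e_{X,M}:X\triangleright M\to X\triangleright M$ such that $e_{X\otimes Y,M}=(\mathrm{id}_X\triangleright e_{Y,M})(c_{Y,X}\triangleright\mathrm{id}_M)(\mathrm{id}_Y\triangleright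 e_{X,M})(c_{Y,X}^{-1}\triangleright\mathrm{id}_M)$ and $e_{X,Y\triangleright M}=(c_{Y,X}\triangleright\mathrm{id}_M)(\mathrm{id}_Y\triangleright e_{X,M})(c_{X,Y}\triangleright\mathrm{id}_M)$. Internal Homs: $\underline{\mathrm{Hom}}(M,-):\mathcal M\to\mathcal C$ is the right adjoint of $(-\triangleright M)$; $\mathrm{coev}_{\mathbf 1,M}:\mathbf 1\to\underline{\mathrm{Hom}}(M,M)$ is the adjunct of $\mathrm{id}_M$ and $\mathrm{ev}_{M,N}:\underline{\mathrm{Hom}}(M,N)\triangleright M\to N$ the counit. There is a canonical isomorphism $X\otimes\underline{\mathrm{Hom}}(M,N)\cong\underline{\mathrm{Hom}}(M,X\triangleright N)$ (adjunct of $\mathrm{id}_X\triangleright\mathrm{ev}_{M,N}$). Put $\mathtt E_{\mathcal C}=\int_{X\in\mathcal C}X\otimes X^*$ and $\mathtt E_{\mathcal M}=\int_{M\in\mathcal M}\underline{\mathrm{Hom}}(M,M)$ (ends in $\mathcal C$), with canonical morphisms $\pi_{\mathcal C}(X):\mathtt E_{\mathcal C}\to X\otimes X^*$ and $\pi_{\mathcal M}(M):\mathtt E_{\mathcal M}\to\underline{\mathrm{Hom}}(M,M)$. Universal copairing: $\omega_{\mathcal M}:\mathbf 1\to\mathtt E_{\mathcal C}\otimes\mathtt E_{\mathcal M}$ is the unique morphism such that for all $X\in\mathcal C$, $M\in\mathcal M$, $(\pi_{\mathcal C}(X)\otimes\pi_{\mathcal M}(M))\circ\omega_{\mathcal M}$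 equals the composite $\mathbf 1\xrightarrow{\mathrm{coev}^L_X\otimes\mathrm{coev}_{\mathbf 1,M}}X\otimes X^*\otimes\underline{\mathrm{Hom}}(M,M)\cong X\otimes\underline{\mathrm{Hom}}(M,X^*\triangleright M)\xrightarrow{\mathrm{id}\otimes\underline{\mathrm{Hom}}(\mathrm{id},e_{X^*,M})}X\otimes\underline{\mathrm{Hom}}(M,X^*\triangleright M)\cong X\otimes X^*\otimes\underline{\mathrm{Hom}}(M,M)$. Nondegenerate: $\theta_{\mathcal M}:=(\mathrm{ev}^L_{\mathtt E_{\mathcal C}}\otimes\mathrm{id}_{\mathtt E_{\mathcal M}})(\mathrm{id}_{\mathtt E_{\mathcal C}^*}\otimes\omega_{\mathcal M}):\mathtt E_{\mathcal C}^*\to\mathtt E_{\mathcal M}$ is an isomorphism in $\mathcal C$. Weakly factorizable: the linear map $\Omega_{\mathcal M}:\mathrm{Hom}_{\mathcal C}(\mathtt E_{\mathcal C},\mathbf 1)\to\mathrm{Hom}_{\mathcal C}(\mathbf 1,\mathtt E_{\mathcal M})$, $f\mapsto(f\otimes\mathrm{id}_{\mathtt E_{\mathcal M}})\circ\omega_{\mathcal M}$, is bijective. Symmetric center: $\mathcal Z_2(\mathcal M)$ is the full subcategory of $\mathcal C$ on the objects $X$ with $e_{X,M}=\mathrm{id}_{X\triangleright M}$ for all $M\in\mathcal M$. It is trivial if $\mathcal Z_2(\mathcal M)\simeq\mathsf{FdVec}$, the category of finite-dimensional $\Bbbk$-vector spaces. *)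

theory Defs
  imports "HOL-Computational_Algebra.Computational_Algebra" "HOL-Library.FuncSet"
begin

section \<open>Vector spaces with explicit carrier\<close>

record ('k, 'v) vec_space =
  vcarrier :: "'v set"
  vzero :: 'v
  vadd :: "'v \<Rightarrow> 'v \<Rightarrow> 'v"
  vscale :: "'k \<Rightarrow> 'v \<Rightarrow> 'v"

locale vector_space_struct =
  fixes V :: "('k::field, 'v) vec_space"
  assumes zero_closed: "vzero V \<in> vcarrier V"
    and add_closed: "\<lbrakk>x \<in> vcarrier V; y \<in> vcarrier V\<rbrakk> \<Longrightarrow> vadd V x y \<in> vcarrier V"
    and scale_closed: "x \<in> vcarrier V \<Longrightarrow> vscale V a x \<in> vcarrier V"
    and add_assoc: "\<lbrakk>x \<in> vcarrier V; y \<in> vcarrier V; z \<in> vcarrier V\<rbrakk>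
      \<Longrightarrow> vadd V (vadd V x y) z = vadd V x (vadd V y z)"
    and add_comm: "\<lbrakk>x \<in> vcarrier V; y \<in> vcarrier V\<rbrakk> \<Longrightarrow> vadd V x y = vadd V y x"
    and add_zero: "x \<in> vcarrier V \<Longrightarrow> vadd V (vzero V) x = x"
    and add_inverse: "x \<in> vcarrier V \<Longrightarrow> \<exists>y \<in> vcarrier V. vadd V x y = vzero V"
    and scale_add: "\<lbrakk>x \<in> vcarrier V; y \<in> vcarrier V\<rbrakk>
      \<Longrightarrow> vscale V a (vadd V x y) = vadd V (vscale V a x) (vscale V a y)"
    and add_scale: "x \<in> vcarrier V
      \<Longrightarrow> vscale V (a + b) x = vadd V (vscale V a x) (vscale V b x)"
    and scale_scale: "x \<in> vcarrier V \<Longrightarrow> vscale V a (vscale V b x) = vscale V (a * b) x"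
    and scale_one: "x \<in> vcarrier V \<Longrightarrow> vscale V 1 x = x"

inductive_set lin_span :: "('k, 'v) vec_space \<Rightarrow> 'v set \<Rightarrow> 'v set"
  for V :: "('k, 'v) vec_space" and S :: "'v set" where
  zero: "vzero V \<in> lin_span V S"
| base: "x \<in> S \<Longrightarrow> x \<in> lin_span V S"
| add: "\<lbrakk>x \<in> lin_span V S; y \<in> lin_span V S\<rbrakk> \<Longrightarrow> vadd V x y \<in> lin_span V S"
| scale: "x \<in> lin_span V S \<Longrightarrow> vscale V a x \<in> lin_span V S"

definition finite_dim :: "('k, 'v) vec_space \<Rightarrow> bool" where
  "finite_dim V \<longleftrightarrow> (\<exists>S. finite S \<and> S \<subseteq> vcarrier V \<and> vcarrier V \<subseteq> lin_span V S)"

definition linear_maps :: "('k, 'v) vec_space \<Rightarrow> ('k, 'w) vec_space \<Rightarrow> ('v \<Rightarrow> 'w) set" where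
  "linear_maps V W = {f \<in> vcarrier V \<rightarrow>\<^sub>E vcarrier W.
     (\<forall>x \<in> vcarrier V. \<forall>y \<in> vcarrier V. f (vadd V x y) = vadd W (f x) (f y)) \<and>
     (\<forall>a. \<forall>x \<in> vcarrier V. f (vscale V a x) = vscale W a (f x))}"


section \<open>Linear categories\<close>

text \<open>Every arrow carries its domain and codomain; \<open>Zer A B\<close> is the zero morphism from A to B.
  \<open>Add\<close> and \<open>Scale\<close> are only meaningful inside a single hom space.\<close>

record ('o, 'm, 'k) lin_cat =
  Ob :: "'o set"
  Ar :: "'m set"
  Dom :: "'m \<Rightarrow> 'o"
  Cod :: "'m \<Rightarrow> 'o"
  Idn :: "'o \<Rightarrow> 'm"
  Comp :: "'m \<Rightarrow> 'm \<Rightarrow> 'm" (infixr "\<cdot>\<index>" 55)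
  Zer :: "'o \<Rightarrow> 'o \<Rightarrow> 'm"
  Add :: "'m \<Rightarrow> 'm \<Rightarrow> 'm"
  Scale :: "'k \<Rightarrow> 'm \<Rightarrow> 'm"

definition Hom :: "('o, 'm, 'k, 'z) lin_cat_scheme \<Rightarrow> 'o \<Rightarrow> 'o \<Rightarrow> 'm set" where
  "Hom C A B = {f \<in> Ar C. Dom C f = A \<and> Cod C f = B}"

definition hom_space :: "('o, 'm, 'k, 'z) lin_cat_scheme \<Rightarrow> 'o \<Rightarrow> 'o \<Rightarrow> ('k, 'm) vec_space" where
  "hom_space C A B =
     \<lparr>vcarrier = Hom C A B, vzero = Zer C A B, vadd = Add C, vscale = Scale C\<rparr>"

locale category =
  fixes C :: "('o, 'm, 'k::field, 'z) lin_cat_scheme" (structure)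
  assumes Dom_Ob: "f \<in> Ar C \<Longrightarrow> Dom C f \<in> Ob C"
    and Cod_Ob: "f \<in> Ar C \<Longrightarrow> Cod C f \<in> Ob C"
    and Idn_Hom: "A \<in> Ob C \<Longrightarrow> Idn C A \<in> Hom C A A"
    and Comp_Hom: "\<lbrakk>f \<in> Hom C A B; g \<in> Hom C B D\<rbrakk> \<Longrightarrow> g \<cdot> f \<in> Hom C A D"
    and Comp_Idn: "f \<in> Hom C A B \<Longrightarrow> f \<cdot> Idn C A = f"
    and Idn_Comp: "f \<in> Hom C A B \<Longrightarrow> Idn C B \<cdot> f = f"
    and Comp_assoc: "\<lbrakk>f \<in> Hom C A B; g \<in> Hom C B D; h \<in> Hom C D E\<rbrakk>
      \<Longrightarrow> (h \<cdot> g) \<cdot> f = h \<cdot> (g \<cdot> f)"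

locale linear_category = category +
  assumes hom_vector_space:
      "\<lbrakk>A \<in> Ob C; B \<in> Ob C\<rbrakk> \<Longrightarrow> vector_space_struct (hom_space C A B)"
    and Comp_Add: "\<lbrakk>f \<in> Hom C A B; f' \<in> Hom C A B; g \<in> Hom C B D\<rbrakk>
      \<Longrightarrow> g \<cdot> Add C f f' = Add C (g \<cdot> f) (g \<cdot> f')"
    and Add_Comp: "\<lbrakk>f \<in> Hom C A B; g \<in> Hom C B D; g' \<in> Hom C B D\<rbrakk>
      \<Longrightarrow> Add C g g' \<cdot> f = Add C (g \<cdot> f) (g' \<cdot> f)"
    and Comp_Scale: "\<lbrakk>f \<in> Hom C A B; g \<in> Hom C B D\<rbrakk>
      \<Longrightarrow> g \<cdot> Scale C a f = Scale C a (g \<cdot> f)"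
    and Scale_Comp: "\<lbrakk>f \<in> Hom C A B; g \<in> Hom C B D\<rbrakk>
      \<Longrightarrow> Scale C a g \<cdot> f = Scale C a (g \<cdot> f)"

definition is_inverse :: "('o, 'm, 'k, 'z) lin_cat_scheme \<Rightarrow> 'm \<Rightarrow> 'm \<Rightarrow> bool" where
  "is_inverse C f g \<longleftrightarrow> f \<in> Ar C \<and> g \<in> Hom C (Cod C f) (Dom C f) \<and>
     g \<cdot>\<^bsub>C\<^esub> f = Idn C (Dom C f) \<and> f \<cdot>\<^bsub>C\<^esub> g = Idn C (Cod C f)"

definition iso :: "('o, 'm, 'k, 'z) lin_cat_scheme \<Rightarrow> 'm \<Rightarrow> bool" where
  "iso C f \<longleftrightarrow> (\<exists>g. is_inverse C f g)"

definition Inv :: "('o, 'm, 'k, 'z) lin_cat_scheme \<Rightarrow> 'm \<Rightarrow> 'm" where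
  "Inv C f = (THE g. is_inverse C f g)"

definition isomorphic :: "('o, 'm, 'k, 'z) lin_cat_scheme \<Rightarrow> 'o \<Rightarrow> 'o \<Rightarrow> bool" where
  "isomorphic C A B \<longleftrightarrow> (\<exists>f \<in> Hom C A B. iso C f)"

definition mono_arrow :: "('o, 'm, 'k, 'z) lin_cat_scheme \<Rightarrow> 'm \<Rightarrow> bool" where
  "mono_arrow C f \<longleftrightarrow> f \<in> Ar C \<and> (\<forall>A \<in> Ob C. \<forall>g \<in> Hom C A (Dom C f). \<forall>h \<in> Hom C A (Dom C f).
     f \<cdot>\<^bsub>C\<^esub> g = f \<cdot>\<^bsub>C\<^esub> h \<longrightarrow> g = h)"

definition epi_arrow :: "('o, 'm, 'k, 'z) lin_cat_scheme \<Rightarrow> 'm \<Rightarrow> bool" where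
  "epi_arrow C f \<longleftrightarrow> f \<in> Ar C \<and> (\<forall>B \<in> Ob C. \<forall>g \<in> Hom C (Cod C f) B. \<forall>h \<in> Hom C (Cod C f) B.
     g \<cdot>\<^bsub>C\<^esub> f = h \<cdot>\<^bsub>C\<^esub> f \<longrightarrow> g = h)"

definition is_zero_object :: "('o, 'm, 'k, 'z) lin_cat_scheme \<Rightarrow> 'o \<Rightarrow> bool" where
  "is_zero_object C Z \<longleftrightarrow> Z \<in> Ob C \<and>
     (\<forall>A \<in> Ob C. (\<exists>!f. f \<in> Hom C Z A) \<and> (\<exists>!f. f \<in> Hom C A Z))"

definition is_biproduct ::
  "('o, 'm, 'k, 'z) lin_cat_scheme \<Rightarrow> 'o \<Rightarrow> 'o \<Rightarrow> 'o \<Rightarrow> 'm \<Rightarrow> 'm \<Rightarrow> 'm \<Rightarrow> 'm \<Rightarrow> bool" where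
  "is_biproduct C A B S i j p q \<longleftrightarrow>
     S \<in> Ob C \<and> i \<in> Hom C A S \<and> j \<in> Hom C B S \<and> p \<in> Hom C S A \<and> q \<in> Hom C S B \<and>
     p \<cdot>\<^bsub>C\<^esub> i = Idn C A \<and> q \<cdot>\<^bsub>C\<^esub> j = Idn C B \<and>
     p \<cdot>\<^bsub>C\<^esub> j = Zer C B A \<and> q \<cdot>\<^bsub>C\<^esub> i = Zer C A B \<and>
     Add C (i \<cdot>\<^bsub>C\<^esub> p) (j \<cdot>\<^bsub>C\<^esub> q) = Idn C S"

definition is_kernel :: "('o, 'm, 'k, 'z) lin_cat_scheme \<Rightarrow> 'm \<Rightarrow> 'm \<Rightarrow> bool" where
  "is_kernel C f k \<longleftrightarrow> f \<in> Ar C \<and> k \<in> Ar C \<and> Cod C k = Dom C f \<and>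
     f \<cdot>\<^bsub>C\<^esub> k = Zer C (Dom C k) (Cod C f) \<and>
     (\<forall>A \<in> Ob C. \<forall>g \<in> Hom C A (Dom C f). f \<cdot>\<^bsub>C\<^esub> g = Zer C A (Cod C f) \<longrightarrow>
        (\<exists>!u. u \<in> Hom C A (Dom C k) \<and> k \<cdot>\<^bsub>C\<^esub> u = g))"

definition is_cokernel :: "('o, 'm, 'k, 'z) lin_cat_scheme \<Rightarrow> 'm \<Rightarrow> 'm \<Rightarrow> bool" where
  "is_cokernel C f q \<longleftrightarrow> f \<in> Ar C \<and> q \<in> Ar C \<and> Dom C q = Cod C f \<and>
     q \<cdot>\<^bsub>C\<^esub> f = Zer C (Dom C f) (Cod C q) \<and>
     (\<forall>B \<in> Ob C. \<forall>g \<in> Hom C (Cod C f) B. g \<cdot>\<^bsub>C\<^esub> f = Zer C (Dom C f) B \<longrightarrow>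
        (\<exists>!u. u \<in> Hom C (Cod C q) B \<and> u \<cdot>\<^bsub>C\<^esub> q = g))"

definition short_exact :: "('o, 'm, 'k, 'z) lin_cat_scheme \<Rightarrow> 'm \<Rightarrow> 'm \<Rightarrow> bool" where
  "short_exact C f g \<longleftrightarrow> is_kernel C g f \<and> is_cokernel C f g"

definition simple_object :: "('o, 'm, 'k, 'z) lin_cat_scheme \<Rightarrow> 'o \<Rightarrow> bool" where
  "simple_object C S \<longleftrightarrow> S \<in> Ob C \<and> \<not> is_zero_object C S \<and>
     (\<forall>f. mono_arrow C f \<and> Cod C f = S \<longrightarrow> is_zero_object C (Dom C f) \<or> iso C f)"

inductive finite_length :: "('o, 'm, 'k, 'z) lin_cat_scheme \<Rightarrow> 'o \<Rightarrow> bool"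
  for C :: "('o, 'm, 'k, 'z) lin_cat_scheme" where
  zero: "is_zero_object C Z \<Longrightarrow> finite_length C Z"
| extension: "\<lbrakk>short_exact C f g; finite_length C (Dom C f); simple_object C (Cod C g)\<rbrakk>
    \<Longrightarrow> finite_length C (Cod C f)"

definition projective :: "('o, 'm, 'k, 'z) lin_cat_scheme \<Rightarrow> 'o \<Rightarrow> bool" where
  "projective C P \<longleftrightarrow> P \<in> Ob C \<and>
     (\<forall>g f. epi_arrow C g \<and> f \<in> Hom C P (Cod C g) \<longrightarrow>
        (\<exists>h \<in> Hom C P (Dom C g). g \<cdot>\<^bsub>C\<^esub> h = f))"

locale abelian_category = linear_category +
  assumes ex_zero: "\<exists>Z. is_zero_object C Z"
    and ex_biproduct: "\<lbrakk>A \<in> Ob C; B \<in> Ob C\<rbrakk> \<Longrightarrow> \<exists>S i j p q. is_biproduct C A B S i j p q"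
    and ex_kernel: "f \<in> Ar C \<Longrightarrow> \<exists>k. is_kernel C f k"
    and ex_cokernel: "f \<in> Ar C \<Longrightarrow> \<exists>q. is_cokernel C f q"
    and mono_normal: "mono_arrow C f \<Longrightarrow> \<exists>g. is_kernel C g f"
    and epi_normal: "epi_arrow C f \<Longrightarrow> \<exists>g. is_cokernel C g f"

text \<open>Finite in the sense of Etingof and Ostrik.\<close>

locale finite_abelian_category = abelian_category +
  assumes finite_dim_hom: "\<lbrakk>A \<in> Ob C; B \<in> Ob C\<rbrakk> \<Longrightarrow> finite_dim (hom_space C A B)"
    and all_finite_length: "A \<in> Ob C \<Longrightarrow> finite_length C A"
    and enough_projectives:
      "A \<in> Ob C \<Longrightarrow> \<exists>f. epi_arrow C f \<and> Cod C f = A \<and> projective C (Dom C f)"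
    and finitely_many_simples:
      "\<exists>F. finite F \<and> F \<subseteq> Ob C \<and> (\<forall>S. simple_object C S \<longrightarrow> (\<exists>T \<in> F. isomorphic C S T))"

definition nonzero_category :: "('o, 'm, 'k, 'z) lin_cat_scheme \<Rightarrow> bool" where
  "nonzero_category C \<longleftrightarrow> (\<exists>A \<in> Ob C. \<not> is_zero_object C A)"


section \<open>Equivalences, and the category of finite-dimensional vector spaces\<close>

locale linear_functor = C: linear_category C + D: linear_category D
  for C :: "('o, 'm, 'k::field, 'z) lin_cat_scheme" and D :: "('p, 'n, 'k, 'y) lin_cat_scheme" +
  fixes F0 :: "'o \<Rightarrow> 'p" and F1 :: "'m \<Rightarrow> 'n"
  assumes F0_Ob: "A \<in> Ob C \<Longrightarrow> F0 A \<in> Ob D"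
    and F1_Hom: "f \<in> Hom C A B \<Longrightarrow> F1 f \<in> Hom D (F0 A) (F0 B)"
    and F1_Idn: "A \<in> Ob C \<Longrightarrow> F1 (Idn C A) = Idn D (F0 A)"
    and F1_Comp: "\<lbrakk>f \<in> Hom C A B; g \<in> Hom C B E\<rbrakk> \<Longrightarrow> F1 (g \<cdot>\<^bsub>C\<^esub> f) = F1 g \<cdot>\<^bsub>D\<^esub> F1 f"
    and F1_Add: "\<lbrakk>f \<in> Hom C A B; g \<in> Hom C A B\<rbrakk> \<Longrightarrow> F1 (Add C f g) = Add D (F1 f) (F1 g)"
    and F1_Scale: "f \<in> Hom C A B \<Longrightarrow> F1 (Scale C a f) = Scale D a (F1 f)"

definition natural_iso ::
  "('o, 'm, 'k, 'z) lin_cat_scheme \<Rightarrow> ('p, 'n, 'k, 'y) lin_cat_scheme \<Rightarrow>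
   ('o \<Rightarrow> 'p) \<Rightarrow> ('m \<Rightarrow> 'n) \<Rightarrow> ('o \<Rightarrow> 'p) \<Rightarrow> ('m \<Rightarrow> 'n) \<Rightarrow> ('o \<Rightarrow> 'n) \<Rightarrow> bool" where
  "natural_iso C D F0 F1 G0 G1 t \<longleftrightarrow>
     (\<forall>A \<in> Ob C. t A \<in> Hom D (F0 A) (G0 A) \<and> iso D (t A)) \<and>
     (\<forall>A \<in> Ob C. \<forall>B \<in> Ob C. \<forall>f \<in> Hom C A B. t B \<cdot>\<^bsub>D\<^esub> F1 f = G1 f \<cdot>\<^bsub>D\<^esub> t A)"

definition linearly_equivalent ::
  "('o, 'm, 'k::field, 'z) lin_cat_scheme \<Rightarrow> ('p, 'n, 'k, 'y) lin_cat_scheme \<Rightarrow> bool" where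
  "linearly_equivalent C D \<longleftrightarrow>
     (\<exists>F0 F1 G0 G1 s t. linear_functor C D F0 F1 \<and> linear_functor D C G0 G1 \<and>
        natural_iso C C (\<lambda>A. A) (\<lambda>f. f) (G0 \<circ> F0) (G1 \<circ> F1) s \<and>
        natural_iso D D (F0 \<circ> G0) (F1 \<circ> G1) (\<lambda>B. B) (\<lambda>g. g) t)"

definition full_subcategory ::
  "('o, 'm, 'k, 'z) lin_cat_scheme \<Rightarrow> 'o set \<Rightarrow> ('o, 'm, 'k, 'z) lin_cat_scheme" where
  "full_subcategory C S = C\<lparr>Ob := S, Ar := {f \<in> Ar C. Dom C f \<in> S \<and> Cod C f \<in> S}\<rparr>"

text \<open>The finite-dimensional vector spaces whose underlying set lies in the type \<open>'v\<close>. As soon as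
  \<open>'v\<close> contains a copy of every coordinate space (such as \<open>nat \<Rightarrow> 'k\<close>), every
  finite-dimensional vector space is isomorphic to an object of this category.\<close>

definition FdVec :: "(('k::field, 'v) vec_space,
    ('k, 'v) vec_space \<times> ('k, 'v) vec_space \<times> ('v \<Rightarrow> 'v), 'k) lin_cat" where
  "FdVec = \<lparr>
     Ob = {V. vector_space_struct V \<and> finite_dim V},
     Ar = {(V, W, f). vector_space_struct V \<and> finite_dim V \<and> vector_space_struct W \<and> finite_dim W \<and>
             f \<in> linear_maps V W},
     Dom = (\<lambda>(V, W, f). V),
     Cod = (\<lambda>(V, W, f). W),
     Idn = (\<lambda>V. (V, V, \<lambda>x \<in> vcarrier V. x)),
     Comp = (\<lambda>(V', W, g) (V, W', f). (V, W, \<lambda>x \<in> vcarrier V. g (f x))),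
     Zer = (\<lambda>V W. (V, W, \<lambda>x \<in> vcarrier V. vzero W)),
     Add = (\<lambda>(V, W, f) (V', W', g). (V, W, \<lambda>x \<in> vcarrier V. vadd W (f x) (g x))),
     Scale = (\<lambda>a (V, W, f). (V, W, \<lambda>x \<in> vcarrier V. vscale W a (f x)))\<rparr>"


section \<open>Finite tensor categories\<close>

text \<open>Associativity and unit constraints are kept explicit:
  \<open>Assoc X Y Z : (X \<otimes> Y) \<otimes> Z \<rightarrow> X \<otimes> (Y \<otimes> Z)\<close>, \<open>LUnit X : 1 \<otimes> X \<rightarrow> X\<close> and
  \<open>RUnit X : X \<otimes> 1 \<rightarrow> X\<close>. A choice of left duals is part of the structure.\<close>

record ('o, 'm, 'k) tensor_cat = "('o, 'm, 'k) lin_cat" +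
  Tens :: "'o \<Rightarrow> 'o \<Rightarrow> 'o" (infixr "\<otimes>\<index>" 70)
  TensM :: "'m \<Rightarrow> 'm \<Rightarrow> 'm" (infixr "\<otimes>\<^sub>m\<index>" 70)
  Unit :: 'o
  Assoc :: "'o \<Rightarrow> 'o \<Rightarrow> 'o \<Rightarrow> 'm"
  LUnit :: "'o \<Rightarrow> 'm"
  RUnit :: "'o \<Rightarrow> 'm"
  LDual :: "'o \<Rightarrow> 'o"
  Ev :: "'o \<Rightarrow> 'm"
  Coev :: "'o \<Rightarrow> 'm"

locale monoidal_category = category C
  for C :: "('o, 'm, 'k::field, 'z) tensor_cat_scheme" (structure) +
  assumes Unit_Ob: "Unit C \<in> Ob C"
    and Tens_Ob: "\<lbrakk>X \<in> Ob C; Y \<in> Ob C\<rbrakk> \<Longrightarrow> X \<otimes> Y \<in> Ob C"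
    and TensM_Hom: "\<lbrakk>f \<in> Hom C X X'; g \<in> Hom C Y Y'\<rbrakk> \<Longrightarrow> f \<otimes>\<^sub>m g \<in> Hom C (X \<otimes> Y) (X' \<otimes> Y')"
    and TensM_Idn: "\<lbrakk>X \<in> Ob C; Y \<in> Ob C\<rbrakk> \<Longrightarrow> Idn C X \<otimes>\<^sub>m Idn C Y = Idn C (X \<otimes> Y)"
    and TensM_Comp: "\<lbrakk>f \<in> Hom C X X'; f' \<in> Hom C X' X''; g \<in> Hom C Y Y'; g' \<in> Hom C Y' Y''\<rbrakk>
      \<Longrightarrow> (f' \<cdot> f) \<otimes>\<^sub>m (g' \<cdot> g) = (f' \<otimes>\<^sub>m g') \<cdot> (f \<otimes>\<^sub>m g)"
    and Assoc_iso: "\<lbrakk>X \<in> Ob C; Y \<in> Ob C; Z \<in> Ob C\<rbrakk>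
      \<Longrightarrow> Assoc C X Y Z \<in> Hom C ((X \<otimes> Y) \<otimes> Z) (X \<otimes> (Y \<otimes> Z)) \<and> iso C (Assoc C X Y Z)"
    and Assoc_natural: "\<lbrakk>f \<in> Hom C X X'; g \<in> Hom C Y Y'; h \<in> Hom C Z Z'\<rbrakk>
      \<Longrightarrow> Assoc C X' Y' Z' \<cdot> ((f \<otimes>\<^sub>m g) \<otimes>\<^sub>m h) = (f \<otimes>\<^sub>m (g \<otimes>\<^sub>m h)) \<cdot> Assoc C X Y Z"
    and LUnit_iso: "X \<in> Ob C \<Longrightarrow> LUnit C X \<in> Hom C (Unit C \<otimes> X) X \<and> iso C (LUnit C X)"
    and LUnit_natural: "f \<in> Hom C X X'
      \<Longrightarrow> LUnit C X' \<cdot> (Idn C (Unit C) \<otimes>\<^sub>m f) = f \<cdot> LUnit C X"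
    and RUnit_iso: "X \<in> Ob C \<Longrightarrow> RUnit C X \<in> Hom C (X \<otimes> Unit C) X \<and> iso C (RUnit C X)"
    and RUnit_natural: "f \<in> Hom C X X'
      \<Longrightarrow> RUnit C X' \<cdot> (f \<otimes>\<^sub>m Idn C (Unit C)) = f \<cdot> RUnit C X"
    and pentagon: "\<lbrakk>W \<in> Ob C; X \<in> Ob C; Y \<in> Ob C; Z \<in> Ob C\<rbrakk>
      \<Longrightarrow> Assoc C W X (Y \<otimes> Z) \<cdot> Assoc C (W \<otimes> X) Y Z =
          (Idn C W \<otimes>\<^sub>m Assoc C X Y Z) \<cdot> Assoc C W (X \<otimes> Y) Z \<cdot> (Assoc C W X Y \<otimes>\<^sub>m Idn C Z)"
    and triangle: "\<lbrakk>X \<in> Ob C; Y \<in> Ob C\<rbrakk>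
      \<Longrightarrow> (Idn C X \<otimes>\<^sub>m LUnit C Y) \<cdot> Assoc C X (Unit C) Y = RUnit C X \<otimes>\<^sub>m Idn C Y"

text \<open>\<open>is_left_dual C X D ev coev\<close>: \<open>D\<close> is left dual to \<open>X\<close> via \<open>ev : D \<otimes> X \<rightarrow> 1\<close> and
  \<open>coev : 1 \<rightarrow> X \<otimes> D\<close>. Equivalently, \<open>X\<close> is right dual to \<open>D\<close>.\<close>

definition is_left_dual ::
  "('o, 'm, 'k, 'z) tensor_cat_scheme \<Rightarrow> 'o \<Rightarrow> 'o \<Rightarrow> 'm \<Rightarrow> 'm \<Rightarrow> bool" where
  "is_left_dual C X D ev coev \<longleftrightarrow>
     X \<in> Ob C \<and> D \<in> Ob C \<and>
     ev \<in> Hom C (D \<otimes>\<^bsub>C\<^esub> X) (Unit C) \<and> coev \<in> Hom C (Unit C) (X \<otimes>\<^bsub>C\<^esub> D) \<and>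
     RUnit C X \<cdot>\<^bsub>C\<^esub> (Idn C X \<otimes>\<^sub>m\<^bsub>C\<^esub> ev) \<cdot>\<^bsub>C\<^esub> Assoc C X D X \<cdot>\<^bsub>C\<^esub>
       (coev \<otimes>\<^sub>m\<^bsub>C\<^esub> Idn C X) \<cdot>\<^bsub>C\<^esub> Inv C (LUnit C X) = Idn C X \<and>
     LUnit C D \<cdot>\<^bsub>C\<^esub> (ev \<otimes>\<^sub>m\<^bsub>C\<^esub> Idn C D) \<cdot>\<^bsub>C\<^esub> Inv C (Assoc C D X D) \<cdot>\<^bsub>C\<^esub>
       (Idn C D \<otimes>\<^sub>m\<^bsub>C\<^esub> coev) \<cdot>\<^bsub>C\<^esub> Inv C (RUnit C D) = Idn C D"

locale finite_tensor_category = finite_abelian_category C + monoidal_category C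
  for C :: "('o, 'm, 'k::field, 'z) tensor_cat_scheme" (structure) +
  assumes TensM_Add_left: "\<lbrakk>f \<in> Hom C X X'; f' \<in> Hom C X X'; g \<in> Hom C Y Y'\<rbrakk>
      \<Longrightarrow> Add C f f' \<otimes>\<^sub>m g = Add C (f \<otimes>\<^sub>m g) (f' \<otimes>\<^sub>m g)"
    and TensM_Add_right: "\<lbrakk>f \<in> Hom C X X'; g \<in> Hom C Y Y'; g' \<in> Hom C Y Y'\<rbrakk>
      \<Longrightarrow> f \<otimes>\<^sub>m Add C g g' = Add C (f \<otimes>\<^sub>m g) (f \<otimes>\<^sub>m g')"
    and TensM_Scale_left: "\<lbrakk>f \<in> Hom C X X'; g \<in> Hom C Y Y'\<rbrakk>
      \<Longrightarrow> Scale C a f \<otimes>\<^sub>m g = Scale C a (f \<otimes>\<^sub>m g)"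
    and TensM_Scale_right: "\<lbrakk>f \<in> Hom C X X'; g \<in> Hom C Y Y'\<rbrakk>
      \<Longrightarrow> f \<otimes>\<^sub>m Scale C a g = Scale C a (f \<otimes>\<^sub>m g)"
    and left_dual: "X \<in> Ob C \<Longrightarrow> is_left_dual C X (LDual C X) (Ev C X) (Coev C X)"
    and ex_right_dual: "X \<in> Ob C \<Longrightarrow> \<exists>D ev coev. is_left_dual C D X ev coev"
    and End_Unit: "bij_betw (\<lambda>a. Scale C a (Idn C (Unit C))) UNIV (Hom C (Unit C) (Unit C))"

definition dual_map :: "('o, 'm, 'k, 'z) tensor_cat_scheme \<Rightarrow> 'm \<Rightarrow> 'm" where
  "dual_map C f =
     (let X = Dom C f; Y = Cod C f; X' = LDual C X; Y' = LDual C Y in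
      LUnit C X' \<cdot>\<^bsub>C\<^esub> (Ev C Y \<otimes>\<^sub>m\<^bsub>C\<^esub> Idn C X') \<cdot>\<^bsub>C\<^esub> ((Idn C Y' \<otimes>\<^sub>m\<^bsub>C\<^esub> f) \<otimes>\<^sub>m\<^bsub>C\<^esub> Idn C X') \<cdot>\<^bsub>C\<^esub>
      Inv C (Assoc C Y' X X') \<cdot>\<^bsub>C\<^esub> (Idn C Y' \<otimes>\<^sub>m\<^bsub>C\<^esub> Coev C X) \<cdot>\<^bsub>C\<^esub> Inv C (RUnit C Y'))"

record ('o, 'm, 'k) braided_cat = "('o, 'm, 'k) tensor_cat" +
  Braid :: "'o \<Rightarrow> 'o \<Rightarrow> 'm"

locale braided_finite_tensor_category = finite_tensor_category C
  for C :: "('o, 'm, 'k::field, 'z) braided_cat_scheme" (structure) +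
  assumes Braid_iso: "\<lbrakk>X \<in> Ob C; Y \<in> Ob C\<rbrakk>
      \<Longrightarrow> Braid C X Y \<in> Hom C (X \<otimes> Y) (Y \<otimes> X) \<and> iso C (Braid C X Y)"
    and Braid_natural: "\<lbrakk>f \<in> Hom C X X'; g \<in> Hom C Y Y'\<rbrakk>
      \<Longrightarrow> Braid C X' Y' \<cdot> (f \<otimes>\<^sub>m g) = (g \<otimes>\<^sub>m f) \<cdot> Braid C X Y"
    and hexagon_left: "\<lbrakk>X \<in> Ob C; Y \<in> Ob C; Z \<in> Ob C\<rbrakk>
      \<Longrightarrow> Braid C (X \<otimes> Y) Z =
          Assoc C Z X Y \<cdot> (Braid C X Z \<otimes>\<^sub>m Idn C Y) \<cdot> Inv C (Assoc C X Z Y) \<cdot>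
          (Idn C X \<otimes>\<^sub>m Braid C Y Z) \<cdot> Assoc C X Y Z"
    and hexagon_right: "\<lbrakk>X \<in> Ob C; Y \<in> Ob C; Z \<in> Ob C\<rbrakk>
      \<Longrightarrow> Braid C X (Y \<otimes> Z) =
          Inv C (Assoc C Y Z X) \<cdot> (Idn C Y \<otimes>\<^sub>m Braid C X Z) \<cdot> Assoc C Y X Z \<cdot>
          (Braid C X Y \<otimes>\<^sub>m Idn C Z) \<cdot> Inv C (Assoc C X Y Z)"


section \<open>Module categories\<close>

text \<open>\<open>MAssoc X Y A : (X \<otimes> Y) \<triangleright> A \<rightarrow> X \<triangleright> (Y \<triangleright> A)\<close> and \<open>MUnit A : 1 \<triangleright> A \<rightarrow> A\<close>.\<close>

record ('p, 'n, 'k, 'o, 'm) module_cat = "('p, 'n, 'k) lin_cat" +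
  Act :: "'o \<Rightarrow> 'p \<Rightarrow> 'p" (infixr "\<triangleright>\<index>" 65)
  ActM :: "'m \<Rightarrow> 'n \<Rightarrow> 'n" (infixr "\<triangleright>\<^sub>m\<index>" 65)
  MAssoc :: "'o \<Rightarrow> 'o \<Rightarrow> 'p \<Rightarrow> 'n"
  MUnit :: "'p \<Rightarrow> 'n"

locale module_category = C: finite_tensor_category C + M: finite_abelian_category M
  for C :: "('o, 'm, 'k::field, 'z) tensor_cat_scheme"
    and M :: "('p, 'n, 'k, 'o, 'm, 'y) module_cat_scheme" +
  assumes Act_Ob: "\<lbrakk>X \<in> Ob C; A \<in> Ob M\<rbrakk> \<Longrightarrow> X \<triangleright>\<^bsub>M\<^esub> A \<in> Ob M"
    and ActM_Hom: "\<lbrakk>f \<in> Hom C X X'; g \<in> Hom M A A'\<rbrakk>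
      \<Longrightarrow> f \<triangleright>\<^sub>m\<^bsub>M\<^esub> g \<in> Hom M (X \<triangleright>\<^bsub>M\<^esub> A) (X' \<triangleright>\<^bsub>M\<^esub> A')"
    and ActM_Idn: "\<lbrakk>X \<in> Ob C; A \<in> Ob M\<rbrakk> \<Longrightarrow> Idn C X \<triangleright>\<^sub>m\<^bsub>M\<^esub> Idn M A = Idn M (X \<triangleright>\<^bsub>M\<^esub> A)"
    and ActM_Comp: "\<lbrakk>f \<in> Hom C X X'; f' \<in> Hom C X' X''; g \<in> Hom M A A'; g' \<in> Hom M A' A''\<rbrakk>
      \<Longrightarrow> (f' \<cdot>\<^bsub>C\<^esub> f) \<triangleright>\<^sub>m\<^bsub>M\<^esub> (g' \<cdot>\<^bsub>M\<^esub> g) = (f' \<triangleright>\<^sub>m\<^bsub>M\<^esub> g') \<cdot>\<^bsub>M\<^esub> (f \<triangleright>\<^sub>m\<^bsub>M\<^esub> g)"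
    and ActM_Add_left: "\<lbrakk>f \<in> Hom C X X'; f' \<in> Hom C X X'; g \<in> Hom M A A'\<rbrakk>
      \<Longrightarrow> Add C f f' \<triangleright>\<^sub>m\<^bsub>M\<^esub> g = Add M (f \<triangleright>\<^sub>m\<^bsub>M\<^esub> g) (f' \<triangleright>\<^sub>m\<^bsub>M\<^esub> g)"
    and ActM_Add_right: "\<lbrakk>f \<in> Hom C X X'; g \<in> Hom M A A'; g' \<in> Hom M A A'\<rbrakk>
      \<Longrightarrow> f \<triangleright>\<^sub>m\<^bsub>M\<^esub> Add M g g' = Add M (f \<triangleright>\<^sub>m\<^bsub>M\<^esub> g) (f \<triangleright>\<^sub>m\<^bsub>M\<^esub> g')"
    and ActM_Scale_left: "\<lbrakk>f \<in> Hom C X X'; g \<in> Hom M A A'\<rbrakk>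
      \<Longrightarrow> Scale C a f \<triangleright>\<^sub>m\<^bsub>M\<^esub> g = Scale M a (f \<triangleright>\<^sub>m\<^bsub>M\<^esub> g)"
    and ActM_Scale_right: "\<lbrakk>f \<in> Hom C X X'; g \<in> Hom M A A'\<rbrakk>
      \<Longrightarrow> f \<triangleright>\<^sub>m\<^bsub>M\<^esub> Scale M a g = Scale M a (f \<triangleright>\<^sub>m\<^bsub>M\<^esub> g)"
    and Act_exact: "\<lbrakk>A \<in> Ob M; short_exact C i q\<rbrakk>
      \<Longrightarrow> short_exact M (i \<triangleright>\<^sub>m\<^bsub>M\<^esub> Idn M A) (q \<triangleright>\<^sub>m\<^bsub>M\<^esub> Idn M A)"
    and MAssoc_iso: "\<lbrakk>X \<in> Ob C; Y \<in> Ob C; A \<in> Ob M\<rbrakk>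
      \<Longrightarrow> MAssoc M X Y A \<in> Hom M ((X \<otimes>\<^bsub>C\<^esub> Y) \<triangleright>\<^bsub>M\<^esub> A) (X \<triangleright>\<^bsub>M\<^esub> (Y \<triangleright>\<^bsub>M\<^esub> A)) \<and>
          iso M (MAssoc M X Y A)"
    and MAssoc_natural: "\<lbrakk>f \<in> Hom C X X'; f' \<in> Hom C Y Y'; g \<in> Hom M A A'\<rbrakk>
      \<Longrightarrow> MAssoc M X' Y' A' \<cdot>\<^bsub>M\<^esub> ((f \<otimes>\<^sub>m\<^bsub>C\<^esub> f') \<triangleright>\<^sub>m\<^bsub>M\<^esub> g) =
          (f \<triangleright>\<^sub>m\<^bsub>M\<^esub> (f' \<triangleright>\<^sub>m\<^bsub>M\<^esub> g)) \<cdot>\<^bsub>M\<^esub> MAssoc M X Y A"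
    and MUnit_iso: "A \<in> Ob M \<Longrightarrow> MUnit M A \<in> Hom M (Unit C \<triangleright>\<^bsub>M\<^esub> A) A \<and> iso M (MUnit M A)"
    and MUnit_natural: "h \<in> Hom M A A'
      \<Longrightarrow> MUnit M A' \<cdot>\<^bsub>M\<^esub> (Idn C (Unit C) \<triangleright>\<^sub>m\<^bsub>M\<^esub> h) = h \<cdot>\<^bsub>M\<^esub> MUnit M A"
    and module_pentagon: "\<lbrakk>X \<in> Ob C; Y \<in> Ob C; Z \<in> Ob C; A \<in> Ob M\<rbrakk>
      \<Longrightarrow> MAssoc M X Y (Z \<triangleright>\<^bsub>M\<^esub> A) \<cdot>\<^bsub>M\<^esub> MAssoc M (X \<otimes>\<^bsub>C\<^esub> Y) Z A =
          (Idn C X \<triangleright>\<^sub>m\<^bsub>M\<^esub> MAssoc M Y Z A) \<cdot>\<^bsub>M\<^esub> MAssoc M X (Y \<otimes>\<^bsub>C\<^esub> Z) A \<cdot>\<^bsub>M\<^esub>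
          (Assoc C X Y Z \<triangleright>\<^sub>m\<^bsub>M\<^esub> Idn M A)"
    and module_triangle: "\<lbrakk>X \<in> Ob C; A \<in> Ob M\<rbrakk>
      \<Longrightarrow> (Idn C X \<triangleright>\<^sub>m\<^bsub>M\<^esub> MUnit M A) \<cdot>\<^bsub>M\<^esub> MAssoc M X (Unit C) A = RUnit C X \<triangleright>\<^sub>m\<^bsub>M\<^esub> Idn M A"

definition exact_module_category ::
  "('o, 'm, 'k, 'z) tensor_cat_scheme \<Rightarrow> ('p, 'n, 'k, 'o, 'm, 'y) module_cat_scheme \<Rightarrow> bool" where
  "exact_module_category C M \<longleftrightarrow>
     (\<forall>P A. projective C P \<and> A \<in> Ob M \<longrightarrow> projective M (P \<triangleright>\<^bsub>M\<^esub> A))"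

text \<open>A decomposition of \<open>M\<close> as a direct sum of two full module subcategories, given by their
  sets of objects.\<close>

definition module_decomposition ::
  "('o, 'm, 'k, 'z) tensor_cat_scheme \<Rightarrow> ('p, 'n, 'k, 'o, 'm, 'y) module_cat_scheme \<Rightarrow>
   'p set \<Rightarrow> 'p set \<Rightarrow> bool" where
  "module_decomposition C M S T \<longleftrightarrow>
     S \<subseteq> Ob M \<and> T \<subseteq> Ob M \<and>
     (\<forall>X \<in> Ob C. (\<forall>A \<in> S. X \<triangleright>\<^bsub>M\<^esub> A \<in> S) \<and> (\<forall>B \<in> T. X \<triangleright>\<^bsub>M\<^esub> B \<in> T)) \<and>
     (\<forall>A \<in> S. \<forall>B \<in> T. Hom M A B = {Zer M A B} \<and> Hom M B A = {Zer M B A}) \<and>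
     (\<forall>N \<in> Ob M. \<exists>A \<in> S. \<exists>B \<in> T. \<exists>i j p q. is_biproduct M A B N i j p q)"

definition indecomposable_module_category ::
  "('o, 'm, 'k, 'z) tensor_cat_scheme \<Rightarrow> ('p, 'n, 'k, 'o, 'm, 'y) module_cat_scheme \<Rightarrow> bool" where
  "indecomposable_module_category C M \<longleftrightarrow>
     \<not> (\<exists>S T. module_decomposition C M S T \<and>
          nonzero_category (full_subcategory M S) \<and> nonzero_category (full_subcategory M T))"

record ('p, 'n, 'k, 'o, 'm) braided_module_cat = "('p, 'n, 'k, 'o, 'm) module_cat" +
  MBraid :: "'o \<Rightarrow> 'p \<Rightarrow> 'n"

locale braided_module_category = C: braided_finite_tensor_category C + module_category C M
  for C :: "('o, 'm, 'k::field, 'z) braided_cat_scheme"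
    and M :: "('p, 'n, 'k, 'o, 'm, 'y) braided_module_cat_scheme" +
  assumes MBraid_iso: "\<lbrakk>X \<in> Ob C; A \<in> Ob M\<rbrakk>
      \<Longrightarrow> MBraid M X A \<in> Hom M (X \<triangleright>\<^bsub>M\<^esub> A) (X \<triangleright>\<^bsub>M\<^esub> A) \<and> iso M (MBraid M X A)"
    and MBraid_natural: "\<lbrakk>f \<in> Hom C X X'; g \<in> Hom M A A'\<rbrakk>
      \<Longrightarrow> MBraid M X' A' \<cdot>\<^bsub>M\<^esub> (f \<triangleright>\<^sub>m\<^bsub>M\<^esub> g) = (f \<triangleright>\<^sub>m\<^bsub>M\<^esub> g) \<cdot>\<^bsub>M\<^esub> MBraid M X A"
    and MBraid_Tens: "\<lbrakk>X \<in> Ob C; Y \<in> Ob C; A \<in> Ob M\<rbrakk>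
      \<Longrightarrow> MBraid M (X \<otimes>\<^bsub>C\<^esub> Y) A =
          Inv M (MAssoc M X Y A) \<cdot>\<^bsub>M\<^esub> (Idn C X \<triangleright>\<^sub>m\<^bsub>M\<^esub> MBraid M Y A) \<cdot>\<^bsub>M\<^esub> MAssoc M X Y A \<cdot>\<^bsub>M\<^esub>
          (Braid C Y X \<triangleright>\<^sub>m\<^bsub>M\<^esub> Idn M A) \<cdot>\<^bsub>M\<^esub>
          Inv M (MAssoc M Y X A) \<cdot>\<^bsub>M\<^esub> (Idn C Y \<triangleright>\<^sub>m\<^bsub>M\<^esub> MBraid M X A) \<cdot>\<^bsub>M\<^esub> MAssoc M Y X A \<cdot>\<^bsub>M\<^esub>
          (Inv C (Braid C Y X) \<triangleright>\<^sub>m\<^bsub>M\<^esub> Idn M A)"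
    and MBraid_Act: "\<lbrakk>X \<in> Ob C; Y \<in> Ob C; A \<in> Ob M\<rbrakk>
      \<Longrightarrow> MBraid M X (Y \<triangleright>\<^bsub>M\<^esub> A) =
          MAssoc M X Y A \<cdot>\<^bsub>M\<^esub> (Braid C Y X \<triangleright>\<^sub>m\<^bsub>M\<^esub> Idn M A) \<cdot>\<^bsub>M\<^esub>
          Inv M (MAssoc M Y X A) \<cdot>\<^bsub>M\<^esub> (Idn C Y \<triangleright>\<^sub>m\<^bsub>M\<^esub> MBraid M X A) \<cdot>\<^bsub>M\<^esub> MAssoc M Y X A \<cdot>\<^bsub>M\<^esub>
          (Braid C X Y \<triangleright>\<^sub>m\<^bsub>M\<^esub> Idn M A) \<cdot>\<^bsub>M\<^esub> Inv M (MAssoc M X Y A)"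


section \<open>Internal Homs\<close>

text \<open>\<open>H A B\<close> is the internal Hom and \<open>ev A B : H A B \<triangleright> A \<rightarrow> B\<close> the counit; \<open>H A\<close> being right
  adjoint to \<open>- \<triangleright> A\<close> is expressed by the universal property of the counit.\<close>

definition is_internal_hom ::
  "('o, 'm, 'k, 'z) tensor_cat_scheme \<Rightarrow> ('p, 'n, 'k, 'o, 'm, 'y) module_cat_scheme \<Rightarrow>
   ('p \<Rightarrow> 'p \<Rightarrow> 'o) \<Rightarrow> ('p \<Rightarrow> 'p \<Rightarrow> 'n) \<Rightarrow> bool" where
  "is_internal_hom C M H ev \<longleftrightarrow>
     (\<forall>A \<in> Ob M. \<forall>B \<in> Ob M. H A B \<in> Ob C \<and> ev A B \<in> Hom M (H A B \<triangleright>\<^bsub>M\<^esub> A) B \<and>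
        (\<forall>X \<in> Ob C. \<forall>f \<in> Hom M (X \<triangleright>\<^bsub>M\<^esub> A) B.
           \<exists>!g. g \<in> Hom C X (H A B) \<and> ev A B \<cdot>\<^bsub>M\<^esub> (g \<triangleright>\<^sub>m\<^bsub>M\<^esub> Idn M A) = f))"

definition adjunct ::
  "('o, 'm, 'k, 'z) tensor_cat_scheme \<Rightarrow> ('p, 'n, 'k, 'o, 'm, 'y) module_cat_scheme \<Rightarrow>
   ('p \<Rightarrow> 'p \<Rightarrow> 'o) \<Rightarrow> ('p \<Rightarrow> 'p \<Rightarrow> 'n) \<Rightarrow> 'o \<Rightarrow> 'p \<Rightarrow> 'p \<Rightarrow> 'n \<Rightarrow> 'm" where
  "adjunct C M H ev X A B f =
     (THE g. g \<in> Hom C X (H A B) \<and> ev A B \<cdot>\<^bsub>M\<^esub> (g \<triangleright>\<^sub>m\<^bsub>M\<^esub> Idn M A) = f)"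

text \<open>For \<open>f : A' \<rightarrow> A\<close> and \<open>g : B \<rightarrow> B'\<close>, the induced morphism \<open>H A B \<rightarrow> H A' B'\<close>.\<close>

definition ihom_map ::
  "('o, 'm, 'k, 'z) tensor_cat_scheme \<Rightarrow> ('p, 'n, 'k, 'o, 'm, 'y) module_cat_scheme \<Rightarrow>
   ('p \<Rightarrow> 'p \<Rightarrow> 'o) \<Rightarrow> ('p \<Rightarrow> 'p \<Rightarrow> 'n) \<Rightarrow> 'n \<Rightarrow> 'n \<Rightarrow> 'm" where
  "ihom_map C M H ev f g =
     (let A' = Dom M f; A = Cod M f; B = Dom M g; B' = Cod M g in
      adjunct C M H ev (H A B) A' B'
        (g \<cdot>\<^bsub>M\<^esub> ev A B \<cdot>\<^bsub>M\<^esub> (Idn C (H A B) \<triangleright>\<^sub>m\<^bsub>M\<^esub> f)))"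

definition ihom_coev ::
  "('o, 'm, 'k, 'z) tensor_cat_scheme \<Rightarrow> ('p, 'n, 'k, 'o, 'm, 'y) module_cat_scheme \<Rightarrow>
   ('p \<Rightarrow> 'p \<Rightarrow> 'o) \<Rightarrow> ('p \<Rightarrow> 'p \<Rightarrow> 'n) \<Rightarrow> 'p \<Rightarrow> 'm" where
  "ihom_coev C M H ev A = adjunct C M H ev (Unit C) A A (MUnit M A)"

text \<open>The canonical isomorphism \<open>X \<otimes> H A B \<rightarrow> H A (X \<triangleright> B)\<close>.\<close>

definition ihom_can ::
  "('o, 'm, 'k, 'z) tensor_cat_scheme \<Rightarrow> ('p, 'n, 'k, 'o, 'm, 'y) module_cat_scheme \<Rightarrow>
   ('p \<Rightarrow> 'p \<Rightarrow> 'o) \<Rightarrow> ('p \<Rightarrow> 'p \<Rightarrow> 'n) \<Rightarrow> 'o \<Rightarrow> 'p \<Rightarrow> 'p \<Rightarrow> 'm" where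
  "ihom_can C M H ev X A B = adjunct C M H ev (X \<otimes>\<^bsub>C\<^esub> H A B) A (X \<triangleright>\<^bsub>M\<^esub> B)
     ((Idn C X \<triangleright>\<^sub>m\<^bsub>M\<^esub> ev A B) \<cdot>\<^bsub>M\<^esub> MAssoc M X (H A B) A)"


section \<open>Ends and the universal copairing\<close>

text \<open>\<open>T0\<close>, \<open>T1\<close> are the object and morphism parts of a functor from \<open>D\<^sup>o\<^sup>p \<times> D\<close> to \<open>C\<close>.\<close>

definition is_wedge ::
  "('p, 'n, 'k, 'y) lin_cat_scheme \<Rightarrow> ('o, 'm, 'k, 'z) lin_cat_scheme \<Rightarrow>
   ('p \<Rightarrow> 'p \<Rightarrow> 'o) \<Rightarrow> ('n \<Rightarrow> 'n \<Rightarrow> 'm) \<Rightarrow> 'o \<Rightarrow> ('p \<Rightarrow> 'm) \<Rightarrow> bool" where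
  "is_wedge D C T0 T1 E p \<longleftrightarrow>
     E \<in> Ob C \<and> (\<forall>A \<in> Ob D. p A \<in> Hom C E (T0 A A)) \<and>
     (\<forall>A \<in> Ob D. \<forall>B \<in> Ob D. \<forall>f \<in> Hom D A B.
        T1 (Idn D A) f \<cdot>\<^bsub>C\<^esub> p A = T1 f (Idn D B) \<cdot>\<^bsub>C\<^esub> p B)"

definition is_end ::
  "('p, 'n, 'k, 'y) lin_cat_scheme \<Rightarrow> ('o, 'm, 'k, 'z) lin_cat_scheme \<Rightarrow>
   ('p \<Rightarrow> 'p \<Rightarrow> 'o) \<Rightarrow> ('n \<Rightarrow> 'n \<Rightarrow> 'm) \<Rightarrow> 'o \<Rightarrow> ('p \<Rightarrow> 'm) \<Rightarrow> bool" where
  "is_end D C T0 T1 E p \<longleftrightarrow> is_wedge D C T0 T1 E p \<and>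
     (\<forall>W q. is_wedge D C T0 T1 W q \<longrightarrow>
        (\<exists>!u. u \<in> Hom C W E \<and> (\<forall>A \<in> Ob D. p A \<cdot>\<^bsub>C\<^esub> u = q A)))"

definition is_tensor_end ::
  "('o, 'm, 'k, 'z) tensor_cat_scheme \<Rightarrow> 'o \<Rightarrow> ('o \<Rightarrow> 'm) \<Rightarrow> bool" where
  "is_tensor_end C E p \<longleftrightarrow>
     is_end C C (\<lambda>X Y. Y \<otimes>\<^bsub>C\<^esub> LDual C X) (\<lambda>f g. g \<otimes>\<^sub>m\<^bsub>C\<^esub> dual_map C f) E p"

definition is_module_end ::
  "('o, 'm, 'k, 'z) tensor_cat_scheme \<Rightarrow> ('p, 'n, 'k, 'o, 'm, 'y) module_cat_scheme \<Rightarrow>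
   ('p \<Rightarrow> 'p \<Rightarrow> 'o) \<Rightarrow> ('p \<Rightarrow> 'p \<Rightarrow> 'n) \<Rightarrow> 'o \<Rightarrow> ('p \<Rightarrow> 'm) \<Rightarrow> bool" where
  "is_module_end C M H ev E p \<longleftrightarrow> is_end M C H (ihom_map C M H ev) E p"

definition copairing_component ::
  "('o, 'm, 'k, 'z) tensor_cat_scheme \<Rightarrow> ('p, 'n, 'k, 'o, 'm, 'y) braided_module_cat_scheme \<Rightarrow>
   ('p \<Rightarrow> 'p \<Rightarrow> 'o) \<Rightarrow> ('p \<Rightarrow> 'p \<Rightarrow> 'n) \<Rightarrow> 'o \<Rightarrow> 'p \<Rightarrow> 'm" where
  "copairing_component C M H ev X A =
     (let X' = LDual C X; can = ihom_can C M H ev X' A A in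
      Inv C (Assoc C X X' (H A A)) \<cdot>\<^bsub>C\<^esub>
      (Idn C X \<otimes>\<^sub>m\<^bsub>C\<^esub> Inv C can) \<cdot>\<^bsub>C\<^esub>
      (Idn C X \<otimes>\<^sub>m\<^bsub>C\<^esub> ihom_map C M H ev (Idn M A) (MBraid M X' A)) \<cdot>\<^bsub>C\<^esub>
      (Idn C X \<otimes>\<^sub>m\<^bsub>C\<^esub> can) \<cdot>\<^bsub>C\<^esub>
      Assoc C X X' (H A A) \<cdot>\<^bsub>C\<^esub>
      (Coev C X \<otimes>\<^sub>m\<^bsub>C\<^esub> ihom_coev C M H ev A) \<cdot>\<^bsub>C\<^esub>
      Inv C (LUnit C (Unit C)))"

definition is_universal_copairing ::
  "('o, 'm, 'k, 'z) tensor_cat_scheme \<Rightarrow> ('p, 'n, 'k, 'o, 'm, 'y) braided_module_cat_scheme \<Rightarrow>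
   ('p \<Rightarrow> 'p \<Rightarrow> 'o) \<Rightarrow> ('p \<Rightarrow> 'p \<Rightarrow> 'n) \<Rightarrow> 'o \<Rightarrow> ('o \<Rightarrow> 'm) \<Rightarrow> 'o \<Rightarrow> ('p \<Rightarrow> 'm) \<Rightarrow> 'm \<Rightarrow> bool" where
  "is_universal_copairing C M H ev EC pC EM pM w \<longleftrightarrow>
     w \<in> Hom C (Unit C) (EC \<otimes>\<^bsub>C\<^esub> EM) \<and>
     (\<forall>X \<in> Ob C. \<forall>A \<in> Ob M. (pC X \<otimes>\<^sub>m\<^bsub>C\<^esub> pM A) \<cdot>\<^bsub>C\<^esub> w = copairing_component C M H ev X A)"

definition theta_map ::
  "('o, 'm, 'k, 'z) tensor_cat_scheme \<Rightarrow> 'o \<Rightarrow> 'o \<Rightarrow> 'm \<Rightarrow> 'm" where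
  "theta_map C EC EM w =
     LUnit C EM \<cdot>\<^bsub>C\<^esub> (Ev C EC \<otimes>\<^sub>m\<^bsub>C\<^esub> Idn C EM) \<cdot>\<^bsub>C\<^esub> Inv C (Assoc C (LDual C EC) EC EM) \<cdot>\<^bsub>C\<^esub>
     (Idn C (LDual C EC) \<otimes>\<^sub>m\<^bsub>C\<^esub> w) \<cdot>\<^bsub>C\<^esub> Inv C (RUnit C (LDual C EC))"

definition Omega_map ::
  "('o, 'm, 'k, 'z) tensor_cat_scheme \<Rightarrow> 'o \<Rightarrow> 'm \<Rightarrow> 'm \<Rightarrow> 'm" where
  "Omega_map C EM w f = LUnit C EM \<cdot>\<^bsub>C\<^esub> (f \<otimes>\<^sub>m\<^bsub>C\<^esub> Idn C EM) \<cdot>\<^bsub>C\<^esub> w"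

definition nondegenerate ::
  "('o, 'm, 'k, 'z) tensor_cat_scheme \<Rightarrow> 'o \<Rightarrow> 'o \<Rightarrow> 'm \<Rightarrow> bool" where
  "nondegenerate C EC EM w \<longleftrightarrow> iso C (theta_map C EC EM w)"

definition weakly_factorizable ::
  "('o, 'm, 'k, 'z) tensor_cat_scheme \<Rightarrow> 'o \<Rightarrow> 'o \<Rightarrow> 'm \<Rightarrow> bool" where
  "weakly_factorizable C EC EM w \<longleftrightarrow>
     bij_betw (Omega_map C EM w) (Hom C EC (Unit C)) (Hom C (Unit C) EM)"

definition symmetric_center ::
  "('o, 'm, 'k, 'z) lin_cat_scheme \<Rightarrow> ('p, 'n, 'k, 'o, 'm, 'y) braided_module_cat_scheme \<Rightarrow>
   ('o, 'm, 'k, 'z) lin_cat_scheme" where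
  "symmetric_center C M = full_subcategory C
     {X \<in> Ob C. \<forall>A \<in> Ob M. MBraid M X A = Idn M (X \<triangleright>\<^bsub>M\<^esub> A)}"

definition trivial_symmetric_center ::
  "('o, 'm, 'k::field, 'z) lin_cat_scheme \<Rightarrow> ('p, 'n, 'k, 'o, 'm, 'y) braided_module_cat_scheme
   \<Rightarrow> bool" where
  "trivial_symmetric_center C M \<longleftrightarrow>
     linearly_equivalent (symmetric_center C M)
       (FdVec :: (('k, nat \<Rightarrow> 'k) vec_space,
          ('k, nat \<Rightarrow> 'k) vec_space \<times> ('k, nat \<Rightarrow> 'k) vec_space \<times> ((nat \<Rightarrow> 'k) \<Rightarrow> nat \<Rightarrow> 'k),
          'k) lin_cat)"

end

theory Submission
  imports Defs
begin

text \<open>The map \<open>\<Omega>\<close> is \<open>\<theta>\<close> preceded by the duality bijection \<open>Hom(E\<^sub>C, 1) \<cong> Hom(1, E\<^sub>C\<^sup>*)\<close>, so it is bijective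
  when \<open>\<theta>\<close> is invertible. For the same reason a morphism \<open>f : E\<^sub>C \<rightarrow> V\<close> is determined by
  \<open>(f \<otimes> E\<^sub>M) \<omega>\<close>. If the module braiding is trivial on \<open>Y = D\<^sup>*\<close>, then the component of \<open>\<omega>\<close> at \<open>D\<close> is
  just \<open>coev\<^sub>D \<otimes> coev\<^sub>A\<close>, and therefore \<open>\<pi>\<^sub>C(D)\<close> factors through \<open>\<pi>\<^sub>C(1)\<close>.

  For a projective cover \<open>Q\<close> of a simple object there are an object \<open>P\<close> and perfect pairings of
  \<open>Hom(P, X)\<close> with \<open>Hom(Q, X\<^sup>*)\<close>, natural in \<open>X\<close>; dual bases \<open>h\<^sub>i\<close>, \<open>k\<^sub>i\<close> give a morphism
  \<open>P \<otimes> Q \<rightarrow> E\<^sub>C\<close> with components \<open>\<Sum> h\<^sub>i \<otimes> k\<^sub>i\<close>. The factorization of \<open>\<pi>\<^sub>C(D)\<close> now shows that whatever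
  is killed by all morphisms \<open>Q \<rightarrow> 1\<close> is killed by all morphisms \<open>Q \<rightarrow> Y\<close>. Letting \<open>Q\<close> vary, \<open>Y\<close> is
  generated by \<open>Hom(1, Y)\<close>; since \<open>1\<close> is simple with scalar endomorphisms, \<open>Y\<close> is a multiple of \<open>1\<close>.
  Conversely the module braiding is trivial on multiples of \<open>1\<close>.\<close>

text \<open>The ends \<open>EC\<close> and \<open>EM\<close> are known only through their universal
  properties, so \<open>EC\<close> can be probed only by mapping into it. The probe must be a wedge
  that remembers every morphism out of \<open>Q\<close>, and its dinaturality requires one linear
  functional to define the pairings for all \<open>X\<close> at once. That functional lives on
  \<open>Hom(Q \<otimes> P, 1)\<close>, where \<open>P\<close> and \<open>Q\<close> cover a dual
  pair of simple objects, and it is normalised at a single nonzero morphism that all the pairings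
  attain. Simplicity of the unit is not an axiom here. It comes from the scalar endomorphisms of the
  unit and the braiding: a subobject \<open>J\<close> of the unit with quotient \<open>L\<close>
  satisfies \<open>J \<otimes> L = 0\<close>, the braiding turns this into the same statement for
  the dual of \<open>L\<close>, and then the quotient morphism splits. The monoidal structure is not
  strict. Currying along a dual pair is therefore proved once, for a general action, and used for
  multiplication from the left, multiplication from the right and the action on
  \<open>M\<close>.\<close>

section \<open>Isomorphisms in a category\<close>

text \<open>Packing the typing of a factor into one predicate leaves a single side condition on it in each
  rewrite rule for composites.\<close>

definition arr_to :: "('o, 'm, 'k, 'z) lin_cat_scheme \<Rightarrow> 'm \<Rightarrow> 'o \<Rightarrow> bool" where
  "arr_to C f B \<longleftrightarrow> f \<in> Ar C \<and> Cod C f = B"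

context category
begin

lemma Hom_iff: "f \<in> Hom C A B \<longleftrightarrow> f \<in> Ar C \<and> Dom C f = A \<and> Cod C f = B"
  by (simp add: Hom_def)

lemma Hom_Ob: "f \<in> Hom C A B \<Longrightarrow> A \<in> Ob C \<and> B \<in> Ob C"
  using Dom_Ob Cod_Ob by (auto simp: Hom_def)

lemma arr_toI [simp]: "\<lbrakk>f \<in> Ar C; Cod C f = B\<rbrakk> \<Longrightarrow> arr_to C f B"
  by (simp add: arr_to_def)

lemma Comp_Ar [simp]: "\<lbrakk>g \<in> Ar C; arr_to C f (Dom C g)\<rbrakk> \<Longrightarrow> g \<cdot> f \<in> Ar C"
  and Dom_Comp [simp]: "\<lbrakk>g \<in> Ar C; arr_to C f (Dom C g)\<rbrakk> \<Longrightarrow> Dom C (g \<cdot> f) = Dom C f"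
  and Cod_Comp [simp]: "\<lbrakk>g \<in> Ar C; arr_to C f (Dom C g)\<rbrakk> \<Longrightarrow> Cod C (g \<cdot> f) = Cod C g"
  using Comp_Hom[of f "Dom C f" "Cod C f" g "Cod C g"] by (auto simp: Hom_iff arr_to_def)

lemma Idn_Ar [simp]: "A \<in> Ob C \<Longrightarrow> Idn C A \<in> Ar C"
  and Dom_Idn [simp]: "A \<in> Ob C \<Longrightarrow> Dom C (Idn C A) = A"
  and Cod_Idn [simp]: "A \<in> Ob C \<Longrightarrow> Cod C (Idn C A) = A"
  using Idn_Hom[of A] by (auto simp: Hom_iff)

lemma Dom_Ob' [simp]: "f \<in> Ar C \<Longrightarrow> Dom C f \<in> Ob C"
  and Cod_Ob' [simp]: "f \<in> Ar C \<Longrightarrow> Cod C f \<in> Ob C"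
  by (rule Dom_Ob Cod_Ob; assumption)+

lemma Comp_Idn' [simp]: "\<lbrakk>f \<in> Ar C; Dom C f = A\<rbrakk> \<Longrightarrow> f \<cdot> Idn C A = f"
  and Idn_Comp' [simp]: "\<lbrakk>f \<in> Ar C; Cod C f = B\<rbrakk> \<Longrightarrow> Idn C B \<cdot> f = f"
  using Comp_Idn[of f A "Cod C f"] Idn_Comp[of f "Dom C f" B] by (auto simp: Hom_iff)

lemma Comp_assoc' [simp]:
  "\<lbrakk>h \<in> Ar C; arr_to C g (Dom C h); arr_to C f (Dom C g)\<rbrakk> \<Longrightarrow> (h \<cdot> g) \<cdot> f = h \<cdot> (g \<cdot> f)"
  using Comp_assoc[of f "Dom C f" "Cod C f" g "Cod C g" h "Cod C h"] by (auto simp: Hom_iff arr_to_def)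

text \<open>Composites are normalised to the right, where an equation for \<open>g \<cdot> f\<close>
  no longer matches; this form applies it at the head of a longer composite.\<close>

lemma Comp_eq:
  "\<lbrakk>g \<cdot> f = h; f \<in> Ar C; g \<in> Ar C; Cod C f = Dom C g; x \<in> Ar C; Cod C x = Dom C f\<rbrakk>
    \<Longrightarrow> g \<cdot> (f \<cdot> x) = h \<cdot> x"
  using Comp_assoc'[of g f x] by simp

lemma is_inverse_unique: "\<lbrakk>is_inverse C f g; is_inverse C f h\<rbrakk> \<Longrightarrow> g = h"
proof -
  assume "is_inverse C f g" "is_inverse C f h"
  then have f: "f \<in> Ar C" and g: "g \<in> Ar C" "Dom C g = Cod C f" "Cod C g = Dom C f"
    "g \<cdot> f = Idn C (Dom C f)" and h: "h \<in> Ar C" "Dom C h = Cod C f" "Cod C h = Dom C f"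
    "f \<cdot> h = Idn C (Cod C f)"
    by (auto simp: is_inverse_def Hom_iff)
  have "g = g \<cdot> (f \<cdot> h)" using g h by simp
  also have "\<dots> = h" using Comp_assoc'[of g f h] f g h by simp
  finally show "g = h" .
qed

lemma Inv_is_inverse: "iso C f \<Longrightarrow> is_inverse C f (Inv C f)"
  unfolding iso_def Inv_def using is_inverse_unique theI'[of "is_inverse C f"] by blast

lemma Inv_eq: "is_inverse C f g \<Longrightarrow> Inv C f = g"
  using Inv_is_inverse is_inverse_unique unfolding iso_def by blast

lemma iso_Ar: "iso C f \<Longrightarrow> f \<in> Ar C"
  by (auto simp: iso_def is_inverse_def)

lemma Inv_Ar [simp]: "iso C f \<Longrightarrow> Inv C f \<in> Ar C"
  and Dom_Inv [simp]: "iso C f \<Longrightarrow> Dom C (Inv C f) = Cod C f"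
  and Cod_Inv [simp]: "iso C f \<Longrightarrow> Cod C (Inv C f) = Dom C f"
  and Inv_Comp [simp]: "iso C f \<Longrightarrow> Inv C f \<cdot> f = Idn C (Dom C f)"
  and Comp_Inv [simp]: "iso C f \<Longrightarrow> f \<cdot> Inv C f = Idn C (Cod C f)"
  using Inv_is_inverse[of f] by (auto simp: is_inverse_def Hom_iff)

lemma Inv_Comp' [simp]: "\<lbrakk>iso C f; x \<in> Ar C; Cod C x = Dom C f\<rbrakk> \<Longrightarrow> Inv C f \<cdot> (f \<cdot> x) = x"
  and Comp_Inv' [simp]: "\<lbrakk>iso C f; x \<in> Ar C; Cod C x = Cod C f\<rbrakk> \<Longrightarrow> f \<cdot> (Inv C f \<cdot> x) = x"
  using Comp_eq[OF Inv_Comp, of f x] Comp_eq[OF Comp_Inv, of f x] by (auto simp: iso_Ar)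

lemma isoI:
  "\<lbrakk>f \<in> Ar C; g \<in> Ar C; Dom C g = Cod C f; Cod C g = Dom C f; g \<cdot> f = Idn C (Dom C f);
    f \<cdot> g = Idn C (Cod C f)\<rbrakk> \<Longrightarrow> iso C f"
  and Inv_eqI:
  "\<lbrakk>f \<in> Ar C; g \<in> Ar C; Dom C g = Cod C f; Cod C g = Dom C f; g \<cdot> f = Idn C (Dom C f);
    f \<cdot> g = Idn C (Cod C f)\<rbrakk> \<Longrightarrow> Inv C f = g"
  using Inv_eq[of f g] by (auto simp: iso_def is_inverse_def Hom_iff)

lemma iso_Inv [simp]: "iso C f \<Longrightarrow> iso C (Inv C f)"
  and Inv_Inv [simp]: "iso C f \<Longrightarrow> Inv C (Inv C f) = f"
  by (auto intro!: isoI[of _ f] Inv_eqI simp: iso_Ar)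

lemma iso_Comp: "\<lbrakk>iso C f; iso C g; Cod C f = Dom C g\<rbrakk> \<Longrightarrow> iso C (g \<cdot> f)"
  and Inv_Comp_distrib: "\<lbrakk>iso C f; iso C g; Cod C f = Dom C g\<rbrakk> \<Longrightarrow> Inv C (g \<cdot> f) = Inv C f \<cdot> Inv C g"
  by (auto intro!: isoI[of _ "Inv C f \<cdot> Inv C g"] Inv_eqI simp: iso_Ar)

lemma iso_Idn [simp]: "A \<in> Ob C \<Longrightarrow> iso C (Idn C A)"
  and Inv_Idn [simp]: "A \<in> Ob C \<Longrightarrow> Inv C (Idn C A) = Idn C A"
  by (auto intro!: isoI[of _ "Idn C A"] Inv_eqI)

lemma iso_cancel_right:
  assumes a: "iso C a" and eq: "f \<cdot> a = g \<cdot> a"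
    and ty: "f \<in> Ar C" "g \<in> Ar C" "Dom C f = Cod C a" "Dom C g = Cod C a"
  shows "f = g"
proof -
  have "f = (f \<cdot> a) \<cdot> Inv C a" using a ty by (simp add: iso_Ar)
  also have "\<dots> = g" unfolding eq using a ty by (simp add: iso_Ar)
  finally show ?thesis .
qed

lemma iso_cancel_left:
  assumes a: "iso C a" and eq: "a \<cdot> f = a \<cdot> g"
    and ty: "f \<in> Ar C" "g \<in> Ar C" "Cod C f = Dom C a" "Cod C g = Dom C a"
  shows "f = g"
proof -
  have "f = Inv C a \<cdot> (a \<cdot> f)" using a ty by simp
  also have "\<dots> = g" unfolding eq using a ty by simp
  finally show ?thesis .
qed

lemma eq_InvI:
  assumes "a \<cdot> x = Idn C (Cod C a)" and a: "iso C a" and x: "x \<in> Ar C" "Cod C x = Dom C a"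
  shows "x = Inv C a"
proof -
  have "x = Inv C a \<cdot> (a \<cdot> x)" using a x by simp
  then show ?thesis using assms by simp
qed

text \<open>For \<open>a\<close> and \<open>b\<close> components of a natural isomorphism, this
  passes from its naturality square to the square of the inverse transformation.\<close>

lemma Inv_swap:
  assumes a: "iso C a" and b: "iso C b" and eq: "b \<cdot> f = g \<cdot> a"
    and ty: "f \<in> Ar C" "g \<in> Ar C" "Dom C f = Dom C a" "Cod C f = Dom C b"
      "Dom C g = Cod C a" "Cod C g = Cod C b"
  shows "Inv C b \<cdot> g = f \<cdot> Inv C a"
proof -
  have "Inv C b \<cdot> g = Inv C b \<cdot> ((g \<cdot> a) \<cdot> Inv C a)" using a b ty by (simp add: iso_Ar)
  also have "\<dots> = f \<cdot> Inv C a" unfolding eq[symmetric] using a b ty by (simp add: iso_Ar)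
  finally show ?thesis .
qed

end

section \<open>Actions of a monoidal category\<close>

text \<open>Only the coherence part of a module category, so that the left and the right multiplication
  of a monoidal category on itself are instances too.\<close>

locale actegory = C: monoidal_category C + M: category M
  for C :: "('o, 'm, 'k::field, 'z) tensor_cat_scheme" and M :: "('p, 'n, 'k, 'y) lin_cat_scheme" +
  fixes act :: "'o \<Rightarrow> 'p \<Rightarrow> 'p" and actm :: "'m \<Rightarrow> 'n \<Rightarrow> 'n"
    and ma :: "'o \<Rightarrow> 'o \<Rightarrow> 'p \<Rightarrow> 'n" and mu :: "'p \<Rightarrow> 'n"
  assumes act_Ob [simp]: "\<lbrakk>X \<in> Ob C; A \<in> Ob M\<rbrakk> \<Longrightarrow> act X A \<in> Ob M"
    and actm_Hom: "\<lbrakk>f \<in> Hom C X X'; g \<in> Hom M A A'\<rbrakk> \<Longrightarrow> actm f g \<in> Hom M (act X A) (act X' A')"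
    and actm_Idn [simp]: "\<lbrakk>X \<in> Ob C; A \<in> Ob M\<rbrakk> \<Longrightarrow> actm (Idn C X) (Idn M A) = Idn M (act X A)"
    and actm_Comp: "\<lbrakk>f \<in> Hom C X X'; f' \<in> Hom C X' X''; g \<in> Hom M A A'; g' \<in> Hom M A' A''\<rbrakk>
      \<Longrightarrow> actm (f' \<cdot>\<^bsub>C\<^esub> f) (g' \<cdot>\<^bsub>M\<^esub> g) = actm f' g' \<cdot>\<^bsub>M\<^esub> actm f g"
    and ma_iso: "\<lbrakk>X \<in> Ob C; Y \<in> Ob C; A \<in> Ob M\<rbrakk>
      \<Longrightarrow> ma X Y A \<in> Hom M (act (X \<otimes>\<^bsub>C\<^esub> Y) A) (act X (act Y A)) \<and> iso M (ma X Y A)"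
    and ma_natural: "\<lbrakk>f \<in> Hom C X X'; f' \<in> Hom C Y Y'; g \<in> Hom M A A'\<rbrakk>
      \<Longrightarrow> ma X' Y' A' \<cdot>\<^bsub>M\<^esub> actm (f \<otimes>\<^sub>m\<^bsub>C\<^esub> f') g = actm f (actm f' g) \<cdot>\<^bsub>M\<^esub> ma X Y A"
    and mu_iso: "A \<in> Ob M \<Longrightarrow> mu A \<in> Hom M (act (Unit C) A) A \<and> iso M (mu A)"
    and mu_natural: "h \<in> Hom M A A' \<Longrightarrow> mu A' \<cdot>\<^bsub>M\<^esub> actm (Idn C (Unit C)) h = h \<cdot>\<^bsub>M\<^esub> mu A"
    and act_pentagon: "\<lbrakk>X \<in> Ob C; Y \<in> Ob C; Z \<in> Ob C; A \<in> Ob M\<rbrakk>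
      \<Longrightarrow> ma X Y (act Z A) \<cdot>\<^bsub>M\<^esub> ma (X \<otimes>\<^bsub>C\<^esub> Y) Z A =
          actm (Idn C X) (ma Y Z A) \<cdot>\<^bsub>M\<^esub> ma X (Y \<otimes>\<^bsub>C\<^esub> Z) A \<cdot>\<^bsub>M\<^esub> actm (Assoc C X Y Z) (Idn M A)"
    and act_triangle: "\<lbrakk>X \<in> Ob C; A \<in> Ob M\<rbrakk>
      \<Longrightarrow> actm (Idn C X) (mu A) \<cdot>\<^bsub>M\<^esub> ma X (Unit C) A = actm (RUnit C X) (Idn M A)"

context monoidal_category
begin

lemma Unit_Ob' [simp]: "Unit C \<in> Ob C"
  and Tens_Ob' [simp]: "\<lbrakk>X \<in> Ob C; Y \<in> Ob C\<rbrakk> \<Longrightarrow> X \<otimes> Y \<in> Ob C"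
  by (fact Unit_Ob Tens_Ob)+

lemma TensM_Ar [simp]: "\<lbrakk>f \<in> Ar C; g \<in> Ar C\<rbrakk> \<Longrightarrow> f \<otimes>\<^sub>m g \<in> Ar C"
  and Dom_TensM [simp]: "\<lbrakk>f \<in> Ar C; g \<in> Ar C\<rbrakk> \<Longrightarrow> Dom C (f \<otimes>\<^sub>m g) = Dom C f \<otimes> Dom C g"
  and Cod_TensM [simp]: "\<lbrakk>f \<in> Ar C; g \<in> Ar C\<rbrakk> \<Longrightarrow> Cod C (f \<otimes>\<^sub>m g) = Cod C f \<otimes> Cod C g"
  using TensM_Hom[of f "Dom C f" "Cod C f" g "Dom C g" "Cod C g"] by (auto simp: Hom_iff)

lemma TensM_Idn' [simp]: "\<lbrakk>X \<in> Ob C; Y \<in> Ob C\<rbrakk> \<Longrightarrow> Idn C X \<otimes>\<^sub>m Idn C Y = Idn C (X \<otimes> Y)"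
  by (fact TensM_Idn)

lemma TensM_merge:
  "\<lbrakk>f \<in> Ar C; f' \<in> Ar C; g \<in> Ar C; g' \<in> Ar C; Cod C f = Dom C f'; Cod C g = Dom C g'\<rbrakk>
    \<Longrightarrow> (f' \<otimes>\<^sub>m g') \<cdot> (f \<otimes>\<^sub>m g) = (f' \<cdot> f) \<otimes>\<^sub>m (g' \<cdot> g)"
  using TensM_Comp[of f "Dom C f" "Cod C f" f' "Cod C f'" g "Dom C g" "Cod C g" g' "Cod C g'"]
  by (simp add: Hom_iff)

lemma Assoc_Ar [simp]: "\<lbrakk>X \<in> Ob C; Y \<in> Ob C; Z \<in> Ob C\<rbrakk> \<Longrightarrow> Assoc C X Y Z \<in> Ar C"
  and Dom_Assoc [simp]: "\<lbrakk>X \<in> Ob C; Y \<in> Ob C; Z \<in> Ob C\<rbrakk> \<Longrightarrow> Dom C (Assoc C X Y Z) = (X \<otimes> Y) \<otimes> Z"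
  and Cod_Assoc [simp]: "\<lbrakk>X \<in> Ob C; Y \<in> Ob C; Z \<in> Ob C\<rbrakk> \<Longrightarrow> Cod C (Assoc C X Y Z) = X \<otimes> (Y \<otimes> Z)"
  and iso_Assoc [simp]: "\<lbrakk>X \<in> Ob C; Y \<in> Ob C; Z \<in> Ob C\<rbrakk> \<Longrightarrow> iso C (Assoc C X Y Z)"
  using Assoc_iso[of X Y Z] by (auto simp: Hom_iff)

lemma LUnit_Ar [simp]: "X \<in> Ob C \<Longrightarrow> LUnit C X \<in> Ar C"
  and Dom_LUnit [simp]: "X \<in> Ob C \<Longrightarrow> Dom C (LUnit C X) = Unit C \<otimes> X"
  and Cod_LUnit [simp]: "X \<in> Ob C \<Longrightarrow> Cod C (LUnit C X) = X"
  and iso_LUnit [simp]: "X \<in> Ob C \<Longrightarrow> iso C (LUnit C X)"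
  using LUnit_iso[of X] by (auto simp: Hom_iff)

lemma RUnit_Ar [simp]: "X \<in> Ob C \<Longrightarrow> RUnit C X \<in> Ar C"
  and Dom_RUnit [simp]: "X \<in> Ob C \<Longrightarrow> Dom C (RUnit C X) = X \<otimes> Unit C"
  and Cod_RUnit [simp]: "X \<in> Ob C \<Longrightarrow> Cod C (RUnit C X) = X"
  and iso_RUnit [simp]: "X \<in> Ob C \<Longrightarrow> iso C (RUnit C X)"
  using RUnit_iso[of X] by (auto simp: Hom_iff)

lemma iso_TensM [simp]: "\<lbrakk>iso C f; iso C g\<rbrakk> \<Longrightarrow> iso C (f \<otimes>\<^sub>m g)"
  and Inv_TensM: "\<lbrakk>iso C f; iso C g\<rbrakk> \<Longrightarrow> Inv C (f \<otimes>\<^sub>m g) = Inv C f \<otimes>\<^sub>m Inv C g"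
  by (auto intro!: isoI[of _ "Inv C f \<otimes>\<^sub>m Inv C g"] Inv_eqI simp: iso_Ar TensM_merge)

end

context actegory
begin

lemma actm_Ar [simp]: "\<lbrakk>f \<in> Ar C; g \<in> Ar M\<rbrakk> \<Longrightarrow> actm f g \<in> Ar M"
  and Dom_actm [simp]: "\<lbrakk>f \<in> Ar C; g \<in> Ar M\<rbrakk> \<Longrightarrow> Dom M (actm f g) = act (Dom C f) (Dom M g)"
  and Cod_actm [simp]: "\<lbrakk>f \<in> Ar C; g \<in> Ar M\<rbrakk> \<Longrightarrow> Cod M (actm f g) = act (Cod C f) (Cod M g)"
  using actm_Hom[of f "Dom C f" "Cod C f" g "Dom M g" "Cod M g"] by (auto simp: C.Hom_iff M.Hom_iff)

lemma actm_merge: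
  "\<lbrakk>f \<in> Ar C; f' \<in> Ar C; g \<in> Ar M; g' \<in> Ar M; Cod C f = Dom C f'; Cod M g = Dom M g'\<rbrakk>
    \<Longrightarrow> actm f' g' \<cdot>\<^bsub>M\<^esub> actm f g = actm (f' \<cdot>\<^bsub>C\<^esub> f) (g' \<cdot>\<^bsub>M\<^esub> g)"
  using actm_Comp[of f "Dom C f" "Cod C f" f' "Cod C f'" g "Dom M g" "Cod M g" g' "Cod M g'"]
  by (simp add: C.Hom_iff M.Hom_iff)

lemma actm_merge':
  "\<lbrakk>f \<in> Ar C; f' \<in> Ar C; g \<in> Ar M; g' \<in> Ar M; Cod C f = Dom C f'; Cod M g = Dom M g';
    x \<in> Ar M; Cod M x = act (Dom C f) (Dom M g)\<rbrakk>
    \<Longrightarrow> actm f' g' \<cdot>\<^bsub>M\<^esub> (actm f g \<cdot>\<^bsub>M\<^esub> x) = actm (f' \<cdot>\<^bsub>C\<^esub> f) (g' \<cdot>\<^bsub>M\<^esub> g) \<cdot>\<^bsub>M\<^esub> x"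
  by (rule M.Comp_eq[OF actm_merge]) auto

lemma actm_expand_right:
  "\<lbrakk>X \<in> Ob C; g \<in> Ar M; g' \<in> Ar M; Cod M g = Dom M g'\<rbrakk>
    \<Longrightarrow> actm (Idn C X) (g' \<cdot>\<^bsub>M\<^esub> g) = actm (Idn C X) g' \<cdot>\<^bsub>M\<^esub> actm (Idn C X) g"
  by (simp add: actm_merge)

lemma actm_expand_left:
  "\<lbrakk>A \<in> Ob M; g \<in> Ar C; g' \<in> Ar C; Cod C g = Dom C g'\<rbrakk>
    \<Longrightarrow> actm (g' \<cdot>\<^bsub>C\<^esub> g) (Idn M A) = actm g' (Idn M A) \<cdot>\<^bsub>M\<^esub> actm g (Idn M A)"
  by (simp add: actm_merge)

lemma ma_Ar [simp]: "\<lbrakk>X \<in> Ob C; Y \<in> Ob C; A \<in> Ob M\<rbrakk> \<Longrightarrow> ma X Y A \<in> Ar M"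
  and Dom_ma [simp]: "\<lbrakk>X \<in> Ob C; Y \<in> Ob C; A \<in> Ob M\<rbrakk> \<Longrightarrow> Dom M (ma X Y A) = act (X \<otimes>\<^bsub>C\<^esub> Y) A"
  and Cod_ma [simp]: "\<lbrakk>X \<in> Ob C; Y \<in> Ob C; A \<in> Ob M\<rbrakk> \<Longrightarrow> Cod M (ma X Y A) = act X (act Y A)"
  and iso_ma [simp]: "\<lbrakk>X \<in> Ob C; Y \<in> Ob C; A \<in> Ob M\<rbrakk> \<Longrightarrow> iso M (ma X Y A)"
  using ma_iso[of X Y A] by (auto simp: M.Hom_iff)

lemma mu_Ar [simp]: "A \<in> Ob M \<Longrightarrow> mu A \<in> Ar M"
  and Dom_mu [simp]: "A \<in> Ob M \<Longrightarrow> Dom M (mu A) = act (Unit C) A"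
  and Cod_mu [simp]: "A \<in> Ob M \<Longrightarrow> Cod M (mu A) = A"
  and iso_mu [simp]: "A \<in> Ob M \<Longrightarrow> iso M (mu A)"
  using mu_iso[of A] by (auto simp: M.Hom_iff)

lemma iso_actm [simp]: "\<lbrakk>iso C f; iso M g\<rbrakk> \<Longrightarrow> iso M (actm f g)"
  and Inv_actm: "\<lbrakk>iso C f; iso M g\<rbrakk> \<Longrightarrow> Inv M (actm f g) = actm (Inv C f) (Inv M g)"
  by (auto intro!: M.isoI[of _ "actm (Inv C f) (Inv M g)"] M.Inv_eqI
      simp: C.iso_Ar M.iso_Ar actm_merge)

lemma ma_nat:
  "\<lbrakk>f \<in> Ar C; f' \<in> Ar C; g \<in> Ar M; X' = Cod C f; Y' = Cod C f'; A' = Cod M g\<rbrakk>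
    \<Longrightarrow> ma X' Y' A' \<cdot>\<^bsub>M\<^esub> actm (f \<otimes>\<^sub>m\<^bsub>C\<^esub> f') g = actm f (actm f' g) \<cdot>\<^bsub>M\<^esub> ma (Dom C f) (Dom C f') (Dom M g)"
  using ma_natural[of f "Dom C f" X' f' "Dom C f'" Y' g "Dom M g" A'] by (simp add: C.Hom_iff M.Hom_iff)

lemma Inv_ma_nat:
  "\<lbrakk>f \<in> Ar C; f' \<in> Ar C; g \<in> Ar M; X' = Cod C f; Y' = Cod C f'; A' = Cod M g\<rbrakk>
    \<Longrightarrow> Inv M (ma X' Y' A') \<cdot>\<^bsub>M\<^esub> actm f (actm f' g)
      = actm (f \<otimes>\<^sub>m\<^bsub>C\<^esub> f') g \<cdot>\<^bsub>M\<^esub> Inv M (ma (Dom C f) (Dom C f') (Dom M g))"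
  by (rule M.Inv_swap) (auto intro: ma_nat)

lemma mu_nat: "\<lbrakk>h \<in> Ar M; A' = Cod M h\<rbrakk>
    \<Longrightarrow> mu A' \<cdot>\<^bsub>M\<^esub> actm (Idn C (Unit C)) h = h \<cdot>\<^bsub>M\<^esub> mu (Dom M h)"
  using mu_natural[of h "Dom M h" A'] by (simp add: M.Hom_iff)

lemma Inv_mu_nat: "\<lbrakk>h \<in> Ar M; A' = Cod M h\<rbrakk>
    \<Longrightarrow> Inv M (mu A') \<cdot>\<^bsub>M\<^esub> h = actm (Idn C (Unit C)) h \<cdot>\<^bsub>M\<^esub> Inv M (mu (Dom M h))"
  by (rule M.Inv_swap) (auto intro: mu_nat)

text \<open>By naturality, \<open>mu\<close> conjugates the action of the unit object into the
  identity functor.\<close>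

lemma act_Unit_faithful:
  assumes "f \<in> Ar M" "g \<in> Ar M" "Dom M f = Dom M g" "Cod M f = Cod M g"
    "actm (Idn C (Unit C)) f = actm (Idn C (Unit C)) g"
  shows "f = g"
proof -
  have "f \<cdot>\<^bsub>M\<^esub> mu (Dom M f) = g \<cdot>\<^bsub>M\<^esub> mu (Dom M f)"
    using mu_nat[of f] mu_nat[of g] assms by simp
  then show ?thesis using assms by (intro M.iso_cancel_right[of "mu (Dom M f)" f g]) simp_all
qed

text \<open>The argument is Kelly's: the unit acts faithfully, so it suffices to compare the two sides after
  acting with the unit, where the pentagon and the triangle apply.\<close>

lemma act_LUnit:
  assumes X: "X \<in> Ob C" and A: "A \<in> Ob M"
  shows "mu (act X A) \<cdot>\<^bsub>M\<^esub> ma (Unit C) X A = actm (LUnit C X) (Idn M A)"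
proof (rule act_Unit_faithful)
  let ?I = "Unit C"
  note [simp] = X A
  \<comment> \<open>The pentagon speaks about composites with this isomorphism, so both sides are
    compared after it and it is cancelled at the end.\<close>
  let ?a = "ma ?I (?I \<otimes>\<^bsub>C\<^esub> X) A \<cdot>\<^bsub>M\<^esub> actm (Assoc C ?I ?I X) (Idn M A)"
  have "actm (Idn C ?I) (mu (act X A) \<cdot>\<^bsub>M\<^esub> ma ?I X A) \<cdot>\<^bsub>M\<^esub> ?a
      = actm (Idn C ?I) (mu (act X A)) \<cdot>\<^bsub>M\<^esub> (ma ?I ?I (act X A) \<cdot>\<^bsub>M\<^esub> ma (?I \<otimes>\<^bsub>C\<^esub> ?I) X A)"
    by (simp add: actm_expand_right act_pentagon)
  also have "\<dots> = actm (RUnit C ?I) (Idn M (act X A)) \<cdot>\<^bsub>M\<^esub> ma (?I \<otimes>\<^bsub>C\<^esub> ?I) X A"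
    by (simp add: M.Comp_eq[OF act_triangle])
  also have "\<dots> = ma ?I X A \<cdot>\<^bsub>M\<^esub> actm (RUnit C ?I \<otimes>\<^sub>m\<^bsub>C\<^esub> Idn C X) (Idn M A)"
    by (simp add: ma_nat)
  also have "\<dots> = ma ?I X A \<cdot>\<^bsub>M\<^esub> actm (Idn C ?I \<otimes>\<^sub>m\<^bsub>C\<^esub> LUnit C X) (Idn M A) \<cdot>\<^bsub>M\<^esub> actm (Assoc C ?I ?I X) (Idn M A)"
    by (simp add: C.triangle[symmetric] actm_expand_left)
  also have "\<dots> = actm (Idn C ?I) (actm (LUnit C X) (Idn M A)) \<cdot>\<^bsub>M\<^esub> ?a"
    by (simp add: M.Comp_eq[OF ma_nat])
  finally show "actm (Idn C ?I) (mu (act X A) \<cdot>\<^bsub>M\<^esub> ma ?I X A)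
      = actm (Idn C ?I) (actm (LUnit C X) (Idn M A))"
    by (rule M.iso_cancel_right[rotated]) (auto intro!: M.iso_Comp)
qed (use assms in auto)

end

subsection \<open>Currying along a dual pair\<close>

context monoidal_category
begin

lemma left_dualD:
  assumes "is_left_dual C X D e c"
  shows "X \<in> Ob C" "D \<in> Ob C" "e \<in> Ar C" "Dom C e = D \<otimes> X" "Cod C e = Unit C"
    "c \<in> Ar C" "Dom C c = Unit C" "Cod C c = X \<otimes> D"
    "RUnit C X \<cdot> (Idn C X \<otimes>\<^sub>m e) \<cdot> Assoc C X D X \<cdot> (c \<otimes>\<^sub>m Idn C X) \<cdot> Inv C (LUnit C X) = Idn C X"
    "LUnit C D \<cdot> (e \<otimes>\<^sub>m Idn C D) \<cdot> Inv C (Assoc C D X D) \<cdot> (Idn C D \<otimes>\<^sub>m c) \<cdot> Inv C (RUnit C D) = Idn C D"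
  using assms by (auto simp: is_left_dual_def Hom_iff)

lemma left_dual_zigzag:
  assumes "is_left_dual C X D e c"
  shows "RUnit C X \<cdot> (Idn C X \<otimes>\<^sub>m e) \<cdot> Assoc C X D X \<cdot> (c \<otimes>\<^sub>m Idn C X) = LUnit C X"
    and "LUnit C D \<cdot> (e \<otimes>\<^sub>m Idn C D) \<cdot> Inv C (Assoc C D X D) \<cdot> (Idn C D \<otimes>\<^sub>m c) = RUnit C D"
proof -
  note d [simp] = left_dualD[OF assms]
  show "RUnit C X \<cdot> (Idn C X \<otimes>\<^sub>m e) \<cdot> Assoc C X D X \<cdot> (c \<otimes>\<^sub>m Idn C X) = LUnit C X"
    by (rule iso_cancel_right[of "Inv C (LUnit C X)"]) simp_all
  show "LUnit C D \<cdot> (e \<otimes>\<^sub>m Idn C D) \<cdot> Inv C (Assoc C D X D) \<cdot> (Idn C D \<otimes>\<^sub>m c) = RUnit C D"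
    by (rule iso_cancel_right[of "Inv C (RUnit C D)"]) simp_all
qed

end

context actegory
begin

text \<open>\<open>curry\<close> and \<open>uncurry\<close> are the two directions of the adjunction
  \<open>Hom(N, act X A) \<cong> Hom(act D N, A)\<close>: acting with the left dual \<open>D\<close>
  is left adjoint to acting with \<open>X\<close>.\<close>

definition curry :: "'o \<Rightarrow> 'o \<Rightarrow> 'm \<Rightarrow> 'p \<Rightarrow> 'n \<Rightarrow> 'n" where
  "curry X D e A h = mu A \<cdot>\<^bsub>M\<^esub> actm e (Idn M A) \<cdot>\<^bsub>M\<^esub> Inv M (ma D X A) \<cdot>\<^bsub>M\<^esub> actm (Idn C D) h"

definition uncurry :: "'o \<Rightarrow> 'o \<Rightarrow> 'm \<Rightarrow> 'p \<Rightarrow> 'n \<Rightarrow> 'n" where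
  "uncurry X D c N f = actm (Idn C X) f \<cdot>\<^bsub>M\<^esub> ma X D N \<cdot>\<^bsub>M\<^esub> actm c (Idn M N) \<cdot>\<^bsub>M\<^esub> Inv M (mu N)"

lemma curry_Hom:
  assumes "is_left_dual C X D e c" "h \<in> Hom M N (act X A)" "A \<in> Ob M"
  shows "curry X D e A h \<in> Hom M (act D N) A"
  using C.left_dualD[OF assms(1)] assms(2,3) by (simp add: curry_def M.Hom_iff)

lemma uncurry_Hom:
  assumes "is_left_dual C X D e c" "f \<in> Hom M (act D N) A" "N \<in> Ob M"
  shows "uncurry X D c N f \<in> Hom M N (act X A)"
  using C.left_dualD[OF assms(1)] assms(2,3) by (simp add: uncurry_def M.Hom_iff)

lemma curry_Comp_right:
  assumes "is_left_dual C X D e c" "h \<in> Hom M N (act X A)" "A \<in> Ob M" "g \<in> Hom M N' N"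
  shows "curry X D e A (h \<cdot>\<^bsub>M\<^esub> g) = curry X D e A h \<cdot>\<^bsub>M\<^esub> actm (Idn C D) g"
  using C.left_dualD[OF assms(1)] assms(2-) by (simp add: curry_def M.Hom_iff actm_expand_right)

lemma curry_act_Comp:
  assumes "is_left_dual C X D e c" "h \<in> Hom M N (act X A)" "f \<in> Hom M A A'"
  shows "curry X D e A' (actm (Idn C X) f \<cdot>\<^bsub>M\<^esub> h) = f \<cdot>\<^bsub>M\<^esub> curry X D e A h"
proof -
  note [simp] = C.left_dualD[OF assms(1)]
  have h [simp]: "h \<in> Ar M" "Dom M h = N" "Cod M h = act X A"
    and f [simp]: "f \<in> Ar M" "Dom M f = A" "Cod M f = A'" and A [simp]: "A \<in> Ob M" "A' \<in> Ob M"
    using assms M.Hom_Ob by (auto simp: M.Hom_iff)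
  have "curry X D e A' (actm (Idn C X) f \<cdot>\<^bsub>M\<^esub> h)
      = mu A' \<cdot>\<^bsub>M\<^esub> actm e (Idn M A') \<cdot>\<^bsub>M\<^esub> (Inv M (ma D X A') \<cdot>\<^bsub>M\<^esub> actm (Idn C D) (actm (Idn C X) f)) \<cdot>\<^bsub>M\<^esub> actm (Idn C D) h"
    by (simp add: curry_def actm_expand_right)
  also have "\<dots> = mu A' \<cdot>\<^bsub>M\<^esub> (actm e (Idn M A') \<cdot>\<^bsub>M\<^esub> actm (Idn C D \<otimes>\<^sub>m\<^bsub>C\<^esub> Idn C X) f) \<cdot>\<^bsub>M\<^esub> Inv M (ma D X A) \<cdot>\<^bsub>M\<^esub> actm (Idn C D) h"
    by (simp add: Inv_ma_nat)
  also have "actm e (Idn M A') \<cdot>\<^bsub>M\<^esub> actm (Idn C D \<otimes>\<^sub>m\<^bsub>C\<^esub> Idn C X) f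
      = actm (Idn C (Unit C)) f \<cdot>\<^bsub>M\<^esub> actm e (Idn M A)"
    by (simp add: actm_merge)
  finally show ?thesis by (simp add: curry_def M.Comp_eq[OF mu_nat])
qed

text \<open>\<open>curry_act_Comp\<close> reduces the claim to the identity in place of
  \<open>f\<close>, that is to the unit \<open>?u\<close> of the adjunction. The equations
  \<open>p1\<close> to \<open>p4\<close> then collect all constraints inside \<open>C\<close>, where
  the composite is the zigzag identity for \<open>D\<close>.\<close>

lemma curry_uncurry:
  assumes "is_left_dual C X D e c" "f \<in> Hom M (act D N) A" "N \<in> Ob M"
  shows "curry X D e A (uncurry X D c N f) = f"
proof -
  note d [simp] = C.left_dualD(1-8)[OF assms(1)]
  have f [simp]: "f \<in> Ar M" "Dom M f = act D N" "Cod M f = A" and A [simp]: "A \<in> Ob M" "N \<in> Ob M"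
    using assms M.Hom_Ob by (auto simp: M.Hom_iff)
  let ?I = "Unit C"
  let ?u = "ma X D N \<cdot>\<^bsub>M\<^esub> actm c (Idn M N) \<cdot>\<^bsub>M\<^esub> Inv M (mu N)"
  have u: "?u \<in> Hom M N (act X (act D N))" by (simp add: M.Hom_iff)
  have p1: "Inv M (ma D X (act D N)) \<cdot>\<^bsub>M\<^esub> actm (Idn C D) (ma X D N)
      = (ma (D \<otimes>\<^bsub>C\<^esub> X) D N \<cdot>\<^bsub>M\<^esub> actm (Inv C (Assoc C D X D)) (Idn M N)) \<cdot>\<^bsub>M\<^esub> Inv M (ma D (X \<otimes>\<^bsub>C\<^esub> D) N)"
  proof (rule M.Inv_swap)
    show "ma D X (act D N) \<cdot>\<^bsub>M\<^esub> ma (D \<otimes>\<^bsub>C\<^esub> X) D N \<cdot>\<^bsub>M\<^esub> actm (Inv C (Assoc C D X D)) (Idn M N)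
        = actm (Idn C D) (ma X D N) \<cdot>\<^bsub>M\<^esub> ma D (X \<otimes>\<^bsub>C\<^esub> D) N"
      by (simp add: M.Comp_eq[OF act_pentagon] actm_merge)
  qed simp_all
  have p2: "Inv M (ma D (X \<otimes>\<^bsub>C\<^esub> D) N) \<cdot>\<^bsub>M\<^esub> actm (Idn C D) (actm c (Idn M N))
      = actm (Idn C D \<otimes>\<^sub>m\<^bsub>C\<^esub> c) (Idn M N) \<cdot>\<^bsub>M\<^esub> Inv M (ma D ?I N)"
    by (simp add: Inv_ma_nat)
  have p3: "actm e (Idn M (act D N)) \<cdot>\<^bsub>M\<^esub> ma (D \<otimes>\<^bsub>C\<^esub> X) D N = ma ?I D N \<cdot>\<^bsub>M\<^esub> actm (e \<otimes>\<^sub>m\<^bsub>C\<^esub> Idn C D) (Idn M N)"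
    by (simp add: ma_nat)
  have p4: "Inv M (ma D ?I N) \<cdot>\<^bsub>M\<^esub> actm (Idn C D) (Inv M (mu N)) = actm (Inv C (RUnit C D)) (Idn M N)"
  proof -
    have "Inv M (ma D ?I N) \<cdot>\<^bsub>M\<^esub> actm (Idn C D) (Inv M (mu N))
        = Inv M (actm (Idn C D) (mu N) \<cdot>\<^bsub>M\<^esub> ma D ?I N)"
      by (simp add: M.Inv_Comp_distrib Inv_actm)
    then show ?thesis by (simp add: act_triangle Inv_actm)
  qed
  have "curry X D e (act D N) ?u
      = mu (act D N) \<cdot>\<^bsub>M\<^esub> actm e (Idn M (act D N)) \<cdot>\<^bsub>M\<^esub>
        (Inv M (ma D X (act D N)) \<cdot>\<^bsub>M\<^esub> actm (Idn C D) (ma X D N)) \<cdot>\<^bsub>M\<^esub>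
        actm (Idn C D) (actm c (Idn M N)) \<cdot>\<^bsub>M\<^esub> actm (Idn C D) (Inv M (mu N))"
    by (simp add: curry_def actm_expand_right)
  also have "\<dots> = mu (act D N) \<cdot>\<^bsub>M\<^esub> (actm e (Idn M (act D N)) \<cdot>\<^bsub>M\<^esub> ma (D \<otimes>\<^bsub>C\<^esub> X) D N) \<cdot>\<^bsub>M\<^esub>
       actm (Inv C (Assoc C D X D)) (Idn M N) \<cdot>\<^bsub>M\<^esub>
       (Inv M (ma D (X \<otimes>\<^bsub>C\<^esub> D) N) \<cdot>\<^bsub>M\<^esub> actm (Idn C D) (actm c (Idn M N))) \<cdot>\<^bsub>M\<^esub> actm (Idn C D) (Inv M (mu N))"
    unfolding p1 by simp
  also have "\<dots> = (mu (act D N) \<cdot>\<^bsub>M\<^esub> ma ?I D N) \<cdot>\<^bsub>M\<^esub> actm (e \<otimes>\<^sub>m\<^bsub>C\<^esub> Idn C D) (Idn M N) \<cdot>\<^bsub>M\<^esub>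
       actm (Inv C (Assoc C D X D)) (Idn M N) \<cdot>\<^bsub>M\<^esub> actm (Idn C D \<otimes>\<^sub>m\<^bsub>C\<^esub> c) (Idn M N) \<cdot>\<^bsub>M\<^esub>
       (Inv M (ma D ?I N) \<cdot>\<^bsub>M\<^esub> actm (Idn C D) (Inv M (mu N)))"
    unfolding p2 p3 by simp
  also have "\<dots> = actm (LUnit C D \<cdot>\<^bsub>C\<^esub> (e \<otimes>\<^sub>m\<^bsub>C\<^esub> Idn C D) \<cdot>\<^bsub>C\<^esub> Inv C (Assoc C D X D) \<cdot>\<^bsub>C\<^esub> (Idn C D \<otimes>\<^sub>m\<^bsub>C\<^esub> c) \<cdot>\<^bsub>C\<^esub> Inv C (RUnit C D)) (Idn M N)"
    unfolding p4 act_LUnit[OF d(2) A(2)] by (simp add: actm_expand_left)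
  finally have z: "curry X D e (act D N) ?u = Idn M (act D N)"
    using C.left_dualD(10)[OF assms(1)] by simp
  show ?thesis
    using curry_act_Comp[OF assms(1) u assms(2)] z by (simp add: uncurry_def)
qed

text \<open>Naturality moves \<open>h\<close> to the end that is applied first, and the constraints
  that remain collect into the zigzag identity for \<open>X\<close>, acting on
  \<open>A\<close>.\<close>

lemma uncurry_curry:
  assumes "is_left_dual C X D e c" "h \<in> Hom M N (act X A)" "A \<in> Ob M"
  shows "uncurry X D c N (curry X D e A h) = h"
proof -
  note d [simp] = C.left_dualD(1-8)[OF assms(1)]
  have h [simp]: "h \<in> Ar M" "Dom M h = N" "Cod M h = act X A" and A [simp]: "A \<in> Ob M" "N \<in> Ob M"
    using assms M.Hom_Ob by (auto simp: M.Hom_iff)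
  let ?I = "Unit C"
  have p1: "Inv M (actm (Idn C X) (ma D X A)) \<cdot>\<^bsub>M\<^esub> ma X D (act X A)
      = (ma X (D \<otimes>\<^bsub>C\<^esub> X) A \<cdot>\<^bsub>M\<^esub> actm (Assoc C X D X) (Idn M A)) \<cdot>\<^bsub>M\<^esub> Inv M (ma (X \<otimes>\<^bsub>C\<^esub> D) X A)"
    by (rule M.Inv_swap) (simp_all add: act_pentagon)
  have p2: "Inv M (ma (X \<otimes>\<^bsub>C\<^esub> D) X A) \<cdot>\<^bsub>M\<^esub> actm c (Idn M (act X A))
      = actm (c \<otimes>\<^sub>m\<^bsub>C\<^esub> Idn C X) (Idn M A) \<cdot>\<^bsub>M\<^esub> Inv M (ma ?I X A)"
    using Inv_ma_nat[of c "Idn C X" "Idn M A" "X \<otimes>\<^bsub>C\<^esub> D" X A] by simp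
  have p3: "actm (Idn C X) (actm e (Idn M A)) \<cdot>\<^bsub>M\<^esub> ma X (D \<otimes>\<^bsub>C\<^esub> X) A
      = ma X ?I A \<cdot>\<^bsub>M\<^esub> actm (Idn C X \<otimes>\<^sub>m\<^bsub>C\<^esub> e) (Idn M A)"
    by (simp add: ma_nat)
  have p4: "Inv M (ma ?I X A) \<cdot>\<^bsub>M\<^esub> Inv M (mu (act X A)) = actm (Inv C (LUnit C X)) (Idn M A)"
  proof -
    have "Inv M (ma ?I X A) \<cdot>\<^bsub>M\<^esub> Inv M (mu (act X A)) = Inv M (mu (act X A) \<cdot>\<^bsub>M\<^esub> ma ?I X A)"
      by (simp add: M.Inv_Comp_distrib)
    then show ?thesis by (simp add: act_LUnit Inv_actm)
  qed
  have p5: "ma X D (act X A) \<cdot>\<^bsub>M\<^esub> actm c h = ma X D (act X A) \<cdot>\<^bsub>M\<^esub> actm c (Idn M (act X A)) \<cdot>\<^bsub>M\<^esub> actm (Idn C ?I) h"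
    by (simp add: actm_merge)
  have "uncurry X D c N (curry X D e A h)
      = actm (Idn C X) (mu A) \<cdot>\<^bsub>M\<^esub> actm (Idn C X) (actm e (Idn M A)) \<cdot>\<^bsub>M\<^esub>
        actm (Idn C X) (Inv M (ma D X A)) \<cdot>\<^bsub>M\<^esub> (actm (Idn C X) (actm (Idn C D) h) \<cdot>\<^bsub>M\<^esub> ma X D N) \<cdot>\<^bsub>M\<^esub>
        actm c (Idn M N) \<cdot>\<^bsub>M\<^esub> Inv M (mu N)"
    by (simp add: uncurry_def curry_def actm_expand_right)
  also have "actm (Idn C X) (actm (Idn C D) h) \<cdot>\<^bsub>M\<^esub> ma X D N = ma X D (act X A) \<cdot>\<^bsub>M\<^esub> actm (Idn C (X \<otimes>\<^bsub>C\<^esub> D)) h"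
    using ma_nat[of "Idn C X" "Idn C D" h X D "act X A"] by simp
  also have "actm (Idn C X) (mu A) \<cdot>\<^bsub>M\<^esub> actm (Idn C X) (actm e (Idn M A)) \<cdot>\<^bsub>M\<^esub>
        actm (Idn C X) (Inv M (ma D X A)) \<cdot>\<^bsub>M\<^esub> (ma X D (act X A) \<cdot>\<^bsub>M\<^esub> actm (Idn C (X \<otimes>\<^bsub>C\<^esub> D)) h) \<cdot>\<^bsub>M\<^esub>
        actm c (Idn M N) \<cdot>\<^bsub>M\<^esub> Inv M (mu N)
     = actm (Idn C X) (mu A) \<cdot>\<^bsub>M\<^esub> actm (Idn C X) (actm e (Idn M A)) \<cdot>\<^bsub>M\<^esub>
        (Inv M (actm (Idn C X) (ma D X A)) \<cdot>\<^bsub>M\<^esub> ma X D (act X A)) \<cdot>\<^bsub>M\<^esub>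
        actm c (Idn M (act X A)) \<cdot>\<^bsub>M\<^esub> (actm (Idn C ?I) h \<cdot>\<^bsub>M\<^esub> Inv M (mu N))"
    by (simp add: Inv_actm actm_merge actm_merge')
  also have "actm (Idn C ?I) h \<cdot>\<^bsub>M\<^esub> Inv M (mu N) = Inv M (mu (act X A)) \<cdot>\<^bsub>M\<^esub> h"
    by (simp add: Inv_mu_nat)
  also have "actm (Idn C X) (mu A) \<cdot>\<^bsub>M\<^esub> actm (Idn C X) (actm e (Idn M A)) \<cdot>\<^bsub>M\<^esub>
        (Inv M (actm (Idn C X) (ma D X A)) \<cdot>\<^bsub>M\<^esub> ma X D (act X A)) \<cdot>\<^bsub>M\<^esub>
        actm c (Idn M (act X A)) \<cdot>\<^bsub>M\<^esub> (Inv M (mu (act X A)) \<cdot>\<^bsub>M\<^esub> h)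
     = actm (Idn C X) (mu A) \<cdot>\<^bsub>M\<^esub> (actm (Idn C X) (actm e (Idn M A)) \<cdot>\<^bsub>M\<^esub> ma X (D \<otimes>\<^bsub>C\<^esub> X) A) \<cdot>\<^bsub>M\<^esub>
        actm (Assoc C X D X) (Idn M A) \<cdot>\<^bsub>M\<^esub>
        (Inv M (ma (X \<otimes>\<^bsub>C\<^esub> D) X A) \<cdot>\<^bsub>M\<^esub> actm c (Idn M (act X A))) \<cdot>\<^bsub>M\<^esub> Inv M (mu (act X A)) \<cdot>\<^bsub>M\<^esub> h"
    unfolding p1 by simp
  also have "\<dots> = (actm (Idn C X) (mu A) \<cdot>\<^bsub>M\<^esub> ma X ?I A) \<cdot>\<^bsub>M\<^esub> actm (Idn C X \<otimes>\<^sub>m\<^bsub>C\<^esub> e) (Idn M A) \<cdot>\<^bsub>M\<^esub>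
        actm (Assoc C X D X) (Idn M A) \<cdot>\<^bsub>M\<^esub> actm (c \<otimes>\<^sub>m\<^bsub>C\<^esub> Idn C X) (Idn M A) \<cdot>\<^bsub>M\<^esub>
        (Inv M (ma ?I X A) \<cdot>\<^bsub>M\<^esub> Inv M (mu (act X A))) \<cdot>\<^bsub>M\<^esub> h"
    unfolding p2 p3 by simp
  also have "\<dots> = actm (RUnit C X \<cdot>\<^bsub>C\<^esub> (Idn C X \<otimes>\<^sub>m\<^bsub>C\<^esub> e) \<cdot>\<^bsub>C\<^esub> Assoc C X D X \<cdot>\<^bsub>C\<^esub> (c \<otimes>\<^sub>m\<^bsub>C\<^esub> Idn C X) \<cdot>\<^bsub>C\<^esub> Inv C (LUnit C X)) (Idn M A) \<cdot>\<^bsub>M\<^esub> h"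
    unfolding p4 act_triangle[OF d(1) A(1)] by (simp add: actm_expand_left)
  finally show ?thesis using C.left_dualD(9)[OF assms(1)] by simp
qed

lemma curry_inject:
  assumes "is_left_dual C X D e c" "h \<in> Hom M N (act X A)" "h' \<in> Hom M N (act X A)" "A \<in> Ob M"
    "curry X D e A h = curry X D e A h'"
  shows "h = h'"
  using uncurry_curry[OF assms(1,2,4)] uncurry_curry[OF assms(1,3,4)] assms(5) by metis

lemma curry_surj:
  assumes "is_left_dual C X D e c" "f \<in> Hom M (act D N) A" "N \<in> Ob M"
  obtains h where "h \<in> Hom M N (act X A)" "curry X D e A h = f"
  using curry_uncurry[OF assms] uncurry_Hom[OF assms] by blast

end

subsection \<open>The reversed monoidal category\<close>

text \<open>Multiplication from the right is an action of the reversed category, so statements about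
  actions also yield their mirror images. A dual pair stays one under the reversal, with the roles
  of its two objects exchanged.\<close>

definition rev_cat :: "('o, 'm, 'k, 'z) tensor_cat_scheme \<Rightarrow> ('o, 'm, 'k, 'z) tensor_cat_scheme" where
  "rev_cat C = C\<lparr>Tens := \<lambda>X Y. Tens C Y X, TensM := \<lambda>f g. TensM C g f,
     Assoc := \<lambda>X Y Z. Inv C (Assoc C Z Y X), LUnit := RUnit C, RUnit := LUnit C\<rparr>"

lemma rev_cat_simps [simp]:
  "Ob (rev_cat C) = Ob C" "Ar (rev_cat C) = Ar C" "Dom (rev_cat C) = Dom C" "Cod (rev_cat C) = Cod C"
  "Idn (rev_cat C) = Idn C" "Comp (rev_cat C) = Comp C" "Hom (rev_cat C) = Hom C"
  "Tens (rev_cat C) X Y = Tens C Y X" "TensM (rev_cat C) f g = TensM C g f"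
  "Unit (rev_cat C) = Unit C" "Assoc (rev_cat C) X Y Z = Inv C (Assoc C Z Y X)"
  "LUnit (rev_cat C) = RUnit C" "RUnit (rev_cat C) = LUnit C"
  "is_inverse (rev_cat C) = is_inverse C" "iso (rev_cat C) = iso C" "Inv (rev_cat C) = Inv C"
  "arr_to (rev_cat C) = arr_to C"
  by (auto simp: rev_cat_def Hom_def arr_to_def iso_def Inv_def is_inverse_def fun_eq_iff)

context monoidal_category
begin

lemma Assoc_nat:
  "\<lbrakk>f \<in> Ar C; g \<in> Ar C; h \<in> Ar C; X' = Cod C f; Y' = Cod C g; Z' = Cod C h\<rbrakk>
    \<Longrightarrow> Assoc C X' Y' Z' \<cdot> ((f \<otimes>\<^sub>m g) \<otimes>\<^sub>m h) = (f \<otimes>\<^sub>m (g \<otimes>\<^sub>m h)) \<cdot> Assoc C (Dom C f) (Dom C g) (Dom C h)"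
  using Assoc_natural[of f "Dom C f" X' g "Dom C g" Y' h "Dom C h" Z'] by (simp add: Hom_iff)

lemma Inv_Assoc_nat:
  "\<lbrakk>f \<in> Ar C; g \<in> Ar C; h \<in> Ar C; X' = Cod C f; Y' = Cod C g; Z' = Cod C h\<rbrakk>
    \<Longrightarrow> Inv C (Assoc C X' Y' Z') \<cdot> (f \<otimes>\<^sub>m (g \<otimes>\<^sub>m h)) = ((f \<otimes>\<^sub>m g) \<otimes>\<^sub>m h) \<cdot> Inv C (Assoc C (Dom C f) (Dom C g) (Dom C h))"
  by (rule Inv_swap) (auto intro: Assoc_nat)

lemma LUnit_nat: "\<lbrakk>f \<in> Ar C; Y = Cod C f\<rbrakk> \<Longrightarrow> LUnit C Y \<cdot> (Idn C (Unit C) \<otimes>\<^sub>m f) = f \<cdot> LUnit C (Dom C f)"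
  and RUnit_nat: "\<lbrakk>f \<in> Ar C; Y = Cod C f\<rbrakk> \<Longrightarrow> RUnit C Y \<cdot> (f \<otimes>\<^sub>m Idn C (Unit C)) = f \<cdot> RUnit C (Dom C f)"
  using LUnit_natural[of f "Dom C f" Y] RUnit_natural[of f "Dom C f" Y] by (auto simp: Hom_iff)

lemma rev_category: "category (rev_cat C)"
  by unfold_locales (auto simp: Hom_iff)

lemma rev_monoidal: "monoidal_category (rev_cat C)"
proof -
  \<comment> \<open>The associators of the reversal are inverses, so its pentagon is the inverse of
    the pentagon of \<open>C\<close>.\<close>
  have pent: "Inv C (Assoc C (Z \<otimes> Y) X W) \<cdot> Inv C (Assoc C Z Y (X \<otimes> W))
      = (Inv C (Assoc C Z Y X) \<otimes>\<^sub>m Idn C W) \<cdot> Inv C (Assoc C Z (Y \<otimes> X) W) \<cdot> (Idn C Z \<otimes>\<^sub>m Inv C (Assoc C Y X W))"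
    if [simp]: "W \<in> Ob C" "X \<in> Ob C" "Y \<in> Ob C" "Z \<in> Ob C" for W X Y Z
  proof -
    have "Inv C (Assoc C (Z \<otimes> Y) X W) \<cdot> Inv C (Assoc C Z Y (X \<otimes> W))
        = Inv C (Assoc C Z Y (X \<otimes> W) \<cdot> Assoc C (Z \<otimes> Y) X W)"
      by (simp add: Inv_Comp_distrib)
    also have "\<dots> = Inv C ((Idn C Z \<otimes>\<^sub>m Assoc C Y X W) \<cdot> Assoc C Z (Y \<otimes> X) W \<cdot> (Assoc C Z Y X \<otimes>\<^sub>m Idn C W))"
      by (simp add: pentagon)
    also have "\<dots> = (Inv C (Assoc C Z Y X) \<otimes>\<^sub>m Idn C W) \<cdot> Inv C (Assoc C Z (Y \<otimes> X) W) \<cdot> (Idn C Z \<otimes>\<^sub>m Inv C (Assoc C Y X W))"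
      by (simp add: Inv_Comp_distrib iso_Comp Inv_TensM)
    finally show ?thesis .
  qed
  have tri: "(RUnit C Y \<otimes>\<^sub>m Idn C X) \<cdot> Inv C (Assoc C Y (Unit C) X) = Idn C Y \<otimes>\<^sub>m LUnit C X"
    if [simp]: "X \<in> Ob C" "Y \<in> Ob C" for X Y
    by (simp add: triangle[symmetric])
  show ?thesis
    by (rule monoidal_category.intro[OF rev_category], unfold_locales)
      (auto simp: Hom_iff TensM_merge Inv_Assoc_nat LUnit_nat RUnit_nat pent tri)
qed

lemma regular_actegory: "actegory C C (Tens C) (TensM C) (Assoc C) (LUnit C)"
  by (unfold_locales) (auto simp: Hom_iff TensM_merge Assoc_nat LUnit_nat pentagon triangle)

lemma rev_actegory: "actegory (rev_cat C) C (\<lambda>X A. A \<otimes> X) (\<lambda>f g. g \<otimes>\<^sub>m f)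
    (\<lambda>X Y A. Inv C (Assoc C A Y X)) (RUnit C)"
proof -
  interpret R: monoidal_category "rev_cat C" by (rule rev_monoidal)
  show ?thesis
    by unfold_locales
      (use R.pentagon R.triangle in \<open>auto simp: Hom_iff TensM_merge Inv_Assoc_nat RUnit_nat\<close>)
qed

lemma rev_left_dual: "is_left_dual (rev_cat C) D X e c \<longleftrightarrow> is_left_dual C X D e c"
proof -
  have "Inv C (Inv C (Assoc C X D X)) = Assoc C X D X" if "X \<in> Ob C" "D \<in> Ob C"
    using that by simp
  then show ?thesis by (auto simp: is_left_dual_def)
qed

lemma LUnit_Tens: "\<lbrakk>X \<in> Ob C; Y \<in> Ob C\<rbrakk> \<Longrightarrow> LUnit C (X \<otimes> Y) \<cdot> Assoc C (Unit C) X Y = LUnit C X \<otimes>\<^sub>m Idn C Y"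
  by (rule actegory.act_LUnit[OF regular_actegory])

lemma RUnit_Tens: "\<lbrakk>X \<in> Ob C; Y \<in> Ob C\<rbrakk> \<Longrightarrow> RUnit C (X \<otimes> Y) \<cdot> Inv C (Assoc C X Y (Unit C)) = Idn C X \<otimes>\<^sub>m RUnit C Y"
  using actegory.act_LUnit[OF rev_actegory, of Y X] by simp

text \<open>Naturality of \<open>LUnit\<close> at itself computes it on
  \<open>1 \<otimes> 1\<close>. With the triangle this makes the two constraints agree after
  tensoring with \<open>1\<close> on the right, and naturality of \<open>RUnit\<close> removes that
  factor.\<close>

lemma LUnit_Unit: "LUnit C (Unit C) = RUnit C (Unit C)"
proof -
  let ?I = "Unit C"
  have "LUnit C (?I \<otimes> ?I) = Idn C ?I \<otimes>\<^sub>m LUnit C ?I"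
    by (rule iso_cancel_left[of "LUnit C ?I"]) (use LUnit_nat[of "LUnit C ?I"] in simp_all)
  then have eq: "LUnit C ?I \<otimes>\<^sub>m Idn C ?I = RUnit C ?I \<otimes>\<^sub>m Idn C ?I"
    using LUnit_Tens[of ?I ?I] triangle[of ?I ?I] by simp
  have "LUnit C ?I \<cdot> RUnit C (?I \<otimes> ?I) = RUnit C ?I \<cdot> RUnit C (?I \<otimes> ?I)"
    using RUnit_nat[of "LUnit C ?I" ?I] RUnit_nat[of "RUnit C ?I" ?I] eq by simp
  then show ?thesis by (rule iso_cancel_right[rotated]) simp_all
qed

text \<open>These are the adjunctions
  \<open>Hom(N, X \<otimes> A) \<cong> Hom(D \<otimes> N, A)\<close> and, for \<open>rcurry\<close>,
  \<open>Hom(N, A \<otimes> D) \<cong> Hom(N \<otimes> X, A)\<close>.\<close>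

definition lcurry :: "'o \<Rightarrow> 'o \<Rightarrow> 'm \<Rightarrow> 'o \<Rightarrow> 'm \<Rightarrow> 'm" where
  "lcurry X D e A h = LUnit C A \<cdot> (e \<otimes>\<^sub>m Idn C A) \<cdot> Inv C (Assoc C D X A) \<cdot> (Idn C D \<otimes>\<^sub>m h)"

definition rcurry :: "'o \<Rightarrow> 'o \<Rightarrow> 'm \<Rightarrow> 'o \<Rightarrow> 'm \<Rightarrow> 'm" where
  "rcurry X D e A h = RUnit C A \<cdot> (Idn C A \<otimes>\<^sub>m e) \<cdot> Assoc C A D X \<cdot> (h \<otimes>\<^sub>m Idn C X)"

context
  fixes X D e c
  assumes dual: "is_left_dual C X D e c"
begin

lemma lcurry_eq: "lcurry X D e A h = actegory.curry C C (TensM C) (Assoc C) (LUnit C) X D e A h"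
  unfolding lcurry_def actegory.curry_def[OF regular_actegory] ..

lemma rcurry_eq:
  assumes "A \<in> Ob C"
  shows "rcurry X D e A h = actegory.curry (rev_cat C) C (\<lambda>f g. g \<otimes>\<^sub>m f)
    (\<lambda>X Y A. Inv C (Assoc C A Y X)) (RUnit C) D X e A h"
  using left_dualD[OF dual] assms unfolding rcurry_def actegory.curry_def[OF rev_actegory] by simp

lemmas rdual = dual[folded rev_left_dual]

lemma lcurry_Hom: "\<lbrakk>h \<in> Hom C N (X \<otimes> A); A \<in> Ob C\<rbrakk> \<Longrightarrow> lcurry X D e A h \<in> Hom C (D \<otimes> N) A"
  unfolding lcurry_eq by (rule actegory.curry_Hom[OF regular_actegory dual])

lemma rcurry_Hom: "\<lbrakk>h \<in> Hom C N (A \<otimes> D); A \<in> Ob C\<rbrakk> \<Longrightarrow> rcurry X D e A h \<in> Hom C (N \<otimes> X) A"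
  using actegory.curry_Hom[OF rev_actegory rdual, of h N A] by (simp add: rcurry_eq)

lemma lcurry_Comp: "\<lbrakk>h \<in> Hom C N (X \<otimes> A); A \<in> Ob C; g \<in> Hom C N' N\<rbrakk>
    \<Longrightarrow> lcurry X D e A (h \<cdot> g) = lcurry X D e A h \<cdot> (Idn C D \<otimes>\<^sub>m g)"
  unfolding lcurry_eq by (rule actegory.curry_Comp_right[OF regular_actegory dual])

lemma rcurry_Comp: "\<lbrakk>h \<in> Hom C N (A \<otimes> D); A \<in> Ob C; g \<in> Hom C N' N\<rbrakk>
    \<Longrightarrow> rcurry X D e A (h \<cdot> g) = rcurry X D e A h \<cdot> (g \<otimes>\<^sub>m Idn C X)"
  using actegory.curry_Comp_right[OF rev_actegory rdual, of h N A g N'] by (simp add: rcurry_eq)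

lemma lcurry_Tens_Comp: "\<lbrakk>h \<in> Hom C N (X \<otimes> A); f \<in> Hom C A A'\<rbrakk>
    \<Longrightarrow> lcurry X D e A' ((Idn C X \<otimes>\<^sub>m f) \<cdot> h) = f \<cdot> lcurry X D e A h"
  unfolding lcurry_eq by (rule actegory.curry_act_Comp[OF regular_actegory dual])

lemma rcurry_Tens_Comp: "\<lbrakk>h \<in> Hom C N (A \<otimes> D); f \<in> Hom C A A'\<rbrakk>
    \<Longrightarrow> rcurry X D e A' ((f \<otimes>\<^sub>m Idn C D) \<cdot> h) = f \<cdot> rcurry X D e A h"
  using actegory.curry_act_Comp[OF rev_actegory rdual, of h N A f A'] Hom_Ob[of f A A']
  by (simp add: rcurry_eq)

lemma lcurry_inject: "\<lbrakk>lcurry X D e A h = lcurry X D e A h'; h \<in> Hom C N (X \<otimes> A);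
    h' \<in> Hom C N (X \<otimes> A); A \<in> Ob C\<rbrakk> \<Longrightarrow> h = h'"
  unfolding lcurry_eq by (rule actegory.curry_inject[OF regular_actegory dual])

lemma rcurry_inject: "\<lbrakk>rcurry X D e A h = rcurry X D e A h'; h \<in> Hom C N (A \<otimes> D);
    h' \<in> Hom C N (A \<otimes> D); A \<in> Ob C\<rbrakk> \<Longrightarrow> h = h'"
  using actegory.curry_inject[OF rev_actegory rdual, of h N A h'] by (simp add: rcurry_eq)

lemma lcurry_surj:
  assumes "f \<in> Hom C (D \<otimes> N) A" "N \<in> Ob C"
  obtains h where "h \<in> Hom C N (X \<otimes> A)" "lcurry X D e A h = f"
  using actegory.curry_surj[OF regular_actegory dual assms] by (auto simp: lcurry_eq)

lemma rcurry_surj: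
  assumes "f \<in> Hom C (N \<otimes> X) A" "N \<in> Ob C"
  obtains h where "h \<in> Hom C N (A \<otimes> D)" "rcurry X D e A h = f"
  using actegory.curry_surj[OF rev_actegory rdual, of f N A] assms Hom_Ob[OF assms(1)]
  by (auto simp: rcurry_eq)

lemma lcurry_coev: "lcurry X D e D c = RUnit C D"
  using left_dual_zigzag(2)[OF dual] by (simp add: lcurry_def)

lemma rcurry_coev: "rcurry X D e X c = LUnit C X"
  using left_dual_zigzag(1)[OF dual] by (simp add: rcurry_def)

text \<open>At \<open>A = 1\<close> currying turns into composition with the evaluation pairing. Its
  bijectivity thereby becomes the perfectness of that pairing, which the \<open>pair\<close> lemmas
  below extract.\<close>

lemma lcurry_Unit:
  assumes "h \<in> Hom C N X"
  shows "lcurry X D e (Unit C) (Inv C (RUnit C X) \<cdot> h) = e \<cdot> (Idn C D \<otimes>\<^sub>m h)"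
proof -
  note [simp] = left_dualD(1-8)[OF dual]
  have h [simp]: "h \<in> Ar C" "Dom C h = N" "Cod C h = X" using assms by (auto simp: Hom_iff)
  have k: "Inv C (Assoc C D X (Unit C)) \<cdot> (Idn C D \<otimes>\<^sub>m Inv C (RUnit C X)) = Inv C (RUnit C (D \<otimes> X))"
  proof -
    have "RUnit C (D \<otimes> X) \<cdot> Inv C (Assoc C D X (Unit C)) \<cdot> (Idn C D \<otimes>\<^sub>m Inv C (RUnit C X)) = Idn C (D \<otimes> X)"
      using RUnit_Tens[of D X] by (simp add: Comp_eq[OF RUnit_Tens] TensM_merge)
    then show ?thesis by (intro eq_InvI) simp_all
  qed
  have "lcurry X D e (Unit C) (Inv C (RUnit C X) \<cdot> h)
     = LUnit C (Unit C) \<cdot> (e \<otimes>\<^sub>m Idn C (Unit C)) \<cdot> (Inv C (Assoc C D X (Unit C)) \<cdot> (Idn C D \<otimes>\<^sub>m Inv C (RUnit C X))) \<cdot> (Idn C D \<otimes>\<^sub>m h)"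
    by (simp add: lcurry_def TensM_merge)
  also have "\<dots> = RUnit C (Unit C) \<cdot> (e \<otimes>\<^sub>m Idn C (Unit C)) \<cdot> Inv C (RUnit C (D \<otimes> X)) \<cdot> (Idn C D \<otimes>\<^sub>m h)"
    unfolding k LUnit_Unit by simp
  finally show ?thesis by (simp add: Comp_eq[OF RUnit_nat])
qed

lemma rcurry_Unit:
  assumes "k \<in> Hom C N D"
  shows "rcurry X D e (Unit C) (Inv C (LUnit C D) \<cdot> k) = e \<cdot> (k \<otimes>\<^sub>m Idn C X)"
proof -
  note [simp] = left_dualD(1-8)[OF dual]
  have h [simp]: "k \<in> Ar C" "Dom C k = N" "Cod C k = D" using assms by (auto simp: Hom_iff)
  have k: "Assoc C (Unit C) D X \<cdot> (Inv C (LUnit C D) \<otimes>\<^sub>m Idn C X) = Inv C (LUnit C (D \<otimes> X))"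
  proof -
    have "LUnit C (D \<otimes> X) \<cdot> Assoc C (Unit C) D X \<cdot> (Inv C (LUnit C D) \<otimes>\<^sub>m Idn C X) = Idn C (D \<otimes> X)"
      by (simp add: Comp_eq[OF LUnit_Tens] TensM_merge)
    then show ?thesis by (intro eq_InvI) simp_all
  qed
  have "rcurry X D e (Unit C) (Inv C (LUnit C D) \<cdot> k)
     = RUnit C (Unit C) \<cdot> (Idn C (Unit C) \<otimes>\<^sub>m e) \<cdot> (Assoc C (Unit C) D X \<cdot> (Inv C (LUnit C D) \<otimes>\<^sub>m Idn C X)) \<cdot> (k \<otimes>\<^sub>m Idn C X)"
    by (simp add: rcurry_def TensM_merge)
  also have "\<dots> = LUnit C (Unit C) \<cdot> (Idn C (Unit C) \<otimes>\<^sub>m e) \<cdot> Inv C (LUnit C (D \<otimes> X)) \<cdot> (k \<otimes>\<^sub>m Idn C X)"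
    unfolding k LUnit_Unit by simp
  finally show ?thesis by (simp add: Comp_eq[OF LUnit_nat])
qed

lemma pair_left_inject:
  assumes "e \<cdot> (Idn C D \<otimes>\<^sub>m h) = e \<cdot> (Idn C D \<otimes>\<^sub>m h')" "h \<in> Hom C N X" "h' \<in> Hom C N X"
  shows "h = h'"
proof (rule iso_cancel_left)
  have "lcurry X D e (Unit C) (Inv C (RUnit C X) \<cdot> h) = lcurry X D e (Unit C) (Inv C (RUnit C X) \<cdot> h')"
    using assms by (simp add: lcurry_Unit)
  then show "Inv C (RUnit C X) \<cdot> h = Inv C (RUnit C X) \<cdot> h'"
    by (rule lcurry_inject[where N = N])
      (use assms(2,3) left_dualD(1)[OF dual] in \<open>auto simp: Hom_iff\<close>)
qed (use assms(2,3) left_dualD(1)[OF dual] in \<open>auto simp: Hom_iff\<close>)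

lemma pair_right_inject:
  assumes "e \<cdot> (k \<otimes>\<^sub>m Idn C X) = e \<cdot> (k' \<otimes>\<^sub>m Idn C X)" "k \<in> Hom C N D" "k' \<in> Hom C N D"
  shows "k = k'"
proof (rule iso_cancel_left)
  have "rcurry X D e (Unit C) (Inv C (LUnit C D) \<cdot> k) = rcurry X D e (Unit C) (Inv C (LUnit C D) \<cdot> k')"
    using assms by (simp add: rcurry_Unit)
  then show "Inv C (LUnit C D) \<cdot> k = Inv C (LUnit C D) \<cdot> k'"
    by (rule rcurry_inject[where N = N])
      (use assms(2,3) left_dualD(2)[OF dual] in \<open>auto simp: Hom_iff\<close>)
qed (use assms(2,3) left_dualD(2)[OF dual] in \<open>auto simp: Hom_iff\<close>)

lemma pair_left_surj:
  assumes "f \<in> Hom C (D \<otimes> N) (Unit C)" "N \<in> Ob C"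
  obtains h where "h \<in> Hom C N X" "e \<cdot> (Idn C D \<otimes>\<^sub>m h) = f"
proof -
  note [simp] = left_dualD(1-8)[OF dual]
  obtain h where h: "h \<in> Hom C N (X \<otimes> Unit C)" "lcurry X D e (Unit C) h = f"
    using lcurry_surj[OF assms] .
  have "RUnit C X \<cdot> h \<in> Hom C N X" "Inv C (RUnit C X) \<cdot> (RUnit C X \<cdot> h) = h"
    using h(1) by (auto simp: Hom_iff)
  then show thesis using lcurry_Unit h(2) that by metis
qed

lemma pair_right_surj:
  assumes "f \<in> Hom C (N \<otimes> X) (Unit C)" "N \<in> Ob C"
  obtains k where "k \<in> Hom C N D" "e \<cdot> (k \<otimes>\<^sub>m Idn C X) = f"
proof -
  note [simp] = left_dualD(1-8)[OF dual]
  obtain h where h: "h \<in> Hom C N (Unit C \<otimes> D)" "rcurry X D e (Unit C) h = f"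
    using rcurry_surj[OF assms] .
  have "LUnit C D \<cdot> h \<in> Hom C N D" "Inv C (LUnit C D) \<cdot> (LUnit C D \<cdot> h) = h"
    using h(1) by (auto simp: Hom_iff)
  then show thesis using rcurry_Unit h(2) that by metis
qed

end

subsection \<open>Transposes\<close>

text \<open>A relation instead of a function: each of \<open>f\<close> and \<open>g\<close>
  determines the other, for any choice of duals, so that left and right transposes are handled
  alike.\<close>

definition transposes :: "'o \<Rightarrow> 'o \<Rightarrow> 'm \<Rightarrow> 'o \<Rightarrow> 'o \<Rightarrow> 'm \<Rightarrow> 'm \<Rightarrow> 'm \<Rightarrow> bool" where
  "transposes X D e X' D' e' f g \<longleftrightarrow> f \<in> Hom C X X' \<and> g \<in> Hom C D' D \<and>
     e \<cdot> (g \<otimes>\<^sub>m Idn C X) = e' \<cdot> (Idn C D' \<otimes>\<^sub>m f)"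

lemma transposes_Comp:
  assumes "is_left_dual C X D e c" "is_left_dual C X' D' e' c'" "is_left_dual C X'' D'' e'' c''"
    and "transposes X D e X' D' e' f g" "transposes X' D' e' X'' D'' e'' f' g'"
  shows "transposes X D e X'' D'' e'' (f' \<cdot> f) (g \<cdot> g')"
proof -
  note [simp] = left_dualD(1-8)[OF assms(1)] left_dualD(1-8)[OF assms(2)] left_dualD(1-8)[OF assms(3)]
  have [simp]: "f \<in> Ar C" "Dom C f = X" "Cod C f = X'" "g \<in> Ar C" "Dom C g = D'" "Cod C g = D"
    "f' \<in> Ar C" "Dom C f' = X'" "Cod C f' = X''" "g' \<in> Ar C" "Dom C g' = D''" "Cod C g' = D'"
    and eq: "e \<cdot> (g \<otimes>\<^sub>m Idn C X) = e' \<cdot> (Idn C D' \<otimes>\<^sub>m f)" "e' \<cdot> (g' \<otimes>\<^sub>m Idn C X') = e'' \<cdot> (Idn C D'' \<otimes>\<^sub>m f')"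
    using assms(4,5) by (auto simp: transposes_def Hom_iff)
  have "e \<cdot> ((g \<cdot> g') \<otimes>\<^sub>m Idn C X) = (e \<cdot> (g \<otimes>\<^sub>m Idn C X)) \<cdot> (g' \<otimes>\<^sub>m Idn C X)"
    by (simp add: TensM_merge)
  also have "\<dots> = (e' \<cdot> (g' \<otimes>\<^sub>m Idn C X')) \<cdot> (Idn C D'' \<otimes>\<^sub>m f)"
    unfolding eq(1) by (simp add: TensM_merge)
  also have "\<dots> = e'' \<cdot> (Idn C D'' \<otimes>\<^sub>m (f' \<cdot> f))"
    unfolding eq(2) by (simp add: TensM_merge)
  finally show ?thesis by (simp add: transposes_def Hom_iff)
qed

lemma transposes_Idn: "is_left_dual C X D e c \<Longrightarrow> transposes X D e X D e (Idn C X) (Idn C D)"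
  using left_dualD(1-8)[of X D e c] by (simp add: transposes_def Hom_iff)

context
  fixes X D e c X' D' e' c'
  assumes dual: "is_left_dual C X D e c" and dual': "is_left_dual C X' D' e' c'"
begin

lemma ex_right_transpose:
  assumes "f \<in> Hom C X X'"
  obtains g where "transposes X D e X' D' e' f g"
proof -
  have "e' \<cdot> (Idn C D' \<otimes>\<^sub>m f) \<in> Hom C (D' \<otimes> X) (Unit C)"
    using left_dualD(1-8)[OF dual'] assms by (auto simp: Hom_iff)
  from pair_right_surj[OF dual this] obtain g where "g \<in> Hom C D' D"
    "e \<cdot> (g \<otimes>\<^sub>m Idn C X) = e' \<cdot> (Idn C D' \<otimes>\<^sub>m f)"
    using left_dualD(2)[OF dual'] by metis
  then show thesis using that assms by (metis transposes_def)
qed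

lemma ex_left_transpose:
  assumes "g \<in> Hom C D' D"
  obtains f where "transposes X D e X' D' e' f g"
proof -
  have "e \<cdot> (g \<otimes>\<^sub>m Idn C X) \<in> Hom C (D' \<otimes> X) (Unit C)"
    using left_dualD(1-8)[OF dual] assms by (auto simp: Hom_iff)
  from pair_left_surj[OF dual' this] obtain f where "f \<in> Hom C X X'"
    "e' \<cdot> (Idn C D' \<otimes>\<^sub>m f) = e \<cdot> (g \<otimes>\<^sub>m Idn C X)"
    using left_dualD(1)[OF dual] by metis
  then show thesis using that assms by (metis transposes_def)
qed

lemma transposes_unique_left:
  "\<lbrakk>transposes X D e X' D' e' f g; transposes X D e X' D' e' f' g\<rbrakk> \<Longrightarrow> f = f'"
  unfolding transposes_def using pair_left_inject[OF dual', of f f' X] by simp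

lemma transposes_unique_right:
  "\<lbrakk>transposes X D e X' D' e' f g; transposes X D e X' D' e' f g'\<rbrakk> \<Longrightarrow> g = g'"
  unfolding transposes_def using pair_right_inject[OF dual, of g g' D'] by simp

end

end

section \<open>Linear algebra with explicit carriers\<close>

text \<open>The vectors live in a type without operations of its own, so finite sums, combinations
  and bases are indexed by initial segments of \<open>nat\<close>.\<close>

primrec vsum :: "('k, 'v) vec_space \<Rightarrow> (nat \<Rightarrow> 'v) \<Rightarrow> nat \<Rightarrow> 'v" where
  "vsum V f 0 = vzero V"
| "vsum V f (Suc n) = vadd V (vsum V f n) (f n)"

lemma vsum_cong: "(\<And>i. i < n \<Longrightarrow> f i = g i) \<Longrightarrow> vsum V f n = vsum V g n"
  by (induction n) auto

definition vcomb :: "('k, 'v) vec_space \<Rightarrow> (nat \<Rightarrow> 'k) \<Rightarrow> (nat \<Rightarrow> 'v) \<Rightarrow> nat \<Rightarrow> 'v" where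
  "vcomb V c b n = vsum V (\<lambda>i. vscale V (c i) (b i)) n"

definition vindep :: "('k::zero, 'v) vec_space \<Rightarrow> nat \<Rightarrow> (nat \<Rightarrow> 'v) \<Rightarrow> bool" where
  "vindep V n b \<longleftrightarrow> (\<forall>i<n. b i \<in> vcarrier V) \<and> (\<forall>c. vcomb V c b n = vzero V \<longrightarrow> (\<forall>i<n. c i = 0))"

definition vspanning :: "('k, 'v) vec_space \<Rightarrow> nat \<Rightarrow> (nat \<Rightarrow> 'v) \<Rightarrow> bool" where
  "vspanning V n b \<longleftrightarrow> (\<forall>i<n. b i \<in> vcarrier V) \<and> (\<forall>x \<in> vcarrier V. \<exists>c. x = vcomb V c b n)"

definition vbasis :: "('k::zero, 'v) vec_space \<Rightarrow> nat \<Rightarrow> (nat \<Rightarrow> 'v) \<Rightarrow> bool" where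
  "vbasis V n b \<longleftrightarrow> vindep V n b \<and> vspanning V n b"

definition vlinear :: "('k, 'v) vec_space \<Rightarrow> ('k, 'w) vec_space \<Rightarrow> ('v \<Rightarrow> 'w) \<Rightarrow> bool" where
  "vlinear V W f \<longleftrightarrow> (\<forall>x \<in> vcarrier V. f x \<in> vcarrier W) \<and>
     (\<forall>x \<in> vcarrier V. \<forall>y \<in> vcarrier V. f (vadd V x y) = vadd W (f x) (f y)) \<and>
     (\<forall>a. \<forall>x \<in> vcarrier V. f (vscale V a x) = vscale W a (f x))"

definition vfunctional :: "('k::field, 'v) vec_space \<Rightarrow> ('v \<Rightarrow> 'k) \<Rightarrow> bool" where
  "vfunctional V t \<longleftrightarrow> (\<forall>x \<in> vcarrier V. \<forall>y \<in> vcarrier V. t (vadd V x y) = t x + t y) \<and>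
     (\<forall>a. \<forall>x \<in> vcarrier V. t (vscale V a x) = a * t x)"

context vector_space_struct
begin

lemmas closed [simp] = zero_closed add_closed scale_closed

lemma add_zero_right [simp]: "x \<in> vcarrier V \<Longrightarrow> vadd V x (vzero V) = x"
  using add_comm[of x "vzero V"] add_zero[of x] by simp

lemma add_left_cancel:
  assumes "vadd V x y = vadd V x z" and xyz: "x \<in> vcarrier V" "y \<in> vcarrier V" "z \<in> vcarrier V"
  shows "y = z"
proof -
  obtain x' where x': "x' \<in> vcarrier V" "vadd V x x' = vzero V" using add_inverse[OF xyz(1)] by blast
  have *: "vadd V x' (vadd V x u) = u" if "u \<in> vcarrier V" for u
    using x' xyz that by (metis add_assoc add_comm add_zero)
  show ?thesis using *[OF xyz(2)] *[OF xyz(3)] assms(1) by metis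
qed

lemma scale_0 [simp]:
  assumes x: "x \<in> vcarrier V"
  shows "vscale V 0 x = vzero V"
proof (rule add_left_cancel)
  show "vadd V (vscale V 0 x) (vscale V 0 x) = vadd V (vscale V 0 x) (vzero V)"
    using x by (subst add_scale[symmetric]) auto
qed (use x in auto)

lemma scale_vzero [simp]: "vscale V a (vzero V) = vzero V"
  using scale_scale[of "vzero V" a 0] scale_0[of "vzero V"] by simp

lemma add_neg [simp]: "x \<in> vcarrier V \<Longrightarrow> vadd V x (vscale V (-1) x) = vzero V"
  using add_scale[of x 1 "-1"] by (simp add: scale_one)

lemma add_eq_zero_iff:
  assumes "x \<in> vcarrier V" "y \<in> vcarrier V"
  shows "vadd V x y = vzero V \<longleftrightarrow> y = vscale V (-1) x"
proof
  assume "vadd V x y = vzero V"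
  then show "y = vscale V (-1) x"
    using assms by - (rule add_left_cancel[of x], auto)
qed (use assms in auto)

lemma diff_eq_zeroD:
  assumes "vadd V x (vscale V (-1) y) = vzero V" "x \<in> vcarrier V" "y \<in> vcarrier V"
  shows "x = y"
proof -
  have "vscale V (-1) y = vscale V (-1) x" using assms add_eq_zero_iff by simp
  then have "vscale V (-1) (vscale V (-1) y) = vscale V (-1) (vscale V (-1) x)" by simp
  then show ?thesis using assms scale_scale scale_one by simp
qed

lemma add_left_commute:
  "\<lbrakk>x \<in> vcarrier V; y \<in> vcarrier V; z \<in> vcarrier V\<rbrakk> \<Longrightarrow> vadd V x (vadd V y z) = vadd V y (vadd V x z)"
  by (metis add_assoc add_comm)

lemmas add_ac = add_assoc add_comm add_left_commute

lemma vsum_closed [simp]: "(\<And>i. i < n \<Longrightarrow> f i \<in> vcarrier V) \<Longrightarrow> vsum V f n \<in> vcarrier V"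
  by (induction n) auto

lemma vsum_zero: "(\<And>i. i < n \<Longrightarrow> f i = vzero V) \<Longrightarrow> vsum V f n = vzero V"
  by (induction n) (auto simp: add_zero)

lemma vsum_add:
  "\<lbrakk>\<And>i. i < n \<Longrightarrow> f i \<in> vcarrier V; \<And>i. i < n \<Longrightarrow> g i \<in> vcarrier V\<rbrakk>
    \<Longrightarrow> vsum V (\<lambda>i. vadd V (f i) (g i)) n = vadd V (vsum V f n) (vsum V g n)"
  by (induction n) (auto simp: add_ac)

lemma vsum_scale:
  "(\<And>i. i < n \<Longrightarrow> f i \<in> vcarrier V) \<Longrightarrow> vsum V (\<lambda>i. vscale V a (f i)) n = vscale V a (vsum V f n)"
  by (induction n) (auto simp: scale_add)

lemma vsum_swap:
  "(\<And>i j. \<lbrakk>i < m; j < n\<rbrakk> \<Longrightarrow> f i j \<in> vcarrier V)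
    \<Longrightarrow> vsum V (\<lambda>i. vsum V (f i) n) m = vsum V (\<lambda>j. vsum V (\<lambda>i. f i j) m) n"
proof (induction m)
  case 0
  then show ?case by (simp add: vsum_zero)
next
  case (Suc m)
  then show ?case by (simp add: vsum_add)
qed

lemma vsum_delta:
  "\<lbrakk>j < n; x \<in> vcarrier V; \<And>i. i < n \<Longrightarrow> f i = (if i = j then x else vzero V)\<rbrakk> \<Longrightarrow> vsum V f n = x"
proof (induction n)
  case (Suc n)
  show ?case
  proof (cases "j = n")
    case True
    then have "vsum V f n = vzero V" using Suc.prems by (intro vsum_zero) auto
    then show ?thesis using Suc.prems True by (simp add: add_zero)
  next
    case False
    then show ?thesis using Suc by auto
  qed
qed simp

lemma vsum_shift:
  "(\<And>i. i < Suc n \<Longrightarrow> f i \<in> vcarrier V) \<Longrightarrow> vsum V f (Suc n) = vadd V (f 0) (vsum V (\<lambda>i. f (Suc i)) n)"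
proof (induction n)
  case 0
  then show ?case by (simp add: add_zero)
next
  case (Suc n)
  have "vsum V f (Suc (Suc n)) = vadd V (vadd V (f 0) (vsum V (\<lambda>i. f (Suc i)) n)) (f (Suc n))"
    using Suc by simp
  also have "\<dots> = vadd V (f 0) (vadd V (vsum V (\<lambda>i. f (Suc i)) n) (f (Suc n)))"
    using Suc.prems by (intro add_assoc) auto
  finally show ?case by simp
qed

lemma vcomb_closed [simp]: "(\<And>i. i < n \<Longrightarrow> b i \<in> vcarrier V) \<Longrightarrow> vcomb V c b n \<in> vcarrier V"
  by (simp add: vcomb_def)

lemma vcomb_add:
  "(\<And>i. i < n \<Longrightarrow> b i \<in> vcarrier V) \<Longrightarrow> vadd V (vcomb V c b n) (vcomb V d b n) = vcomb V (\<lambda>i. c i + d i) b n"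
  unfolding vcomb_def by (subst vsum_add[symmetric]) (auto intro!: vsum_cong simp: add_scale)

lemma vcomb_scale:
  "(\<And>i. i < n \<Longrightarrow> b i \<in> vcarrier V) \<Longrightarrow> vscale V a (vcomb V c b n) = vcomb V (\<lambda>i. a * c i) b n"
  unfolding vcomb_def by (subst vsum_scale[symmetric]) (auto intro!: vsum_cong simp: scale_scale)

lemma vcomb_zero: "(\<And>i. i < n \<Longrightarrow> b i \<in> vcarrier V) \<Longrightarrow> (\<And>i. i < n \<Longrightarrow> c i = 0) \<Longrightarrow> vcomb V c b n = vzero V"
  unfolding vcomb_def by (rule vsum_zero) simp

lemma vcomb_delta: "j < n \<Longrightarrow> (\<And>i. i < n \<Longrightarrow> b i \<in> vcarrier V) \<Longrightarrow> vcomb V (\<lambda>i. if i = j then 1 else 0) b n = b j"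
  unfolding vcomb_def by (rule vsum_delta[of j]) (auto simp: scale_one)

lemma vcomb_eq_iff:
  assumes "vindep V n b"
  shows "vcomb V c b n = vcomb V d b n \<longleftrightarrow> (\<forall>i<n. c i = d i)"
proof
  have b: "i < n \<Longrightarrow> b i \<in> vcarrier V" for i using assms by (simp add: vindep_def)
  assume eq: "vcomb V c b n = vcomb V d b n"
  have "vcomb V (\<lambda>i. c i + (-1) * d i) b n = vadd V (vcomb V c b n) (vscale V (-1) (vcomb V d b n))"
    using b by (simp add: vcomb_add vcomb_scale del: mult_minus_left)
  also have "\<dots> = vzero V" using b by (simp add: eq)
  finally have "\<forall>i<n. c i + (-1) * d i = 0" using assms unfolding vindep_def by blast
  then show "\<forall>i<n. c i = d i" by simp
qed (auto simp: vcomb_def intro: vsum_cong)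

lemma vlinear_vsum:
  assumes "vlinear V W f" "vector_space_struct W" "\<And>i. i < n \<Longrightarrow> x i \<in> vcarrier V"
  shows "f (vsum V x n) = vsum W (\<lambda>i. f (x i)) n"
  using assms(3)
proof (induction n)
  case 0
  interpret W: vector_space_struct W by fact
  have "f (vscale V 0 (vzero V)) = vscale W 0 (f (vzero V))" using assms(1) by (simp only: vlinear_def zero_closed)
  then show ?case using assms(1) by (simp add: vlinear_def)
next
  case (Suc n)
  then show ?case using assms(1) by (simp add: vlinear_def)
qed

lemma vlinear_vcomb:
  assumes "vlinear V W f" "vector_space_struct W" "\<And>i. i < n \<Longrightarrow> b i \<in> vcarrier V"
  shows "f (vcomb V c b n) = vcomb W c (\<lambda>i. f (b i)) n"
  unfolding vcomb_def using assms
  by (subst vlinear_vsum[OF assms(1,2)]) (auto simp: vlinear_def intro!: vsum_cong)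

text \<open>The generators are taken in one at a time: one that already lies in the span is dropped,
  any other is appended to the basis at position \<open>n\<close>.\<close>

lemma ex_vbasis:
  assumes "finite_dim V"
  obtains n b where "vbasis V n b"
proof -
  have "\<exists>n b. vindep V n b \<and> (\<forall>x \<in> lin_span V S. \<exists>c. x = vcomb V c b n)"
    if "finite S" "S \<subseteq> vcarrier V" for S
    using that
  proof (induction S rule: finite_induct)
    case empty
    have "x = vzero V" if "x \<in> lin_span V {}" for x
      using that by (induction rule: lin_span.induct) (auto simp: add_zero)
    then show ?case by (intro exI[of _ 0]) (auto simp: vindep_def vcomb_def)
  next
    case (insert s S)
    then obtain n b where b: "vindep V n b" and span: "\<forall>x \<in> lin_span V S. \<exists>c. x = vcomb V c b n"
      by auto
    have bV: "i < n \<Longrightarrow> b i \<in> vcarrier V" for i using b by (simp add: vindep_def)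
    have s: "s \<in> vcarrier V" using insert by simp
    have ex: "\<exists>c a. x = vadd V (vcomb V c b n) (vscale V a s)" if "x \<in> lin_span V (insert s S)" for x
      using that
    proof (induction rule: lin_span.induct)
      case zero
      then show ?case using bV s vcomb_zero[of n b "\<lambda>_. 0"] by (intro exI[of _ "\<lambda>_. 0"] exI[of _ 0]) simp
    next
      case (base x)
      show ?case
      proof (cases "x = s")
        case True
        then show ?thesis using bV s vcomb_zero[of n b "\<lambda>_. 0"]
          by (intro exI[of _ "\<lambda>_. 0"] exI[of _ 1]) (simp add: scale_one add_zero)
      next
        case False
        then have "x \<in> lin_span V S" using base by (auto intro: lin_span.base)
        then obtain c where "x = vcomb V c b n" using span by blast
        then show ?thesis using bV s by (intro exI[of _ c] exI[of _ 0]) simp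
      qed
    next
      case (add x y)
      then obtain c a d e where "x = vadd V (vcomb V c b n) (vscale V a s)"
        "y = vadd V (vcomb V d b n) (vscale V e s)" by blast
      then have "vadd V x y = vadd V (vcomb V (\<lambda>i. c i + d i) b n) (vscale V (a + e) s)"
        using bV s by (simp add: add_ac add_scale vcomb_add[symmetric])
      then show ?case by blast
    next
      case (scale x r)
      then obtain c a where "x = vadd V (vcomb V c b n) (vscale V a s)" by blast
      then have "vscale V r x = vadd V (vcomb V (\<lambda>i. r * c i) b n) (vscale V (r * a) s)"
        using bV s by (simp add: scale_add scale_scale vcomb_scale)
      then show ?case by blast
    qed
    show ?case
    proof (cases "\<exists>d. s = vcomb V d b n")
      case True
      then obtain d where d: "s = vcomb V d b n" by blast
      have "\<exists>c. x = vcomb V c b n" if "x \<in> lin_span V (insert s S)" for x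
        using ex[OF that] bV by (auto simp: d vcomb_scale vcomb_add)
      then show ?thesis using b by blast
    next
      case False
      define b' where "b' = b(n := s)"
      have comb: "vcomb V c b' (Suc n) = vadd V (vcomb V c b n) (vscale V (c n) s)" for c
        unfolding vcomb_def by (auto simp: b'_def intro!: arg_cong2[of _ _ _ _ "vadd V"] vsum_cong)
      have "vindep V (Suc n) b'"
        unfolding vindep_def
      proof (intro conjI allI impI)
        fix i assume "i < Suc n" then show "b' i \<in> vcarrier V" using bV s by (simp add: b'_def)
      next
        fix c i assume 0: "vcomb V c b' (Suc n) = vzero V" and i: "i < Suc n"
        have eq: "vadd V (vcomb V c b n) (vscale V (c n) s) = vzero V" using 0 comb by simp
        have cn: "c n = 0"
        proof (rule ccontr)
          assume cn: "c n \<noteq> 0"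
          have "vscale V (c n) s = vscale V (-1) (vcomb V c b n)"
            using eq bV s add_eq_zero_iff by simp
          then have "vscale V (inverse (c n)) (vscale V (c n) s) = vcomb V (\<lambda>i. inverse (c n) * - c i) b n"
            using bV by (simp add: vcomb_scale)
          then have "s = vcomb V (\<lambda>i. inverse (c n) * - c i) b n"
            using cn s by (simp add: scale_scale scale_one)
          then show False using False by blast
        qed
        then have "vcomb V c b n = vzero V" using eq bV s by simp
        then have "\<forall>i<n. c i = 0" using b by (simp add: vindep_def)
        then show "c i = 0" using i cn by (auto simp: less_Suc_eq)
      qed
      moreover have "\<exists>c. x = vcomb V c b' (Suc n)" if x: "x \<in> lin_span V (insert s S)" for x
      proof -
        obtain c a where "x = vadd V (vcomb V c b n) (vscale V a s)" using ex[OF x] by blast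
        moreover have "vcomb V c b n = vcomb V (c(n := a)) b n" by (auto simp: vcomb_def intro: vsum_cong)
        ultimately have "x = vcomb V (c(n := a)) b' (Suc n)" using comb[of "c(n := a)"] by simp
        then show ?thesis by blast
      qed
      ultimately show ?thesis by blast
    qed
  qed
  then obtain n b where "vindep V n b" "\<forall>x \<in> vcarrier V. \<exists>c. x = vcomb V c b n"
    using assms unfolding finite_dim_def by (meson subset_iff)
  then show thesis using that unfolding vbasis_def vspanning_def vindep_def by blast
qed

text \<open>Gaussian elimination by induction on the number of equations. The unknowns are indexed
  by an arbitrary finite set because the pivot that is removed from it can be any element.\<close>

lemma homogeneous_system:
  fixes A :: "'i \<Rightarrow> nat \<Rightarrow> 'k"
  assumes "finite J" "n < card J"
  shows "\<exists>c. (\<exists>j\<in>J. c j \<noteq> 0) \<and> (\<forall>i<n. (\<Sum>j\<in>J. c j * A j i) = 0)"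
  using assms
proof (induction n arbitrary: A J)
  case 0
  then obtain j where "j \<in> J" by fastforce
  then show ?case by (intro exI[of _ "\<lambda>_. 1"]) auto
next
  case (Suc n)
  show ?case
  proof (cases "\<exists>p\<in>J. A p n \<noteq> 0")
    case False
    obtain c where "(\<exists>j\<in>J. c j \<noteq> 0)" "\<forall>i<n. (\<Sum>j\<in>J. c j * A j i) = 0" using Suc by force
    then show ?thesis using False by (intro exI[of _ c]) (auto simp: less_Suc_eq)
  next
    case True
    then obtain p where p: "p \<in> J" "A p n \<noteq> 0" by blast
    \<comment> \<open>The coefficients of the first \<open>n\<close> equations after the last one
      has been used to eliminate the unknown \<open>p\<close>.\<close>
    define B where "B j i = A j i - A j n / A p n * A p i" for j i
    have fin: "finite (J - {p})" and lt: "n < card (J - {p})" using Suc.prems p by auto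
    obtain c where c: "\<exists>j\<in>J - {p}. c j \<noteq> 0" "\<forall>i<n. (\<Sum>j\<in>J - {p}. c j * B j i) = 0"
      using Suc.IH[OF fin lt, of B] by blast
    \<comment> \<open>The value of the eliminated unknown that equation \<open>n\<close>
      forces.\<close>
    define r where "r = - (\<Sum>j\<in>J - {p}. c j * A j n) / A p n"
    have sum: "(\<Sum>j\<in>J. (c(p := r)) j * A j i) = r * A p i + (\<Sum>j\<in>J - {p}. c j * A j i)" for i
      using Suc.prems p by (simp add: sum.remove[of J p])
    have "(\<Sum>j\<in>J - {p}. c j * B j i) = (\<Sum>j\<in>J - {p}. c j * A j i) + r * A p i" for i
      by (simp add: B_def r_def right_diff_distrib sum_subtractf sum_distrib_right sum_divide_distrib)
        (simp add: sum_negf[symmetric] divide_inverse mult_ac sum_distrib_left)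
    then have "\<forall>i<n. (\<Sum>j\<in>J. (c(p := r)) j * A j i) = 0" using c sum by (simp add: add.commute)
    moreover have "(\<Sum>j\<in>J. (c(p := r)) j * A j n) = 0" unfolding sum using p by (simp add: r_def)
    ultimately show ?thesis using c(1) by (intro exI[of _ "c(p := r)"]) (auto simp: less_Suc_eq)
  qed
qed

text \<open>Expanding the \<open>x j\<close> in the generators turns a relation among them into a
  homogeneous system of \<open>n\<close> equations in \<open>m\<close> unknowns, which has a nonzero
  solution as soon as \<open>n < m\<close>.\<close>

lemma vindep_le:
  assumes x: "vindep V m x" and b: "vspanning V n b"
  shows "m \<le> n"
proof (rule ccontr)
  assume "\<not> m \<le> n"
  have xV: "i < m \<Longrightarrow> x i \<in> vcarrier V" and bV: "i < n \<Longrightarrow> b i \<in> vcarrier V" for i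
    using x b by (auto simp: vindep_def vspanning_def)
  have "\<forall>j. \<exists>d. j < m \<longrightarrow> x j = vcomb V d b n" using b xV by (auto simp: vspanning_def)
  then obtain A where A: "\<And>j. j < m \<Longrightarrow> x j = vcomb V (A j) b n" by metis
  obtain c where c: "\<exists>j<m. c j \<noteq> 0" "\<forall>i<n. (\<Sum>j<m. c j * A j i) = 0"
    using homogeneous_system[of "{..<m}" n A] \<open>\<not> m \<le> n\<close> by auto
  have "vcomb V c x k = vcomb V (\<lambda>i. \<Sum>j<k. c j * A j i) b n" if "k \<le> m" for k
    using that
  proof (induction k)
    case 0
    then show ?case using bV vcomb_zero[of n b "\<lambda>_. 0"] by (simp add: vcomb_def[of V c])
  next
    case (Suc k)
    have "vcomb V c x (Suc k) = vadd V (vcomb V c x k) (vscale V (c k) (x k))" by (simp add: vcomb_def)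
    also have "\<dots> = vadd V (vcomb V (\<lambda>i. \<Sum>j<k. c j * A j i) b n) (vcomb V (\<lambda>i. c k * A k i) b n)"
      using Suc A[of k] bV by (simp add: vcomb_scale)
    also have "\<dots> = vcomb V (\<lambda>i. \<Sum>j<Suc k. c j * A j i) b n" using bV by (simp add: vcomb_add)
    finally show ?case .
  qed
  from this[of m] have "vcomb V c x m = vzero V" using bV c(2) by (simp add: vcomb_zero)
  then show False using x c(1) by (auto simp: vindep_def)
qed

text \<open>Lifts of the independent \<open>d i\<close> stay independent when the kernel element
  \<open>x\<close> is added to them, so \<open>V\<close> has room for one vector more than
  \<open>W\<close>. This strict drop drives the minimality argument for projective covers.\<close>

lemma vlinear_kernel_less:
  assumes f: "vlinear V W f" "vector_space_struct W" and surj: "\<And>y. y \<in> vcarrier W \<Longrightarrow> \<exists>x\<in>vcarrier V. f x = y"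
    and x: "x \<in> vcarrier V" "x \<noteq> vzero V" "f x = vzero W"
    and b: "vspanning V n b" and d: "vindep W m d"
  shows "m < n"
proof -
  interpret W: vector_space_struct W by fact
  have dW: "i < m \<Longrightarrow> d i \<in> vcarrier W" for i using d by (simp add: vindep_def)
  have "\<forall>i. \<exists>v. i < m \<longrightarrow> v \<in> vcarrier V \<and> f v = d i" using surj dW by blast
  then obtain v where v: "\<And>i. i < m \<Longrightarrow> v i \<in> vcarrier V \<and> f (v i) = d i" by metis
  define v' where "v' = v(m := x)"
  have comb: "vcomb V c v' (Suc m) = vadd V (vcomb V c v m) (vscale V (c m) x)" for c
    unfolding vcomb_def by (auto simp: v'_def intro!: arg_cong2[of _ _ _ _ "vadd V"] vsum_cong)
  have "vindep V (Suc m) v'"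
    unfolding vindep_def
  proof (intro conjI allI impI)
    fix i assume "i < Suc m" then show "v' i \<in> vcarrier V" using v x by (simp add: v'_def)
  next
    fix c i assume 0: "vcomb V c v' (Suc m) = vzero V" and i: "i < Suc m"
    have "f (vadd V (vcomb V c v m) (vscale V (c m) x)) = vadd W (f (vcomb V c v m)) (vscale W (c m) (f x))"
      using f(1) v x by (auto simp: vlinear_def)
    also have "\<dots> = f (vcomb V c v m)" using x(3) v f(1) by (simp add: vlinear_def)
    also have "\<dots> = vcomb W c (\<lambda>i. f (v i)) m" using v by (intro vlinear_vcomb[OF f]) auto
    also have "\<dots> = vcomb W c d m" unfolding vcomb_def using v by (intro vsum_cong) auto
    finally have "vcomb W c d m = f (vzero V)" using 0 comb by simp
    also have "f (vzero V) = vzero W" using vlinear_vsum[OF f, of 0] by simp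
    finally have c0: "\<forall>i<m. c i = 0" using d by (simp add: vindep_def)
    then have "vcomb V c v m = vzero V" using v by (intro vcomb_zero) auto
    then have "vscale V (c m) x = vzero V" using 0 comb x by (simp add: add_zero)
    moreover have "x = vscale V (inverse (c m)) (vscale V (c m) x)" if "c m \<noteq> 0"
      using that x by (simp add: scale_scale scale_one)
    ultimately have "c m = 0" using x(2) by (metis scale_vzero)
    then show "c i = 0" using c0 i by (auto simp: less_Suc_eq)
  qed
  then show ?thesis using vindep_le[OF _ b] by fastforce
qed

text \<open>Some coordinate of \<open>x\<close> in a basis is nonzero; the functional is that
  coordinate, divided by its value at \<open>x\<close>.\<close>

lemma ex_functional:
  assumes fd: "finite_dim V" and x: "x \<in> vcarrier V" "x \<noteq> vzero V"
  obtains t where "vfunctional V t" "t x = 1"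
proof -
  obtain n b where b: "vbasis V n b" using ex_vbasis[OF fd] .
  have bV: "i < n \<Longrightarrow> b i \<in> vcarrier V" for i using b by (simp add: vbasis_def vindep_def)
  have "\<forall>y. \<exists>c. y \<in> vcarrier V \<longrightarrow> y = vcomb V c b n" using b by (auto simp: vbasis_def vspanning_def)
  then obtain c where c: "\<And>y. y \<in> vcarrier V \<Longrightarrow> vcomb V (c y) b n = y" by metis
  have uniq: "i < n \<Longrightarrow> c y i = d i" if "y \<in> vcarrier V" "y = vcomb V d b n" for y d i
    using c[OF that(1)] that(2) vcomb_eq_iff[of n b "c y" d] b by (simp add: vbasis_def)
  have "\<exists>i<n. c x i \<noteq> 0"
  proof (rule ccontr)
    assume "\<not> (\<exists>i<n. c x i \<noteq> 0)"
    then have "vcomb V (c x) b n = vzero V" using bV by (intro vcomb_zero) auto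
    then show False using c[OF x(1)] x(2) by metis
  qed
  then obtain i where i: "i < n" "c x i \<noteq> 0" by blast
  have "vfunctional V (\<lambda>y. c y i / c x i)"
    unfolding vfunctional_def
  proof (intro conjI ballI allI)
    fix y z a assume y: "y \<in> vcarrier V"
    have e: "vadd V y z = vcomb V (\<lambda>i. c y i + c z i) b n" if "z \<in> vcarrier V"
      using vcomb_add[of n b "c y" "c z"] bV c[OF y] c[OF that] by simp
    show "c (vadd V y z) i / c x i = c y i / c x i + c z i / c x i" if "z \<in> vcarrier V"
      using uniq[OF _ e[OF that] i(1)] y that by (simp add: add_divide_distrib)
    have e: "vscale V a y = vcomb V (\<lambda>i. a * c y i) b n"
      using vcomb_scale[of n b a "c y"] bV c[OF y] by simp
    show "c (vscale V a y) i / c x i = a * (c y i / c x i)"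
      using uniq[OF _ e i(1)] y by simp
  qed
  moreover have "c x i / c x i = 1" using i by simp
  ultimately show thesis by (rule that)
qed

end

text \<open>Take a biorthogonal system of maximal length, which exists because biorthogonal vectors
  are independent and \<open>U\<close> is finite-dimensional. A vector outside the span of the
  \<open>h i\<close> would leave a nonzero residue, and a partner for this residue would extend the
  system.\<close>

lemma perfect_pairing_dual_bases:
  fixes U :: "('k::field, 'u) vec_space" and V :: "('k, 'v) vec_space"
  assumes "vector_space_struct U" "vector_space_struct V" "finite_dim U"
    and addl: "\<And>x y v. \<lbrakk>x \<in> vcarrier U; y \<in> vcarrier U; v \<in> vcarrier V\<rbrakk> \<Longrightarrow> t (vadd U x y) v = t x v + t y v"
    and scalel: "\<And>a x v. \<lbrakk>x \<in> vcarrier U; v \<in> vcarrier V\<rbrakk> \<Longrightarrow> t (vscale U a x) v = a * t x v"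
    and addr: "\<And>x v w. \<lbrakk>x \<in> vcarrier U; v \<in> vcarrier V; w \<in> vcarrier V\<rbrakk> \<Longrightarrow> t x (vadd V v w) = t x v + t x w"
    and scaler: "\<And>a x v. \<lbrakk>x \<in> vcarrier U; v \<in> vcarrier V\<rbrakk> \<Longrightarrow> t x (vscale V a v) = a * t x v"
    and ndl: "\<And>x. \<lbrakk>x \<in> vcarrier U; x \<noteq> vzero U\<rbrakk> \<Longrightarrow> \<exists>v\<in>vcarrier V. t x v = 1"
    and ndr: "\<And>v. \<lbrakk>v \<in> vcarrier V; v \<noteq> vzero V\<rbrakk> \<Longrightarrow> \<exists>x\<in>vcarrier U. t x v = 1"
  obtains n h k where "\<And>i. i < n \<Longrightarrow> h i \<in> vcarrier U" "\<And>i. i < n \<Longrightarrow> k i \<in> vcarrier V"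
    "\<And>i j. \<lbrakk>i < n; j < n\<rbrakk> \<Longrightarrow> t (h i) (k j) = (if i = j then 1 else 0)"
    "\<And>x. x \<in> vcarrier U \<Longrightarrow> x = vcomb U (\<lambda>i. t x (k i)) h n"
    "\<And>v. v \<in> vcarrier V \<Longrightarrow> v = vcomb V (\<lambda>i. t (h i) v) k n"
    "vindep U n h"
proof -
  interpret U: vector_space_struct U by fact
  interpret V: vector_space_struct V by fact
  define P where "P n h k \<longleftrightarrow> (\<forall>i<n. h i \<in> vcarrier U \<and> k i \<in> vcarrier V) \<and>
      (\<forall>i<n. \<forall>j<n. t (h i) (k j) = (if i = j then 1 else 0))" for n :: nat and h k
  have t0l: "t (vzero U) v = 0" if "v \<in> vcarrier V" for v using scalel[of "vzero U" v 0] that by simp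
  have t0r: "t x (vzero V) = 0" if "x \<in> vcarrier U" for x using scaler[of x "vzero V" 0] that by simp
  have suml: "t (vcomb U c h n) v = (\<Sum>i<n. c i * t (h i) v)"
    if "\<And>i. i < n \<Longrightarrow> h i \<in> vcarrier U" "v \<in> vcarrier V" for c h n v
    unfolding vcomb_def using that by (induction n) (auto simp: t0l addl scalel)
  have sumr: "t x (vcomb V c k n) = (\<Sum>i<n. c i * t x (k i))"
    if "\<And>i. i < n \<Longrightarrow> k i \<in> vcarrier V" "x \<in> vcarrier U" for c k n x
    unfolding vcomb_def using that by (induction n) (auto simp: t0r addr scaler)
  obtain d b where b: "vbasis U d b" using U.ex_vbasis[OF assms(3)] .
  have indep: "vindep U n h" if "P n h k" for n h k
    unfolding vindep_def
  proof (intro conjI allI impI)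
    fix c i assume "vcomb U c h n = vzero U" "i < n"
    then have "0 = (\<Sum>j<n. c j * t (h j) (k i))"
      using suml[of n h "k i" c] t0l[of "k i"] that by (simp add: P_def)
    also have "\<dots> = (\<Sum>j<n. if j = i then c j else 0)"
      using that \<open>i < n\<close> by (intro sum.cong) (auto simp: P_def)
    finally show "c i = 0" using \<open>i < n\<close> by simp
  qed (use that in \<open>auto simp: P_def\<close>)
  have le: "n \<le> d" if "P n h k" for n h k
    using b unfolding vbasis_def by (blast intro: U.vindep_le[OF indep[OF that]])
  define Q where "Q n \<longleftrightarrow> (\<exists>h k. P n h k)" for n
  have "Q 0" by (simp add: Q_def P_def)
  have Qle: "Q m \<Longrightarrow> m \<le> d" for m using le by (auto simp: Q_def)
  define n where "n = (GREATEST n. Q n)"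
  have Qn: "Q n" and max: "Q m \<Longrightarrow> m \<le> n" for m
    unfolding n_def using \<open>Q 0\<close> Qle GreatestI_nat[of Q 0 d] Greatest_le_nat[of Q m d] by blast+
  obtain h k where hk: "P n h k" using Qn by (auto simp: Q_def)
  have hU: "i < n \<Longrightarrow> h i \<in> vcarrier U" and kV: "i < n \<Longrightarrow> k i \<in> vcarrier V"
    and delta: "\<lbrakk>i < n; j < n\<rbrakk> \<Longrightarrow> t (h i) (k j) = (if i = j then 1 else 0)" for i j
    using hk by (auto simp: P_def)
  \<comment> \<open>\<open>rx\<close> and \<open>rv\<close> subtract the components along the
    system, so that their values are orthogonal to all \<open>k j\<close> and to all
    \<open>h j\<close> respectively.\<close>
  define rx where "rx x = vadd U x (vscale U (-1) (vcomb U (\<lambda>i. t x (k i)) h n))" for x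
  define rv where "rv v = vadd V v (vscale V (-1) (vcomb V (\<lambda>i. t (h i) v) k n))" for v
  have rxU: "rx x \<in> vcarrier U" if "x \<in> vcarrier U" for x using that hU by (simp add: rx_def)
  have rvV: "rv v \<in> vcarrier V" if "v \<in> vcarrier V" for v using that kV by (simp add: rv_def)
  have txk: "t (rx x) (k j) = 0" if "x \<in> vcarrier U" "j < n" for x j
  proof -
    have "(\<Sum>i<n. t x (k i) * t (h i) (k j)) = (\<Sum>i<n. if i = j then t x (k i) else 0)"
      using that delta by (intro sum.cong) auto
    then show ?thesis
      using that hU kV by (simp add: rx_def addl scalel suml del: mult_minus_left)
  qed
  have tvh: "t (h j) (rv v) = 0" if "v \<in> vcarrier V" "j < n" for v j
  proof -
    have "(\<Sum>i<n. t (h i) v * t (h j) (k i)) = (\<Sum>i<n. if i = j then t (h i) v else 0)"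
      using that delta by (intro sum.cong) auto
    then show ?thesis
      using that hU kV by (simp add: rv_def addr scaler sumr del: mult_minus_left)
  qed
  have rx0: "rx x = vzero U" if x: "x \<in> vcarrier U" for x
  proof (rule ccontr)
    assume "rx x \<noteq> vzero U"
    then obtain v where v: "v \<in> vcarrier V" "t (rx x) v = 1" using ndl rxU x by blast
    \<comment> \<open>Passing from \<open>v\<close> to its residue does not change the value,
      because \<open>rx x\<close> is orthogonal to every \<open>k i\<close>.\<close>
    have 1: "t (rx x) (rv v) = 1"
    proof -
      have "(\<Sum>i<n. t (h i) v * t (rx x) (k i)) = 0" using txk[OF x] by simp
      then show ?thesis using v rxU[OF x] kV by (simp add: rv_def addr scaler sumr)
    qed
    have "P (Suc n) (h(n := rx x)) (k(n := rv v))"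
      using hU kV delta rxU[OF x] rvV[OF v(1)] 1 txk[OF x] tvh[OF v(1)]
      by (auto simp: P_def less_Suc_eq)
    then have "Q (Suc n)" by (auto simp: Q_def)
    then show False using max by fastforce
  qed
  have ex: "x = vcomb U (\<lambda>i. t x (k i)) h n" if "x \<in> vcarrier U" for x
    using rx0[OF that] that hU unfolding rx_def by - (rule U.diff_eq_zeroD, auto)
  \<comment> \<open>On this side the system is not extended again: \<open>rv v\<close> is orthogonal
    to every \<open>h i\<close>, and these already span \<open>U\<close>.\<close>
  have "rv v = vzero V" if v: "v \<in> vcarrier V" for v
  proof (rule ccontr)
    assume "rv v \<noteq> vzero V"
    then obtain x where x: "x \<in> vcarrier U" "t x (rv v) = 1" using ndr rvV v by blast
    have "t x (rv v) = t (vcomb U (\<lambda>i. t x (k i)) h n) (rv v)" using ex[OF x(1)] by simp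
    also have "\<dots> = 0" using suml[OF hU rvV[OF v]] tvh[OF v] by simp
    finally show False using x by simp
  qed
  then have ev: "v = vcomb V (\<lambda>i. t (h i) v) k n" if "v \<in> vcarrier V" for v
    using that kV unfolding rv_def by - (rule V.diff_eq_zeroD, auto)
  show thesis using that[OF hU kV delta ex ev indep[OF hk]] .
qed

section \<open>Linear and abelian categories\<close>

lemma hom_space_simps [simp]:
  "vcarrier (hom_space C A B) = Hom C A B" "vzero (hom_space C A B) = Zer C A B"
  "vadd (hom_space C A B) = Add C" "vscale (hom_space C A B) = Scale C"
  by (simp_all add: hom_space_def)

context category
begin

lemma monoD: "\<lbrakk>f \<cdot> g = f \<cdot> h; mono_arrow C f; g \<in> Hom C A (Dom C f); h \<in> Hom C A (Dom C f)\<rbrakk> \<Longrightarrow> g = h"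
  using Hom_Ob[of g A "Dom C f"] unfolding mono_arrow_def by blast

lemma epiD: "\<lbrakk>g \<cdot> f = h \<cdot> f; epi_arrow C f; g \<in> Hom C (Cod C f) B; h \<in> Hom C (Cod C f) B\<rbrakk> \<Longrightarrow> g = h"
  using Hom_Ob[of g "Cod C f" B] unfolding epi_arrow_def by blast

lemma mono_Ar: "mono_arrow C f \<Longrightarrow> f \<in> Ar C" and epi_Ar: "epi_arrow C f \<Longrightarrow> f \<in> Ar C"
  by (auto simp: mono_arrow_def epi_arrow_def)

lemma mono_split_iso:
  assumes f: "mono_arrow C f" and s: "s \<in> Hom C (Cod C f) (Dom C f)" "f \<cdot> s = Idn C (Cod C f)"
  shows "iso C f"
proof (rule isoI[of _ s])
  note [simp] = mono_Ar[OF f]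
  have [simp]: "s \<in> Ar C" "Dom C s = Cod C f" "Cod C s = Dom C f" using s by (auto simp: Hom_iff)
  have "f \<cdot> (s \<cdot> f) = (f \<cdot> s) \<cdot> f" by simp
  also have "\<dots> = f \<cdot> Idn C (Dom C f)" unfolding s(2) by simp
  finally show "s \<cdot> f = Idn C (Dom C f)" by (rule monoD[OF _ f, where A = "Dom C f"]) (simp_all add: Hom_iff)
qed (use assms in \<open>auto simp: mono_Ar Hom_iff\<close>)

lemma iso_mono: "iso C f \<Longrightarrow> mono_arrow C f"
  unfolding mono_arrow_def
  by (auto simp: iso_Ar Hom_iff intro: iso_cancel_left[of f])

lemma iso_epi: "iso C f \<Longrightarrow> epi_arrow C f"
  unfolding epi_arrow_def
  by (auto simp: iso_Ar Hom_iff intro: iso_cancel_right[of f])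

lemma epi_Comp:
  assumes f: "epi_arrow C f" and g: "epi_arrow C g" and "Cod C f = Dom C g"
  shows "epi_arrow C (g \<cdot> f)"
  unfolding epi_arrow_def
proof (intro conjI ballI impI)
  note [simp] = epi_Ar[OF f] epi_Ar[OF g] assms(3)
  show "g \<cdot> f \<in> Ar C" by simp
  fix B h k assume "h \<in> Hom C (Cod C (g \<cdot> f)) B" "k \<in> Hom C (Cod C (g \<cdot> f)) B"
  then have hk [simp]: "h \<in> Ar C" "Dom C h = Cod C g" "Cod C h = B" "k \<in> Ar C" "Dom C k = Cod C g" "Cod C k = B"
    by (auto simp: Hom_iff)
  assume "h \<cdot> (g \<cdot> f) = k \<cdot> (g \<cdot> f)"
  then have "(h \<cdot> g) \<cdot> f = (k \<cdot> g) \<cdot> f" by simp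
  from epiD[OF this f, of B] have "h \<cdot> g = k \<cdot> g" by (simp add: Hom_iff)
  from epiD[OF this g, of B] show "h = k" by (simp add: Hom_iff)
qed

end

context linear_category
begin

lemma hom_vs [simp]: "\<lbrakk>A \<in> Ob C; B \<in> Ob C\<rbrakk> \<Longrightarrow> vector_space_struct (hom_space C A B)"
  by (rule hom_vector_space)

lemma Zer_Hom: "\<lbrakk>A \<in> Ob C; B \<in> Ob C\<rbrakk> \<Longrightarrow> Zer C A B \<in> Hom C A B"
  using vector_space_struct.zero_closed[OF hom_vs] by simp

lemma Zer_Ar [simp]: "\<lbrakk>A \<in> Ob C; B \<in> Ob C\<rbrakk> \<Longrightarrow> Zer C A B \<in> Ar C"
  and Dom_Zer [simp]: "\<lbrakk>A \<in> Ob C; B \<in> Ob C\<rbrakk> \<Longrightarrow> Dom C (Zer C A B) = A"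
  and Cod_Zer [simp]: "\<lbrakk>A \<in> Ob C; B \<in> Ob C\<rbrakk> \<Longrightarrow> Cod C (Zer C A B) = B"
  using Zer_Hom[of A B] by (auto simp: Hom_iff)

lemma Add_Hom: "\<lbrakk>f \<in> Hom C A B; g \<in> Hom C A B\<rbrakk> \<Longrightarrow> Add C f g \<in> Hom C A B"
  using vector_space_struct.add_closed[OF hom_vs, of A B f g] Hom_Ob[of f A B] by simp

lemma Scale_Hom: "f \<in> Hom C A B \<Longrightarrow> Scale C a f \<in> Hom C A B"
  using vector_space_struct.scale_closed[OF hom_vs, of A B f] Hom_Ob[of f A B] by simp

lemma Scale_Ar [simp]: "f \<in> Ar C \<Longrightarrow> Scale C a f \<in> Ar C"
  and Dom_Scale [simp]: "f \<in> Ar C \<Longrightarrow> Dom C (Scale C a f) = Dom C f"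
  and Cod_Scale [simp]: "f \<in> Ar C \<Longrightarrow> Cod C (Scale C a f) = Cod C f"
  using Scale_Hom[of f "Dom C f" "Cod C f" a] by (auto simp: Hom_iff)

lemma Scale_0: "f \<in> Hom C A B \<Longrightarrow> Scale C 0 f = Zer C A B"
  using vector_space_struct.scale_0[OF hom_vs, of A B f] Hom_Ob[of f A B] by simp

lemma Scale_1: "f \<in> Ar C \<Longrightarrow> Scale C 1 f = f"
  using vector_space_struct.scale_one[OF hom_vs, of "Dom C f" "Cod C f" f] by (simp add: Hom_iff)

lemma Scale_Scale: "f \<in> Ar C \<Longrightarrow> Scale C a (Scale C b f) = Scale C (a * b) f"
  using vector_space_struct.scale_scale[OF hom_vs, of "Dom C f" "Cod C f" f] by (simp add: Hom_iff)

lemma Scale_Zer: "\<lbrakk>A \<in> Ob C; B \<in> Ob C\<rbrakk> \<Longrightarrow> Scale C a (Zer C A B) = Zer C A B"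
  using vector_space_struct.scale_vzero[OF hom_vs, of A B a] by simp

lemma Scale_eq_Zer:
  assumes "Scale C a f = Zer C A B" "f \<in> Hom C A B"
  shows "a = 0 \<or> f = Zer C A B"
proof (rule disjCI)
  assume "f \<noteq> Zer C A B"
  show "a = 0"
  proof (rule ccontr)
    assume "a \<noteq> 0"
    then have "f = Scale C (inverse a) (Scale C a f)"
      using assms(2) by (simp add: Scale_Scale Scale_1 Hom_iff)
    then have "f = Zer C A B" using assms Hom_Ob[OF assms(2)] Scale_Zer by metis
    with \<open>f \<noteq> Zer C A B\<close> show False by simp
  qed
qed

lemma Comp_Scale': "\<lbrakk>f \<in> Ar C; g \<in> Ar C; Cod C f = Dom C g\<rbrakk> \<Longrightarrow> g \<cdot> Scale C a f = Scale C a (g \<cdot> f)"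
  and Scale_Comp': "\<lbrakk>f \<in> Ar C; g \<in> Ar C; Cod C f = Dom C g\<rbrakk> \<Longrightarrow> Scale C a g \<cdot> f = Scale C a (g \<cdot> f)"
  by (rule Comp_Scale Scale_Comp; auto simp: Hom_iff)+

lemma Comp_Zer: "\<lbrakk>f \<in> Ar C; Dom C f = B; A \<in> Ob C\<rbrakk> \<Longrightarrow> f \<cdot> Zer C A B = Zer C A (Cod C f)"
  using Comp_Scale'[of "Zer C A B" f 0] Scale_0[of "Zer C A B" A B] Scale_0[of "f \<cdot> Zer C A B" A "Cod C f"]
  by (auto simp: Hom_iff)

lemma Zer_Comp: "\<lbrakk>f \<in> Ar C; Cod C f = A; B \<in> Ob C\<rbrakk> \<Longrightarrow> Zer C A B \<cdot> f = Zer C (Dom C f) B"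
  using Scale_Comp'[of f "Zer C A B" 0] Scale_0[of "Zer C A B" A B] Scale_0[of "Zer C A B \<cdot> f" "Dom C f" B]
  by (auto simp: Hom_iff)

lemma diff_eq_ZerD:
  "\<lbrakk>Add C f (Scale C (-1) g) = Zer C A B; f \<in> Hom C A B; g \<in> Hom C A B\<rbrakk> \<Longrightarrow> f = g"
  using vector_space_struct.diff_eq_zeroD[OF hom_vs, of A B f g] Hom_Ob[of f A B] by simp

lemma diff_self: "f \<in> Hom C A B \<Longrightarrow> Add C f (Scale C (-1) f) = Zer C A B"
  using vector_space_struct.add_neg[OF hom_vs, of A B f] Hom_Ob[of f A B] by simp

lemma vlinear_Comp_left: "\<lbrakk>g \<in> Hom C B D; A \<in> Ob C\<rbrakk> \<Longrightarrow> vlinear (hom_space C A B) (hom_space C A D) (\<lambda>f. g \<cdot> f)"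
  unfolding vlinear_def by (auto simp: Comp_Add Comp_Scale intro: Comp_Hom)

lemma vlinear_Comp_right: "\<lbrakk>f \<in> Hom C A B; D \<in> Ob C\<rbrakk> \<Longrightarrow> vlinear (hom_space C B D) (hom_space C A D) (\<lambda>g. g \<cdot> f)"
  unfolding vlinear_def by (auto simp: Add_Comp Scale_Comp intro: Comp_Hom)

text \<open>The endpoints are arguments because the empty sum has to be the zero morphism between
  them.\<close>

definition hsum :: "'a \<Rightarrow> 'a \<Rightarrow> (nat \<Rightarrow> 'b) \<Rightarrow> nat \<Rightarrow> 'b" where
  "hsum A B f n = vsum (hom_space C A B) f n"

lemma hsum_Hom: "\<lbrakk>\<And>i. i < n \<Longrightarrow> f i \<in> Hom C A B; A \<in> Ob C; B \<in> Ob C\<rbrakk> \<Longrightarrow> hsum A B f n \<in> Hom C A B"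
  using vector_space_struct.vsum_closed[OF hom_vs, of A B n f] by (simp add: hsum_def)

lemma hsum_cong: "(\<And>i. i < n \<Longrightarrow> f i = g i) \<Longrightarrow> hsum A B f n = hsum A B g n"
  unfolding hsum_def by (rule vsum_cong)

lemma hsum_Zer: "\<lbrakk>\<And>i. i < n \<Longrightarrow> f i = Zer C A B; A \<in> Ob C; B \<in> Ob C\<rbrakk> \<Longrightarrow> hsum A B f n = Zer C A B"
  using vector_space_struct.vsum_zero[OF hom_vs, of A B n f] by (simp add: hsum_def)

lemma hsum_delta: "\<lbrakk>j < n; x \<in> Hom C A B; \<And>i. i < n \<Longrightarrow> f i = (if i = j then x else Zer C A B)\<rbrakk> \<Longrightarrow> hsum A B f n = x"
  using vector_space_struct.vsum_delta[OF hom_vs, of A B j n x f] Hom_Ob[of x A B] by (simp add: hsum_def)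

lemma hsum_swap:
  "\<lbrakk>\<And>i j. \<lbrakk>i < m; j < n\<rbrakk> \<Longrightarrow> f i j \<in> Hom C A B; A \<in> Ob C; B \<in> Ob C\<rbrakk>
    \<Longrightarrow> hsum A B (\<lambda>i. hsum A B (f i) n) m = hsum A B (\<lambda>j. hsum A B (\<lambda>i. f i j) m) n"
  using vector_space_struct.vsum_swap[OF hom_vs, of A B m n f] by (simp add: hsum_def)

lemma Comp_hsum: "\<lbrakk>g \<in> Hom C B D; A \<in> Ob C; \<And>i. i < n \<Longrightarrow> f i \<in> Hom C A B\<rbrakk>
    \<Longrightarrow> g \<cdot> hsum A B f n = hsum A D (\<lambda>i. g \<cdot> f i) n"
  unfolding hsum_def using vector_space_struct.vlinear_vsum[OF hom_vs vlinear_Comp_left hom_vs, of A B g D n f]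
    Hom_Ob[of g B D] by simp

lemma hsum_Comp: "\<lbrakk>f \<in> Hom C A B; D \<in> Ob C; \<And>i. i < n \<Longrightarrow> g i \<in> Hom C B D\<rbrakk>
    \<Longrightarrow> hsum B D g n \<cdot> f = hsum A D (\<lambda>i. g i \<cdot> f) n"
  unfolding hsum_def using vector_space_struct.vlinear_vsum[OF hom_vs vlinear_Comp_right hom_vs, of B D f A n g]
    Hom_Ob[of f A B] by simp

lemma zero_object_iff: "is_zero_object C A \<longleftrightarrow> A \<in> Ob C \<and> Idn C A = Zer C A A"
proof
  assume "is_zero_object C A"
  then have A: "A \<in> Ob C" and ex: "\<exists>!f. f \<in> Hom C A A" by (auto simp: is_zero_object_def)
  show "A \<in> Ob C \<and> Idn C A = Zer C A A" using A ex Idn_Hom[OF A] Zer_Hom[OF A A] by blast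
next
  assume A: "A \<in> Ob C \<and> Idn C A = Zer C A A"
  have "f = Zer C A B" if "f \<in> Hom C A B" for f B
  proof -
    have "f \<cdot> Idn C A = Zer C A B" using A that by (auto simp: Comp_Zer Hom_iff)
    then show ?thesis using that by (simp add: Hom_iff)
  qed
  moreover have "f = Zer C B A" if "f \<in> Hom C B A" for f B
  proof -
    have "Idn C A \<cdot> f = Zer C B A" using A that by (auto simp: Zer_Comp Hom_iff)
    then show ?thesis using that by (simp add: Hom_iff)
  qed
  ultimately show "is_zero_object C A" using A unfolding is_zero_object_def by (blast intro: Zer_Hom)
qed

lemma mono_arrowI:
  assumes f: "f \<in> Hom C A B" and z: "\<And>Z g. \<lbrakk>g \<in> Hom C Z A; f \<cdot> g = Zer C Z B\<rbrakk> \<Longrightarrow> g = Zer C Z A"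
  shows "mono_arrow C f"
  unfolding mono_arrow_def
proof (intro conjI ballI impI)
  show "f \<in> Ar C" using f by (simp add: Hom_iff)
  fix Z g h assume Z: "Z \<in> Ob C" and g: "g \<in> Hom C Z (Dom C f)" and h: "h \<in> Hom C Z (Dom C f)"
    and eq: "f \<cdot> g = f \<cdot> h"
  have [simp]: "Dom C f = A" using f by (simp add: Hom_iff)
  have "f \<cdot> Add C g (Scale C (-1) h) = Add C (f \<cdot> h) (Scale C (-1) (f \<cdot> h))"
    using f g h by (simp add: Comp_Add[where A = Z and B = A and D = B] Scale_Hom Comp_Scale[where A = Z and B = A and D = B] eq)
  also have "\<dots> = Zer C Z B" using f h by (intro diff_self) (auto intro: Comp_Hom)
  finally have "Add C g (Scale C (-1) h) = Zer C Z A" using g h by (intro z) (auto intro: Add_Hom Scale_Hom)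
  then show "g = h" using g h diff_eq_ZerD[of g h Z A] by simp
qed

lemma epi_arrowI:
  assumes f: "f \<in> Hom C A B" and z: "\<And>Z g. \<lbrakk>g \<in> Hom C B Z; g \<cdot> f = Zer C A Z\<rbrakk> \<Longrightarrow> g = Zer C B Z"
  shows "epi_arrow C f"
  unfolding epi_arrow_def
proof (intro conjI ballI impI)
  show "f \<in> Ar C" using f by (simp add: Hom_iff)
  fix Z g h assume Z: "Z \<in> Ob C" and g: "g \<in> Hom C (Cod C f) Z" and h: "h \<in> Hom C (Cod C f) Z"
    and eq: "g \<cdot> f = h \<cdot> f"
  have [simp]: "Cod C f = B" using f by (simp add: Hom_iff)
  have "Add C g (Scale C (-1) h) \<cdot> f = Add C (h \<cdot> f) (Scale C (-1) (h \<cdot> f))"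
    using f g h by (simp add: Add_Comp[where A = A and B = B and D = Z] Scale_Hom Scale_Comp[where A = A and B = B and D = Z] eq)
  also have "\<dots> = Zer C A Z" using f h by (intro diff_self) (auto intro: Comp_Hom)
  finally have "Add C g (Scale C (-1) h) = Zer C B Z" using g h by (intro z) (auto intro: Add_Hom Scale_Hom)
  then show "g = h" using g h diff_eq_ZerD[of g h B Z] by simp
qed

lemma mono_ZerD: "\<lbrakk>f \<cdot> g = Zer C A (Cod C f); mono_arrow C f; g \<in> Hom C A (Dom C f)\<rbrakk> \<Longrightarrow> g = Zer C A (Dom C f)"
  using monoD[of f g "Zer C A (Dom C f)" A] Hom_Ob[of g A "Dom C f"] by (simp add: Comp_Zer mono_Ar Zer_Hom)

lemma epi_ZerD: "\<lbrakk>g \<cdot> f = Zer C (Dom C f) B; epi_arrow C f; g \<in> Hom C (Cod C f) B\<rbrakk> \<Longrightarrow> g = Zer C (Cod C f) B"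
  using epiD[of g f "Zer C (Cod C f) B" B] Hom_Ob[of g "Cod C f" B] by (simp add: Zer_Comp epi_Ar Zer_Hom)

lemma is_kernel_mono:
  assumes "is_kernel C f k" shows "mono_arrow C k"
proof (rule mono_arrowI)
  show "k \<in> Hom C (Dom C k) (Cod C k)" using assms by (simp add: is_kernel_def Hom_iff)
  have k [simp]: "k \<in> Ar C" "f \<in> Ar C" "Cod C k = Dom C f" "f \<cdot> k = Zer C (Dom C k) (Cod C f)"
    and uni: "\<And>A g. \<lbrakk>A \<in> Ob C; g \<in> Hom C A (Dom C f); f \<cdot> g = Zer C A (Cod C f)\<rbrakk>
        \<Longrightarrow> \<exists>!u. u \<in> Hom C A (Dom C k) \<and> k \<cdot> u = g"
    using assms by (auto simp: is_kernel_def)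
  fix Z g assume g: "g \<in> Hom C Z (Dom C k)" and 0: "k \<cdot> g = Zer C Z (Cod C k)"
  have Z: "Z \<in> Ob C" using g Hom_Ob by blast
  have "\<exists>!u. u \<in> Hom C Z (Dom C k) \<and> k \<cdot> u = Zer C Z (Dom C f)"
    using Z by (intro uni) (auto simp: Zer_Hom Comp_Zer)
  moreover have "k \<cdot> Zer C Z (Dom C k) = Zer C Z (Dom C f)" using Z by (simp add: Comp_Zer)
  ultimately show "g = Zer C Z (Dom C k)" using g 0 Zer_Hom[of Z "Dom C k"] Z by auto
qed

lemma is_cokernel_epi:
  assumes "is_cokernel C f q" shows "epi_arrow C q"
proof (rule epi_arrowI)
  show "q \<in> Hom C (Dom C q) (Cod C q)" using assms by (simp add: is_cokernel_def Hom_iff)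
  have k [simp]: "q \<in> Ar C" "f \<in> Ar C" "Dom C q = Cod C f" "q \<cdot> f = Zer C (Dom C f) (Cod C q)"
    and uni: "\<And>B g. \<lbrakk>B \<in> Ob C; g \<in> Hom C (Cod C f) B; g \<cdot> f = Zer C (Dom C f) B\<rbrakk>
        \<Longrightarrow> \<exists>!u. u \<in> Hom C (Cod C q) B \<and> u \<cdot> q = g"
    using assms by (auto simp: is_cokernel_def)
  fix Z g assume g: "g \<in> Hom C (Cod C q) Z" and 0: "g \<cdot> q = Zer C (Dom C q) Z"
  have Z: "Z \<in> Ob C" using g Hom_Ob by blast
  have "\<exists>!u. u \<in> Hom C (Cod C q) Z \<and> u \<cdot> q = Zer C (Cod C f) Z"
    using Z by (intro uni) (auto simp: Zer_Hom Zer_Comp)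
  moreover have "Zer C (Cod C q) Z \<cdot> q = Zer C (Cod C f) Z" using Z by (simp add: Zer_Comp)
  ultimately show "g = Zer C (Cod C q) Z" using g 0 Zer_Hom[of "Cod C q" Z] Z by auto
qed

end

section \<open>Images, simple objects and quotients in abelian categories\<close>

context abelian_category
begin

lemma is_kernelD:
  assumes "is_kernel C f k"
  shows "f \<in> Ar C" "k \<in> Ar C" "Cod C k = Dom C f" "f \<cdot> k = Zer C (Dom C k) (Cod C f)"
    "\<lbrakk>g \<in> Ar C; Cod C g = Dom C f; f \<cdot> g = Zer C (Dom C g) (Cod C f)\<rbrakk> \<Longrightarrow> \<exists>u\<in>Hom C (Dom C g) (Dom C k). k \<cdot> u = g"
  using assms Dom_Ob[of g] Hom_iff[of g "Dom C g" "Dom C f"] unfolding is_kernel_def by blast+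

lemma is_cokernelD:
  assumes "is_cokernel C f q"
  shows "f \<in> Ar C" "q \<in> Ar C" "Dom C q = Cod C f" "q \<cdot> f = Zer C (Dom C f) (Cod C q)"
    "\<lbrakk>g \<in> Ar C; Dom C g = Cod C f; g \<cdot> f = Zer C (Dom C f) (Cod C g)\<rbrakk> \<Longrightarrow> \<exists>u\<in>Hom C (Cod C q) (Cod C g). u \<cdot> q = g"
  using assms Cod_Ob[of g] Hom_iff[of g "Cod C f" "Cod C g"] unfolding is_cokernel_def by blast+

lemma kernelE:
  assumes "f \<in> Hom C A B"
  obtains K k where "k \<in> Hom C K A" "mono_arrow C k" "f \<cdot> k = Zer C K B"
    "\<And>Z g. \<lbrakk>g \<in> Hom C Z A; f \<cdot> g = Zer C Z B\<rbrakk> \<Longrightarrow> \<exists>u\<in>Hom C Z K. k \<cdot> u = g"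
proof -
  obtain k where k: "is_kernel C f k" using ex_kernel assms unfolding Hom_iff by blast
  note D = is_kernelD[OF k]
  have [simp]: "Dom C f = A" "Cod C f = B" using assms by (auto simp: Hom_iff)
  show thesis
  proof (rule that[of k "Dom C k"])
    fix Z g assume "g \<in> Hom C Z A" "f \<cdot> g = Zer C Z B"
    then show "\<exists>u\<in>Hom C Z (Dom C k). k \<cdot> u = g" using D(5)[of g] unfolding Hom_iff by auto
  qed (use D(1-4) is_kernel_mono[OF k] in \<open>auto simp: Hom_iff\<close>)
qed

lemma cokernelE:
  assumes "f \<in> Hom C A B"
  obtains Q q where "q \<in> Hom C B Q" "epi_arrow C q" "q \<cdot> f = Zer C A Q"
    "\<And>Z g. \<lbrakk>g \<in> Hom C B Z; g \<cdot> f = Zer C A Z\<rbrakk> \<Longrightarrow> \<exists>u\<in>Hom C Q Z. u \<cdot> q = g"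
proof -
  obtain q where q: "is_cokernel C f q" using ex_cokernel assms unfolding Hom_iff by blast
  note D = is_cokernelD[OF q]
  have [simp]: "Dom C f = A" "Cod C f = B" using assms by (auto simp: Hom_iff)
  show thesis
  proof (rule that[of q "Cod C q"])
    fix Z g assume "g \<in> Hom C B Z" "g \<cdot> f = Zer C A Z"
    then show "\<exists>u\<in>Hom C (Cod C q) Z. u \<cdot> q = g" using D(5)[of g] unfolding Hom_iff by auto
  qed (use D(1-4) is_cokernel_epi[OF q] in \<open>auto simp: Hom_iff\<close>)
qed

text \<open>As a kernel of some \<open>g\<close>, the mono \<open>f\<close> satisfies
  \<open>g \<cdot> f = 0\<close>. Cancelling the epi gives \<open>g = 0\<close>, so the identity
  factors through \<open>f\<close> and splits it.\<close>

lemma mono_epi_iso: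
  assumes m: "mono_arrow C f" and e: "epi_arrow C f"
  shows "iso C f"
proof -
  note [simp] = mono_Ar[OF m]
  obtain g where g: "is_kernel C g f" using mono_normal m by blast
  have [simp]: "g \<in> Ar C" "Dom C g = Cod C f" and 0: "g \<cdot> f = Zer C (Dom C f) (Cod C g)"
    using is_kernelD(1-4)[OF g] by simp_all
  have "g = Zer C (Cod C f) (Cod C g)" by (rule epi_ZerD[OF 0 e]) (simp add: Hom_iff)
  then have "g \<cdot> Idn C (Cod C f) = Zer C (Cod C f) (Cod C g)" by simp
  then obtain s where "s \<in> Hom C (Cod C f) (Dom C f)" "f \<cdot> s = Idn C (Cod C f)"
    using is_kernelD(5)[OF g, of "Idn C (Cod C f)"] by auto
  then show ?thesis using mono_split_iso[OF m] by simp
qed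

text \<open>\<open>i\<close> is the kernel of some \<open>g\<close>, and \<open>g\<close> factors
  through the cokernel \<open>q\<close> of \<open>i\<close>. Whatever \<open>q\<close> kills is
  therefore killed by \<open>g\<close>.\<close>

lemma mono_kernel_of_cokernel:
  assumes i: "mono_arrow C i" "i \<in> Hom C A B" and q: "q \<in> Hom C B Q"
    and q_uni: "\<And>Z g. \<lbrakk>g \<in> Hom C B Z; g \<cdot> i = Zer C A Z\<rbrakk> \<Longrightarrow> \<exists>u\<in>Hom C Q Z. u \<cdot> q = g"
    and h: "h \<in> Hom C Z B" "q \<cdot> h = Zer C Z Q"
  shows "\<exists>u\<in>Hom C Z A. i \<cdot> u = h"
proof -
  have [simp]: "i \<in> Ar C" "Dom C i = A" "Cod C i = B" "q \<in> Ar C" "Dom C q = B" "Cod C q = Q"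
    "h \<in> Ar C" "Dom C h = Z" "Cod C h = B" using i(2) q h(1) by (simp_all add: Hom_iff)
  have [simp]: "Z \<in> Ob C" "B \<in> Ob C" using Hom_Ob[OF h(1)] by auto
  obtain g where g: "is_kernel C g i" using mono_normal i by blast
  have [simp]: "g \<in> Ar C" "Dom C g = B" and 0: "g \<cdot> i = Zer C A (Cod C g)"
    using is_kernelD(1-4)[OF g] by simp_all
  obtain u where u: "u \<in> Hom C Q (Cod C g)" "u \<cdot> q = g" using q_uni[of g, OF _ 0] Hom_iff[of g B "Cod C g"] by auto
  have [simp]: "u \<in> Ar C" "Dom C u = Q" "Cod C u = Cod C g" using u by (auto simp: Hom_iff)
  have "g \<cdot> h = u \<cdot> (q \<cdot> h)" unfolding u(2)[symmetric] by simp
  also have "\<dots> = Zer C Z (Cod C g)" unfolding h(2) by (simp add: Comp_Zer)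
  finally show ?thesis using is_kernelD(5)[OF g, of h] by simp
qed

text \<open>The dual argument: \<open>e\<close> is the cokernel of some \<open>g\<close>, and
  \<open>g\<close> factors through the kernel \<open>k\<close> of \<open>e\<close>.\<close>

lemma epi_cokernel_of_kernel:
  assumes e: "epi_arrow C e" "e \<in> Hom C A B" and k: "k \<in> Hom C K A"
    and k_uni: "\<And>Z g. \<lbrakk>g \<in> Hom C Z A; e \<cdot> g = Zer C Z B\<rbrakk> \<Longrightarrow> \<exists>u\<in>Hom C Z K. k \<cdot> u = g"
    and h: "h \<in> Hom C A Z" "h \<cdot> k = Zer C K Z"
  shows "\<exists>u\<in>Hom C B Z. u \<cdot> e = h"
proof -
  have [simp]: "e \<in> Ar C" "Dom C e = A" "Cod C e = B" "k \<in> Ar C" "Dom C k = K" "Cod C k = A"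
    "h \<in> Ar C" "Dom C h = A" "Cod C h = Z" using e(2) k h(1) by (simp_all add: Hom_iff)
  have [simp]: "Z \<in> Ob C" "A \<in> Ob C" using Hom_Ob[OF h(1)] by auto
  obtain g where g: "is_cokernel C g e" using epi_normal e by blast
  have [simp]: "g \<in> Ar C" "Cod C g = A" and 0: "e \<cdot> g = Zer C (Dom C g) B"
    using is_cokernelD(1-4)[OF g] by simp_all
  obtain u where u: "u \<in> Hom C (Dom C g) K" "k \<cdot> u = g" using k_uni[of g, OF _ 0] Hom_iff[of g "Dom C g" A] by auto
  have [simp]: "u \<in> Ar C" "Dom C u = Dom C g" "Cod C u = K" using u by (auto simp: Hom_iff)
  have "h \<cdot> g = (h \<cdot> k) \<cdot> u" unfolding u(2)[symmetric] by simp
  also have "\<dots> = Zer C (Dom C g) Z" unfolding h(2) by (simp add: Zer_Comp)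
  finally show ?thesis using is_cokernelD(5)[OF g, of h] by simp
qed

text \<open>The image is the kernel \<open>m\<close> of the cokernel \<open>q\<close> of
  \<open>f\<close>. To see that \<open>e\<close> is epi, let \<open>g \<cdot> e = 0\<close> and let
  \<open>k\<close> be the kernel of \<open>g\<close>. Then \<open>f\<close> factors through the mono
  \<open>m \<cdot> k\<close>, which is the kernel of some \<open>r\<close>; this \<open>r\<close>
  kills \<open>f\<close>, hence factors through \<open>q\<close> and kills \<open>m\<close>. So
  \<open>m\<close> factors through \<open>m \<cdot> k\<close>, which splits \<open>k\<close> and
  makes \<open>g\<close> vanish.\<close>

lemma imageE:
  assumes f: "f \<in> Hom C A B"
  obtains I e m where "e \<in> Hom C A I" "epi_arrow C e" "m \<in> Hom C I B" "mono_arrow C m" "f = m \<cdot> e"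
proof -
  obtain Q q where q: "q \<in> Hom C B Q" "q \<cdot> f = Zer C A Q"
    and q_uni: "\<And>Z g. \<lbrakk>g \<in> Hom C B Z; g \<cdot> f = Zer C A Z\<rbrakk> \<Longrightarrow> \<exists>u\<in>Hom C Q Z. u \<cdot> q = g"
    using cokernelE[OF f] by metis
  obtain I m where m: "m \<in> Hom C I B" "mono_arrow C m" "q \<cdot> m = Zer C I Q"
    and m_uni: "\<And>Z g. \<lbrakk>g \<in> Hom C Z B; q \<cdot> g = Zer C Z Q\<rbrakk> \<Longrightarrow> \<exists>u\<in>Hom C Z I. m \<cdot> u = g"
    using kernelE[OF q(1)] by metis
  obtain e where e: "e \<in> Hom C A I" "m \<cdot> e = f" using m_uni[OF f q(2)] by blast
  have [simp]: "f \<in> Ar C" "Dom C f = A" "Cod C f = B" "q \<in> Ar C" "Dom C q = B" "Cod C q = Q"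
    "m \<in> Ar C" "Dom C m = I" "Cod C m = B" "e \<in> Ar C" "Dom C e = A" "Cod C e = I"
    using f q m e by (auto simp: Hom_iff)
  have [simp]: "A \<in> Ob C" "B \<in> Ob C" "I \<in> Ob C" using Hom_Ob f m by blast+
  have "epi_arrow C e"
  proof (rule epi_arrowI[OF e(1)])
    fix Z g assume g: "g \<in> Hom C I Z" "g \<cdot> e = Zer C A Z"
    have [simp]: "g \<in> Ar C" "Dom C g = I" "Cod C g = Z" "Z \<in> Ob C" using g Hom_Ob by (auto simp: Hom_iff)
    obtain K k where k: "k \<in> Hom C K I" "mono_arrow C k" "g \<cdot> k = Zer C K Z"
      and k_uni: "\<And>W h. \<lbrakk>h \<in> Hom C W I; g \<cdot> h = Zer C W Z\<rbrakk> \<Longrightarrow> \<exists>u\<in>Hom C W K. k \<cdot> u = h"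
      using kernelE[OF g(1)] by metis
    have [simp]: "k \<in> Ar C" "Dom C k = K" "Cod C k = I" "K \<in> Ob C" using k Hom_Ob by (auto simp: Hom_iff)
    obtain e' where e': "e' \<in> Hom C A K" "k \<cdot> e' = e" using k_uni[OF e(1) g(2)] by blast
    have [simp]: "e' \<in> Ar C" "Dom C e' = A" "Cod C e' = K" using e' by (auto simp: Hom_iff)
    have mk: "mono_arrow C (m \<cdot> k)"
    proof (rule mono_arrowI)
      show "m \<cdot> k \<in> Hom C K B" by (simp add: Hom_iff)
      fix W h assume h: "h \<in> Hom C W K" "(m \<cdot> k) \<cdot> h = Zer C W B"
      have [simp]: "h \<in> Ar C" "Dom C h = W" "Cod C h = K" using h by (auto simp: Hom_iff)
      have "m \<cdot> (k \<cdot> h) = Zer C W B" using h(2) by simp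
      then have "k \<cdot> h = Zer C W I" using mono_ZerD[of m "k \<cdot> h" W] m by (simp add: Hom_iff)
      then show "h = Zer C W K" using mono_ZerD[of k h W] k by (simp add: Hom_iff)
    qed
    obtain r where r: "is_kernel C r (m \<cdot> k)" using mono_normal[OF mk] by blast
    have [simp]: "r \<in> Ar C" "Dom C r = B" and r0: "r \<cdot> (m \<cdot> k) = Zer C K (Cod C r)"
      using is_kernelD(1-4)[OF r] by simp_all
    have "f = (m \<cdot> k) \<cdot> e'" using e(2) e'(2) by simp
    then have "r \<cdot> f = (r \<cdot> (m \<cdot> k)) \<cdot> e'" by simp
    also have "\<dots> = Zer C A (Cod C r)" unfolding r0 by (simp add: Zer_Comp)
    finally obtain r' where r': "r' \<in> Hom C Q (Cod C r)" "r' \<cdot> q = r"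
      using q_uni[of r "Cod C r"] Hom_iff[of r B "Cod C r"] by auto
    have [simp]: "r' \<in> Ar C" "Dom C r' = Q" "Cod C r' = Cod C r" using r' by (auto simp: Hom_iff)
    have "r \<cdot> m = r' \<cdot> (q \<cdot> m)" unfolding r'(2)[symmetric] by simp
    also have "\<dots> = Zer C I (Cod C r)" unfolding m(3) by (simp add: Comp_Zer)
    finally obtain s where s: "s \<in> Hom C I K" "(m \<cdot> k) \<cdot> s = m"
      using is_kernelD(5)[OF r, of m] by auto
    have [simp]: "s \<in> Ar C" "Dom C s = I" "Cod C s = K" using s by (auto simp: Hom_iff)
    have "m \<cdot> (k \<cdot> s) = m \<cdot> Idn C I" using s(2) by simp
    from monoD[OF this m(2)] have "k \<cdot> s = Idn C I" by (simp add: Hom_iff)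
    then have "g = (g \<cdot> k) \<cdot> s" by simp
    also have "\<dots> = Zer C I Z" unfolding k(3) by (simp add: Zer_Comp)
    finally show "g = Zer C I Z" .
  qed
  with e m show thesis using that by blast
qed

text \<open>The image of a nonzero morphism is a nonzero subobject, hence all of
  \<open>S\<close>.\<close>

lemma Hom_simple_epi:
  assumes S: "simple_object C S" and f: "f \<in> Hom C A S" "f \<noteq> Zer C A S"
  shows "epi_arrow C f"
proof -
  obtain I e m where em: "e \<in> Hom C A I" "epi_arrow C e" "m \<in> Hom C I S" "mono_arrow C m" "f = m \<cdot> e"
    using imageE[OF f(1)] .
  have [simp]: "e \<in> Ar C" "Dom C e = A" "Cod C e = I" "m \<in> Ar C" "Dom C m = I" "Cod C m = S"
    "A \<in> Ob C" "I \<in> Ob C" "S \<in> Ob C"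
    using em Hom_Ob by (auto simp: Hom_iff)
  have "\<not> is_zero_object C I"
  proof
    assume "is_zero_object C I"
    then have "Idn C I = Zer C I I" by (simp add: zero_object_iff)
    then have "f = m \<cdot> (Zer C I I \<cdot> e)" using em(5) Idn_Comp'[of e I] by simp
    then show False using f(2) by (simp add: Zer_Comp Comp_Zer)
  qed
  then have "iso C m" using S em by (auto simp: simple_object_def)
  then show ?thesis unfolding em(5) using epi_Comp[OF em(2) iso_epi] by simp
qed

text \<open>The last step of the filtration behind \<open>finite_length\<close> has a simple
  cokernel.\<close>

lemma finite_length_simple_quotient:
  assumes "finite_length C J" "\<not> is_zero_object C J"
  obtains T g where "simple_object C T" "g \<in> Hom C J T" "epi_arrow C g"
  using assms
proof (cases rule: finite_length.cases)
  case (extension f g)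
  then have g: "is_cokernel C f g" by (simp add: short_exact_def)
  then show thesis using that[of "Cod C g" g] extension is_cokernel_epi[OF g] is_cokernelD(1-4)[OF g]
    by (auto simp: Hom_iff)
qed simp

end

section \<open>Finite tensor categories\<close>

context linear_category
begin

lemma iso_Scale_Idn: "\<lbrakk>a \<noteq> 0; A \<in> Ob C\<rbrakk> \<Longrightarrow> iso C (Scale C a (Idn C A))"
  by (rule isoI[of _ "Scale C (inverse a) (Idn C A)"])
    (simp_all add: Comp_Scale' Scale_Comp' Scale_Scale Scale_1)

end

context monoidal_category
begin

lemma TensM_merge':
  "\<lbrakk>f \<in> Ar C; f' \<in> Ar C; g \<in> Ar C; g' \<in> Ar C; Cod C f = Dom C f'; Cod C g = Dom C g';
    x \<in> Ar C; Cod C x = Dom C f \<otimes> Dom C g\<rbrakk>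
    \<Longrightarrow> (f' \<otimes>\<^sub>m g') \<cdot> ((f \<otimes>\<^sub>m g) \<cdot> x) = ((f' \<cdot> f) \<otimes>\<^sub>m (g' \<cdot> g)) \<cdot> x"
  by (rule Comp_eq[OF TensM_merge]) auto

lemma TensM_expand_left:
  "\<lbrakk>A \<in> Ob C; g \<in> Ar C; g' \<in> Ar C; Cod C g = Dom C g'\<rbrakk>
    \<Longrightarrow> (g' \<cdot> g) \<otimes>\<^sub>m Idn C A = (g' \<otimes>\<^sub>m Idn C A) \<cdot> (g \<otimes>\<^sub>m Idn C A)"
  by (simp_all add: TensM_merge)

end

context finite_tensor_category
begin

lemma ex_left_dual: "X \<in> Ob C \<Longrightarrow> \<exists>D e c. is_left_dual C X D e c"
  using left_dual by blast

text \<open>Tensoring with an object that has both duals is a left and a right adjoint, so it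
  preserves monos and epis. Here and in the next two lemmas, currying along the suitable dual moves
  the question to the untensored morphism.\<close>

lemma mono_TensM_right:
  assumes X: "X \<in> Ob C" and i: "mono_arrow C i" "i \<in> Hom C A A'"
  shows "mono_arrow C (i \<otimes>\<^sub>m Idn C X)"
proof -
  obtain D e c where d: "is_left_dual C D X e c" using ex_right_dual X by blast
  have [simp]: "i \<in> Ar C" "Dom C i = A" "Cod C i = A'" "A \<in> Ob C" "A' \<in> Ob C" "X \<in> Ob C"
    using i Hom_Ob X by (auto simp: Hom_iff)
  show ?thesis
    unfolding mono_arrow_def
  proof (intro conjI ballI impI)
    fix Z g h assume "g \<in> Hom C Z (Dom C (i \<otimes>\<^sub>m Idn C X))" "h \<in> Hom C Z (Dom C (i \<otimes>\<^sub>m Idn C X))"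
    then have g: "g \<in> Hom C Z (A \<otimes> X)" and h: "h \<in> Hom C Z (A \<otimes> X)" by simp_all
    assume "(i \<otimes>\<^sub>m Idn C X) \<cdot> g = (i \<otimes>\<^sub>m Idn C X) \<cdot> h"
    then have "i \<cdot> rcurry D X e A g = i \<cdot> rcurry D X e A h"
      using rcurry_Tens_Comp[OF d g i(2)] rcurry_Tens_Comp[OF d h i(2)] by metis
    from monoD[OF this i(1), of "Z \<otimes> D"] have "rcurry D X e A g = rcurry D X e A h"
      using rcurry_Hom[OF d g] rcurry_Hom[OF d h] by simp
    then show "g = h" by (rule rcurry_inject[OF d _ g h]) simp
  qed simp
qed

lemma epi_TensM_left:
  assumes X: "X \<in> Ob C" and i: "epi_arrow C i" "i \<in> Hom C A A'"
  shows "epi_arrow C (Idn C X \<otimes>\<^sub>m i)"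
proof -
  obtain D e c where d: "is_left_dual C D X e c" using ex_right_dual X by blast
  have [simp]: "i \<in> Ar C" "Dom C i = A" "Cod C i = A'" "A \<in> Ob C" "A' \<in> Ob C" "X \<in> Ob C"
    using i Hom_Ob X by (auto simp: Hom_iff)
  show ?thesis
    unfolding epi_arrow_def
  proof (intro conjI ballI impI)
    fix Z g h assume Z: "Z \<in> Ob C" and "g \<in> Hom C (Cod C (Idn C X \<otimes>\<^sub>m i)) Z" "h \<in> Hom C (Cod C (Idn C X \<otimes>\<^sub>m i)) Z"
    then have g: "g \<in> Hom C (X \<otimes> A') Z" and h: "h \<in> Hom C (X \<otimes> A') Z" by simp_all
    obtain g' where g': "g' \<in> Hom C A' (D \<otimes> Z)" "lcurry D X e Z g' = g" using lcurry_surj[OF d g] by auto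
    obtain h' where h': "h' \<in> Hom C A' (D \<otimes> Z)" "lcurry D X e Z h' = h" using lcurry_surj[OF d h] by auto
    assume "g \<cdot> (Idn C X \<otimes>\<^sub>m i) = h \<cdot> (Idn C X \<otimes>\<^sub>m i)"
    then have "lcurry D X e Z (g' \<cdot> i) = lcurry D X e Z (h' \<cdot> i)"
      using lcurry_Comp[OF d g'(1) Z i(2)] lcurry_Comp[OF d h'(1) Z i(2)] g'(2) h'(2) by metis
    then have "g' \<cdot> i = h' \<cdot> i"
      by (rule lcurry_inject[OF d _ Comp_Hom[OF i(2) g'(1)] Comp_Hom[OF i(2) h'(1)] Z])
    from epiD[OF this i(1)] have "g' = h'" using g' h' by simp
    then show "g = h" using g'(2) h'(2) by metis
  qed simp
qed

lemma epi_TensM_right: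
  assumes X: "X \<in> Ob C" and i: "epi_arrow C i" "i \<in> Hom C A A'"
  shows "epi_arrow C (i \<otimes>\<^sub>m Idn C X)"
proof -
  obtain D e c where d: "is_left_dual C X D e c" using ex_left_dual X by blast
  have [simp]: "i \<in> Ar C" "Dom C i = A" "Cod C i = A'" "A \<in> Ob C" "A' \<in> Ob C" "X \<in> Ob C"
    using i Hom_Ob X by (auto simp: Hom_iff)
  show ?thesis
    unfolding epi_arrow_def
  proof (intro conjI ballI impI)
    fix Z g h assume Z: "Z \<in> Ob C" and "g \<in> Hom C (Cod C (i \<otimes>\<^sub>m Idn C X)) Z" "h \<in> Hom C (Cod C (i \<otimes>\<^sub>m Idn C X)) Z"
    then have g: "g \<in> Hom C (A' \<otimes> X) Z" and h: "h \<in> Hom C (A' \<otimes> X) Z" by simp_all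
    obtain g' where g': "g' \<in> Hom C A' (Z \<otimes> D)" "rcurry X D e Z g' = g" using rcurry_surj[OF d g] by auto
    obtain h' where h': "h' \<in> Hom C A' (Z \<otimes> D)" "rcurry X D e Z h' = h" using rcurry_surj[OF d h] by auto
    assume "g \<cdot> (i \<otimes>\<^sub>m Idn C X) = h \<cdot> (i \<otimes>\<^sub>m Idn C X)"
    then have "rcurry X D e Z (g' \<cdot> i) = rcurry X D e Z (h' \<cdot> i)"
      using rcurry_Comp[OF d g'(1) Z i(2)] rcurry_Comp[OF d h'(1) Z i(2)] g'(2) h'(2) by metis
    then have "g' \<cdot> i = h' \<cdot> i"
      by (rule rcurry_inject[OF d _ Comp_Hom[OF i(2) g'(1)] Comp_Hom[OF i(2) h'(1)] Z])
    from epiD[OF this i(1)] have "g' = h'" using g' h' by simp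
    then show "g = h" using g'(2) h'(2) by metis
  qed simp
qed

lemma vlinear_TensM_left: "\<lbrakk>g \<in> Hom C Y Y'; X \<in> Ob C; X' \<in> Ob C\<rbrakk>
    \<Longrightarrow> vlinear (hom_space C X X') (hom_space C (X \<otimes> Y) (X' \<otimes> Y')) (\<lambda>f. f \<otimes>\<^sub>m g)"
  unfolding vlinear_def by (auto simp: TensM_Add_left TensM_Scale_left intro: TensM_Hom)

lemma vlinear_TensM_right: "\<lbrakk>f \<in> Hom C X X'; Y \<in> Ob C; Y' \<in> Ob C\<rbrakk>
    \<Longrightarrow> vlinear (hom_space C Y Y') (hom_space C (X \<otimes> Y) (X' \<otimes> Y')) (\<lambda>g. f \<otimes>\<^sub>m g)"
  unfolding vlinear_def by (auto simp: TensM_Add_right TensM_Scale_right intro: TensM_Hom)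

lemma hsum_TensM:
  "\<lbrakk>g \<in> Hom C Y Y'; X \<in> Ob C; X' \<in> Ob C; \<And>i. i < n \<Longrightarrow> f i \<in> Hom C X X'\<rbrakk>
    \<Longrightarrow> hsum X X' f n \<otimes>\<^sub>m g = hsum (X \<otimes> Y) (X' \<otimes> Y') (\<lambda>i. f i \<otimes>\<^sub>m g) n"
  unfolding hsum_def using vector_space_struct.vlinear_vsum[OF hom_vs vlinear_TensM_left hom_vs, of X X' g Y Y' n f]
    Hom_Ob[of g Y Y'] by simp

lemma TensM_hsum:
  "\<lbrakk>f \<in> Hom C X X'; Y \<in> Ob C; Y' \<in> Ob C; \<And>i. i < n \<Longrightarrow> g i \<in> Hom C Y Y'\<rbrakk>
    \<Longrightarrow> f \<otimes>\<^sub>m hsum Y Y' g n = hsum (X \<otimes> Y) (X' \<otimes> Y') (\<lambda>i. f \<otimes>\<^sub>m g i) n"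
  unfolding hsum_def using vector_space_struct.vlinear_vsum[OF hom_vs vlinear_TensM_right hom_vs, of Y Y' f X X' n g]
    Hom_Ob[of f X X'] by simp

text \<open>The zero morphism is the empty sum, so these are the cases of length 0 of the
  distributive laws.\<close>

lemma TensM_Zer: "\<lbrakk>f \<in> Ar C; A \<in> Ob C; B \<in> Ob C\<rbrakk> \<Longrightarrow> f \<otimes>\<^sub>m Zer C A B = Zer C (Dom C f \<otimes> A) (Cod C f \<otimes> B)"
  and Zer_TensM: "\<lbrakk>f \<in> Ar C; A \<in> Ob C; B \<in> Ob C\<rbrakk> \<Longrightarrow> Zer C A B \<otimes>\<^sub>m f = Zer C (A \<otimes> Dom C f) (B \<otimes> Cod C f)"
  using TensM_hsum[of f "Dom C f" "Cod C f" A B 0] hsum_TensM[of f "Dom C f" "Cod C f" A B 0]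
  by (simp_all add: hsum_def Hom_iff)

text \<open>Transposition reverses composition and is injective, so cancelling \<open>g\<close> on
  one side becomes cancelling the mono \<open>f\<close> on the other. The target \<open>B\<close> is
  presented as the left dual of some \<open>B'\<close> so that morphisms into it can be
  transposed.\<close>

lemma transposes_epi_right:
  assumes d: "is_left_dual C X D e c" and d': "is_left_dual C X' D' e' c'"
    and tr: "transposes X D e X' D' e' f g" and f: "mono_arrow C f"
  shows "epi_arrow C g"
  unfolding epi_arrow_def
proof (intro conjI ballI impI)
  have fH: "f \<in> Hom C X X'" and gH: "g \<in> Hom C D' D" using tr by (auto simp: transposes_def)
  then show "g \<in> Ar C" by (simp add: Hom_iff)
  fix B t t' assume B: "B \<in> Ob C" and "t \<in> Hom C (Cod C g) B" "t' \<in> Hom C (Cod C g) B"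
  then have t: "t \<in> Hom C D B" and t': "t' \<in> Hom C D B" using gH by (auto simp: Hom_iff)
  obtain B' eB cB where b: "is_left_dual C B' B eB cB" using ex_right_dual B by blast
  obtain s where s: "transposes B' B eB X D e s t" using ex_left_transpose[OF b d t] .
  obtain s' where s': "transposes B' B eB X D e s' t'" using ex_left_transpose[OF b d t'] .
  assume eq: "t \<cdot> g = t' \<cdot> g"
  have "f \<cdot> s = f \<cdot> s'"
    using transposes_Comp[OF b d d' s tr] transposes_Comp[OF b d d' s' tr] unfolding eq
    by (rule transposes_unique_left[OF b d'])
  from monoD[OF this f, of B'] have "s = s'" using s s' fH by (simp add: transposes_def Hom_iff)
  then show "t = t'" using transposes_unique_right[OF b d] s s' by blast
qed

text \<open>The mirror image of \<open>transposes_epi_right\<close>: morphisms into \<open>B\<close>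
  are now transposed through a left dual of \<open>B\<close>.\<close>

lemma transposes_epi_left:
  assumes d: "is_left_dual C X D e c" and d': "is_left_dual C X' D' e' c'"
    and tr: "transposes X D e X' D' e' f g" and g: "mono_arrow C g"
  shows "epi_arrow C f"
  unfolding epi_arrow_def
proof (intro conjI ballI impI)
  have fH: "f \<in> Hom C X X'" and gH: "g \<in> Hom C D' D" using tr by (auto simp: transposes_def)
  then show "f \<in> Ar C" by (simp add: Hom_iff)
  fix B t t' assume B: "B \<in> Ob C" and "t \<in> Hom C (Cod C f) B" "t' \<in> Hom C (Cod C f) B"
  then have t: "t \<in> Hom C X' B" and t': "t' \<in> Hom C X' B" using fH by (auto simp: Hom_iff)
  obtain B' eB cB where b: "is_left_dual C B B' eB cB" using ex_left_dual B by blast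
  obtain s where s: "transposes X' D' e' B B' eB t s" using ex_right_transpose[OF d' b t] .
  obtain s' where s': "transposes X' D' e' B B' eB t' s'" using ex_right_transpose[OF d' b t'] .
  assume eq: "t \<cdot> f = t' \<cdot> f"
  have "g \<cdot> s = g \<cdot> s'"
    using transposes_Comp[OF d d' b tr s] transposes_Comp[OF d d' b tr s'] unfolding eq
    by (rule transposes_unique_right[OF d b])
  from monoD[OF this g, of B'] have "s = s'" using s s' gH by (simp add: transposes_def Hom_iff)
  then show "t = t'" using transposes_unique_left[OF d' b] s s' by blast
qed

text \<open>The identity of \<open>X\<close> has a transpose in each direction, and these are
  mutually inverse because their composites again transpose the identity.\<close>

lemma left_dual_unique:
  assumes d: "is_left_dual C X D e c" and d': "is_left_dual C X D' e' c'"
  obtains s where "s \<in> Hom C D D'" "iso C s"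
proof -
  have X: "Idn C X \<in> Hom C X X" using left_dualD(1)[OF d] by (simp add: Hom_iff)
  obtain s where s: "transposes X D' e' X D e (Idn C X) s" using ex_right_transpose[OF d' d X] .
  obtain s' where s': "transposes X D e X D' e' (Idn C X) s'" using ex_right_transpose[OF d d' X] .
  have id: "Idn C X \<cdot> Idn C X = Idn C X" using X by (simp add: Hom_iff)
  have 1: "s \<cdot> s' = Idn C D'"
    using transposes_Comp[OF d' d d' s s'] transposes_Idn[OF d'] unfolding id
    by (rule transposes_unique_right[OF d' d'])
  have 2: "s' \<cdot> s = Idn C D"
    using transposes_Comp[OF d d' d s' s] transposes_Idn[OF d] unfolding id
    by (rule transposes_unique_right[OF d d])
  have sH: "s \<in> Hom C D D'" "s' \<in> Hom C D' D" using s s' by (auto simp: transposes_def)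
  then have "iso C s" using 1 2 by (intro isoI[of s s']) (auto simp: Hom_iff)
  with sH show thesis using that by blast
qed

text \<open>The explicit formula is compared with an abstract transpose \<open>g\<close>. Replacing
  \<open>f\<close> under the evaluation of \<open>Y\<close> by \<open>g\<close> under the evaluation
  of \<open>X\<close> lets \<open>g\<close> slide out of the formula, and a zigzag remains.\<close>

lemma dual_map_transposes:
  assumes f: "f \<in> Hom C X Y"
  shows "transposes X (LDual C X) (Ev C X) Y (LDual C Y) (Ev C Y) f (dual_map C f)"
proof -
  have XY: "X \<in> Ob C" "Y \<in> Ob C" using f Hom_Ob by auto
  note dX = left_dual[OF XY(1)] and dY = left_dual[OF XY(2)]
  note [simp] = left_dualD(1-8)[OF dX] left_dualD(1-8)[OF dY]
  have [simp]: "f \<in> Ar C" "Dom C f = X" "Cod C f = Y" using f by (auto simp: Hom_iff)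
  obtain g where g: "transposes X (LDual C X) (Ev C X) Y (LDual C Y) (Ev C Y) f g"
    using ex_right_transpose[OF dX dY f] .
  then have [simp]: "g \<in> Ar C" "Dom C g = LDual C Y" "Cod C g = LDual C X"
    and eq: "Ev C X \<cdot> (g \<otimes>\<^sub>m Idn C X) = Ev C Y \<cdot> (Idn C (LDual C Y) \<otimes>\<^sub>m f)"
    by (auto simp: transposes_def Hom_iff)
  let ?X = "LDual C X" and ?Y = "LDual C Y"
  have "dual_map C f = LUnit C ?X \<cdot> ((Ev C Y \<cdot> (Idn C ?Y \<otimes>\<^sub>m f)) \<otimes>\<^sub>m Idn C ?X) \<cdot>
      Inv C (Assoc C ?Y X ?X) \<cdot> (Idn C ?Y \<otimes>\<^sub>m Coev C X) \<cdot> Inv C (RUnit C ?Y)"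
    by (simp add: dual_map_def Let_def TensM_expand_left)
  also have "\<dots> = LUnit C ?X \<cdot> (Ev C X \<otimes>\<^sub>m Idn C ?X) \<cdot> (((g \<otimes>\<^sub>m Idn C X) \<otimes>\<^sub>m Idn C ?X) \<cdot>
      Inv C (Assoc C ?Y X ?X)) \<cdot> (Idn C ?Y \<otimes>\<^sub>m Coev C X) \<cdot> Inv C (RUnit C ?Y)"
    unfolding eq[symmetric] by (simp add: TensM_expand_left)
  also have "((g \<otimes>\<^sub>m Idn C X) \<otimes>\<^sub>m Idn C ?X) \<cdot> Inv C (Assoc C ?Y X ?X)
      = Inv C (Assoc C ?X X ?X) \<cdot> (g \<otimes>\<^sub>m Idn C (X \<otimes> ?X))"
  proof -
    have "Inv C (Assoc C ?X X ?X) \<cdot> (g \<otimes>\<^sub>m (Idn C X \<otimes>\<^sub>m Idn C ?X))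
        = ((g \<otimes>\<^sub>m Idn C X) \<otimes>\<^sub>m Idn C ?X) \<cdot> Inv C (Assoc C ?Y X ?X)"
      by (rule trans[OF Inv_Assoc_nat]) simp_all
    then show ?thesis by simp
  qed
  also have "LUnit C ?X \<cdot> (Ev C X \<otimes>\<^sub>m Idn C ?X) \<cdot> (Inv C (Assoc C ?X X ?X) \<cdot> (g \<otimes>\<^sub>m Idn C (X \<otimes> ?X))) \<cdot>
       (Idn C ?Y \<otimes>\<^sub>m Coev C X) \<cdot> Inv C (RUnit C ?Y)
     = LUnit C ?X \<cdot> (Ev C X \<otimes>\<^sub>m Idn C ?X) \<cdot> Inv C (Assoc C ?X X ?X) \<cdot>
       (Idn C ?X \<otimes>\<^sub>m Coev C X) \<cdot> ((g \<otimes>\<^sub>m Idn C (Unit C)) \<cdot> Inv C (RUnit C ?Y))"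
    by (simp add: TensM_merge')
  also have "(g \<otimes>\<^sub>m Idn C (Unit C)) \<cdot> Inv C (RUnit C ?Y) = Inv C (RUnit C ?X) \<cdot> g"
    by (rule Inv_swap[symmetric]) (simp_all add: RUnit_nat)
  also have "LUnit C ?X \<cdot> (Ev C X \<otimes>\<^sub>m Idn C ?X) \<cdot> Inv C (Assoc C ?X X ?X) \<cdot>
       (Idn C ?X \<otimes>\<^sub>m Coev C X) \<cdot> (Inv C (RUnit C ?X) \<cdot> g) = g"
    using Comp_eq[OF left_dualD(10)[OF dX], of g] by simp
  finally show ?thesis using g by simp
qed

subsection \<open>The unit object\<close>

lemma Idn_Unit_nonzero: "Idn C (Unit C) \<noteq> Zer C (Unit C) (Unit C)"
proof
  assume "Idn C (Unit C) = Zer C (Unit C) (Unit C)"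
  then have "Scale C 0 (Idn C (Unit C)) = Scale C 1 (Idn C (Unit C))"
    by (simp add: Scale_1 Scale_0[of _ "Unit C" "Unit C"] Hom_iff)
  then show False using End_Unit unfolding bij_betw_def inj_on_def by fastforce
qed

lemma End_Unit_scalar:
  assumes "f \<in> Hom C (Unit C) (Unit C)"
  obtains a where "f = Scale C a (Idn C (Unit C))"
  using End_Unit assms unfolding bij_betw_def by blast

text \<open>Evaluation, read through \<open>RUnit\<close>, is a morphism \<open>?a\<close> from the
  dual to the unit. It is mono because the evaluation pairing separates morphisms, and it has a
  section because some \<open>k\<close> is paired to \<open>RUnit\<close>.\<close>

lemma LDual_Unit:
  obtains a where "a \<in> Hom C (LDual C (Unit C)) (Unit C)" "iso C a"
proof -
  let ?I = "Unit C"
  note d = left_dual[OF Unit_Ob]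
  note [simp] = left_dualD(1-8)[OF d]
  let ?a = "Ev C ?I \<cdot> Inv C (RUnit C (LDual C ?I))"
  have key: "Ev C ?I \<cdot> (k \<otimes>\<^sub>m Idn C ?I) = (?a \<cdot> k) \<cdot> RUnit C B" if "k \<in> Hom C B (LDual C ?I)" for k B
  proof -
    have [simp]: "k \<in> Ar C" "Dom C k = B" "Cod C k = LDual C ?I" "B \<in> Ob C" using that Hom_Ob by (auto simp: Hom_iff)
    have "(?a \<cdot> k) \<cdot> RUnit C B = ?a \<cdot> RUnit C (LDual C ?I) \<cdot> (k \<otimes>\<^sub>m Idn C ?I)" by (simp add: RUnit_nat)
    then show ?thesis by simp
  qed
  have mono: "mono_arrow C ?a"
    unfolding mono_arrow_def
  proof (intro conjI ballI impI)
    fix Z g h assume "g \<in> Hom C Z (Dom C ?a)" "h \<in> Hom C Z (Dom C ?a)" "?a \<cdot> g = ?a \<cdot> h"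
    then show "g = h"
      using key[of g Z] key[of h Z] pair_right_inject[OF d, of g h Z] by simp
  qed simp
  have "RUnit C ?I \<in> Hom C (?I \<otimes> ?I) ?I" by (simp add: Hom_iff)
  then obtain k where k: "k \<in> Hom C ?I (LDual C ?I)" "Ev C ?I \<cdot> (k \<otimes>\<^sub>m Idn C ?I) = RUnit C ?I"
    using pair_right_surj[OF d _ Unit_Ob] by blast
  have [simp]: "k \<in> Ar C" "Dom C k = ?I" "Cod C k = LDual C ?I" using k by (auto simp: Hom_iff)
  have "(?a \<cdot> k) \<cdot> RUnit C ?I = Idn C ?I \<cdot> RUnit C ?I" using key[OF k(1)] k(2) by simp
  then have "?a \<cdot> k = Idn C ?I" by (rule iso_cancel_right[rotated]) simp_all
  then have "iso C ?a" using mono_split_iso[OF mono, of k] k by simp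
  then show thesis using that[of ?a] by (simp add: Hom_iff)
qed

text \<open>Once its target is identified with the unit, \<open>Coev\<close> is a scalar multiple of
  the identity. The scalar is nonzero, since otherwise the zigzag would make the identity of the
  unit zero. The inverse allows any coevaluation to be written through that of the unit.\<close>

lemma iso_Coev_Unit: "iso C (Coev C (Unit C))"
proof -
  let ?I = "Unit C"
  note d = left_dual[OF Unit_Ob]
  note [simp] = left_dualD(1-8)[OF d]
  obtain a where a: "a \<in> Hom C (LDual C ?I) ?I" "iso C a" using LDual_Unit .
  have [simp]: "a \<in> Ar C" "Dom C a = LDual C ?I" "Cod C a = ?I" using a by (auto simp: Hom_iff)
  let ?b = "a \<cdot> LUnit C (LDual C ?I)"
  have b: "iso C ?b" using a by (intro iso_Comp) auto
  obtain s where s: "?b \<cdot> Coev C ?I = Scale C s (Idn C ?I)"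
    using End_Unit_scalar[of "?b \<cdot> Coev C ?I"] by (auto simp: Hom_iff)
  have eq: "Coev C ?I = Inv C ?b \<cdot> Scale C s (Idn C ?I)"
    unfolding s[symmetric] using Inv_Comp'[OF b, of "Coev C ?I"] by simp
  have "s \<noteq> 0"
  proof
    assume "s = 0"
    then have "Coev C ?I = Zer C ?I (?I \<otimes> LDual C ?I)"
      using eq b by (simp add: Scale_0[of _ ?I ?I] Hom_iff Comp_Zer)
    then have "Idn C ?I = Zer C ?I ?I"
      using left_dualD(9)[OF d] by (simp add: Zer_TensM Zer_Comp Comp_Zer)
    then show False using Idn_Unit_nonzero by simp
  qed
  then show ?thesis unfolding eq using b by (intro iso_Comp iso_Scale_Idn) auto
qed

subsection \<open>Copairings\<close>

lemma lcurry_theta: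
  assumes "E \<in> Ob C" "F \<in> Ob C" "w \<in> Hom C (Unit C) (E \<otimes> F)"
  shows "lcurry E (LDual C E) (Ev C E) F w = theta_map C E F w \<cdot> RUnit C (LDual C E)"
  using left_dualD(1-8)[OF left_dual[OF assms(1)]] assms
  by (simp add: lcurry_def theta_map_def Hom_iff)

lemma theta_Hom:
  assumes "E \<in> Ob C" "F \<in> Ob C" "w \<in> Hom C (Unit C) (E \<otimes> F)"
  shows "theta_map C E F w \<in> Hom C (LDual C E) F"
  using left_dualD(1-8)[OF left_dual[OF assms(1)]] assms by (simp add: theta_map_def Hom_iff)

text \<open>\<open>theta_map\<close> is \<open>w\<close> curried along \<open>E\<close>, while
  \<open>Coev\<close> curries to the right unit constraint; both sides therefore have the same
  curried form.\<close>

lemma copairing_theta: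
  assumes EF: "E \<in> Ob C" "F \<in> Ob C" and w: "w \<in> Hom C (Unit C) (E \<otimes> F)"
  shows "w = (Idn C E \<otimes>\<^sub>m theta_map C E F w) \<cdot> Coev C E"
proof (rule lcurry_inject[OF left_dual[OF EF(1)] _ w _ EF(2)])
  note d = left_dual[OF EF(1)]
  note t = theta_Hom[OF EF w]
  have c: "Coev C E \<in> Hom C (Unit C) (E \<otimes> LDual C E)" using d by (simp add: is_left_dual_def)
  show "lcurry E (LDual C E) (Ev C E) F w
      = lcurry E (LDual C E) (Ev C E) F ((Idn C E \<otimes>\<^sub>m theta_map C E F w) \<cdot> Coev C E)"
    using lcurry_Tens_Comp[OF d c t] lcurry_coev[OF d] lcurry_theta[OF EF w] by simp
  show "(Idn C E \<otimes>\<^sub>m theta_map C E F w) \<cdot> Coev C E \<in> Hom C (Unit C) (E \<otimes> F)"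
    using t left_dualD(1-8)[OF d] by (auto simp: Hom_iff)
qed

lemma TensM_Coev_inject:
  assumes d: "is_left_dual C E D e c" and f: "f \<in> Hom C E V" "f' \<in> Hom C E V"
    and eq: "(f \<otimes>\<^sub>m Idn C D) \<cdot> c = (f' \<otimes>\<^sub>m Idn C D) \<cdot> c"
  shows "f = f'"
proof -
  have c: "c \<in> Hom C (Unit C) (E \<otimes> D)" using d by (simp add: is_left_dual_def)
  have "f \<cdot> LUnit C E = f' \<cdot> LUnit C E"
    using rcurry_Tens_Comp[OF d c f(1)] rcurry_Tens_Comp[OF d c f(2)] rcurry_coev[OF d] eq by simp
  then show ?thesis
    by (rule iso_cancel_right[rotated]) (use f left_dualD(1)[OF d] in \<open>auto simp: Hom_iff\<close>)
qed

text \<open>By \<open>copairing_theta\<close>, \<open>w\<close> is \<open>Coev\<close> followed by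
  the isomorphism \<open>?t\<close> on the second factor, and a morphism \<open>f\<close> is
  determined by \<open>(f \<otimes> id) \<cdot> Coev\<close>. The target \<open>V\<close> is left
  free: the unit gives injectivity of \<open>Omega_map\<close>, and
  \<open>D \<otimes> LDual C D\<close> serves the symmetric center.\<close>

lemma copairing_inject:
  assumes EF: "E \<in> Ob C" "F \<in> Ob C" and w: "w \<in> Hom C (Unit C) (E \<otimes> F)"
    and nd: "nondegenerate C E F w" and f: "f \<in> Hom C E V" "f' \<in> Hom C E V"
    and eq: "(f \<otimes>\<^sub>m Idn C F) \<cdot> w = (f' \<otimes>\<^sub>m Idn C F) \<cdot> w"
  shows "f = f'"
proof (rule TensM_Coev_inject[OF left_dual[OF EF(1)] f])
  note [simp] = left_dualD(1-8)[OF left_dual[OF EF(1)]] EF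
  let ?t = "theta_map C E F w"
  have t [simp]: "iso C ?t" "?t \<in> Ar C" "Dom C ?t = LDual C E" "Cod C ?t = F"
    using nd theta_Hom[OF EF w] by (auto simp: nondegenerate_def Hom_iff)
  have fs [simp]: "f \<in> Ar C" "Dom C f = E" "Cod C f = V" "f' \<in> Ar C" "Dom C f' = E" "Cod C f' = V" "V \<in> Ob C"
    using f Hom_Ob by (auto simp: Hom_iff)
  have *: "(g \<otimes>\<^sub>m Idn C F) \<cdot> w = (Idn C V \<otimes>\<^sub>m ?t) \<cdot> (g \<otimes>\<^sub>m Idn C (LDual C E)) \<cdot> Coev C E"
    if "g \<in> Hom C E V" for g
  proof -
    have [simp]: "g \<in> Ar C" "Dom C g = E" "Cod C g = V" using that by (auto simp: Hom_iff)
    have "(g \<otimes>\<^sub>m Idn C F) \<cdot> w = (g \<otimes>\<^sub>m Idn C F) \<cdot> ((Idn C E \<otimes>\<^sub>m ?t) \<cdot> Coev C E)"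
      using copairing_theta[OF EF w] by simp
    then show ?thesis by (simp add: TensM_merge')
  qed
  have "(Idn C V \<otimes>\<^sub>m ?t) \<cdot> ((f \<otimes>\<^sub>m Idn C (LDual C E)) \<cdot> Coev C E)
      = (Idn C V \<otimes>\<^sub>m ?t) \<cdot> ((f' \<otimes>\<^sub>m Idn C (LDual C E)) \<cdot> Coev C E)"
    using *[OF f(1)] *[OF f(2)] eq by simp
  then show "(f \<otimes>\<^sub>m Idn C (LDual C E)) \<cdot> Coev C E = (f' \<otimes>\<^sub>m Idn C (LDual C E)) \<cdot> Coev C E"
    by (rule iso_cancel_left[rotated]) simp_all
qed

theorem nondegenerate_weakly_factorizable:
  assumes EF: "E \<in> Ob C" "F \<in> Ob C" and w: "w \<in> Hom C (Unit C) (E \<otimes> F)"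
    and nd: "nondegenerate C E F w"
  shows "weakly_factorizable C E F w"
  unfolding weakly_factorizable_def bij_betw_def
proof (intro conjI inj_onI subset_antisym subsetI)
  let ?I = "Unit C" and ?D = "LDual C E"
  note d = left_dual[OF EF(1)]
  note [simp] = left_dualD(1-8)[OF d] EF
  let ?t = "theta_map C E F w"
  have t [simp]: "iso C ?t" "?t \<in> Ar C" "Dom C ?t = ?D" "Cod C ?t = F"
    using nd theta_Hom[OF EF w] by (auto simp: nondegenerate_def Hom_iff)
  have [simp]: "w \<in> Ar C" "Dom C w = ?I" "Cod C w = E \<otimes> F" using w by (auto simp: Hom_iff)
  {
    fix f f' assume f: "f \<in> Hom C E ?I" "f' \<in> Hom C E ?I"
    then have [simp]: "f \<in> Ar C" "Dom C f = E" "Cod C f = ?I" "f' \<in> Ar C" "Dom C f' = E" "Cod C f' = ?I"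
      by (auto simp: Hom_iff)
    assume "Omega_map C F w f = Omega_map C F w f'"
    then have "LUnit C F \<cdot> ((f \<otimes>\<^sub>m Idn C F) \<cdot> w) = LUnit C F \<cdot> ((f' \<otimes>\<^sub>m Idn C F) \<cdot> w)"
      by (simp add: Omega_map_def)
    then have "(f \<otimes>\<^sub>m Idn C F) \<cdot> w = (f' \<otimes>\<^sub>m Idn C F) \<cdot> w"
      by (rule iso_cancel_left[rotated]) simp_all
    then show "f = f'" by (rule copairing_inject[OF EF w nd f])
  next
    fix g assume "g \<in> Omega_map C F w ` Hom C E ?I"
    then show "g \<in> Hom C ?I F" by (auto simp: Omega_map_def Hom_iff)
  next
    fix g assume g: "g \<in> Hom C ?I F"
    then have [simp]: "g \<in> Ar C" "Dom C g = ?I" "Cod C g = F" by (auto simp: Hom_iff)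
    \<comment> \<open>For surjectivity, \<open>g\<close> is pulled back along \<open>?t\<close> to a
      morphism from the unit to the dual of \<open>E\<close>. The preimage \<open>f\<close> is the
      functional on \<open>E\<close> that currying assigns to it.\<close>
    let ?g = "Inv C (LUnit C ?D) \<cdot> Inv C ?t \<cdot> g"
    have gH: "?g \<in> Hom C ?I (?I \<otimes> ?D)" by (simp add: Hom_iff)
    have gc: "rcurry E ?D (Ev C E) ?I ?g \<in> Hom C (?I \<otimes> E) ?I" using rcurry_Hom[OF d gH] by simp
    define f where "f = rcurry E ?D (Ev C E) ?I ?g \<cdot> Inv C (LUnit C E)"
    have f: "f \<in> Hom C E ?I" using gc unfolding f_def by (simp add: Hom_iff)
    then have [simp]: "f \<in> Ar C" "Dom C f = E" "Cod C f = ?I" by (auto simp: Hom_iff)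
    have c: "Coev C E \<in> Hom C ?I (E \<otimes> ?D)" using d by (simp add: is_left_dual_def)
    have "rcurry E ?D (Ev C E) ?I ((f \<otimes>\<^sub>m Idn C ?D) \<cdot> Coev C E) = rcurry E ?D (Ev C E) ?I ?g"
      using rcurry_Tens_Comp[OF d c f] rcurry_coev[OF d] gc by (simp add: f_def Hom_iff)
    then have fc: "(f \<otimes>\<^sub>m Idn C ?D) \<cdot> Coev C E = ?g"
      by (rule rcurry_inject[OF d _ _ gH]) (simp_all add: Hom_iff)
    have "Omega_map C F w f = LUnit C F \<cdot> (f \<otimes>\<^sub>m Idn C F) \<cdot> ((Idn C E \<otimes>\<^sub>m ?t) \<cdot> Coev C E)"
      unfolding Omega_map_def using copairing_theta[OF EF w] by simp
    also have "\<dots> = (LUnit C F \<cdot> (Idn C ?I \<otimes>\<^sub>m ?t)) \<cdot> ((f \<otimes>\<^sub>m Idn C ?D) \<cdot> Coev C E)"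
      by (simp add: TensM_merge')
    also have "\<dots> = g" unfolding fc LUnit_nat[OF t(2) t(4)[symmetric]] by simp
    finally show "g \<in> Omega_map C F w ` Hom C E ?I" using f by blast
  }
qed

end

section \<open>Zero objects\<close>

context linear_category
begin

lemma zero_Hom_from:
  assumes A: "is_zero_object C A" and f: "f \<in> Hom C A B"
  shows "f = Zer C A B"
proof -
  have [simp]: "f \<in> Ar C" "Dom C f = A" "Cod C f = B" and "A \<in> Ob C" using f Hom_Ob by (auto simp: Hom_iff)
  have "f = f \<cdot> Idn C A" by simp
  also have "\<dots> = Zer C A B" using A by (simp add: zero_object_iff Comp_Zer)
  finally show ?thesis .
qed

lemma zero_Hom_to:
  assumes A: "is_zero_object C A" and g: "g \<in> Hom C B A"
  shows "g = Zer C B A"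
proof -
  have [simp]: "g \<in> Ar C" "Dom C g = B" "Cod C g = A" and "A \<in> Ob C" using g Hom_Ob by (auto simp: Hom_iff)
  have "g = Idn C A \<cdot> g" by simp
  also have "\<dots> = Zer C B A" using A by (simp add: zero_object_iff Zer_Comp)
  finally show ?thesis .
qed

lemma zero_retract:
  assumes "is_zero_object C B" and s: "s \<in> Hom C A B" "r \<in> Hom C B A" "r \<cdot> s = Idn C A"
  shows "is_zero_object C A"
proof -
  have A: "A \<in> Ob C" "B \<in> Ob C" using Hom_Ob s by blast+
  have "r = Zer C B A" using zero_Hom_from assms by blast
  then have "Idn C A = Zer C B A \<cdot> s" using s(3) by simp
  also have "\<dots> = Zer C A A" using s(1) A by (simp add: Zer_Comp Hom_iff)
  finally show ?thesis using A by (simp add: zero_object_iff)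
qed

lemma zero_iso: "\<lbrakk>is_zero_object C (Cod C f); iso C f\<rbrakk> \<Longrightarrow> is_zero_object C (Dom C f)"
  by (rule zero_retract[of "Cod C f" f "Dom C f" "Inv C f"]) (simp_all add: Hom_iff iso_Ar)

lemma Zer_mono_zero:
  assumes m: "mono_arrow C f" and 0: "f = Zer C A B" and f: "f \<in> Hom C A B"
  shows "is_zero_object C A"
proof -
  have [simp]: "f \<in> Ar C" "Dom C f = A" "Cod C f = B" "A \<in> Ob C" using f Hom_Ob by (auto simp: Hom_iff)
  have "f \<cdot> Idn C A = f" by simp
  then have "f \<cdot> Idn C A = Zer C A (Cod C f)" using 0 \<open>Cod C f = B\<close> by metis
  then have "Idn C A = Zer C A (Dom C f)" by (rule mono_ZerD[OF _ m]) (simp add: Hom_iff)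
  then show ?thesis by (simp add: zero_object_iff)
qed

end

context finite_tensor_category
begin

lemma zero_TensM: "\<lbrakk>is_zero_object C X; Y \<in> Ob C\<rbrakk> \<Longrightarrow> is_zero_object C (X \<otimes> Y)"
  and TensM_zero: "\<lbrakk>is_zero_object C X; Y \<in> Ob C\<rbrakk> \<Longrightarrow> is_zero_object C (Y \<otimes> X)"
proof -
  assume X: "is_zero_object C X" and Y: "Y \<in> Ob C"
  then have X': "X \<in> Ob C" "Idn C X = Zer C X X" by (auto simp: zero_object_iff)
  have "Idn C (X \<otimes> Y) = Zer C X X \<otimes>\<^sub>m Idn C Y" "Idn C (Y \<otimes> X) = Idn C Y \<otimes>\<^sub>m Zer C X X"
    using X' Y TensM_Idn by metis+
  then show "is_zero_object C (X \<otimes> Y)" "is_zero_object C (Y \<otimes> X)"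
    using X' Y by (auto simp: zero_object_iff TensM_Zer Zer_TensM)
qed

end

section \<open>Simplicity of the unit object\<close>

context braided_finite_tensor_category
begin

lemma Braid_Ar [simp]: "\<lbrakk>X \<in> Ob C; Y \<in> Ob C\<rbrakk> \<Longrightarrow> Braid C X Y \<in> Ar C"
  and Dom_Braid [simp]: "\<lbrakk>X \<in> Ob C; Y \<in> Ob C\<rbrakk> \<Longrightarrow> Dom C (Braid C X Y) = X \<otimes> Y"
  and Cod_Braid [simp]: "\<lbrakk>X \<in> Ob C; Y \<in> Ob C\<rbrakk> \<Longrightarrow> Cod C (Braid C X Y) = Y \<otimes> X"
  and iso_Braid [simp]: "\<lbrakk>X \<in> Ob C; Y \<in> Ob C\<rbrakk> \<Longrightarrow> iso C (Braid C X Y)"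
  using Braid_iso[of X Y] by (auto simp: Hom_iff)

text \<open>\<open>J \<otimes> L = 0\<close> implies \<open>J \<otimes> L\<^sup>* = 0\<close>, because \<open>L\<^sup>*\<close> is a retract of \<open>L\<^sup>* \<otimes> L \<otimes> L\<^sup>*\<close>,
  which is isomorphic to \<open>L \<otimes> L\<^sup>* \<otimes> L\<^sup>*\<close>.\<close>

lemma zero_Tens_LDual:
  assumes J: "J \<in> Ob C" and L: "L \<in> Ob C" and 0: "is_zero_object C (J \<otimes> L)"
  shows "is_zero_object C (J \<otimes> LDual C L)"
proof -
  let ?D = "LDual C L"
  note d = left_dual[OF L]
  note [simp] = J left_dualD(1-8)[OF d]
  have "is_zero_object C ((J \<otimes> L) \<otimes> (?D \<otimes> ?D))" by (rule zero_TensM[OF 0]) simp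
  then have "is_zero_object C (J \<otimes> (L \<otimes> (?D \<otimes> ?D)))"
    using zero_iso[of "Inv C (Assoc C J L (?D \<otimes> ?D))"] by simp
  then have "is_zero_object C (J \<otimes> ((L \<otimes> ?D) \<otimes> ?D))"
    using zero_iso[of "Idn C J \<otimes>\<^sub>m Assoc C L ?D ?D"] by simp
  then have z: "is_zero_object C (J \<otimes> ((?D \<otimes> L) \<otimes> ?D))"
    using zero_iso[of "Idn C J \<otimes>\<^sub>m (Braid C ?D L \<otimes>\<^sub>m Idn C ?D)"] by simp
  let ?r = "LUnit C ?D \<cdot> (Ev C L \<otimes>\<^sub>m Idn C ?D)"
  let ?s = "Inv C (Assoc C ?D L ?D) \<cdot> (Idn C ?D \<otimes>\<^sub>m Coev C L) \<cdot> Inv C (RUnit C ?D)"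
  have "?r \<cdot> ?s = Idn C ?D" using left_dualD(10)[OF d] by simp
  then have "(Idn C J \<otimes>\<^sub>m ?r) \<cdot> (Idn C J \<otimes>\<^sub>m ?s) = Idn C (J \<otimes> ?D)"
    by (subst TensM_merge) (simp_all add: TensM_merge)
  then show ?thesis by (rule zero_retract[OF z, rotated 2]) (simp_all add: Hom_iff)
qed

text \<open>Let \<open>i\<close> be a subobject of the unit with quotient \<open>p\<close>.
  Tensoring \<open>p\<close> with the dual \<open>?D\<close> makes it invertible, and transposing
  the inverse gives a section \<open>s\<close> of \<open>p\<close>. The endomorphism
  \<open>s \<cdot> p\<close> is a scalar \<open>a\<close> with \<open>a p = p\<close>. If
  \<open>a = 1\<close> then \<open>i = s \<cdot> p \<cdot> i = 0\<close>; otherwise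
  \<open>p = 0\<close>, and the identity factors through \<open>i\<close>.\<close>

lemma Unit_simple: "simple_object C (Unit C)"
  unfolding simple_object_def
proof (intro conjI allI impI)
  let ?I = "Unit C"
  show "?I \<in> Ob C" by simp
  show "\<not> is_zero_object C ?I" using Idn_Unit_nonzero by (simp add: zero_object_iff)
  fix i assume "mono_arrow C i \<and> Cod C i = ?I"
  define J where "J = Dom C i"
  have i: "mono_arrow C i" "i \<in> Hom C J ?I" and [simp]: "i \<in> Ar C" "Dom C i = J" "Cod C i = ?I" "J \<in> Ob C"
    using \<open>mono_arrow C i \<and> Cod C i = ?I\<close> Hom_Ob by (auto simp: J_def mono_Ar Hom_iff)
  obtain L p where p: "p \<in> Hom C ?I L" "epi_arrow C p" "p \<cdot> i = Zer C J L"
    and p_uni: "\<And>Z g. \<lbrakk>g \<in> Hom C ?I Z; g \<cdot> i = Zer C J Z\<rbrakk> \<Longrightarrow> \<exists>u\<in>Hom C L Z. u \<cdot> p = g"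
    using cokernelE[OF i(2)] by metis
  have [simp]: "p \<in> Ar C" "Dom C p = ?I" "Cod C p = L" "L \<in> Ob C" using p Hom_Ob by (auto simp: Hom_iff)
  let ?D = "LDual C L"
  note d = left_dual[OF \<open>L \<in> Ob C\<close>]
  note dd [simp] = left_dualD(1-8)[OF d]
  \<comment> \<open>By interchange, the composite of \<open>id \<otimes> p\<close> with
    \<open>i \<otimes> id\<close> is \<open>p \<cdot> i = 0\<close> up to unit constraints. As
    \<open>id \<otimes> p\<close> is epi, \<open>i \<otimes> id\<close> is zero; but it is also
    mono.\<close>
  have "is_zero_object C (J \<otimes> L)"
  proof -
    have "LUnit C L \<cdot> ((Idn C ?I \<otimes>\<^sub>m p) \<cdot> (i \<otimes>\<^sub>m Idn C ?I)) = (LUnit C L \<cdot> (Idn C ?I \<otimes>\<^sub>m p)) \<cdot> (i \<otimes>\<^sub>m Idn C ?I)"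
      by simp
    also have "\<dots> = p \<cdot> (RUnit C ?I \<cdot> (i \<otimes>\<^sub>m Idn C ?I))"
      by (subst LUnit_nat) (simp_all add: LUnit_Unit)
    also have "\<dots> = (p \<cdot> i) \<cdot> RUnit C J" by (subst RUnit_nat) simp_all
    also have "\<dots> = Zer C (J \<otimes> ?I) L" unfolding p(3) by (simp add: Zer_Comp)
    finally have "(Idn C ?I \<otimes>\<^sub>m p) \<cdot> (i \<otimes>\<^sub>m Idn C ?I) = Zer C (J \<otimes> ?I) (?I \<otimes> L)"
      using mono_ZerD[OF _ iso_mono, of "LUnit C L" "(Idn C ?I \<otimes>\<^sub>m p) \<cdot> (i \<otimes>\<^sub>m Idn C ?I)" "J \<otimes> ?I"]
      by (simp add: Hom_iff)
    then have "(i \<otimes>\<^sub>m Idn C L) \<cdot> (Idn C J \<otimes>\<^sub>m p) = Zer C (J \<otimes> ?I) (?I \<otimes> L)"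
      by (simp add: TensM_merge)
    then have "i \<otimes>\<^sub>m Idn C L = Zer C (J \<otimes> L) (?I \<otimes> L)"
      using epi_ZerD[OF _ epi_TensM_left[OF \<open>J \<in> Ob C\<close> p(2,1)], of "i \<otimes>\<^sub>m Idn C L" "?I \<otimes> L"]
      by (simp add: Hom_iff)
    then show ?thesis
      by (rule Zer_mono_zero[OF mono_TensM_right[OF \<open>L \<in> Ob C\<close> i]]) (simp add: Hom_iff)
  qed
  then have z: "is_zero_object C (J \<otimes> ?D)" by (rule zero_Tens_LDual[rotated 2]) simp_all
  \<comment> \<open>The kernel of this morphism is \<open>J \<otimes> ?D\<close>, which is zero:
    after currying, whatever it kills factors through \<open>i\<close>.\<close>
  have "mono_arrow C (p \<otimes>\<^sub>m Idn C ?D)"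
  proof (rule mono_arrowI)
    show "p \<otimes>\<^sub>m Idn C ?D \<in> Hom C (?I \<otimes> ?D) (L \<otimes> ?D)" by (simp add: Hom_iff)
    fix Z g assume g: "g \<in> Hom C Z (?I \<otimes> ?D)" "(p \<otimes>\<^sub>m Idn C ?D) \<cdot> g = Zer C Z (L \<otimes> ?D)"
    have [simp]: "Z \<in> Ob C" using g Hom_Ob by blast
    let ?rc = "rcurry L ?D (Ev C L)"
    have "p \<cdot> ?rc ?I g = ?rc L (Zer C Z (L \<otimes> ?D))"
      using rcurry_Tens_Comp[OF d g(1) p(1)] g(2) by simp
    also have "\<dots> = Zer C (Z \<otimes> L) L" by (simp add: rcurry_def Zer_TensM Comp_Zer)
    finally obtain u where u: "u \<in> Hom C (Z \<otimes> L) J" "i \<cdot> u = ?rc ?I g"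
      using mono_kernel_of_cokernel[OF i p(1) p_uni rcurry_Hom[OF d g(1)]] by auto
    obtain v where v: "v \<in> Hom C Z (J \<otimes> ?D)" "?rc J v = u" using rcurry_surj[OF d u(1)] by auto
    have "?rc ?I g = ?rc ?I ((i \<otimes>\<^sub>m Idn C ?D) \<cdot> v)"
      using rcurry_Tens_Comp[OF d v(1) i(2)] u(2) v(2) by simp
    then have "g = (i \<otimes>\<^sub>m Idn C ?D) \<cdot> v"
      by (rule rcurry_inject[OF d _ g(1)]) (use v in \<open>auto simp: Hom_iff\<close>)
    also have "v = Zer C Z (J \<otimes> ?D)" by (rule zero_Hom_to[OF z v(1)])
    finally show "g = Zer C Z (?I \<otimes> ?D)" by (simp add: Comp_Zer)
  qed
  then have pD [simp]: "iso C (p \<otimes>\<^sub>m Idn C ?D)"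
    by (rule mono_epi_iso) (rule epi_TensM_right[OF dd(2) p(2,1)])
  \<comment> \<open>\<open>p \<otimes> id\<close> carries \<open>?t\<close> back to
    \<open>Coev\<close>, whose curried form is the left unit constraint. The curried form of
    \<open>?t\<close> is therefore, up to that constraint, a section of \<open>p\<close>.\<close>
  let ?t = "Inv C (p \<otimes>\<^sub>m Idn C ?D) \<cdot> Coev C L"
  have t: "?t \<in> Hom C ?I (?I \<otimes> ?D)" by (simp add: Hom_iff)
  let ?s' = "rcurry L ?D (Ev C L) ?I ?t"
  have s' [simp]: "?s' \<in> Ar C" "Dom C ?s' = ?I \<otimes> L" "Cod C ?s' = ?I"
    using rcurry_Hom[OF d t] by (auto simp: Hom_iff)
  have ps': "p \<cdot> ?s' = LUnit C L"
    using rcurry_Tens_Comp[OF d t p(1)] rcurry_coev[OF d] by simp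
  define s where "s = ?s' \<cdot> Inv C (LUnit C L)"
  have [simp]: "s \<in> Ar C" "Dom C s = L" "Cod C s = ?I" by (simp_all add: s_def)
  have ps: "p \<cdot> s = Idn C L"
  proof -
    have "p \<cdot> s = (p \<cdot> ?s') \<cdot> Inv C (LUnit C L)" by (simp add: s_def)
    then show ?thesis unfolding ps' by simp
  qed
  obtain a where a: "s \<cdot> p = Scale C a (Idn C ?I)" using End_Unit_scalar[of "s \<cdot> p"] by (auto simp: Hom_iff)
  have "p = (p \<cdot> s) \<cdot> p" unfolding ps by simp
  also have "\<dots> = p \<cdot> (s \<cdot> p)" by simp
  finally have pa: "Scale C a p = p" unfolding a by (simp add: Comp_Scale')
  show "is_zero_object C (Dom C i) \<or> iso C i"
  proof (cases "a = 1")
    case True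
    then have "i = (s \<cdot> p) \<cdot> i" unfolding a by (simp add: Scale_1)
    also have "\<dots> = s \<cdot> (p \<cdot> i)" by simp
    also have "\<dots> = Zer C (Dom C i) ?I" unfolding p(3) by (simp add: Comp_Zer)
    finally show ?thesis using Zer_mono_zero[OF i(1) _ i(2)] by simp
  next
    case False
    have "Scale C (a + (-1)) p = Add C (Scale C a p) (Scale C (-1) p)"
      using vector_space_struct.add_scale[OF hom_vs, of ?I L p a "-1"] by (simp add: Hom_iff)
    then have "Scale C (a + (-1)) p = Zer C ?I L" using diff_self[OF p(1)] pa by metis
    then have "p = Zer C ?I L" using Scale_eq_Zer[of "a + (-1)", OF _ p(1)] False by auto
    then have "p \<cdot> Idn C ?I = Zer C ?I L" by simp
    then obtain u where "u \<in> Hom C ?I J" "i \<cdot> u = Idn C ?I"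
      using mono_kernel_of_cokernel[OF i p(1) p_uni Idn_Hom[OF Unit_Ob]] by auto
    then show ?thesis using mono_split_iso[OF i(1)] by simp
  qed
qed

end

section \<open>Projective covers\<close>

definition proj_cover :: "('o, 'm, 'k, 'z) lin_cat_scheme \<Rightarrow> 'o \<Rightarrow> 'm \<Rightarrow> 'o \<Rightarrow> bool" where
  "proj_cover C P p S \<longleftrightarrow> projective C P \<and> p \<in> Hom C P S \<and> p \<noteq> Zer C P S \<and>
     (\<forall>f \<in> Hom C P P. p \<cdot>\<^bsub>C\<^esub> f = p \<longrightarrow> iso C f)"

section \<open>Fitting's lemma for an endomorphism\<close>

context finite_abelian_category
begin

primrec pw :: "'a \<Rightarrow> 'b \<Rightarrow> nat \<Rightarrow> 'b" where
  "pw P f 0 = Idn C P"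
| "pw P f (Suc n) = f \<cdot> pw P f n"

lemma pw_Hom: "f \<in> Hom C P P \<Longrightarrow> pw P f n \<in> Hom C P P"
  using Hom_Ob[of f P P] by (induction n) (auto intro: Comp_Hom Idn_Hom)

lemma pw_Ar [simp]: "\<lbrakk>f \<in> Ar C; Dom C f = P; Cod C f = P\<rbrakk> \<Longrightarrow> pw P f n \<in> Ar C"
  and Dom_pw [simp]: "\<lbrakk>f \<in> Ar C; Dom C f = P; Cod C f = P\<rbrakk> \<Longrightarrow> Dom C (pw P f n) = P"
  and Cod_pw [simp]: "\<lbrakk>f \<in> Ar C; Dom C f = P; Cod C f = P\<rbrakk> \<Longrightarrow> Cod C (pw P f n) = P"
  using pw_Hom[of f P n] by (auto simp: Hom_iff)

lemma pw_add: "f \<in> Hom C P P \<Longrightarrow> pw P f (m + n) = pw P f m \<cdot> pw P f n"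
  by (induction m) (auto simp: Hom_iff)

lemma pw_commute:
  assumes f: "f \<in> Hom C P P" and g: "g \<in> Hom C P P" and fg: "g \<cdot> f = f \<cdot> g"
  shows "g \<cdot> pw P f n = pw P f n \<cdot> g"
proof (induction n)
  case 0
  then show ?case using f g Hom_Ob by (auto simp: Hom_iff)
next
  case (Suc n)
  have [simp]: "f \<in> Ar C" "Dom C f = P" "Cod C f = P" "g \<in> Ar C" "Dom C g = P" "Cod C g = P"
    using f g by (auto simp: Hom_iff)
  have "g \<cdot> pw P f (Suc n) = (g \<cdot> f) \<cdot> pw P f n" by simp
  also have "\<dots> = f \<cdot> (g \<cdot> pw P f n)" unfolding fg by simp
  finally show ?case unfolding Suc by simp
qed

text \<open>In a polynomial relation for \<open>f\<close>, solving for the term of lowest degree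
  with nonzero coefficient writes a power of \<open>f\<close> as the next power times a polynomial
  in \<open>f\<close>. Vanishing low coefficients are absorbed by raising \<open>m\<close>, which is
  why \<open>c\<close> and \<open>m\<close> vary in the induction.\<close>

lemma fitting_step:
  assumes f: "f \<in> Hom C P P"
    and rel: "vcomb (hom_space C P P) c (\<lambda>i. pw P f (i + m)) N = Zer C P P" and nz: "\<exists>i<N. c i \<noteq> 0"
  shows "\<exists>m g. g \<in> Hom C P P \<and> g \<cdot> f = f \<cdot> g \<and> pw P f m = pw P f (Suc m) \<cdot> g"
  using rel nz
proof (induction N arbitrary: c m)
  case 0
  then show ?case by simp
next
  case (Suc N)
  have [simp]: "P \<in> Ob C" "f \<in> Ar C" "Dom C f = P" "Cod C f = P" using f Hom_Ob by (auto simp: Hom_iff)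
  let ?V = "hom_space C P P"
  interpret V: vector_space_struct ?V by simp
  have pV: "pw P f i \<in> Hom C P P" for i by (rule pw_Hom[OF f])
  have split: "vcomb ?V c (\<lambda>i. pw P f (i + m)) (Suc N)
      = Add C (Scale C (c 0) (pw P f m)) (vcomb ?V (\<lambda>i. c (Suc i)) (\<lambda>i. pw P f (i + Suc m)) N)"
    unfolding vcomb_def by (subst V.vsum_shift) (auto simp: pV Scale_Hom intro: Comp_Hom[OF pV f])
  show ?case
  proof (cases "c 0 = 0")
    case True
    have "vcomb ?V (\<lambda>i. c (Suc i)) (\<lambda>i. pw P f (i + Suc m)) N \<in> vcarrier ?V"
      by (rule V.vcomb_closed) (simp only: hom_space_simps pV)
    then have "vcomb ?V (\<lambda>i. c (Suc i)) (\<lambda>i. pw P f (i + Suc m)) N = Zer C P P"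
      using Suc.prems(1) split True V.add_zero pV[of m] by (simp add: Scale_0)
    moreover have "\<exists>i<N. c (Suc i) \<noteq> 0" using Suc.prems(2) True by (metis Suc_less_eq gr0_implies_Suc neq0_conv)
    ultimately show ?thesis by (rule Suc.IH)
  next
    case False
    \<comment> \<open>\<open>x\<close> collects the higher terms: the relation reads
      \<open>c 0 f^m + f^(m+1) x = 0\<close>.\<close>
    define x where "x = vcomb ?V (\<lambda>i. c (Suc i)) (pw P f) N"
    have xH: "x \<in> Hom C P P" using V.vcomb_closed[of N "pw P f"] pV by (simp add: x_def)
    have "vcomb ?V (\<lambda>i. c (Suc i)) (\<lambda>i. pw P f (i + Suc m)) N
        = vcomb ?V (\<lambda>i. c (Suc i)) (\<lambda>i. pw P f (Suc m) \<cdot> pw P f i) N"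
      unfolding vcomb_def using pw_add[OF f, of "Suc m"] by (simp add: add.commute)
    also have "\<dots> = pw P f (Suc m) \<cdot> x"
      unfolding x_def
      by (rule V.vlinear_vcomb[OF vlinear_Comp_left[OF pV] hom_vs, symmetric]) (simp_all add: pV del: pw.simps)
    finally have sum0: "Add C (Scale C (c 0) (pw P f m)) (pw P f (Suc m) \<cdot> x) = Zer C P P"
      using Suc.prems(1) split by simp
    define y where "y = pw P f (Suc m) \<cdot> x"
    have yH: "y \<in> Hom C P P" unfolding y_def by (rule Comp_Hom[OF xH pV])
    have zH: "Scale C (c 0) (pw P f m) \<in> Hom C P P" by (rule Scale_Hom[OF pV])
    have "Add C y (Scale C (c 0) (pw P f m)) = Zer C P P"
      using sum0[folded y_def] V.add_comm[of y "Scale C (c 0) (pw P f m)"] yH zH by simp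
    then have "Scale C (c 0) (pw P f m) = Scale C (-1) y"
      using V.add_eq_zero_iff[of y "Scale C (c 0) (pw P f m)"] yH zH by simp
    then have "Scale C (inverse (c 0)) (Scale C (c 0) (pw P f m)) = Scale C (inverse (c 0)) (Scale C (-1) y)"
      by simp
    then have "pw P f m = Scale C (- inverse (c 0)) y"
      using False yH by (simp add: Scale_Scale Scale_1 Hom_iff)
    also have "\<dots> = pw P f (Suc m) \<cdot> Scale C (- inverse (c 0)) x"
      unfolding y_def by (rule Comp_Scale[OF xH pV, symmetric])
    finally have 1: "pw P f m = pw P f (Suc m) \<cdot> Scale C (- inverse (c 0)) x" .
    have "x \<cdot> f = vcomb ?V (\<lambda>i. c (Suc i)) (\<lambda>i. pw P f i \<cdot> f) N"
      unfolding x_def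
      by (rule V.vlinear_vcomb[OF vlinear_Comp_right[OF f] hom_vs]) (simp_all add: pV)
    also have "\<dots> = vcomb ?V (\<lambda>i. c (Suc i)) (\<lambda>i. f \<cdot> pw P f i) N"
      using pw_commute[OF f f] by simp
    also have "\<dots> = f \<cdot> x"
      unfolding x_def
      by (rule V.vlinear_vcomb[OF vlinear_Comp_left[OF f] hom_vs, symmetric]) (simp_all add: pV)
    finally have "Scale C (- inverse (c 0)) x \<cdot> f = f \<cdot> Scale C (- inverse (c 0)) x"
      using xH by (simp add: Comp_Scale' Scale_Comp' Hom_iff)
    then show ?thesis using 1 Scale_Hom[OF xH] by blast
  qed
qed

text \<open>The powers of \<open>f\<close> are linearly dependent because the endomorphisms of
  \<open>P\<close> form a finite-dimensional space. Iterating \<open>fitting_step\<close> gives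
  \<open>a = a \<cdot> a \<cdot> g\<close> for a power \<open>a\<close> of \<open>f\<close> that
  commutes with \<open>g\<close>, so \<open>a \<cdot> g\<close> is idempotent. The exponent is a
  successor so that invertibility of \<open>a\<close> passes to \<open>f\<close>.\<close>

lemma fitting:
  assumes f: "f \<in> Hom C P P"
  obtains m g where "g \<in> Hom C P P" "g \<cdot> pw P f (Suc m) = pw P f (Suc m) \<cdot> g"
    "pw P f (Suc m) = pw P f (Suc m) \<cdot> pw P f (Suc m) \<cdot> g"
proof -
  have [simp]: "P \<in> Ob C" "f \<in> Ar C" "Dom C f = P" "Cod C f = P" using f Hom_Ob by (auto simp: Hom_iff)
  let ?V = "hom_space C P P"
  interpret V: vector_space_struct ?V by simp
  obtain n b where b: "vbasis ?V n b" using V.ex_vbasis[OF finite_dim_hom] by auto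
  \<comment> \<open>The powers with exponents 0 to \<open>n\<close> are one more than the dimension
    \<open>n\<close>.\<close>
  have "\<not> vindep ?V (Suc n) (pw P f)" using V.vindep_le[of "Suc n" _ n b] b by (auto simp: vbasis_def)
  then obtain c where "vcomb ?V c (\<lambda>i. pw P f (i + 0)) (Suc n) = Zer C P P" "\<exists>i<Suc n. c i \<noteq> 0"
    using pw_Hom[OF f] by (auto simp: vindep_def)
  from fitting_step[OF f this] obtain m g where g: "g \<in> Hom C P P" "g \<cdot> f = f \<cdot> g"
    and eq: "pw P f m = pw P f (Suc m) \<cdot> g" by blast
  have [simp]: "g \<in> Ar C" "Dom C g = P" "Cod C g = P" using g by (auto simp: Hom_iff)
  have gf: "f \<cdot> pw P g j = pw P g j \<cdot> f" for j using pw_commute[OF g(1) f] g(2) by simp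
  \<comment> \<open>Each use of \<open>eq\<close> pays one factor \<open>g\<close> for one more
    factor \<open>f\<close>; at \<open>j = Suc m\<close> the power has doubled.\<close>
  have it: "pw P f (Suc m) = pw P f (Suc m + j) \<cdot> pw P g j" for j
  proof (induction j)
    case (Suc j)
    have "pw P f (Suc m + j) = pw P f (Suc j) \<cdot> pw P f m"
      using pw_add[OF f, of "Suc j" m] by (simp add: add.commute)
    also have "\<dots> = pw P f (Suc j) \<cdot> (pw P f (Suc m) \<cdot> g)" using eq by simp
    also have "\<dots> = pw P f (Suc m + Suc j) \<cdot> g"
      using pw_add[OF f, of "Suc j" "Suc m"] by (simp add: add.commute del: pw.simps)
    finally have X: "pw P f (Suc m + j) = pw P f (Suc m + Suc j) \<cdot> g" .
    have "pw P f (Suc m) = pw P f (Suc m + j) \<cdot> pw P g j" by (rule Suc)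
    also have "\<dots> = (pw P f (Suc m + Suc j) \<cdot> g) \<cdot> pw P g j" by (simp only: X)
    also have "\<dots> = pw P f (Suc m + Suc j) \<cdot> pw P g (Suc j)"
      unfolding pw.simps(2)[of P g] by (rule Comp_assoc') (simp_all del: pw.simps)
    finally show ?case .
  qed simp
  have com: "pw P g (Suc m) \<cdot> pw P f (Suc m) = pw P f (Suc m) \<cdot> pw P g (Suc m)"
    using pw_commute[OF f pw_Hom[OF g(1)]] gf by metis
  have "pw P f (Suc m) = pw P f (Suc m) \<cdot> pw P f (Suc m) \<cdot> pw P g (Suc m)"
  proof -
    have "pw P f (Suc m) = pw P f (Suc m + Suc m) \<cdot> pw P g (Suc m)" by (rule it)
    also have "\<dots> = (pw P f (Suc m) \<cdot> pw P f (Suc m)) \<cdot> pw P g (Suc m)" by (simp only: pw_add[OF f])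
    also have "\<dots> = pw P f (Suc m) \<cdot> pw P f (Suc m) \<cdot> pw P g (Suc m)"
      by (rule Comp_assoc') (simp_all del: pw.simps)
    finally show ?thesis .
  qed
  with com pw_Hom[OF g(1)] show thesis using that by blast
qed

end

section \<open>Existence of projective covers\<close>

context finite_abelian_category
begin

lemma projective_lift:
  assumes P: "projective C P" and g: "epi_arrow C g" "g \<in> Hom C A B" and f: "f \<in> Hom C P B"
  obtains h where "h \<in> Hom C P A" "g \<cdot> h = f"
proof -
  have "Dom C g = A" "Cod C g = B" using g by (auto simp: Hom_iff)
  then show thesis using P g(1) f that unfolding projective_def by blast
qed

lemma projective_retract:
  assumes P: "projective C P" and i: "i \<in> Hom C P' P" and r: "r \<in> Hom C P P'" "r \<cdot> i = Idn C P'"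
  shows "projective C P'"
  unfolding projective_def
proof (intro conjI allI impI)
  have [simp]: "i \<in> Ar C" "Dom C i = P'" "Cod C i = P" "r \<in> Ar C" "Dom C r = P" "Cod C r = P'"
    using i r by (auto simp: Hom_iff)
  show "P' \<in> Ob C" using i Hom_Ob by blast
  fix g f assume gf: "epi_arrow C g \<and> f \<in> Hom C P' (Cod C g)"
  then have [simp]: "g \<in> Ar C" "f \<in> Ar C" "Dom C f = P'" "Cod C f = Cod C g" by (auto simp: epi_Ar Hom_iff)
  obtain h where h: "h \<in> Hom C P (Dom C g)" "g \<cdot> h = f \<cdot> r"
    using projective_lift[OF P, of g "Dom C g" "Cod C g" "f \<cdot> r"] gf by (auto simp: Hom_iff)
  have [simp]: "h \<in> Ar C" "Dom C h = P" "Cod C h = Dom C g" using h by (auto simp: Hom_iff)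
  have "g \<cdot> (h \<cdot> i) = (g \<cdot> h) \<cdot> i" by simp
  also have "\<dots> = f" unfolding h(2) using r(2) by simp
  finally show "\<exists>h\<in>Hom C P' (Dom C g). g \<cdot> h = f" by (intro bexI[of _ "h \<cdot> i"]) (simp_all add: Hom_iff)
qed

text \<open>Among the projective objects with a nonzero morphism to \<open>S\<close>, take one whose
  endomorphism space has the least dimension \<open>n0\<close>. If \<open>p \<cdot> f = p\<close>,
  Fitting's lemma yields an idempotent \<open>e\<close> with \<open>p \<cdot> e = p\<close>, and the
  image of \<open>e\<close> is again such an object. Were \<open>e\<close> not the identity, the
  dimension would drop; so \<open>e\<close> is the identity, and \<open>f\<close> is
  invertible.\<close>

lemma ex_proj_cover:
  assumes S: "simple_object C S"
  obtains P p where "proj_cover C P p S"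
proof -
  have [simp]: "S \<in> Ob C" and nz: "\<not> is_zero_object C S" using S by (auto simp: simple_object_def)
  define N where "N n \<longleftrightarrow> (\<exists>P p b. projective C P \<and> p \<in> Hom C P S \<and> p \<noteq> Zer C P S \<and> vbasis (hom_space C P P) n b)" for n
  obtain p where p: "epi_arrow C p" "Cod C p = S" "projective C (Dom C p)"
    using enough_projectives[of S] by auto
  have [simp]: "p \<in> Ar C" using p epi_Ar by blast
  have "p \<noteq> Zer C (Dom C p) S"
  proof
    assume 0: "p = Zer C (Dom C p) S"
    have "Idn C S \<cdot> p = p" using p by simp
    then have "Idn C S \<cdot> p = Zer C (Dom C p) S" using 0 by metis
    then have "Idn C (Cod C p) = Zer C (Cod C p) S"
      using epi_ZerD[of "Idn C S" p S] p by (simp add: Hom_iff)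
    then show False using nz p by (simp add: zero_object_iff)
  qed
  moreover obtain n b where "vbasis (hom_space C (Dom C p) (Dom C p)) n b"
    using vector_space_struct.ex_vbasis[OF hom_vs finite_dim_hom, of "Dom C p" "Dom C p"] by auto
  moreover have "p \<in> Hom C (Dom C p) S" using p by (simp add: Hom_iff)
  ultimately have "N n" using p(3) unfolding N_def by blast
  define n0 where "n0 = (LEAST n. N n)"
  have "N n0" unfolding n0_def by (rule LeastI[of N n]) fact
  have min: "\<not> N m" if "m < n0" for m using that unfolding n0_def by (rule not_less_Least)
  obtain P p b where P: "projective C P" and p: "p \<in> Hom C P S" and pnz: "p \<noteq> Zer C P S"
    and b: "vbasis (hom_space C P P) n0 b" using \<open>N n0\<close> unfolding N_def by blast
  have [simp]: "p \<in> Ar C" "Dom C p = P" "Cod C p = S" "P \<in> Ob C" using p Hom_Ob by (auto simp: Hom_iff)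
  have "iso C f" if f: "f \<in> Hom C P P" and pf: "p \<cdot> f = p" for f
  proof -
    have [simp]: "f \<in> Ar C" "Dom C f = P" "Cod C f = P" using f by (auto simp: Hom_iff)
    obtain m g where g: "g \<in> Hom C P P" and com: "g \<cdot> pw P f (Suc m) = pw P f (Suc m) \<cdot> g"
      and eq: "pw P f (Suc m) = pw P f (Suc m) \<cdot> pw P f (Suc m) \<cdot> g"
      using fitting[OF f] .
    define a where "a = pw P f (Suc m)"
    have aH: "a \<in> Hom C P P" unfolding a_def by (rule pw_Hom[OF f])
    have [simp]: "a \<in> Ar C" "Dom C a = P" "Cod C a = P" "g \<in> Ar C" "Dom C g = P" "Cod C g = P"
      using aH g by (auto simp: Hom_iff)
    note com = com[folded a_def] and eq = eq[folded a_def]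
    define e where "e = a \<cdot> g"
    have [simp]: "e \<in> Ar C" "Dom C e = P" "Cod C e = P" by (simp_all add: e_def)
    have ae: "a \<cdot> e = a" unfolding e_def by (rule eq[symmetric])
    have ee: "e \<cdot> e = e"
    proof -
      have "e \<cdot> e = (g \<cdot> a) \<cdot> e" unfolding com e_def ..
      also have "\<dots> = g \<cdot> (a \<cdot> e)" by simp
      also have "\<dots> = e" unfolding ae by (simp add: com e_def)
      finally show ?thesis .
    qed
    have "p \<cdot> pw P f j = p" for j
    proof (induction j)
      case (Suc j)
      have "p \<cdot> pw P f (Suc j) = (p \<cdot> f) \<cdot> pw P f j" by simp
      then show ?case unfolding pf Suc .
    qed simp
    then have pa: "p \<cdot> a = p" unfolding a_def .
    have pe: "p \<cdot> e = p"
    proof -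
      have "p \<cdot> e = (p \<cdot> a) \<cdot> e" unfolding pa ..
      also have "\<dots> = p \<cdot> (a \<cdot> e)" by simp
      finally show ?thesis unfolding ae pa .
    qed
    have eH: "e \<in> Hom C P P" by (simp add: Hom_iff)
    obtain P' r i where r: "r \<in> Hom C P P'" "epi_arrow C r" and i: "i \<in> Hom C P' P" "mono_arrow C i"
      and ir: "e = i \<cdot> r" using imageE[OF eH] .
    have [simp]: "i \<in> Ar C" "Dom C i = P'" "Cod C i = P" "r \<in> Ar C" "Dom C r = P" "Cod C r = P'" "P' \<in> Ob C"
      using i r Hom_Ob by (auto simp: Hom_iff)
    have "i \<cdot> (r \<cdot> i \<cdot> r) = i \<cdot> r" using ee unfolding ir by simp
    from monoD[OF this i(2), of P] have "(r \<cdot> i) \<cdot> r = Idn C P' \<cdot> r" by (simp add: Hom_iff)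
    from epiD[OF this r(2), of P'] have ri: "r \<cdot> i = Idn C P'" by (simp add: Hom_iff)
    have ePe: "e = Idn C P"
    proof (rule ccontr)
      assume ne: "e \<noteq> Idn C P"
      have "projective C P'" by (rule projective_retract[OF P i(1) r(1) ri])
      moreover have "p \<cdot> i \<noteq> Zer C P' S"
      proof
        assume 0: "p \<cdot> i = Zer C P' S"
        have "p = (p \<cdot> i) \<cdot> r" using pe unfolding ir by simp
        also have "\<dots> = Zer C P S" unfolding 0 by (simp add: Zer_Comp)
        finally show False using pnz by simp
      qed
      moreover obtain m' b' where b': "vbasis (hom_space C P' P') m' b'"
        using vector_space_struct.ex_vbasis[OF hom_vs finite_dim_hom, of P' P'] by auto
      ultimately have "N m'" unfolding N_def by (intro exI[of _ P'] exI[of _ "p \<cdot> i"]) (auto simp: Hom_iff)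
      moreover have "m' < n0"
      proof (rule vector_space_struct.vlinear_kernel_less[OF hom_vs _ hom_vs])
        let ?V = "hom_space C P P" and ?W = "hom_space C P' P'"
        \<comment> \<open>Compression to the image of \<open>e\<close>. It is onto the endomorphisms
          of \<open>P'\<close> and kills the nonzero \<open>id - e\<close>, which is
          \<open>?x\<close> below.\<close>
        let ?F = "\<lambda>x. r \<cdot> (x \<cdot> i)"
        show "vlinear ?V ?W ?F"
          using vlinear_Comp_left[OF r(1), of P'] vlinear_Comp_right[OF i(1), of P]
          unfolding vlinear_def by simp
        show "\<exists>x\<in>vcarrier ?V. ?F x = y" if "y \<in> vcarrier ?W" for y
        proof (intro bexI[of _ "i \<cdot> (y \<cdot> r)"])
          have [simp]: "y \<in> Ar C" "Dom C y = P'" "Cod C y = P'" using that by (auto simp: Hom_iff)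
          have "r \<cdot> (i \<cdot> (y \<cdot> r)) \<cdot> i = (r \<cdot> i) \<cdot> y \<cdot> (r \<cdot> i)" by simp
          then show "?F (i \<cdot> (y \<cdot> r)) = y" unfolding ri by simp
          show "i \<cdot> (y \<cdot> r) \<in> vcarrier ?V" by (simp add: Hom_iff)
        qed
        let ?x = "Add C (Idn C P) (Scale C (-1) e)"
        have idH: "Idn C P \<in> Hom C P P" by (simp add: Hom_iff)
        show xH: "?x \<in> vcarrier ?V" using Add_Hom[OF idH Scale_Hom[OF eH]] by simp
        show "?x \<noteq> vzero ?V" using diff_eq_ZerD[OF _ idH eH] ne by auto
        have "?F ?x = r \<cdot> Add C i (Scale C (-1) (e \<cdot> i))"
          using Add_Comp[OF i(1) idH Scale_Hom[OF eH]] by (simp add: Scale_Comp')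
        also have "e \<cdot> i = i \<cdot> (r \<cdot> i)" unfolding ir by simp
        also have "\<dots> = i" unfolding ri by simp
        also have "r \<cdot> Add C i (Scale C (-1) i) = vzero ?W"
          using diff_self[OF i(1)] by (simp add: Comp_Zer)
        finally show "?F ?x = vzero ?W" .
        show "vspanning ?V n0 b" "vindep ?W m' b'" using b b' by (auto simp: vbasis_def)
      qed simp_all
      ultimately show False using min by blast
    qed
    \<comment> \<open>That \<open>e\<close> is the identity reads \<open>f \<cdot> ?q = id\<close>;
      since \<open>g\<close> commutes with \<open>a\<close>, it also yields a left inverse of
      \<open>f\<close>.\<close>
    let ?q = "pw P f m \<cdot> g"
    have 1: "f \<cdot> ?q = Idn C P" using ePe unfolding e_def a_def by simp
    have "g \<cdot> a = Idn C P" using ePe unfolding e_def com .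
    then have "(g \<cdot> pw P f m) \<cdot> f = Idn C P"
      unfolding a_def using pw_commute[OF f f, of m] by simp
    then have m: "mono_arrow C f"
    proof -
      have l: "(g \<cdot> pw P f m) \<cdot> f = Idn C P" by fact
      show ?thesis
      proof (rule mono_arrowI[OF f])
        fix Z h assume h: "h \<in> Hom C Z P" "f \<cdot> h = Zer C Z P"
        have [simp]: "h \<in> Ar C" "Dom C h = Z" "Cod C h = P" "Z \<in> Ob C" using h Hom_Ob by (auto simp: Hom_iff)
        have "h = ((g \<cdot> pw P f m) \<cdot> f) \<cdot> h" unfolding l by simp
        also have "\<dots> = (g \<cdot> pw P f m) \<cdot> (f \<cdot> h)" by simp
        also have "\<dots> = Zer C Z P" unfolding h(2) by (simp add: Comp_Zer)
        finally show "h = Zer C Z P" .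
      qed
    qed
    show "iso C f" using mono_split_iso[OF m, of ?q] 1 by (simp add: Hom_iff)
  qed
  then show thesis using that P p pnz unfolding proj_cover_def by blast
qed

lemma proj_cover_epi: "\<lbrakk>proj_cover C P p S; simple_object C S\<rbrakk> \<Longrightarrow> epi_arrow C p"
  using Hom_simple_epi unfolding proj_cover_def by blast

text \<open>It suffices that \<open>p\<close> kills the kernel \<open>k\<close> of \<open>e\<close>.
  Otherwise \<open>p \<cdot> k\<close> is onto the simple \<open>S\<close>, and lifting
  \<open>p\<close> along it gives an \<open>f\<close> with \<open>p \<cdot> k \<cdot> f = p\<close>.
  By minimality \<open>k \<cdot> f\<close> is invertible, yet \<open>e\<close> kills it; so
  \<open>e = 0\<close>, although its target is nonzero.\<close>

lemma proj_cover_factor: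
  assumes c: "proj_cover C P p S" and S: "simple_object C S"
    and e: "e \<in> Hom C P J" "epi_arrow C e" and J: "\<not> is_zero_object C J"
  obtains s where "s \<in> Hom C J S" "s \<cdot> e = p"
proof -
  have P: "projective C P" and p: "p \<in> Hom C P S" and cov: "\<And>f. \<lbrakk>f \<in> Hom C P P; p \<cdot> f = p\<rbrakk> \<Longrightarrow> iso C f"
    using c by (auto simp: proj_cover_def)
  have [simp]: "p \<in> Ar C" "Dom C p = P" "Cod C p = S" "P \<in> Ob C" "e \<in> Ar C" "Dom C e = P" "Cod C e = J" "J \<in> Ob C"
    using p e Hom_Ob by (auto simp: Hom_iff)
  obtain K k where k: "k \<in> Hom C K P" "e \<cdot> k = Zer C K J"
    and k_uni: "\<And>Z g. \<lbrakk>g \<in> Hom C Z P; e \<cdot> g = Zer C Z J\<rbrakk> \<Longrightarrow> \<exists>u\<in>Hom C Z K. k \<cdot> u = g"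
    using kernelE[OF e(1)] by metis
  have [simp]: "k \<in> Ar C" "Dom C k = K" "Cod C k = P" "K \<in> Ob C" using k Hom_Ob by (auto simp: Hom_iff)
  have "p \<cdot> k = Zer C K S"
  proof (rule ccontr)
    assume "p \<cdot> k \<noteq> Zer C K S"
    then have "epi_arrow C (p \<cdot> k)" by (intro Hom_simple_epi[OF S, of _ K]) (auto simp: Hom_iff)
    then obtain f where f: "f \<in> Hom C P K" "(p \<cdot> k) \<cdot> f = p"
      using projective_lift[OF P, of "p \<cdot> k" K S p] p by (auto simp: Hom_iff)
    have [simp]: "f \<in> Ar C" "Dom C f = P" "Cod C f = K" using f by (auto simp: Hom_iff)
    have "p \<cdot> (k \<cdot> f) = p" using f(2) by simp
    then have kf: "iso C (k \<cdot> f)" by (rule cov[rotated]) (simp add: Hom_iff)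
    have "e \<cdot> (k \<cdot> f) = (e \<cdot> k) \<cdot> f" by simp
    also have "\<dots> = Zer C (Dom C (k \<cdot> f)) J" unfolding k(2) by (simp add: Zer_Comp)
    finally have "e = Zer C P J" using epi_ZerD[OF _ iso_epi[OF kf], of e J] by (simp add: Hom_iff)
    moreover have "Idn C J \<cdot> e = e" by simp
    ultimately have "Idn C J \<cdot> e = Zer C (Dom C e) J" by simp
    then have "Idn C J = Zer C J J" using epi_ZerD[OF _ e(2), of "Idn C J" J] by (simp add: Hom_iff)
    then show False using J by (simp add: zero_object_iff)
  qed
  then show thesis using epi_cokernel_of_kernel[OF e(2,1) k(1) k_uni p] that by blast
qed

end

section \<open>Duality between projective covers\<close>

context finite_tensor_category
begin

text \<open>A subobject \<open>j\<close> of \<open>S\<close> transposes to an epi \<open>g\<close>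
  from \<open>T\<close> onto the dual of its source. The kernel of \<open>g\<close> is zero or all
  of \<open>T\<close>: in the first case \<open>g\<close> is invertible and transposing its inverse
  splits \<open>j\<close>, in the second \<open>g\<close> and with it \<open>j\<close>
  vanishes.\<close>

lemma simple_right_dual:
  assumes d: "is_left_dual C S T e c" and T: "simple_object C T"
  shows "simple_object C S"
  unfolding simple_object_def
proof (intro conjI allI impI)
  note [simp] = left_dualD(1-8)[OF d]
  show "S \<in> Ob C" by simp
  show "\<not> is_zero_object C S"
  proof
    assume "is_zero_object C S"
    then have z: "is_zero_object C (T \<otimes> S)" by (rule TensM_zero) simp
    have "e \<cdot> (Idn C T \<otimes>\<^sub>m Idn C S) = e \<cdot> (Zer C T T \<otimes>\<^sub>m Idn C S)"
      using zero_Hom_from[OF z, of "e \<cdot> (Idn C T \<otimes>\<^sub>m Idn C S)" "Unit C"]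
        zero_Hom_from[OF z, of "e \<cdot> (Zer C T T \<otimes>\<^sub>m Idn C S)" "Unit C"] by (simp add: Hom_iff)
    then have "Idn C T = Zer C T T" by (rule pair_right_inject[OF d]) (simp_all add: Hom_iff)
    then show False using T by (simp add: simple_object_def zero_object_iff)
  qed
  fix j assume j': "mono_arrow C j \<and> Cod C j = S"
  define N where "N = Dom C j"
  have j: "mono_arrow C j" "j \<in> Hom C N S" and [simp]: "j \<in> Ar C" "Dom C j = N" "Cod C j = S" "N \<in> Ob C"
    using j' Hom_Ob by (auto simp: N_def mono_Ar Hom_iff)
  let ?N = "LDual C N"
  note dN = left_dual[OF \<open>N \<in> Ob C\<close>]
  note [simp] = left_dualD(1-8)[OF dN]
  obtain g where g: "transposes N ?N (Ev C N) S T e j g" using ex_right_transpose[OF dN d j(2)] .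
  have gH: "g \<in> Hom C T ?N" using g by (simp add: transposes_def)
  then have [simp]: "g \<in> Ar C" "Dom C g = T" "Cod C g = ?N" by (auto simp: Hom_iff)
  have epi: "epi_arrow C g" by (rule transposes_epi_right[OF dN d g j(1)])
  obtain K k where k: "k \<in> Hom C K T" "mono_arrow C k" "g \<cdot> k = Zer C K ?N"
    and k_uni: "\<And>Z h. \<lbrakk>h \<in> Hom C Z T; g \<cdot> h = Zer C Z ?N\<rbrakk> \<Longrightarrow> \<exists>u\<in>Hom C Z K. k \<cdot> u = h"
    using kernelE[OF gH] by metis
  have [simp]: "k \<in> Ar C" "Dom C k = K" "Cod C k = T" "K \<in> Ob C" using k Hom_Ob by (auto simp: Hom_iff)
  consider "is_zero_object C K" | "iso C k" using T k by (auto simp: simple_object_def)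
  then show "is_zero_object C (Dom C j) \<or> iso C j"
  proof cases
    case 2
    have "g \<cdot> k = Zer C (Dom C k) ?N" using k(3) by simp
    then have "g = Zer C T ?N" using epi_ZerD[OF _ iso_epi[OF 2], of g ?N] gH by simp
    then have "e \<cdot> (Idn C T \<otimes>\<^sub>m j) = e \<cdot> (Idn C T \<otimes>\<^sub>m Zer C N S)"
      using g by (simp add: transposes_def Zer_TensM TensM_Zer Comp_Zer)
    then have "j = Zer C N S" by (rule pair_left_inject[OF d _ j(2)]) (simp add: Hom_iff)
    then show ?thesis using Zer_mono_zero[OF j(1) _ j(2)] by simp
  next
    case 1
    have "mono_arrow C g"
    proof (rule mono_arrowI[OF gH])
      fix Z h assume h: "h \<in> Hom C Z T" "g \<cdot> h = Zer C Z ?N"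
      obtain u where u: "u \<in> Hom C Z K" "k \<cdot> u = h" using k_uni[OF h] by blast
      then show "h = Zer C Z T" using zero_Hom_to[OF 1 u(1)] Hom_Ob[OF u(1)] by (simp add: Comp_Zer)
    qed
    then have ig: "iso C g" using mono_epi_iso epi by blast
    have "Inv C g \<in> Hom C ?N T" using ig by (simp add: Hom_iff)
    then obtain j' where j': "transposes S T e N ?N (Ev C N) j' (Inv C g)"
      using ex_left_transpose[OF d dN] by blast
    have "transposes S T e S T e (j \<cdot> j') (Inv C g \<cdot> g)" by (rule transposes_Comp[OF d dN d j' g])
    then have "transposes S T e S T e (j \<cdot> j') (Idn C T)" using ig by simp
    then have "j \<cdot> j' = Idn C S" using transposes_Idn[OF d] by (rule transposes_unique_left[OF d d])
    then show ?thesis using mono_split_iso[OF j(1), of j'] j' by (simp add: transposes_def)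
  qed
qed

lemma transposes_pair:
  assumes d: "is_left_dual C X D e c" and d': "is_left_dual C X' D' e' c'"
    and tr: "transposes X D e X' D' e' f g" and u: "u \<in> Hom C A D'" and v: "v \<in> Hom C B X"
  shows "e' \<cdot> (u \<otimes>\<^sub>m (f \<cdot> v)) = e \<cdot> ((g \<cdot> u) \<otimes>\<^sub>m v)"
proof -
  note [simp] = left_dualD(1-8)[OF d] left_dualD(1-8)[OF d']
  have [simp]: "f \<in> Ar C" "Dom C f = X" "Cod C f = X'" "g \<in> Ar C" "Dom C g = D'" "Cod C g = D"
    "u \<in> Ar C" "Dom C u = A" "Cod C u = D'" "v \<in> Ar C" "Dom C v = B" "Cod C v = X"
    and eq: "e \<cdot> (g \<otimes>\<^sub>m Idn C X) = e' \<cdot> (Idn C D' \<otimes>\<^sub>m f)"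
    using tr u v by (auto simp: transposes_def Hom_iff)
  have "e' \<cdot> (u \<otimes>\<^sub>m (f \<cdot> v)) = (e' \<cdot> (Idn C D' \<otimes>\<^sub>m f)) \<cdot> (u \<otimes>\<^sub>m v)" by (simp add: TensM_merge)
  also have "\<dots> = e \<cdot> ((g \<cdot> u) \<otimes>\<^sub>m v)" unfolding eq[symmetric] by (simp add: TensM_merge)
  finally show ?thesis .
qed

text \<open>\<open>P\<close> covers the object \<open>S\<close> whose left dual is \<open>T\<close>.
  A nonzero \<open>h\<close> out of \<open>P\<close> has an image \<open>J\<close> that still maps
  onto \<open>S\<close>. Dually, \<open>T\<close> maps to the dual of \<open>J\<close>, onto which
  the dual of \<open>X\<close> projects, and projectivity of \<open>Q\<close> lifts this to a
  \<open>k\<close> for which the pairing with \<open>h\<close> is \<open>sg\<close>. One functional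
  with value 1 at \<open>sg\<close> thus detects all nonzero morphisms.\<close>

lemma ex_perfect_pairing:
  assumes T: "simple_object C T" and q: "proj_cover C Q q T"
  obtains P t where "P \<in> Ob C" "vfunctional (hom_space C (Q \<otimes> P) (Unit C)) t"
    "\<forall>X\<in>Ob C. \<forall>h\<in>Hom C P X - {Zer C P X}. \<exists>k\<in>Hom C Q (LDual C X). t (Ev C X \<cdot> (k \<otimes>\<^sub>m h)) = 1"
    "\<forall>X\<in>Ob C. \<forall>k\<in>Hom C Q (LDual C X) - {Zer C Q (LDual C X)}. \<exists>h\<in>Hom C P X. t (Ev C X \<cdot> (k \<otimes>\<^sub>m h)) = 1"
proof -
  have [simp]: "T \<in> Ob C" using T by (simp add: simple_object_def)
  obtain S e c where d: "is_left_dual C S T e c" using ex_right_dual[of T] by auto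
  note [simp] = left_dualD(1-8)[OF d]
  have S: "simple_object C S" by (rule simple_right_dual[OF d T])
  obtain P p where p: "proj_cover C P p S" using ex_proj_cover[OF S] .
  have PQ: "projective C P" "projective C Q" using p q by (auto simp: proj_cover_def)
  have pH: "p \<in> Hom C P S" and qH: "q \<in> Hom C Q T" and qnz: "q \<noteq> Zer C Q T" using p q by (auto simp: proj_cover_def)
  have [simp]: "p \<in> Ar C" "Dom C p = P" "Cod C p = S" "P \<in> Ob C" "q \<in> Ar C" "Dom C q = Q" "Cod C q = T" "Q \<in> Ob C"
    using pH qH Hom_Ob by (auto simp: Hom_iff)
  have pe: "epi_arrow C p" and qe: "epi_arrow C q" using proj_cover_epi p q S T by blast+
  let ?I = "Unit C"
  \<comment> \<open>The evaluation of \<open>S\<close>, pulled back to the two covers. It is nonzero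
    because \<open>p\<close> is epi and \<open>q\<close> is not zero.\<close>
  define sg where "sg = e \<cdot> (q \<otimes>\<^sub>m p)"
  have sgH: "sg \<in> Hom C (Q \<otimes> P) ?I" by (simp add: sg_def Hom_iff)
  have "sg \<noteq> Zer C (Q \<otimes> P) ?I"
  proof
    assume "sg = Zer C (Q \<otimes> P) ?I"
    then have "(e \<cdot> (q \<otimes>\<^sub>m Idn C S)) \<cdot> (Idn C Q \<otimes>\<^sub>m p) = Zer C (Dom C (Idn C Q \<otimes>\<^sub>m p)) ?I"
      by (simp add: sg_def TensM_merge)
    from epi_ZerD[OF this epi_TensM_left[OF _ pe pH]]
    have "e \<cdot> (q \<otimes>\<^sub>m Idn C S) = Zer C (Q \<otimes> S) ?I" by (simp add: Hom_iff)
    then have "e \<cdot> (q \<otimes>\<^sub>m Idn C S) = e \<cdot> (Zer C Q T \<otimes>\<^sub>m Idn C S)"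
      by (simp add: Zer_TensM Comp_Zer)
    then have "q = Zer C Q T" by (rule pair_right_inject[OF d _ qH]) (simp add: Hom_iff)
    then show False using qnz by simp
  qed
  then have sgnz: "sg \<noteq> vzero (hom_space C (Q \<otimes> P) ?I)" by simp
  interpret V: vector_space_struct "hom_space C (Q \<otimes> P) ?I" by simp
  have sgV: "sg \<in> vcarrier (hom_space C (Q \<otimes> P) ?I)" by (simp add: sgH)
  have fd: "finite_dim (hom_space C (Q \<otimes> P) ?I)" by (rule finite_dim_hom) simp_all
  obtain t where t: "vfunctional (hom_space C (Q \<otimes> P) ?I) t" "t sg = 1"
    using V.ex_functional[OF fd sgV sgnz] .
  have nd1: "\<exists>k\<in>Hom C Q (LDual C X). Ev C X \<cdot> (k \<otimes>\<^sub>m h) = sg"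
    if X: "X \<in> Ob C" and h: "h \<in> Hom C P X" "h \<noteq> Zer C P X" for X h
  proof -
    obtain J m ep where ep: "ep \<in> Hom C P J" "epi_arrow C ep" and m: "m \<in> Hom C J X" "mono_arrow C m"
      and hm: "h = m \<cdot> ep" using imageE[OF h(1)] .
    have [simp]: "m \<in> Ar C" "Dom C m = J" "Cod C m = X" "ep \<in> Ar C" "Dom C ep = P" "Cod C ep = J" "J \<in> Ob C" "X \<in> Ob C"
      using ep m Hom_Ob by (auto simp: Hom_iff)
    have "\<not> is_zero_object C J"
    proof
      assume "is_zero_object C J"
      then have "ep = Zer C P J" using zero_Hom_to ep by blast
      then show False using h(2) hm by (simp add: Comp_Zer)
    qed
    then obtain s where s: "s \<in> Hom C J S" "s \<cdot> ep = p" using proj_cover_factor[OF p S ep] by blast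
    note dJ = left_dual[OF \<open>J \<in> Ob C\<close>] and dX = left_dual[OF X]
    obtain m' where m': "transposes J (LDual C J) (Ev C J) X (LDual C X) (Ev C X) m m'"
      using ex_right_transpose[OF dJ dX m(1)] .
    obtain s' where s': "transposes J (LDual C J) (Ev C J) S T e s s'" using ex_right_transpose[OF dJ d s(1)] .
    have m'e: "epi_arrow C m'" by (rule transposes_epi_right[OF dJ dX m' m(2)])
    have m'H: "m' \<in> Hom C (LDual C X) (LDual C J)" and s'H: "s' \<in> Hom C T (LDual C J)"
      using m' s' by (auto simp: transposes_def)
    obtain k where k: "k \<in> Hom C Q (LDual C X)" "m' \<cdot> k = s' \<cdot> q"
      using projective_lift[OF PQ(2) m'e m'H Comp_Hom[OF qH s'H]] .
    have "Ev C X \<cdot> (k \<otimes>\<^sub>m h) = Ev C J \<cdot> ((m' \<cdot> k) \<otimes>\<^sub>m ep)"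
      unfolding hm by (rule transposes_pair[OF dJ dX m' k(1) ep(1)])
    also have "\<dots> = e \<cdot> (q \<otimes>\<^sub>m (s \<cdot> ep))"
      unfolding k(2) by (rule transposes_pair[OF dJ d s' qH ep(1), symmetric])
    finally show ?thesis using k(1) s(2) by (auto simp: sg_def)
  qed
  \<comment> \<open>The mirror image of \<open>nd1\<close>. The image \<open>L\<close> of
    \<open>k\<close> is now a subobject of the dual of \<open>X\<close>, so a right dual
    \<open>L'\<close> of \<open>L\<close> is used to transpose.\<close>
  have nd2: "\<exists>h\<in>Hom C P X. Ev C X \<cdot> (k \<otimes>\<^sub>m h) = sg"
    if X: "X \<in> Ob C" and k: "k \<in> Hom C Q (LDual C X)" "k \<noteq> Zer C Q (LDual C X)" for X k
  proof -
    note dX = left_dual[OF X]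
    note [simp] = left_dualD(1-8)[OF dX]
    obtain L m ep where ep: "ep \<in> Hom C Q L" "epi_arrow C ep" and m: "m \<in> Hom C L (LDual C X)" "mono_arrow C m"
      and km: "k = m \<cdot> ep" using imageE[OF k(1)] .
    have [simp]: "m \<in> Ar C" "Dom C m = L" "Cod C m = LDual C X" "ep \<in> Ar C" "Dom C ep = Q" "Cod C ep = L" "L \<in> Ob C"
      using ep m Hom_Ob by (auto simp: Hom_iff)
    have "\<not> is_zero_object C L"
    proof
      assume "is_zero_object C L"
      then have "ep = Zer C Q L" using zero_Hom_to ep by blast
      then show False using k(2) km by (simp add: Comp_Zer)
    qed
    then obtain s where s: "s \<in> Hom C L T" "s \<cdot> ep = q" using proj_cover_factor[OF q T ep] by blast
    obtain L' eL cL where dL: "is_left_dual C L' L eL cL" using ex_right_dual[of L] by auto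
    obtain m' where m': "transposes X (LDual C X) (Ev C X) L' L eL m' m" using ex_left_transpose[OF dX dL m(1)] .
    obtain s' where s': "transposes S T e L' L eL s' s" using ex_left_transpose[OF d dL s(1)] .
    have m'e: "epi_arrow C m'" by (rule transposes_epi_left[OF dX dL m' m(2)])
    have m'H: "m' \<in> Hom C X L'" and s'H: "s' \<in> Hom C S L'" using m' s' by (auto simp: transposes_def)
    obtain h where h: "h \<in> Hom C P X" "m' \<cdot> h = s' \<cdot> p"
      using projective_lift[OF PQ(1) m'e m'H Comp_Hom[OF pH s'H]] .
    have "Ev C X \<cdot> (k \<otimes>\<^sub>m h) = eL \<cdot> (ep \<otimes>\<^sub>m (m' \<cdot> h))"
      unfolding km by (rule transposes_pair[OF dX dL m' ep(1) h(1), symmetric])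
    also have "\<dots> = e \<cdot> ((s \<cdot> ep) \<otimes>\<^sub>m p)"
      unfolding h(2) by (rule transposes_pair[OF d dL s' ep(1) pH])
    finally show ?thesis using h(1) s(2) by (auto simp: sg_def)
  qed
  show thesis
  proof (rule that[OF \<open>P \<in> Ob C\<close> t(1)])
    show "\<forall>X\<in>Ob C. \<forall>h\<in>Hom C P X - {Zer C P X}. \<exists>k\<in>Hom C Q (LDual C X). t (Ev C X \<cdot> (k \<otimes>\<^sub>m h)) = 1"
      using nd1 t(2) by (metis DiffD1 DiffD2 singletonI)
    show "\<forall>X\<in>Ob C. \<forall>k\<in>Hom C Q (LDual C X) - {Zer C Q (LDual C X)}. \<exists>h\<in>Hom C P X. t (Ev C X \<cdot> (k \<otimes>\<^sub>m h)) = 1"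
      using nd2 t(2) by (metis DiffD1 DiffD2 singletonI)
  qed
qed

lemma ex_dual_bases:
  assumes P: "P \<in> Ob C" and Q: "Q \<in> Ob C" and X: "X \<in> Ob C"
    and vf: "vfunctional (hom_space C (Q \<otimes> P) (Unit C)) t"
    and nd1: "\<forall>h\<in>Hom C P X - {Zer C P X}. \<exists>k\<in>Hom C Q (LDual C X). t (Ev C X \<cdot> (k \<otimes>\<^sub>m h)) = 1"
    and nd2: "\<forall>k\<in>Hom C Q (LDual C X) - {Zer C Q (LDual C X)}. \<exists>h\<in>Hom C P X. t (Ev C X \<cdot> (k \<otimes>\<^sub>m h)) = 1"
  shows "\<exists>n h k. (\<forall>i<n. h i \<in> Hom C P X \<and> k i \<in> Hom C Q (LDual C X)) \<and> vindep (hom_space C P X) n h \<and>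
    (\<forall>x\<in>Hom C P X. x = hsum P X (\<lambda>i. Scale C (t (Ev C X \<cdot> (k i \<otimes>\<^sub>m x))) (h i)) n) \<and>
    (\<forall>y\<in>Hom C Q (LDual C X). y = hsum Q (LDual C X) (\<lambda>i. Scale C (t (Ev C X \<cdot> (y \<otimes>\<^sub>m h i))) (k i)) n)"
proof -
  let ?D = "LDual C X" and ?I = "Unit C"
  have t: "\<And>f g. \<lbrakk>f \<in> Hom C (Q \<otimes> P) ?I; g \<in> Hom C (Q \<otimes> P) ?I\<rbrakk> \<Longrightarrow> t (Add C f g) = t f + t g"
    "\<And>a f. f \<in> Hom C (Q \<otimes> P) ?I \<Longrightarrow> t (Scale C a f) = a * t f"
    using vf by (simp_all add: vfunctional_def)
  note d [simp] = left_dualD(1-8)[OF left_dual[OF X]]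
  have e: "Ev C X \<in> Hom C (?D \<otimes> X) ?I" by (simp add: Hom_iff)
  let ?U = "hom_space C P X" and ?V = "hom_space C Q ?D"
  let ?b = "\<lambda>x y. t (Ev C X \<cdot> (y \<otimes>\<^sub>m x))"
  have H: "Ev C X \<cdot> (y \<otimes>\<^sub>m x) \<in> Hom C (Q \<otimes> P) ?I" if "x \<in> Hom C P X" "y \<in> Hom C Q ?D" for x y
    by (rule Comp_Hom[OF TensM_Hom[OF that(2,1)] e])
  have T: "y \<otimes>\<^sub>m x \<in> Hom C (Q \<otimes> P) (?D \<otimes> X)" if "x \<in> Hom C P X" "y \<in> Hom C Q ?D" for x y
    by (rule TensM_Hom[OF that(2,1)])
  obtain n h k where hk: "\<And>i. i < n \<Longrightarrow> h i \<in> vcarrier ?U" "\<And>i. i < n \<Longrightarrow> k i \<in> vcarrier ?V"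
    and delta: "\<And>i j. \<lbrakk>i < n; j < n\<rbrakk> \<Longrightarrow> ?b (h i) (k j) = (if i = j then 1 else 0)"
    and ex: "\<And>x. x \<in> vcarrier ?U \<Longrightarrow> x = vcomb ?U (\<lambda>i. ?b x (k i)) h n"
    and ey: "\<And>y. y \<in> vcarrier ?V \<Longrightarrow> y = vcomb ?V (\<lambda>i. ?b (h i) y) k n"
    and ind: "vindep ?U n h"
  proof (rule perfect_pairing_dual_bases[of ?U ?V ?b])
    show "vector_space_struct ?U" "vector_space_struct ?V" "finite_dim ?U" using P Q X finite_dim_hom by auto
    show "?b (vadd ?U x y) v = ?b x v + ?b y v"
      if "x \<in> vcarrier ?U" "y \<in> vcarrier ?U" "v \<in> vcarrier ?V" for x y v
    proof -
      have xy: "x \<in> Hom C P X" "y \<in> Hom C P X" and v: "v \<in> Hom C Q ?D" using that by simp_all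
      show ?thesis using t(1)[OF H[OF xy(1) v] H[OF xy(2) v]]
        by (simp add: TensM_Add_right[OF v xy] Comp_Add[OF T[OF xy(1) v] T[OF xy(2) v] e])
    qed
    show "?b x (vadd ?V v w) = ?b x v + ?b x w"
      if "x \<in> vcarrier ?U" "v \<in> vcarrier ?V" "w \<in> vcarrier ?V" for x v w
    proof -
      have x: "x \<in> Hom C P X" and vw: "v \<in> Hom C Q ?D" "w \<in> Hom C Q ?D" using that by simp_all
      show ?thesis using t(1)[OF H[OF x vw(1)] H[OF x vw(2)]]
        by (simp add: TensM_Add_left[OF vw x] Comp_Add[OF T[OF x vw(1)] T[OF x vw(2)] e])
    qed
    show "?b (vscale ?U a x) v = a * ?b x v" if "x \<in> vcarrier ?U" "v \<in> vcarrier ?V" for a x v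
    proof -
      have x: "x \<in> Hom C P X" and v: "v \<in> Hom C Q ?D" using that by simp_all
      show ?thesis using t(2)[OF H[OF x v]] by (simp add: TensM_Scale_right[OF v x] Comp_Scale[OF T[OF x v] e])
    qed
    show "?b x (vscale ?V a v) = a * ?b x v" if "x \<in> vcarrier ?U" "v \<in> vcarrier ?V" for a x v
    proof -
      have x: "x \<in> Hom C P X" and v: "v \<in> Hom C Q ?D" using that by simp_all
      show ?thesis using t(2)[OF H[OF x v]] by (simp add: TensM_Scale_left[OF v x] Comp_Scale[OF T[OF x v] e])
    qed
    show "\<exists>v\<in>vcarrier ?V. ?b x v = 1" if "x \<in> vcarrier ?U" "x \<noteq> vzero ?U" for x using nd1 that by (simp del: bex_simps)
    show "\<exists>x\<in>vcarrier ?U. ?b x v = 1" if "v \<in> vcarrier ?V" "v \<noteq> vzero ?V" for v using nd2 that by simp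
  qed (rule that; assumption)
  show ?thesis
    using hk ex ey ind unfolding hsum_def vcomb_def by (intro exI[of _ n] exI[of _ h] exI[of _ k]) simp
qed

text \<open>The canonical element \<open>\<Sum> h\<^sub>i \<otimes> k\<^sub>i\<close> of the perfect pairing between \<open>Hom(P, X)\<close> and
  \<open>Hom(Q, X\<^sup>*)\<close> is dinatural in \<open>X\<close>.\<close>

lemma ex_dual_bases_wedge:
  assumes T: "simple_object C T" and q: "proj_cover C Q q T"
  obtains P n h k where "P \<in> Ob C"
    "\<And>X i. \<lbrakk>X \<in> Ob C; i < n X\<rbrakk> \<Longrightarrow> h X i \<in> Hom C P X"
    "\<And>X i. \<lbrakk>X \<in> Ob C; i < n X\<rbrakk> \<Longrightarrow> k X i \<in> Hom C Q (LDual C X)"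
    "\<And>X. X \<in> Ob C \<Longrightarrow> vindep (hom_space C P X) (n X) (h X)"
    "\<And>X y. \<lbrakk>X \<in> Ob C; y \<in> Hom C Q (LDual C X)\<rbrakk> \<Longrightarrow> \<exists>c. y = hsum Q (LDual C X) (\<lambda>i. Scale C (c i) (k X i)) (n X)"
    "is_wedge C C (\<lambda>X Y. Y \<otimes> LDual C X) (\<lambda>f g. g \<otimes>\<^sub>m dual_map C f) (P \<otimes> Q)
      (\<lambda>X. hsum (P \<otimes> Q) (X \<otimes> LDual C X) (\<lambda>i. h X i \<otimes>\<^sub>m k X i) (n X))"
proof -
  obtain P t where P [simp]: "P \<in> Ob C" and t: "vfunctional (hom_space C (Q \<otimes> P) (Unit C)) t"
    and nd: "\<forall>X\<in>Ob C. \<forall>h\<in>Hom C P X - {Zer C P X}. \<exists>k\<in>Hom C Q (LDual C X). t (Ev C X \<cdot> (k \<otimes>\<^sub>m h)) = 1"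
    "\<forall>X\<in>Ob C. \<forall>k\<in>Hom C Q (LDual C X) - {Zer C Q (LDual C X)}. \<exists>h\<in>Hom C P X. t (Ev C X \<cdot> (k \<otimes>\<^sub>m h)) = 1"
    using ex_perfect_pairing[OF T q] .
  have Q [simp]: "Q \<in> Ob C" using q Hom_Ob unfolding proj_cover_def by blast
  have LD [simp]: "LDual C X \<in> Ob C" if "X \<in> Ob C" for X using left_dualD(2)[OF left_dual[OF that]] .
  define G where "G X n h k \<longleftrightarrow> (\<forall>i<n. h i \<in> Hom C P X \<and> k i \<in> Hom C Q (LDual C X)) \<and> vindep (hom_space C P X) n h \<and>
    (\<forall>x\<in>Hom C P X. x = hsum P X (\<lambda>i. Scale C (t (Ev C X \<cdot> (k i \<otimes>\<^sub>m x))) (h i)) n) \<and>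
    (\<forall>y\<in>Hom C Q (LDual C X). y = hsum Q (LDual C X) (\<lambda>i. Scale C (t (Ev C X \<cdot> (y \<otimes>\<^sub>m h i))) (k i)) n)"
    for X n h k
  have "\<exists>n h k. G X n h k" if "X \<in> Ob C" for X
    unfolding G_def by (rule ex_dual_bases[OF P Q that t]) (use nd that in blast)+
  then obtain n h k where "\<And>X. X \<in> Ob C \<Longrightarrow> G X (n X) (h X) (k X)" by metis
  note nhk = this[unfolded G_def]
  have hH: "h X i \<in> Hom C P X" and kH: "k X i \<in> Hom C Q (LDual C X)" if "X \<in> Ob C" "i < n X" for X i
    using nhk[OF that(1)] that(2) by blast+
  have ex: "x = hsum P X (\<lambda>i. Scale C (t (Ev C X \<cdot> (k X i \<otimes>\<^sub>m x))) (h X i)) (n X)" if "X \<in> Ob C" "x \<in> Hom C P X" for X x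
    using nhk[OF that(1)] that(2) by blast
  have ey: "y = hsum Q (LDual C X) (\<lambda>i. Scale C (t (Ev C X \<cdot> (y \<otimes>\<^sub>m h X i))) (k X i)) (n X)" if "X \<in> Ob C" "y \<in> Hom C Q (LDual C X)" for X y
    using nhk[OF that(1)] that(2) by blast
  let ?q = "\<lambda>X. hsum (P \<otimes> Q) (X \<otimes> LDual C X) (\<lambda>i. h X i \<otimes>\<^sub>m k X i) (n X)"
  have hkH: "h X i \<otimes>\<^sub>m k X i \<in> Hom C (P \<otimes> Q) (X \<otimes> LDual C X)" if "X \<in> Ob C" "i < n X" for X i
    by (rule TensM_Hom[OF hH[OF that] kH[OF that]])
  have qH: "?q X \<in> Hom C (P \<otimes> Q) (X \<otimes> LDual C X)" if "X \<in> Ob C" for X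
    by (rule hsum_Hom) (use hkH that in auto)
  have nat: "(f \<otimes>\<^sub>m dual_map C (Idn C A)) \<cdot> ?q A = (Idn C B \<otimes>\<^sub>m dual_map C f) \<cdot> ?q B"
    if A [simp]: "A \<in> Ob C" and B [simp]: "B \<in> Ob C" and f: "f \<in> Hom C A B" for A B f
  proof -
    let ?A = "LDual C A" and ?B = "LDual C B"
    note dA = left_dual[OF A] and dB = left_dual[OF B]
    have [simp]: "f \<in> Ar C" "Dom C f = A" "Cod C f = B" using f by (auto simp: Hom_iff)
    have idA: "dual_map C (Idn C A) = Idn C ?A"
      by (rule transposes_unique_right[OF dA dA dual_map_transposes transposes_Idn[OF dA]]) (simp add: Hom_iff)
    note tr = dual_map_transposes[OF f]
    have gH: "dual_map C f \<in> Hom C ?B ?A" using tr by (simp add: transposes_def)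
    then have [simp]: "dual_map C f \<in> Ar C" "Dom C (dual_map C f) = ?B" "Cod C (dual_map C f) = ?A" by (auto simp: Hom_iff)
    \<comment> \<open>\<open>b\<close> is the matrix of composition with \<open>f\<close> in the
      bases \<open>h A\<close> and \<open>h B\<close>. By \<open>transposes_pair\<close> the dual
      map has the transposed matrix in the bases \<open>k B\<close> and \<open>k A\<close>, so both
      sides of the wedge condition are the same double sum.\<close>
    define b where "b i j = t (Ev C B \<cdot> (k B j \<otimes>\<^sub>m (f \<cdot> h A i)))" for i j
    have fA: "f \<otimes>\<^sub>m Idn C ?A \<in> Hom C (A \<otimes> ?A) (B \<otimes> ?A)" and Bf: "Idn C B \<otimes>\<^sub>m dual_map C f \<in> Hom C (B \<otimes> ?B) (B \<otimes> ?A)"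
      by (simp_all add: Hom_iff)
    have hk': "h B j \<otimes>\<^sub>m k A i \<in> Hom C (P \<otimes> Q) (B \<otimes> ?A)" if "i < n A" "j < n B" for i j
      by (rule TensM_Hom[OF hH[OF B that(2)] kH[OF A that(1)]])
    have fh: "f \<cdot> h A i = hsum P B (\<lambda>j. Scale C (b i j) (h B j)) (n B)" if "i < n A" for i
      unfolding b_def by (rule ex[OF B Comp_Hom[OF hH[OF A that] f]])
    have gk: "dual_map C f \<cdot> k B j = hsum Q ?A (\<lambda>i. Scale C (b i j) (k A i)) (n A)" if j: "j < n B" for j
    proof -
      have "dual_map C f \<cdot> k B j = hsum Q ?A (\<lambda>i. Scale C (t (Ev C A \<cdot> ((dual_map C f \<cdot> k B j) \<otimes>\<^sub>m h A i))) (k A i)) (n A)"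
        by (rule ey[OF A Comp_Hom[OF kH[OF B j] gH]])
      also have "\<dots> = hsum Q ?A (\<lambda>i. Scale C (b i j) (k A i)) (n A)"
        unfolding b_def by (rule hsum_cong) (simp add: transposes_pair[OF dA dB tr kH[OF B j] hH[OF A]])
      finally show ?thesis .
    qed
    have "(f \<otimes>\<^sub>m Idn C ?A) \<cdot> ?q A = hsum (P \<otimes> Q) (B \<otimes> ?A) (\<lambda>i. (f \<otimes>\<^sub>m Idn C ?A) \<cdot> (h A i \<otimes>\<^sub>m k A i)) (n A)"
      by (rule Comp_hsum[OF fA]) (auto intro: hkH)
    also have "\<dots> = hsum (P \<otimes> Q) (B \<otimes> ?A) (\<lambda>i. hsum (P \<otimes> Q) (B \<otimes> ?A) (\<lambda>j. Scale C (b i j) (h B j \<otimes>\<^sub>m k A i)) (n B)) (n A)"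
    proof (rule hsum_cong)
      fix i assume i: "i < n A"
      have [simp]: "h A i \<in> Ar C" "Dom C (h A i) = P" "Cod C (h A i) = A" "k A i \<in> Ar C" "Dom C (k A i) = Q" "Cod C (k A i) = ?A"
        using hH[OF A i] kH[OF A i] by (auto simp: Hom_iff)
      have "(f \<otimes>\<^sub>m Idn C ?A) \<cdot> (h A i \<otimes>\<^sub>m k A i) = (f \<cdot> h A i) \<otimes>\<^sub>m k A i" by (simp add: TensM_merge)
      also have "\<dots> = hsum (P \<otimes> Q) (B \<otimes> ?A) (\<lambda>j. Scale C (b i j) (h B j) \<otimes>\<^sub>m k A i) (n B)"
        unfolding fh[OF i] by (rule hsum_TensM[OF kH[OF A i]]) (simp_all add: Scale_Hom[OF hH[OF B]])
      also have "\<dots> = hsum (P \<otimes> Q) (B \<otimes> ?A) (\<lambda>j. Scale C (b i j) (h B j \<otimes>\<^sub>m k A i)) (n B)"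
        by (rule hsum_cong) (rule TensM_Scale_left[OF hH[OF B] kH[OF A i]])
      finally show "(f \<otimes>\<^sub>m Idn C ?A) \<cdot> (h A i \<otimes>\<^sub>m k A i)
          = hsum (P \<otimes> Q) (B \<otimes> ?A) (\<lambda>j. Scale C (b i j) (h B j \<otimes>\<^sub>m k A i)) (n B)" .
    qed
    also have "\<dots> = hsum (P \<otimes> Q) (B \<otimes> ?A) (\<lambda>j. hsum (P \<otimes> Q) (B \<otimes> ?A) (\<lambda>i. Scale C (b i j) (h B j \<otimes>\<^sub>m k A i)) (n A)) (n B)"
      by (rule hsum_swap) (simp_all add: Scale_Hom[OF hk'])
    also have "\<dots> = hsum (P \<otimes> Q) (B \<otimes> ?A) (\<lambda>j. (Idn C B \<otimes>\<^sub>m dual_map C f) \<cdot> (h B j \<otimes>\<^sub>m k B j)) (n B)"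
    proof (rule hsum_cong)
      fix j assume j: "j < n B"
      have [simp]: "h B j \<in> Ar C" "Dom C (h B j) = P" "Cod C (h B j) = B" "k B j \<in> Ar C" "Dom C (k B j) = Q" "Cod C (k B j) = ?B"
        using hH[OF B j] kH[OF B j] by (auto simp: Hom_iff)
      have "(Idn C B \<otimes>\<^sub>m dual_map C f) \<cdot> (h B j \<otimes>\<^sub>m k B j) = h B j \<otimes>\<^sub>m (dual_map C f \<cdot> k B j)" by (simp add: TensM_merge)
      also have "\<dots> = hsum (P \<otimes> Q) (B \<otimes> ?A) (\<lambda>i. h B j \<otimes>\<^sub>m Scale C (b i j) (k A i)) (n A)"
        unfolding gk[OF j] by (rule TensM_hsum[OF hH[OF B j]]) (simp_all add: Scale_Hom[OF kH[OF A]])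
      also have "\<dots> = hsum (P \<otimes> Q) (B \<otimes> ?A) (\<lambda>i. Scale C (b i j) (h B j \<otimes>\<^sub>m k A i)) (n A)"
        by (rule hsum_cong) (rule TensM_Scale_right[OF hH[OF B j] kH[OF A]])
      finally show "hsum (P \<otimes> Q) (B \<otimes> ?A) (\<lambda>i. Scale C (b i j) (h B j \<otimes>\<^sub>m k A i)) (n A)
          = (Idn C B \<otimes>\<^sub>m dual_map C f) \<cdot> (h B j \<otimes>\<^sub>m k B j)" by simp
    qed
    also have "\<dots> = (Idn C B \<otimes>\<^sub>m dual_map C f) \<cdot> ?q B"
      by (rule Comp_hsum[OF Bf, symmetric]) (auto intro: hkH)
    finally show ?thesis unfolding idA .
  qed
  show thesis
  proof (rule that[of P n h k])
    show "is_wedge C C (\<lambda>X Y. Y \<otimes> LDual C X) (\<lambda>f g. g \<otimes>\<^sub>m dual_map C f) (P \<otimes> Q) ?q"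
      unfolding is_wedge_def using qH nat by simp
    show "\<exists>c. y = hsum Q (LDual C X) (\<lambda>i. Scale C (c i) (k X i)) (n X)" if "X \<in> Ob C" "y \<in> Hom C Q (LDual C X)" for X y
      by (rule exI, rule ey[OF that])
    show "vindep (hom_space C P X) (n X) (h X)" if "X \<in> Ob C" for X using nhk[OF that] by blast
  qed (use hH kH in auto)
qed

end

section \<open>Multiples of the unit object\<close>

lemma vindepD: "\<lbrakk>vcomb V c b n = vzero V; vindep V n b; i < n\<rbrakk> \<Longrightarrow> c i = 0"
  by (simp add: vindep_def)

lemma vlinear_Comp_fun: "\<lbrakk>vlinear U V f; vlinear V W g\<rbrakk> \<Longrightarrow> vlinear U W (\<lambda>x. g (f x))"
  by (simp add: vlinear_def)

context linear_category
begin

text \<open>This presents \<open>X\<close> as a direct sum of \<open>n\<close> copies of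
  \<open>U\<close>, with inclusions \<open>i\<close> and projections \<open>r\<close>, purely by
  equations.\<close>

definition unit_sum :: "'a \<Rightarrow> 'a \<Rightarrow> nat \<Rightarrow> (nat \<Rightarrow> 'b) \<Rightarrow> (nat \<Rightarrow> 'b) \<Rightarrow> bool" where
  "unit_sum U X n i r \<longleftrightarrow> U \<in> Ob C \<and> X \<in> Ob C \<and> (\<forall>a<n. i a \<in> Hom C U X \<and> r a \<in> Hom C X U) \<and>
     (\<forall>a<n. \<forall>b<n. r a \<cdot> i b = (if a = b then Idn C U else Zer C U U)) \<and>
     hsum X X (\<lambda>a. i a \<cdot> r a) n = Idn C X"

lemma unit_sum_iso:
  assumes X: "unit_sum U X n i r" and g: "g \<in> Hom C X Y" "iso C g"
  shows "unit_sum U Y n (\<lambda>a. g \<cdot> i a) (\<lambda>a. r a \<cdot> Inv C g)"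
proof -
  have [simp]: "g \<in> Ar C" "Dom C g = X" "Cod C g = Y" "X \<in> Ob C" "Y \<in> Ob C" "U \<in> Ob C" "iso C g"
    using g Hom_Ob X by (auto simp: Hom_iff unit_sum_def)
  have ir [simp]: "i a \<in> Ar C" "Dom C (i a) = U" "Cod C (i a) = X" "r a \<in> Ar C" "Dom C (r a) = X" "Cod C (r a) = U"
    if "a < n" for a
    using X that by (auto simp: unit_sum_def Hom_iff)
  have sum: "hsum X X (\<lambda>a. i a \<cdot> r a) n = Idn C X"
    and rid: "\<And>a b. \<lbrakk>a < n; b < n\<rbrakk> \<Longrightarrow> r a \<cdot> i b = (if a = b then Idn C U else Zer C U U)"
    using X by (auto simp: unit_sum_def)
  have gi: "Inv C g \<in> Hom C Y X" by (simp add: Hom_iff)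
  have "hsum Y Y (\<lambda>a. (g \<cdot> i a) \<cdot> (r a \<cdot> Inv C g)) n = hsum Y Y (\<lambda>a. g \<cdot> ((i a \<cdot> r a) \<cdot> Inv C g)) n"
    by (rule hsum_cong) simp
  also have "\<dots> = g \<cdot> hsum Y X (\<lambda>a. (i a \<cdot> r a) \<cdot> Inv C g) n"
    by (rule Comp_hsum[OF g(1), symmetric]) (simp_all add: Hom_iff)
  also have "hsum Y X (\<lambda>a. (i a \<cdot> r a) \<cdot> Inv C g) n = hsum X X (\<lambda>a. i a \<cdot> r a) n \<cdot> Inv C g"
    by (rule hsum_Comp[OF gi, symmetric]) (simp_all add: Hom_iff)
  finally have 1: "hsum Y Y (\<lambda>a. (g \<cdot> i a) \<cdot> (r a \<cdot> Inv C g)) n = Idn C Y" unfolding sum by simp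
  have 2: "(r a \<cdot> Inv C g) \<cdot> (g \<cdot> i b) = (if a = b then Idn C U else Zer C U U)" if "a < n" "b < n" for a b
  proof -
    have "(r a \<cdot> Inv C g) \<cdot> (g \<cdot> i b) = r a \<cdot> i b" using that by simp
    then show ?thesis using rid[OF that] by simp
  qed
  show ?thesis unfolding unit_sum_def using 1 2 by (simp add: Hom_iff)
qed

end

context abelian_category
begin

lemma Hom_simple_mono:
  assumes S: "simple_object C S" and f: "f \<in> Hom C S B" "f \<noteq> Zer C S B"
  shows "mono_arrow C f"
proof (rule mono_arrowI[OF f(1)])
  fix Z g assume g: "g \<in> Hom C Z S" "f \<cdot> g = Zer C Z B"
  obtain K k where k: "k \<in> Hom C K S" "mono_arrow C k" "f \<cdot> k = Zer C K B"
    and k_uni: "\<And>Z g. \<lbrakk>g \<in> Hom C Z S; f \<cdot> g = Zer C Z B\<rbrakk> \<Longrightarrow> \<exists>u\<in>Hom C Z K. k \<cdot> u = g"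
    using kernelE[OF f(1)] by metis
  have [simp]: "f \<in> Ar C" "Dom C f = S" "Cod C f = B" "k \<in> Ar C" "Dom C k = K" "Cod C k = S" "B \<in> Ob C" "Z \<in> Ob C"
    using f k g Hom_Ob by (auto simp: Hom_iff)
  consider "is_zero_object C K" | "iso C k" using S k by (auto simp: simple_object_def)
  then show "g = Zer C Z S"
  proof cases
    case 1
    obtain u where u: "u \<in> Hom C Z K" "k \<cdot> u = g" using k_uni[OF g] by blast
    have "g = k \<cdot> Zer C Z K" using zero_Hom_to[OF 1 u(1)] u(2) by simp
    then show ?thesis by (simp add: Comp_Zer)
  next
    case 2
    have "f \<cdot> k = Zer C (Dom C k) B" using k(3) by simp
    then have "f = Zer C S B" using epi_ZerD[OF _ iso_epi[OF 2], of f B] f(1) by simp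
    then show ?thesis using f(2) by simp
  qed
qed

lemma ex_unit_sum:
  assumes U: "U \<in> Ob C"
  shows "\<exists>X i r. unit_sum U X n i r"
proof (induction n)
  case 0
  obtain Z where "is_zero_object C Z" using ex_zero by blast
  then have "unit_sum U Z 0 i r" for i r
    using U by (simp add: unit_sum_def hsum_def zero_object_iff)
  then show ?case by blast
next
  case (Suc n)
  then obtain X i r where X: "unit_sum U X n i r" by blast
  have [simp]: "U \<in> Ob C" "X \<in> Ob C" using X by (auto simp: unit_sum_def)
  have ir [simp]: "i a \<in> Ar C" "Dom C (i a) = U" "Cod C (i a) = X" "r a \<in> Ar C" "Dom C (r a) = X" "Cod C (r a) = U"
    if "a < n" for a
    using X that by (auto simp: unit_sum_def Hom_iff)
  have sum: "hsum X X (\<lambda>a. i a \<cdot> r a) n = Idn C X"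
    and rid: "\<And>a b. \<lbrakk>a < n; b < n\<rbrakk> \<Longrightarrow> r a \<cdot> i b = (if a = b then Idn C U else Zer C U U)"
    using X by (auto simp: unit_sum_def)
  obtain S s j p q where b: "is_biproduct C X U S s j p q" using ex_biproduct[of X U] by auto
  have [simp]: "S \<in> Ob C" "s \<in> Ar C" "Dom C s = X" "Cod C s = S" "j \<in> Ar C" "Dom C j = U" "Cod C j = S"
    "p \<in> Ar C" "Dom C p = S" "Cod C p = X" "q \<in> Ar C" "Dom C q = S" "Cod C q = U"
    and ps: "p \<cdot> s = Idn C X" and qj: "q \<cdot> j = Idn C U" and pj: "p \<cdot> j = Zer C U X" and qs: "q \<cdot> s = Zer C X U"
    and bsum: "Add C (s \<cdot> p) (j \<cdot> q) = Idn C S"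
    using b by (auto simp: is_biproduct_def Hom_iff)
  have sH: "s \<in> Hom C X S" and pH: "p \<in> Hom C S X" by (simp_all add: Hom_iff)
  define i' where "i' a = (if a < n then s \<cdot> i a else j)" for a
  define r' where "r' a = (if a < n then r a \<cdot> p else q)" for a
  have "hsum S S (\<lambda>a. i' a \<cdot> r' a) (Suc n) = Add C (hsum S S (\<lambda>a. i' a \<cdot> r' a) n) (j \<cdot> q)"
    by (simp add: hsum_def i'_def r'_def)
  also have "hsum S S (\<lambda>a. i' a \<cdot> r' a) n = hsum S S (\<lambda>a. s \<cdot> ((i a \<cdot> r a) \<cdot> p)) n"
    by (rule hsum_cong) (simp add: i'_def r'_def)
  also have "\<dots> = s \<cdot> hsum S X (\<lambda>a. (i a \<cdot> r a) \<cdot> p) n"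
    by (rule Comp_hsum[OF sH, symmetric]) (simp_all add: Hom_iff)
  also have "hsum S X (\<lambda>a. (i a \<cdot> r a) \<cdot> p) n = hsum X X (\<lambda>a. i a \<cdot> r a) n \<cdot> p"
    by (rule hsum_Comp[OF pH, symmetric]) (simp_all add: Hom_iff)
  finally have 1: "hsum S S (\<lambda>a. i' a \<cdot> r' a) (Suc n) = Idn C S" unfolding sum by (simp add: bsum)
  have 2: "r' a \<cdot> i' b = (if a = b then Idn C U else Zer C U U)" if ab: "a < Suc n" "b < Suc n" for a b
  proof -
    have A: "(r a \<cdot> p) \<cdot> (s \<cdot> i b) = (if a = b then Idn C U else Zer C U U)" if "a < n" "b < n"
    proof -
      have "(r a \<cdot> p) \<cdot> (s \<cdot> i b) = r a \<cdot> (p \<cdot> s) \<cdot> i b" using that by simp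
      then show ?thesis unfolding ps using that rid by simp
    qed
    have B: "(r a \<cdot> p) \<cdot> j = Zer C U U" if "a < n"
    proof -
      have "(r a \<cdot> p) \<cdot> j = r a \<cdot> (p \<cdot> j)" using that by simp
      then show ?thesis unfolding pj using that by (simp add: Comp_Zer)
    qed
    have D: "q \<cdot> (s \<cdot> i b) = Zer C U U" if "b < n"
    proof -
      have "q \<cdot> (s \<cdot> i b) = (q \<cdot> s) \<cdot> i b" using that by simp
      then show ?thesis unfolding qs using that by (simp add: Zer_Comp)
    qed
    show ?thesis using A B D qj ab by (auto simp: i'_def r'_def less_Suc_eq)
  qed
  have "unit_sum U S (Suc n) i' r'"
    unfolding unit_sum_def using 1 2 by (auto simp: Hom_iff i'_def r'_def)
  then show ?case by blast
qed

end

section \<open>Independence of morphisms to and from the unit\<close>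

context braided_finite_tensor_category
begin

abbreviation "unit \<equiv> Unit C"

lemma Hom_Unit_epi: "\<lbrakk>f \<in> Hom C A unit; f \<noteq> Zer C A unit\<rbrakk> \<Longrightarrow> epi_arrow C f"
  by (rule Hom_simple_epi[OF Unit_simple])

lemma vindep_nonzero:
  assumes "vindep (hom_space C A B) n f" "j < n" "A \<in> Ob C" "B \<in> Ob C"
  shows "f j \<noteq> Zer C A B"
proof
  interpret V: vector_space_struct "hom_space C A B" using assms by simp
  assume "f j = Zer C A B"
  then have "vcomb (hom_space C A B) (\<lambda>i. if i = j then 1 else 0) f n = Zer C A B"
    using V.vcomb_delta[of j n f] assms by (simp add: vindep_def)
  then show False using assms unfolding vindep_def by fastforce
qed

text \<open>Restriction to the kernel \<open>K\<close> of \<open>f n\<close> removes the last term.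
  The other \<open>f i\<close> stay independent there: a combination that vanishes on
  \<open>K\<close> factors through the epi \<open>f n\<close>, and is then a multiple of it because
  endomorphisms of the unit are scalars. After the induction hypothesis only
  \<open>f n \<otimes> w n = 0\<close> is left, and \<open>f n \<otimes> id\<close> is epi.\<close>

lemma unit_Tens_indep:
  assumes "vindep (hom_space C Z unit) n f" "Z \<in> Ob C" and W: "W \<in> Ob C" "B \<in> Ob C"
    and "\<And>i. i < n \<Longrightarrow> w i \<in> Hom C W B"
    and "hsum (Z \<otimes> W) (unit \<otimes> B) (\<lambda>i. f i \<otimes>\<^sub>m w i) n = Zer C (Z \<otimes> W) (unit \<otimes> B)"
  shows "\<forall>i<n. w i = Zer C W B"
  using assms(1,2,5,6)
proof (induction n arbitrary: Z f)
  case 0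
  then show ?case by simp
next
  case (Suc n)
  note [simp] = W Suc.prems(2)
  have fH: "f i \<in> Hom C Z unit" if "i < Suc n" for i using Suc.prems(1) that by (simp add: vindep_def)
  have [simp]: "f i \<in> Ar C" "Dom C (f i) = Z" "Cod C (f i) = unit" "w i \<in> Ar C" "Dom C (w i) = W" "Cod C (w i) = B"
    if "i < Suc n" for i using fH Suc.prems(3) that by (auto simp: Hom_iff)
  have fn: "epi_arrow C (f n)" "f n \<in> Hom C Z unit"
    using vindep_nonzero[OF Suc.prems(1)] Hom_Unit_epi[OF fH] fH by auto
  obtain K k where k: "k \<in> Hom C K Z" "f n \<cdot> k = Zer C K unit"
    and k_uni: "\<And>Y g. \<lbrakk>g \<in> Hom C Y Z; f n \<cdot> g = Zer C Y unit\<rbrakk> \<Longrightarrow> \<exists>u\<in>Hom C Y K. k \<cdot> u = g"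
    using kernelE[OF fn(2)] by metis
  have [simp]: "k \<in> Ar C" "Dom C k = K" "Cod C k = Z" "K \<in> Ob C" using k Hom_Ob by (auto simp: Hom_iff)
  let ?V = "hom_space C Z unit" and ?K = "hom_space C K unit"
  interpret V: vector_space_struct ?V by simp
  interpret KW: vector_space_struct "hom_space C (K \<otimes> W) (unit \<otimes> B)" by simp
  interpret ZW: vector_space_struct "hom_space C (Z \<otimes> W) (unit \<otimes> B)" by simp
  have fwH: "f i \<otimes>\<^sub>m w i \<in> Hom C (Z \<otimes> W) (unit \<otimes> B)" if "i < Suc n" for i
    using that by (simp add: Hom_iff)
  have indK: "vindep ?K n (\<lambda>i. f i \<cdot> k)"
    unfolding vindep_def
  proof (intro conjI allI impI)
    fix i assume "i < n" then show "f i \<cdot> k \<in> vcarrier ?K" by (simp add: Hom_iff)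
  next
    fix c i assume 0: "vcomb ?K c (\<lambda>i. f i \<cdot> k) n = vzero ?K" and i: "i < n"
    have vH: "vcomb ?V c f n \<in> Hom C Z unit" using V.vcomb_closed[of n f c] fH by simp
    have "vcomb ?V c f n \<cdot> k = vcomb ?K c (\<lambda>i. f i \<cdot> k) n"
      by (rule V.vlinear_vcomb[OF vlinear_Comp_right[OF k(1)] hom_vs]) (simp_all add: fH)
    then have "vcomb ?V c f n \<cdot> k = Zer C K unit" using 0 by simp
    then obtain u where u: "u \<in> Hom C unit unit" "u \<cdot> f n = vcomb ?V c f n"
      using epi_cokernel_of_kernel[OF fn k(1) k_uni vH] by blast
    obtain a where "u = Scale C a (Idn C unit)" using End_Unit_scalar[OF u(1)] .
    then have a: "vcomb ?V c f n = Scale C a (f n)" using u(2) by (simp add: Scale_Comp')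
    have "vcomb ?V (c(n := - a)) f (Suc n) = vadd ?V (vcomb ?V c f n) (vscale ?V (- a) (f n))"
      unfolding vcomb_def by (auto intro!: arg_cong2[of _ _ _ _ "Add C"] vsum_cong)
    also have "\<dots> = Add C (Scale C a (f n)) (Scale C (-1) (Scale C a (f n)))"
      by (simp add: a Scale_Scale)
    also have "\<dots> = vzero ?V" using diff_self[OF Scale_Hom[OF fn(2)]] by simp
    finally have "(c(n := - a)) i = 0" by (rule vindepD[OF _ Suc.prems(1)]) (use i in simp)
    then show "c i = 0" using i by simp
  qed
  have kW: "k \<otimes>\<^sub>m Idn C W \<in> Hom C (K \<otimes> W) (Z \<otimes> W)" by (simp add: Hom_iff)
  have "hsum (K \<otimes> W) (unit \<otimes> B) (\<lambda>i. (f i \<cdot> k) \<otimes>\<^sub>m w i) (Suc n)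
      = hsum (K \<otimes> W) (unit \<otimes> B) (\<lambda>i. (f i \<otimes>\<^sub>m w i) \<cdot> (k \<otimes>\<^sub>m Idn C W)) (Suc n)"
    by (rule hsum_cong) (simp add: TensM_merge)
  also have "\<dots> = hsum (Z \<otimes> W) (unit \<otimes> B) (\<lambda>i. f i \<otimes>\<^sub>m w i) (Suc n) \<cdot> (k \<otimes>\<^sub>m Idn C W)"
    by (rule hsum_Comp[OF kW, symmetric]) (simp_all add: fwH)
  also have "\<dots> = Zer C (K \<otimes> W) (unit \<otimes> B)"
    unfolding Suc.prems(4) by (simp add: Zer_Comp)
  finally have "Add C (hsum (K \<otimes> W) (unit \<otimes> B) (\<lambda>i. (f i \<cdot> k) \<otimes>\<^sub>m w i) n) ((f n \<cdot> k) \<otimes>\<^sub>m w n)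
      = Zer C (K \<otimes> W) (unit \<otimes> B)" by (simp add: hsum_def)
  moreover have "(f n \<cdot> k) \<otimes>\<^sub>m w n = Zer C (K \<otimes> W) (unit \<otimes> B)" unfolding k(2) by (simp add: Zer_TensM)
  moreover have "hsum (K \<otimes> W) (unit \<otimes> B) (\<lambda>i. (f i \<cdot> k) \<otimes>\<^sub>m w i) n \<in> Hom C (K \<otimes> W) (unit \<otimes> B)"
    by (rule hsum_Hom) (simp_all add: Hom_iff)
  ultimately have "hsum (K \<otimes> W) (unit \<otimes> B) (\<lambda>i. (f i \<cdot> k) \<otimes>\<^sub>m w i) n = Zer C (K \<otimes> W) (unit \<otimes> B)"
    using KW.add_zero_right by simp
  then have w0: "\<forall>i<n. w i = Zer C W B"
    by (rule Suc.IH[OF indK \<open>K \<in> Ob C\<close>, rotated]) (simp add: Suc.prems(3))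
  have "hsum (Z \<otimes> W) (unit \<otimes> B) (\<lambda>i. f i \<otimes>\<^sub>m w i) n = Zer C (Z \<otimes> W) (unit \<otimes> B)"
    by (rule hsum_Zer) (simp_all add: w0 TensM_Zer)
  then have "Add C (Zer C (Z \<otimes> W) (unit \<otimes> B)) (f n \<otimes>\<^sub>m w n) = Zer C (Z \<otimes> W) (unit \<otimes> B)"
    using Suc.prems(4) by (simp add: hsum_def)
  then have "f n \<otimes>\<^sub>m w n = Zer C (Z \<otimes> W) (unit \<otimes> B)" using ZW.add_zero[of "f n \<otimes>\<^sub>m w n"] fwH[of n] by simp
  then have "(Idn C unit \<otimes>\<^sub>m w n) \<cdot> (f n \<otimes>\<^sub>m Idn C W) = Zer C (Dom C (f n \<otimes>\<^sub>m Idn C W)) (unit \<otimes> B)"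
    by (simp add: TensM_merge)
  from epi_ZerD[OF this epi_TensM_right[OF W(1) fn]]
  have 0: "Idn C unit \<otimes>\<^sub>m w n = Zer C (unit \<otimes> W) (unit \<otimes> B)" by (simp add: Hom_iff)
  have "w n \<cdot> LUnit C W = LUnit C B \<cdot> (Idn C unit \<otimes>\<^sub>m w n)" using LUnit_nat[of "w n" B] by simp
  also have "\<dots> = Zer C (Dom C (LUnit C W)) B" unfolding 0 by (simp add: Comp_Zer)
  finally have "w n = Zer C W B" using epi_ZerD[OF _ iso_epi, of "w n" "LUnit C W" B] by (simp add: Hom_iff)
  then show ?case using w0 by (auto simp: less_Suc_eq)
qed

text \<open>If \<open>w n\<close> were nonzero, hence epi, the induction hypothesis on its kernel
  would make every other \<open>w i\<close> a multiple of \<open>w n\<close>; cancelling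
  \<open>w n\<close> would leave a relation among the \<open>f i\<close> with coefficient 1 at
  \<open>n\<close>. In other words, the \<open>f i\<close> together embed \<open>n\<close> copies of
  the unit into \<open>X\<close>.\<close>

lemma unit_Comp_indep:
  assumes ind: "vindep (hom_space C unit X) n f" and X: "X \<in> Ob C"
    and "N \<in> Ob C" "\<And>i. i < n \<Longrightarrow> w i \<in> Hom C N unit"
    and "hsum N X (\<lambda>i. f i \<cdot> w i) n = Zer C N X"
  shows "\<forall>i<n. w i = Zer C N unit"
  using assms
proof (induction n arbitrary: N w)
  case 0
  then show ?case by simp
next
  case (Suc n)
  note [simp] = X Suc.prems(3)
  have fH: "f i \<in> Hom C unit X" if "i < Suc n" for i using Suc.prems(1) that by (simp add: vindep_def)
  have wH: "w i \<in> Hom C N unit" if "i < Suc n" for i using Suc.prems(4) that by simp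
  have [simp]: "f i \<in> Ar C" "Dom C (f i) = unit" "Cod C (f i) = X" "w i \<in> Ar C" "Dom C (w i) = N" "Cod C (w i) = unit"
    if "i < Suc n" for i using fH wH that by (auto simp: Hom_iff)
  let ?V = "hom_space C unit X"
  interpret V: vector_space_struct ?V by simp
  have indn: "vindep ?V n f"
    unfolding vindep_def
  proof (intro conjI allI impI)
    fix c i assume 0: "vcomb ?V c f n = vzero ?V" and i: "i < n"
    have "vcomb ?V (c(n := 0)) f (Suc n) = vadd ?V (vcomb ?V c f n) (vscale ?V 0 (f n))"
      unfolding vcomb_def by (auto intro!: arg_cong2[of _ _ _ _ "Add C"] vsum_cong)
    also have "\<dots> = vzero ?V" using 0 V.scale_0[of "f n"] V.add_zero[OF V.zero_closed] fH[of n] by simp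
    finally have "(c(n := 0)) i = 0" by (rule vindepD[OF _ Suc.prems(1)]) (use i in simp)
    then show "c i = 0" using i by simp
  qed (use fH in simp)
  have wn: "w n = Zer C N unit"
  proof (rule ccontr)
    assume "w n \<noteq> Zer C N unit"
    then have e: "epi_arrow C (w n)" "w n \<in> Hom C N unit" using Hom_Unit_epi wH by auto
    obtain K k where k: "k \<in> Hom C K N" "w n \<cdot> k = Zer C K unit"
      and k_uni: "\<And>Y g. \<lbrakk>g \<in> Hom C Y N; w n \<cdot> g = Zer C Y unit\<rbrakk> \<Longrightarrow> \<exists>u\<in>Hom C Y K. k \<cdot> u = g"
      using kernelE[OF e(2)] by metis
    have [simp]: "k \<in> Ar C" "Dom C k = K" "Cod C k = N" "K \<in> Ob C" using k Hom_Ob by (auto simp: Hom_iff)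
    have "hsum K X (\<lambda>i. f i \<cdot> (w i \<cdot> k)) (Suc n) = hsum K X (\<lambda>i. (f i \<cdot> w i) \<cdot> k) (Suc n)"
      by (rule hsum_cong) simp
    also have "\<dots> = hsum N X (\<lambda>i. f i \<cdot> w i) (Suc n) \<cdot> k"
      by (rule hsum_Comp[OF k(1), symmetric]) (simp_all add: Hom_iff)
    also have "\<dots> = Zer C K X" unfolding Suc.prems(5) by (simp add: Zer_Comp)
    finally have "Add C (hsum K X (\<lambda>i. f i \<cdot> (w i \<cdot> k)) n) (f n \<cdot> (w n \<cdot> k)) = Zer C K X"
      by (simp add: hsum_def)
    moreover have "hsum K X (\<lambda>i. f i \<cdot> (w i \<cdot> k)) n \<in> Hom C K X" by (rule hsum_Hom) (simp_all add: Hom_iff)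
    ultimately have "hsum K X (\<lambda>i. f i \<cdot> (w i \<cdot> k)) n = Zer C K X"
      unfolding k(2) using vector_space_struct.add_zero_right[OF hom_vs, of K X] by (simp add: Comp_Zer)
    then have "\<forall>i<n. w i \<cdot> k = Zer C K unit"
      by (rule Suc.IH[OF indn X \<open>K \<in> Ob C\<close>, rotated]) (simp add: Hom_iff)
    then have "\<forall>i<n. \<exists>u\<in>Hom C unit unit. u \<cdot> w n = w i"
      using epi_cokernel_of_kernel[OF e k(1) k_uni wH] by auto
    then have "\<forall>i. \<exists>a. i < n \<longrightarrow> w i = Scale C a (w n)"
    proof (intro allI)
      fix i assume "\<forall>i<n. \<exists>u\<in>Hom C unit unit. u \<cdot> w n = w i"
      then show "\<exists>a. i < n \<longrightarrow> w i = Scale C a (w n)"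
        using End_Unit_scalar by (metis Scale_Comp' Idn_Comp' Idn_Ar Dom_Idn \<open>w n \<in> Hom C N unit\<close> Hom_iff Unit_Ob')
    qed
    then obtain a where a: "\<And>i. i < n \<Longrightarrow> w i = Scale C (a i) (w n)" by metis
    let ?a = "a(n := 1)"
    have wa: "w i = Scale C (?a i) (w n)" if "i < Suc n" for i
      using that a by (auto simp: less_Suc_eq Scale_1)
    have "vcomb ?V ?a f (Suc n) \<cdot> w n = vcomb (hom_space C N X) ?a (\<lambda>i. f i \<cdot> w n) (Suc n)"
      by (rule V.vlinear_vcomb[OF vlinear_Comp_right[OF e(2)] hom_vs]) (simp_all add: fH)
    also have "\<dots> = hsum N X (\<lambda>i. f i \<cdot> w i) (Suc n)"
      unfolding vcomb_def hsum_def
    proof (rule vsum_cong)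
      fix i assume i: "i < Suc n"
      show "vscale (hom_space C N X) (?a i) (f i \<cdot> w n) = f i \<cdot> w i"
        unfolding wa[OF i] using i by (simp add: Comp_Scale')
    qed
    also have "\<dots> = Zer C (Dom C (w n)) X" unfolding Suc.prems(5) by simp
    finally have "vcomb ?V ?a f (Suc n) = Zer C (Cod C (w n)) X"
      by (rule epi_ZerD[OF _ e(1)]) (use V.vcomb_closed[of "Suc n" f ?a] fH in simp)
    then have "?a n = 0" using vindepD[of ?V ?a f "Suc n" n] Suc.prems(1) by simp
    then show False by simp
  qed
  have "hsum N X (\<lambda>i. f i \<cdot> w i) n \<in> Hom C N X" by (rule hsum_Hom) (simp_all add: Hom_iff)
  then have "hsum N X (\<lambda>i. f i \<cdot> w i) n = Zer C N X"
    using Suc.prems(5) wn vector_space_struct.add_zero_right[OF hom_vs, of N X] by (simp add: hsum_def Comp_Zer)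
  then have "\<forall>i<n. w i = Zer C N unit"
    by (rule Suc.IH[OF indn X \<open>N \<in> Ob C\<close>, rotated]) (rule wH, simp)
  then show ?case using wn by (auto simp: less_Suc_eq)
qed

text \<open>A basis of the morphisms from the unit to \<open>Y\<close> assembles into
  \<open>g\<close>, defined on as many copies of the unit. It is epi because these morphisms
  generate \<open>Y\<close>, and mono by \<open>unit_Comp_indep\<close>.\<close>

lemma unit_sum_of_generated:
  assumes Y: "Y \<in> Ob C"
    and gen: "\<And>B f. \<lbrakk>f \<in> Hom C Y B; \<And>i. i \<in> Hom C unit Y \<Longrightarrow> f \<cdot> i = Zer C unit B\<rbrakk> \<Longrightarrow> f = Zer C Y B"
  shows "\<exists>n i r. unit_sum unit Y n i r"
proof -
  let ?V = "hom_space C unit Y"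
  note [simp] = Y
  interpret V: vector_space_struct ?V by simp
  obtain n b where b: "vbasis ?V n b" using V.ex_vbasis[OF finite_dim_hom] by auto
  then have bH: "b i \<in> Hom C unit Y" if "i < n" for i using that by (simp add: vbasis_def vindep_def)
  obtain X i r where X: "unit_sum unit X n i r" using ex_unit_sum[OF Unit_Ob] by blast
  have [simp]: "X \<in> Ob C" using X by (auto simp: unit_sum_def)
  have iH: "i a \<in> Hom C unit X" and rH: "r a \<in> Hom C X unit" if "a < n" for a
    using X that by (auto simp: unit_sum_def)
  have [simp]: "i a \<in> Ar C" "Dom C (i a) = unit" "Cod C (i a) = X" "r a \<in> Ar C" "Dom C (r a) = X" "Cod C (r a) = unit"
    "b a \<in> Ar C" "Dom C (b a) = unit" "Cod C (b a) = Y"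
    if "a < n" for a using iH rH bH that by (auto simp: Hom_iff)
  have sum: "hsum X X (\<lambda>a. i a \<cdot> r a) n = Idn C X"
    and rid: "\<And>a b. \<lbrakk>a < n; b < n\<rbrakk> \<Longrightarrow> r a \<cdot> i b = (if a = b then Idn C unit else Zer C unit unit)"
    using X by (auto simp: unit_sum_def)
  define g where "g = hsum X Y (\<lambda>a. b a \<cdot> r a) n"
  have gH: "g \<in> Hom C X Y" unfolding g_def by (rule hsum_Hom) (simp_all add: Hom_iff)
  have [simp]: "g \<in> Ar C" "Dom C g = X" "Cod C g = Y" using gH by (auto simp: Hom_iff)
  have gi: "g \<cdot> i a = b a" if a: "a < n" for a
  proof -
    have "g \<cdot> i a = hsum unit Y (\<lambda>c. (b c \<cdot> r c) \<cdot> i a) n"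
      unfolding g_def by (rule hsum_Comp[OF iH[OF a]]) (simp_all add: Hom_iff)
    also have "\<dots> = b a"
    proof (rule hsum_delta[OF a bH[OF a]])
      fix c assume c: "c < n"
      have "(b c \<cdot> r c) \<cdot> i a = b c \<cdot> (r c \<cdot> i a)" using a c by simp
      then show "(b c \<cdot> r c) \<cdot> i a = (if c = a then b a else Zer C unit Y)"
        using a c by (simp add: rid Comp_Zer)
    qed
    finally show ?thesis .
  qed
  have "epi_arrow C g"
  proof (rule epi_arrowI[OF gH])
    fix Z f assume f: "f \<in> Hom C Y Z" "f \<cdot> g = Zer C X Z"
    have [simp]: "f \<in> Ar C" "Dom C f = Y" "Cod C f = Z" "Z \<in> Ob C" using f Hom_Ob by (auto simp: Hom_iff)
    have fb: "f \<cdot> b a = Zer C unit Z" if "a < n" for a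
    proof -
      have "f \<cdot> b a = (f \<cdot> g) \<cdot> i a" unfolding gi[OF that, symmetric] using that by simp
      then show ?thesis unfolding f(2) using that by (simp add: Zer_Comp)
    qed
    show "f = Zer C Y Z"
    proof (rule gen[OF f(1)])
      fix j assume "j \<in> Hom C unit Y"
      then obtain c where "j = vcomb ?V c b n" using b by (auto simp: vbasis_def vspanning_def)
      then have "f \<cdot> j = vcomb (hom_space C unit Z) c (\<lambda>a. f \<cdot> b a) n"
        using V.vlinear_vcomb[OF vlinear_Comp_left[OF f(1) Unit_Ob] hom_vs, of n b c] bH by simp
      also have "\<dots> = Zer C unit Z"
        unfolding vcomb_def by (rule hsum_Zer[unfolded hsum_def]) (simp_all add: fb Scale_Zer)
      finally show "f \<cdot> j = Zer C unit Z" .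
    qed
  qed
  moreover have "mono_arrow C g"
  proof (rule mono_arrowI[OF gH])
    fix Z z assume z: "z \<in> Hom C Z X" "g \<cdot> z = Zer C Z Y"
    have [simp]: "z \<in> Ar C" "Dom C z = Z" "Cod C z = X" "Z \<in> Ob C" using z Hom_Ob by (auto simp: Hom_iff)
    have "hsum Z Y (\<lambda>a. b a \<cdot> (r a \<cdot> z)) n = hsum Z Y (\<lambda>a. (b a \<cdot> r a) \<cdot> z) n"
      by (rule hsum_cong) simp
    also have "\<dots> = g \<cdot> z" unfolding g_def by (rule hsum_Comp[OF z(1), symmetric]) (simp_all add: Hom_iff)
    finally have "hsum Z Y (\<lambda>a. b a \<cdot> (r a \<cdot> z)) n = Zer C Z Y" unfolding z(2) .
    then have rz: "\<forall>a<n. r a \<cdot> z = Zer C Z unit"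
      by (rule unit_Comp_indep[of Y n b Z, rotated 4]) (use b in \<open>simp_all add: vbasis_def Hom_iff\<close>)
    have "z = hsum X X (\<lambda>a. i a \<cdot> r a) n \<cdot> z" unfolding sum by simp
    also have "\<dots> = hsum Z X (\<lambda>a. (i a \<cdot> r a) \<cdot> z) n" by (rule hsum_Comp[OF z(1)]) (simp_all add: Hom_iff)
    also have "\<dots> = Zer C Z X" by (rule hsum_Zer) (simp_all add: rz Comp_Zer)
    finally show "z = Zer C Z X" .
  qed
  ultimately have "iso C g" using mono_epi_iso by blast
  then show ?thesis using unit_sum_iso[OF X gH] by blast
qed

end

section \<open>Braided module categories\<close>

sublocale module_category \<subseteq> A: actegory C M "Act M" "ActM M" "MAssoc M" "MUnit M"
  by unfold_locales (fact Act_Ob ActM_Hom ActM_Idn ActM_Comp MAssoc_iso MAssoc_natural MUnit_iso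
    MUnit_natural module_pentagon module_triangle)+

context actegory
begin

text \<open>The two currying operations use the same evaluation, once on \<open>M\<close> and once
  inside \<open>C\<close>, and the pentagon matches the associators in between. This transfers the
  comparison in \<open>iso_ihom_can\<close> from \<open>M\<close> to \<open>C\<close>.\<close>

lemma curry_ma:
  assumes d: "is_left_dual C X D e c" and g: "g \<in> Hom C Z (X \<otimes>\<^bsub>C\<^esub> H)" and H: "H \<in> Ob C" and A: "A \<in> Ob M"
  shows "curry X D e (act H A) (ma X H A \<cdot>\<^bsub>M\<^esub> actm g (Idn M A)) \<cdot>\<^bsub>M\<^esub> ma D Z A
    = actm (C.lcurry X D e H g) (Idn M A)"
proof -
  note [simp] = C.left_dualD(1-8)[OF d] H A
  have [simp]: "g \<in> Ar C" "Dom C g = Z" "Cod C g = X \<otimes>\<^bsub>C\<^esub> H" "Z \<in> Ob C" using g C.Hom_Ob by (auto simp: C.Hom_iff)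
  let ?i = "Idn M A" and ?I = "Unit C"
  have p1: "actm (Idn C D) (actm g ?i) \<cdot>\<^bsub>M\<^esub> ma D Z A = ma D (X \<otimes>\<^bsub>C\<^esub> H) A \<cdot>\<^bsub>M\<^esub> actm (Idn C D \<otimes>\<^sub>m\<^bsub>C\<^esub> g) ?i"
    by (simp add: ma_nat)
  have p2: "actm (Idn C D) (ma X H A) \<cdot>\<^bsub>M\<^esub> ma D (X \<otimes>\<^bsub>C\<^esub> H) A
      = ma D X (act H A) \<cdot>\<^bsub>M\<^esub> ma (D \<otimes>\<^bsub>C\<^esub> X) H A \<cdot>\<^bsub>M\<^esub> actm (Inv C (Assoc C D X H)) ?i"
  proof (rule M.iso_cancel_right)
    show "(actm (Idn C D) (ma X H A) \<cdot>\<^bsub>M\<^esub> ma D (X \<otimes>\<^bsub>C\<^esub> H) A) \<cdot>\<^bsub>M\<^esub> actm (Assoc C D X H) ?i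
      = (ma D X (act H A) \<cdot>\<^bsub>M\<^esub> ma (D \<otimes>\<^bsub>C\<^esub> X) H A \<cdot>\<^bsub>M\<^esub> actm (Inv C (Assoc C D X H)) ?i) \<cdot>\<^bsub>M\<^esub> actm (Assoc C D X H) ?i"
      by (simp add: act_pentagon actm_merge)
  qed simp_all
  have p3: "actm e (Idn M (act H A)) \<cdot>\<^bsub>M\<^esub> ma (D \<otimes>\<^bsub>C\<^esub> X) H A = ma ?I H A \<cdot>\<^bsub>M\<^esub> actm (e \<otimes>\<^sub>m\<^bsub>C\<^esub> Idn C H) ?i"
    by (simp add: ma_nat)
  have "curry X D e (act H A) (ma X H A \<cdot>\<^bsub>M\<^esub> actm g ?i) \<cdot>\<^bsub>M\<^esub> ma D Z A
      = mu (act H A) \<cdot>\<^bsub>M\<^esub> actm e (Idn M (act H A)) \<cdot>\<^bsub>M\<^esub> Inv M (ma D X (act H A)) \<cdot>\<^bsub>M\<^esub>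
        actm (Idn C D) (ma X H A) \<cdot>\<^bsub>M\<^esub> (actm (Idn C D) (actm g ?i) \<cdot>\<^bsub>M\<^esub> ma D Z A)"
    by (simp add: curry_def actm_expand_right)
  also have "\<dots> = mu (act H A) \<cdot>\<^bsub>M\<^esub> actm e (Idn M (act H A)) \<cdot>\<^bsub>M\<^esub> Inv M (ma D X (act H A)) \<cdot>\<^bsub>M\<^esub>
        (actm (Idn C D) (ma X H A) \<cdot>\<^bsub>M\<^esub> ma D (X \<otimes>\<^bsub>C\<^esub> H) A) \<cdot>\<^bsub>M\<^esub> actm (Idn C D \<otimes>\<^sub>m\<^bsub>C\<^esub> g) ?i"
    unfolding p1 by simp
  also have "\<dots> = mu (act H A) \<cdot>\<^bsub>M\<^esub> (actm e (Idn M (act H A)) \<cdot>\<^bsub>M\<^esub> ma (D \<otimes>\<^bsub>C\<^esub> X) H A) \<cdot>\<^bsub>M\<^esub>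
        actm (Inv C (Assoc C D X H)) ?i \<cdot>\<^bsub>M\<^esub> actm (Idn C D \<otimes>\<^sub>m\<^bsub>C\<^esub> g) ?i"
    unfolding p2 by simp
  also have "\<dots> = (mu (act H A) \<cdot>\<^bsub>M\<^esub> ma ?I H A) \<cdot>\<^bsub>M\<^esub> actm (e \<otimes>\<^sub>m\<^bsub>C\<^esub> Idn C H) ?i \<cdot>\<^bsub>M\<^esub>
        actm (Inv C (Assoc C D X H)) ?i \<cdot>\<^bsub>M\<^esub> actm (Idn C D \<otimes>\<^sub>m\<^bsub>C\<^esub> g) ?i"
    unfolding p3 by simp
  also have "\<dots> = actm (C.lcurry X D e H g) ?i"
    unfolding act_LUnit[OF H A] by (simp add: C.lcurry_def actm_expand_left)
  finally show ?thesis .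
qed

end

section \<open>Internal Homs\<close>

context module_category
begin

context
  fixes H :: "'p \<Rightarrow> 'p \<Rightarrow> 'o" and ev :: "'p \<Rightarrow> 'p \<Rightarrow> 'n"
  assumes ih: "is_internal_hom C M H ev"
begin

lemma ihom_Ob [simp]: "\<lbrakk>A \<in> Ob M; B \<in> Ob M\<rbrakk> \<Longrightarrow> H A B \<in> Ob C"
  and ev_Hom: "\<lbrakk>A \<in> Ob M; B \<in> Ob M\<rbrakk> \<Longrightarrow> ev A B \<in> Hom M (H A B \<triangleright>\<^bsub>M\<^esub> A) B"
  using ih by (auto simp: is_internal_hom_def)

lemma ev_Ar [simp]: "\<lbrakk>A \<in> Ob M; B \<in> Ob M\<rbrakk> \<Longrightarrow> ev A B \<in> Ar M"
  and Dom_ev [simp]: "\<lbrakk>A \<in> Ob M; B \<in> Ob M\<rbrakk> \<Longrightarrow> Dom M (ev A B) = H A B \<triangleright>\<^bsub>M\<^esub> A"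
  and Cod_ev [simp]: "\<lbrakk>A \<in> Ob M; B \<in> Ob M\<rbrakk> \<Longrightarrow> Cod M (ev A B) = B"
  using ev_Hom[of A B] by (auto simp: M.Hom_iff)

lemma adjunct_ex1:
  "\<lbrakk>A \<in> Ob M; B \<in> Ob M; X \<in> Ob C; f \<in> Hom M (X \<triangleright>\<^bsub>M\<^esub> A) B\<rbrakk>
    \<Longrightarrow> \<exists>!g. g \<in> Hom C X (H A B) \<and> ev A B \<cdot>\<^bsub>M\<^esub> (g \<triangleright>\<^sub>m\<^bsub>M\<^esub> Idn M A) = f"
  using ih by (auto simp: is_internal_hom_def)

lemma adjunct:
  assumes "A \<in> Ob M" "B \<in> Ob M" "X \<in> Ob C" "f \<in> Hom M (X \<triangleright>\<^bsub>M\<^esub> A) B"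
  shows "adjunct C M H ev X A B f \<in> Hom C X (H A B)"
    and "ev A B \<cdot>\<^bsub>M\<^esub> (adjunct C M H ev X A B f \<triangleright>\<^sub>m\<^bsub>M\<^esub> Idn M A) = f"
  using theI'[OF adjunct_ex1[OF assms]] unfolding adjunct_def by auto

lemma adjunct_unique:
  assumes "ev A B \<cdot>\<^bsub>M\<^esub> (g \<triangleright>\<^sub>m\<^bsub>M\<^esub> Idn M A) = ev A B \<cdot>\<^bsub>M\<^esub> (g' \<triangleright>\<^sub>m\<^bsub>M\<^esub> Idn M A)"
    and "A \<in> Ob M" "B \<in> Ob M" "g \<in> Hom C X (H A B)" "g' \<in> Hom C X (H A B)"
  shows "g = g'"
proof -
  have X: "X \<in> Ob C" using assms(4) C.Hom_Ob by blast
  have "ev A B \<cdot>\<^bsub>M\<^esub> (g \<triangleright>\<^sub>m\<^bsub>M\<^esub> Idn M A) \<in> Hom M (X \<triangleright>\<^bsub>M\<^esub> A) B"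
    using assms(2-4) by (auto simp: C.Hom_iff M.Hom_iff)
  from adjunct_ex1[OF assms(2,3) X this] show ?thesis using assms by auto
qed

lemma ihom_map_Hom:
  assumes f: "f \<in> Hom M A' A" and g: "g \<in> Hom M B B'"
  shows "ihom_map C M H ev f g \<in> Hom C (H A B) (H A' B')"
proof -
  have [simp]: "f \<in> Ar M" "Dom M f = A'" "Cod M f = A" "g \<in> Ar M" "Dom M g = B" "Cod M g = B'"
    "A \<in> Ob M" "A' \<in> Ob M" "B \<in> Ob M" "B' \<in> Ob M"
    using f g M.Hom_Ob by (auto simp: M.Hom_iff)
  show ?thesis unfolding ihom_map_def Let_def by (simp, rule adjunct(1)) (simp_all add: M.Hom_iff)
qed

lemma ihom_map_Idn:
  assumes [simp]: "A \<in> Ob M" "B \<in> Ob M"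
  shows "ihom_map C M H ev (Idn M A) (Idn M B) = Idn C (H A B)"
proof -
  have "adjunct C M H ev (H A B) A B (ev A B) = Idn C (H A B)"
    by (rule adjunct_unique[where A = A and B = B and X = "H A B"])
      (simp_all add: adjunct ev_Hom C.Hom_iff[of "Idn C (H A B)"])
  then show ?thesis by (simp add: ihom_map_def Let_def)
qed

lemma ihom_coev_Hom: "A \<in> Ob M \<Longrightarrow> ihom_coev C M H ev A \<in> Hom C (Unit C) (H A A)"
  unfolding ihom_coev_def by (rule adjunct(1)) (simp_all add: M.Hom_iff)

text \<open>Composing with \<open>ihom_can\<close> is, up to the bijections given by duality and by the internal
  Hom adjunction, the identity.\<close>

lemma iso_ihom_can:
  assumes X [simp]: "X \<in> Ob C" and A [simp]: "A \<in> Ob M" and B [simp]: "B \<in> Ob M"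
  shows "ihom_can C M H ev X A B \<in> Hom C (X \<otimes>\<^bsub>C\<^esub> H A B) (H A (X \<triangleright>\<^bsub>M\<^esub> B))" and "iso C (ihom_can C M H ev X A B)"
proof -
  let ?c = "ihom_can C M H ev X A B" and ?H = "H A B" and ?H' = "H A (X \<triangleright>\<^bsub>M\<^esub> B)"
  let ?f = "(Idn C X \<triangleright>\<^sub>m\<^bsub>M\<^esub> ev A B) \<cdot>\<^bsub>M\<^esub> MAssoc M X ?H A"
  have f: "?f \<in> Hom M ((X \<otimes>\<^bsub>C\<^esub> ?H) \<triangleright>\<^bsub>M\<^esub> A) (X \<triangleright>\<^bsub>M\<^esub> B)" by (simp add: M.Hom_iff)
  have X': "X \<otimes>\<^bsub>C\<^esub> ?H \<in> Ob C" "X \<triangleright>\<^bsub>M\<^esub> B \<in> Ob M" by simp_all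
  note ca = adjunct[OF A X'(2) X'(1) f, folded ihom_can_def]
  show cH: "?c \<in> Hom C (X \<otimes>\<^bsub>C\<^esub> ?H) ?H'" by (rule ca(1))
  then have [simp]: "?c \<in> Ar C" "Dom C ?c = X \<otimes>\<^bsub>C\<^esub> ?H" "Cod C ?c = ?H'" by (auto simp: C.Hom_iff)
  let ?D = "LDual C X" and ?e = "Ev C X"
  note d = C.left_dual[OF X]
  note [simp] = C.left_dualD(1-8)[OF d]
  let ?cur = "A.curry X ?D ?e B" and ?lc = "C.lcurry X ?D ?e ?H"
  have key: "?cur (ev A (X \<triangleright>\<^bsub>M\<^esub> B) \<cdot>\<^bsub>M\<^esub> ((?c \<cdot>\<^bsub>C\<^esub> g) \<triangleright>\<^sub>m\<^bsub>M\<^esub> Idn M A)) \<cdot>\<^bsub>M\<^esub> MAssoc M ?D Z A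
      = ev A B \<cdot>\<^bsub>M\<^esub> (?lc g \<triangleright>\<^sub>m\<^bsub>M\<^esub> Idn M A)"
    if g: "g \<in> Hom C Z (X \<otimes>\<^bsub>C\<^esub> ?H)" for g Z
  proof -
    have [simp]: "g \<in> Ar C" "Dom C g = Z" "Cod C g = X \<otimes>\<^bsub>C\<^esub> ?H" "Z \<in> Ob C" using g C.Hom_Ob by (auto simp: C.Hom_iff)
    let ?m = "MAssoc M X ?H A \<cdot>\<^bsub>M\<^esub> (g \<triangleright>\<^sub>m\<^bsub>M\<^esub> Idn M A)"
    have mH: "?m \<in> Hom M (Z \<triangleright>\<^bsub>M\<^esub> A) (X \<triangleright>\<^bsub>M\<^esub> (?H \<triangleright>\<^bsub>M\<^esub> A))" by (simp add: M.Hom_iff)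
    have cm: "A.curry X ?D ?e (?H \<triangleright>\<^bsub>M\<^esub> A) ?m \<in> Hom M (?D \<triangleright>\<^bsub>M\<^esub> (Z \<triangleright>\<^bsub>M\<^esub> A)) (?H \<triangleright>\<^bsub>M\<^esub> A)"
      by (rule A.curry_Hom[OF d mH]) simp
    then have [simp]: "A.curry X ?D ?e (?H \<triangleright>\<^bsub>M\<^esub> A) ?m \<in> Ar M" "Dom M (A.curry X ?D ?e (?H \<triangleright>\<^bsub>M\<^esub> A) ?m) = ?D \<triangleright>\<^bsub>M\<^esub> (Z \<triangleright>\<^bsub>M\<^esub> A)"
      "Cod M (A.curry X ?D ?e (?H \<triangleright>\<^bsub>M\<^esub> A) ?m) = ?H \<triangleright>\<^bsub>M\<^esub> A" by (auto simp: M.Hom_iff)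
    have "ev A (X \<triangleright>\<^bsub>M\<^esub> B) \<cdot>\<^bsub>M\<^esub> ((?c \<cdot>\<^bsub>C\<^esub> g) \<triangleright>\<^sub>m\<^bsub>M\<^esub> Idn M A)
        = (ev A (X \<triangleright>\<^bsub>M\<^esub> B) \<cdot>\<^bsub>M\<^esub> (?c \<triangleright>\<^sub>m\<^bsub>M\<^esub> Idn M A)) \<cdot>\<^bsub>M\<^esub> (g \<triangleright>\<^sub>m\<^bsub>M\<^esub> Idn M A)"
      by (simp add: A.actm_expand_left)
    also have "\<dots> = (Idn C X \<triangleright>\<^sub>m\<^bsub>M\<^esub> ev A B) \<cdot>\<^bsub>M\<^esub> ?m" unfolding ca(2) by simp
    finally have "?cur (ev A (X \<triangleright>\<^bsub>M\<^esub> B) \<cdot>\<^bsub>M\<^esub> ((?c \<cdot>\<^bsub>C\<^esub> g) \<triangleright>\<^sub>m\<^bsub>M\<^esub> Idn M A))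
        = ev A B \<cdot>\<^bsub>M\<^esub> A.curry X ?D ?e (?H \<triangleright>\<^bsub>M\<^esub> A) ?m"
      using A.curry_act_Comp[OF d mH ev_Hom[OF A B]] by simp
    then have "?cur (ev A (X \<triangleright>\<^bsub>M\<^esub> B) \<cdot>\<^bsub>M\<^esub> ((?c \<cdot>\<^bsub>C\<^esub> g) \<triangleright>\<^sub>m\<^bsub>M\<^esub> Idn M A)) \<cdot>\<^bsub>M\<^esub> MAssoc M ?D Z A
        = ev A B \<cdot>\<^bsub>M\<^esub> (A.curry X ?D ?e (?H \<triangleright>\<^bsub>M\<^esub> A) ?m \<cdot>\<^bsub>M\<^esub> MAssoc M ?D Z A)"
      by simp
    then show ?thesis using A.curry_ma[OF d g] by simp
  qed
  have mono: "mono_arrow C ?c"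
    unfolding mono_arrow_def
  proof (intro conjI ballI impI)
    fix Z g g' assume "g \<in> Hom C Z (Dom C ?c)" "g' \<in> Hom C Z (Dom C ?c)" and eq: "?c \<cdot>\<^bsub>C\<^esub> g = ?c \<cdot>\<^bsub>C\<^esub> g'"
    then have g: "g \<in> Hom C Z (X \<otimes>\<^bsub>C\<^esub> ?H)" "g' \<in> Hom C Z (X \<otimes>\<^bsub>C\<^esub> ?H)" by simp_all
    have "ev A B \<cdot>\<^bsub>M\<^esub> (?lc g \<triangleright>\<^sub>m\<^bsub>M\<^esub> Idn M A) = ev A B \<cdot>\<^bsub>M\<^esub> (?lc g' \<triangleright>\<^sub>m\<^bsub>M\<^esub> Idn M A)"
      using key[OF g(1)] key[OF g(2)] eq by metis
    then have "?lc g = ?lc g'"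
      by (rule adjunct_unique[OF _ A B C.lcurry_Hom[OF d g(1)] C.lcurry_Hom[OF d g(2)]]) simp_all
    then show "g = g'" by (rule C.lcurry_inject[OF d _ g]) simp
  qed simp
  let ?ev' = "ev A (X \<triangleright>\<^bsub>M\<^esub> B)"
  have ev': "?ev' \<in> Hom M (?H' \<triangleright>\<^bsub>M\<^esub> A) (X \<triangleright>\<^bsub>M\<^esub> B)" by (rule ev_Hom) simp_all
  have cu: "?cur ?ev' \<in> Hom M (?D \<triangleright>\<^bsub>M\<^esub> (?H' \<triangleright>\<^bsub>M\<^esub> A)) B" by (rule A.curry_Hom[OF d ev' B])
  have ph: "?cur ?ev' \<cdot>\<^bsub>M\<^esub> MAssoc M ?D ?H' A \<in> Hom M ((?D \<otimes>\<^bsub>C\<^esub> ?H') \<triangleright>\<^bsub>M\<^esub> A) B"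
    using cu by (simp add: M.Hom_iff)
  have DH: "?D \<otimes>\<^bsub>C\<^esub> ?H' \<in> Ob C" by simp
  note k = adjunct[OF A B DH ph]
  \<comment> \<open>The candidate for the inverse: the \<open>g\<close> that corresponds, under the
    bijections, to the counit \<open>?ev'\<close>, the morphism to which the identity of
    \<open>?H'\<close> corresponds.\<close>
  obtain g where g: "g \<in> Hom C ?H' (X \<otimes>\<^bsub>C\<^esub> ?H)"
    "?lc g = adjunct C M H ev (?D \<otimes>\<^bsub>C\<^esub> ?H') A B (?cur ?ev' \<cdot>\<^bsub>M\<^esub> MAssoc M ?D ?H' A)"
    using C.lcurry_surj[OF d k(1)] by auto
  have [simp]: "g \<in> Ar C" "Dom C g = ?H'" "Cod C g = X \<otimes>\<^bsub>C\<^esub> ?H" using g by (auto simp: C.Hom_iff)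
  let ?v = "?ev' \<cdot>\<^bsub>M\<^esub> ((?c \<cdot>\<^bsub>C\<^esub> g) \<triangleright>\<^sub>m\<^bsub>M\<^esub> Idn M A)"
  have vH: "?v \<in> Hom M (?H' \<triangleright>\<^bsub>M\<^esub> A) (X \<triangleright>\<^bsub>M\<^esub> B)" by (simp add: M.Hom_iff)
  have "?cur ?v \<cdot>\<^bsub>M\<^esub> MAssoc M ?D ?H' A = ?cur ?ev' \<cdot>\<^bsub>M\<^esub> MAssoc M ?D ?H' A"
    using key[OF g(1)] g(2) k(2) by simp
  then have "?cur ?v = ?cur ?ev'"
    by (rule M.iso_cancel_right[rotated]) (use cu A.curry_Hom[OF d vH B] in \<open>simp_all add: M.Hom_iff\<close>)
  then have "?v = ?ev'" using A.curry_inject[OF d vH ev' B] by simp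
  then have "?ev' \<cdot>\<^bsub>M\<^esub> ((?c \<cdot>\<^bsub>C\<^esub> g) \<triangleright>\<^sub>m\<^bsub>M\<^esub> Idn M A) = ?ev' \<cdot>\<^bsub>M\<^esub> (Idn C ?H' \<triangleright>\<^sub>m\<^bsub>M\<^esub> Idn M A)" by simp
  then have "?c \<cdot>\<^bsub>C\<^esub> g = Idn C ?H'" by (rule adjunct_unique) (simp_all add: C.Hom_iff)
  then show "iso C ?c" using C.mono_split_iso[OF mono, of g] g by simp
qed

end

end

section \<open>The module braiding on multiples of the unit\<close>

context braided_module_category
begin

lemma MBraid_Ar [simp]: "\<lbrakk>X \<in> Ob C; A \<in> Ob M\<rbrakk> \<Longrightarrow> MBraid M X A \<in> Ar M"
  and Dom_MBraid [simp]: "\<lbrakk>X \<in> Ob C; A \<in> Ob M\<rbrakk> \<Longrightarrow> Dom M (MBraid M X A) = X \<triangleright>\<^bsub>M\<^esub> A"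
  and Cod_MBraid [simp]: "\<lbrakk>X \<in> Ob C; A \<in> Ob M\<rbrakk> \<Longrightarrow> Cod M (MBraid M X A) = X \<triangleright>\<^bsub>M\<^esub> A"
  and iso_MBraid [simp]: "\<lbrakk>X \<in> Ob C; A \<in> Ob M\<rbrakk> \<Longrightarrow> iso M (MBraid M X A)"
  using MBraid_iso[of X A] by (auto simp: M.Hom_iff)

lemma MBraid_Idn_iso:
  assumes s: "s \<in> Hom C X Y" "iso C s" and A: "A \<in> Ob M" and X: "MBraid M X A = Idn M (X \<triangleright>\<^bsub>M\<^esub> A)"
  shows "MBraid M Y A = Idn M (Y \<triangleright>\<^bsub>M\<^esub> A)"
proof -
  have [simp]: "s \<in> Ar C" "Dom C s = X" "Cod C s = Y" "X \<in> Ob C" "Y \<in> Ob C" "A \<in> Ob M" "iso C s"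
    using s A C.Hom_Ob by (auto simp: C.Hom_iff)
  have "MBraid M Y A \<cdot>\<^bsub>M\<^esub> (s \<triangleright>\<^sub>m\<^bsub>M\<^esub> Idn M A) = Idn M (Y \<triangleright>\<^bsub>M\<^esub> A) \<cdot>\<^bsub>M\<^esub> (s \<triangleright>\<^sub>m\<^bsub>M\<^esub> Idn M A)"
    using MBraid_natural[OF s(1) M.Idn_Hom[OF A]] X by simp
  then show ?thesis by (rule M.iso_cancel_right[rotated]) simp_all
qed

text \<open>Endomorphisms of \<open>1 \<otimes> 1\<close> are scalars, so the braidings in
  \<open>MBraid_Tens\<close> cancel and the module braiding on \<open>1 \<otimes> 1\<close> becomes
  the conjugate of a square. Naturality along \<open>RUnit\<close> compares it with the one on the
  unit and gives \<open>?E \<cdot> ?E = ?E\<close>; an invertible idempotent is the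
  identity.\<close>

lemma MBraid_Unit:
  assumes [simp]: "A \<in> Ob M"
  shows "MBraid M (Unit C) A = Idn M (Unit C \<triangleright>\<^bsub>M\<^esub> A)"
proof -
  let ?I = "Unit C" and ?u = "MUnit M A"
  let ?e = "MBraid M ?I A" and ?B = "?I \<triangleright>\<^bsub>M\<^esub> A" and ?a = "MAssoc M ?I ?I A"
  let ?c = "Braid C ?I ?I"
  obtain a where a: "?c = Scale C a (Idn C (?I \<otimes>\<^bsub>C\<^esub> ?I))"
  proof -
    let ?r = "RUnit C ?I"
    obtain a where "?r \<cdot>\<^bsub>C\<^esub> (?c \<cdot>\<^bsub>C\<^esub> Inv C ?r) = Scale C a (Idn C ?I)"
      using C.End_Unit_scalar[of "?r \<cdot>\<^bsub>C\<^esub> (?c \<cdot>\<^bsub>C\<^esub> Inv C ?r)"] by (auto simp: C.Hom_iff)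
    then have "Inv C ?r \<cdot>\<^bsub>C\<^esub> (?r \<cdot>\<^bsub>C\<^esub> (?c \<cdot>\<^bsub>C\<^esub> Inv C ?r)) \<cdot>\<^bsub>C\<^esub> ?r = Inv C ?r \<cdot>\<^bsub>C\<^esub> Scale C a (Idn C ?I) \<cdot>\<^bsub>C\<^esub> ?r"
      by simp
    then show thesis by (intro that[of a]) (simp add: C.Comp_Scale' C.Scale_Comp')
  qed
  have cc: "(?c \<triangleright>\<^sub>m\<^bsub>M\<^esub> Idn M A) \<cdot>\<^bsub>M\<^esub> x \<cdot>\<^bsub>M\<^esub> (Inv C ?c \<triangleright>\<^sub>m\<^bsub>M\<^esub> Idn M A) = x"
    if x: "x \<in> Hom M ((?I \<otimes>\<^bsub>C\<^esub> ?I) \<triangleright>\<^bsub>M\<^esub> A) ((?I \<otimes>\<^bsub>C\<^esub> ?I) \<triangleright>\<^bsub>M\<^esub> A)" for x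
  proof -
    have [simp]: "x \<in> Ar M" "Dom M x = (?I \<otimes>\<^bsub>C\<^esub> ?I) \<triangleright>\<^bsub>M\<^esub> A" "Cod M x = (?I \<otimes>\<^bsub>C\<^esub> ?I) \<triangleright>\<^bsub>M\<^esub> A" using x by (auto simp: M.Hom_iff)
    have ca: "?c \<triangleright>\<^sub>m\<^bsub>M\<^esub> Idn M A = Scale M a (Idn M ((?I \<otimes>\<^bsub>C\<^esub> ?I) \<triangleright>\<^bsub>M\<^esub> A))"
      unfolding a by (subst ActM_Scale_left[where X = "?I \<otimes>\<^bsub>C\<^esub> ?I" and X' = "?I \<otimes>\<^bsub>C\<^esub> ?I" and A = A and A' = A])
        (simp_all add: C.Hom_iff M.Hom_iff)
    have "(?c \<triangleright>\<^sub>m\<^bsub>M\<^esub> Idn M A) \<cdot>\<^bsub>M\<^esub> x = x \<cdot>\<^bsub>M\<^esub> (?c \<triangleright>\<^sub>m\<^bsub>M\<^esub> Idn M A)"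
      unfolding ca by (simp add: M.Comp_Scale' M.Scale_Comp')
    then have "((?c \<triangleright>\<^sub>m\<^bsub>M\<^esub> Idn M A) \<cdot>\<^bsub>M\<^esub> x) \<cdot>\<^bsub>M\<^esub> (Inv C ?c \<triangleright>\<^sub>m\<^bsub>M\<^esub> Idn M A)
        = x \<cdot>\<^bsub>M\<^esub> ((?c \<triangleright>\<^sub>m\<^bsub>M\<^esub> Idn M A) \<cdot>\<^bsub>M\<^esub> (Inv C ?c \<triangleright>\<^sub>m\<^bsub>M\<^esub> Idn M A))"
      by simp
    then show ?thesis by (simp add: A.actm_merge)
  qed
  let ?E = "Idn C ?I \<triangleright>\<^sub>m\<^bsub>M\<^esub> ?e"
  let ?y = "Inv M ?a \<cdot>\<^bsub>M\<^esub> ?E \<cdot>\<^bsub>M\<^esub> ?a"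
  have yH: "?y \<in> Hom M ((?I \<otimes>\<^bsub>C\<^esub> ?I) \<triangleright>\<^bsub>M\<^esub> A) ((?I \<otimes>\<^bsub>C\<^esub> ?I) \<triangleright>\<^bsub>M\<^esub> A)" by (simp add: M.Hom_iff)
  have "MBraid M (?I \<otimes>\<^bsub>C\<^esub> ?I) A = ?y \<cdot>\<^bsub>M\<^esub> ((?c \<triangleright>\<^sub>m\<^bsub>M\<^esub> Idn M A) \<cdot>\<^bsub>M\<^esub> ?y \<cdot>\<^bsub>M\<^esub> (Inv C ?c \<triangleright>\<^sub>m\<^bsub>M\<^esub> Idn M A))"
    by (simp add: MBraid_Tens)
  also have "\<dots> = Inv M ?a \<cdot>\<^bsub>M\<^esub> ?E \<cdot>\<^bsub>M\<^esub> ?E \<cdot>\<^bsub>M\<^esub> ?a" unfolding cc[OF yH] by simp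
  finally have e2: "MBraid M (?I \<otimes>\<^bsub>C\<^esub> ?I) A = Inv M ?a \<cdot>\<^bsub>M\<^esub> ?E \<cdot>\<^bsub>M\<^esub> ?E \<cdot>\<^bsub>M\<^esub> ?a" .
  let ?R = "RUnit C ?I \<triangleright>\<^sub>m\<^bsub>M\<^esub> Idn M A" and ?U = "Idn C ?I \<triangleright>\<^sub>m\<^bsub>M\<^esub> ?u"
  have RU: "?R = ?U \<cdot>\<^bsub>M\<^esub> ?a" by (simp add: module_triangle)
  have nat: "?e \<cdot>\<^bsub>M\<^esub> ?R = ?R \<cdot>\<^bsub>M\<^esub> MBraid M (?I \<otimes>\<^bsub>C\<^esub> ?I) A"
    by (rule MBraid_natural) (simp_all add: C.Hom_iff M.Hom_iff)
  have "(?e \<cdot>\<^bsub>M\<^esub> ?U) \<cdot>\<^bsub>M\<^esub> ?a = (?U \<cdot>\<^bsub>M\<^esub> ?E \<cdot>\<^bsub>M\<^esub> ?E) \<cdot>\<^bsub>M\<^esub> ?a"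
    using nat unfolding RU e2 by simp
  then have eU: "?e \<cdot>\<^bsub>M\<^esub> ?U = ?U \<cdot>\<^bsub>M\<^esub> ?E \<cdot>\<^bsub>M\<^esub> ?E"
    by (rule M.iso_cancel_right[rotated]) simp_all
  have uu: "MUnit M ?B = ?U"
    by (rule M.iso_cancel_left[of ?u]) (simp_all add: A.mu_nat)
  have "?U \<cdot>\<^bsub>M\<^esub> ?E = ?e \<cdot>\<^bsub>M\<^esub> ?U"
    unfolding uu[symmetric] by (subst A.mu_nat) simp_all
  then have "?U \<cdot>\<^bsub>M\<^esub> (?E \<cdot>\<^bsub>M\<^esub> ?E) = ?U \<cdot>\<^bsub>M\<^esub> ?E" using eU by simp
  then have "?E \<cdot>\<^bsub>M\<^esub> ?E = ?E" by (rule M.iso_cancel_left[rotated]) simp_all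
  then have "?E \<cdot>\<^bsub>M\<^esub> ?E = ?E \<cdot>\<^bsub>M\<^esub> Idn M (?I \<triangleright>\<^bsub>M\<^esub> ?B)" by simp
  then have "?E = Idn M (?I \<triangleright>\<^bsub>M\<^esub> ?B)" by (rule M.iso_cancel_left[rotated]) simp_all
  then have "?E = Idn C ?I \<triangleright>\<^sub>m\<^bsub>M\<^esub> Idn M ?B" by simp
  then show ?thesis by (rule A.act_Unit_faithful[rotated 4]) simp_all
qed

text \<open>By naturality the module braiding can be computed on each summand, where
  \<open>MBraid_Unit\<close> applies; the summands add up because the action is additive in its
  first argument.\<close>

lemma MBraid_unit_sum:
  assumes X: "C.unit_sum (Unit C) X n i r" and A [simp]: "A \<in> Ob M"
  shows "MBraid M X A = Idn M (X \<triangleright>\<^bsub>M\<^esub> A)"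
proof -
  let ?I = "Unit C"
  have [simp]: "X \<in> Ob C" using X by (auto simp: C.unit_sum_def)
  have [simp]: "i a \<in> Ar C" "Dom C (i a) = ?I" "Cod C (i a) = X" "r a \<in> Ar C" "Dom C (r a) = X" "Cod C (r a) = ?I"
    if "a < n" for a using X that by (auto simp: C.unit_sum_def C.Hom_iff)
  have sum: "C.hsum X X (\<lambda>a. i a \<cdot>\<^bsub>C\<^esub> r a) n = Idn C X" using X by (auto simp: C.unit_sum_def)
  have lin: "vlinear (hom_space C X X) (hom_space M (X \<triangleright>\<^bsub>M\<^esub> A) (X \<triangleright>\<^bsub>M\<^esub> A)) (\<lambda>f. f \<triangleright>\<^sub>m\<^bsub>M\<^esub> Idn M A)"
    unfolding vlinear_def using M.Idn_Hom[OF A] by (auto simp: ActM_Add_left ActM_Scale_left intro: ActM_Hom)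
  have e: "MBraid M X A \<in> Hom M (X \<triangleright>\<^bsub>M\<^esub> A) (X \<triangleright>\<^bsub>M\<^esub> A)" by (simp add: M.Hom_iff)
  let ?s = "\<lambda>a. (i a \<cdot>\<^bsub>C\<^esub> r a) \<triangleright>\<^sub>m\<^bsub>M\<^esub> Idn M A"
  have id: "M.hsum (X \<triangleright>\<^bsub>M\<^esub> A) (X \<triangleright>\<^bsub>M\<^esub> A) ?s n = Idn M (X \<triangleright>\<^bsub>M\<^esub> A)"
    using vector_space_struct.vlinear_vsum[OF _ lin, of n "\<lambda>a. i a \<cdot>\<^bsub>C\<^esub> r a"] sum
    by (simp add: C.hsum_def M.hsum_def C.Hom_iff)
  have "MBraid M X A = MBraid M X A \<cdot>\<^bsub>M\<^esub> M.hsum (X \<triangleright>\<^bsub>M\<^esub> A) (X \<triangleright>\<^bsub>M\<^esub> A) ?s n" unfolding id by simp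
  also have "\<dots> = M.hsum (X \<triangleright>\<^bsub>M\<^esub> A) (X \<triangleright>\<^bsub>M\<^esub> A) (\<lambda>a. MBraid M X A \<cdot>\<^bsub>M\<^esub> ?s a) n"
    by (rule M.Comp_hsum[OF e]) (simp_all add: M.Hom_iff)
  also have "\<dots> = M.hsum (X \<triangleright>\<^bsub>M\<^esub> A) (X \<triangleright>\<^bsub>M\<^esub> A) ?s n"
  proof (rule M.hsum_cong)
    fix a assume a: "a < n"
    have "MBraid M X A \<cdot>\<^bsub>M\<^esub> (i a \<triangleright>\<^sub>m\<^bsub>M\<^esub> Idn M A) = (i a \<triangleright>\<^sub>m\<^bsub>M\<^esub> Idn M A) \<cdot>\<^bsub>M\<^esub> MBraid M ?I A"
      by (rule MBraid_natural) (simp_all add: C.Hom_iff M.Hom_iff a)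
    then have n: "MBraid M X A \<cdot>\<^bsub>M\<^esub> (i a \<triangleright>\<^sub>m\<^bsub>M\<^esub> Idn M A) = i a \<triangleright>\<^sub>m\<^bsub>M\<^esub> Idn M A"
      using a by (simp add: MBraid_Unit)
    have "MBraid M X A \<cdot>\<^bsub>M\<^esub> ?s a = (MBraid M X A \<cdot>\<^bsub>M\<^esub> (i a \<triangleright>\<^sub>m\<^bsub>M\<^esub> Idn M A)) \<cdot>\<^bsub>M\<^esub> (r a \<triangleright>\<^sub>m\<^bsub>M\<^esub> Idn M A)"
      using a by (simp add: A.actm_expand_left)
    then show "MBraid M X A \<cdot>\<^bsub>M\<^esub> ?s a = ?s a" unfolding n using a by (simp add: A.actm_expand_left)
  qed
  finally show ?thesis unfolding id .
qed

lemma copairing_component_trivial: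
  assumes ih: "is_internal_hom C M H ev" and X [simp]: "X \<in> Ob C" and A [simp]: "A \<in> Ob M"
    and e: "MBraid M (LDual C X) A = Idn M (LDual C X \<triangleright>\<^bsub>M\<^esub> A)"
  shows "copairing_component C M H ev X A = (Coev C X \<otimes>\<^sub>m\<^bsub>C\<^esub> ihom_coev C M H ev A) \<cdot>\<^bsub>C\<^esub> Inv C (LUnit C (Unit C))"
proof -
  let ?D = "LDual C X"
  note [simp] = C.left_dualD(1-8)[OF C.left_dual[OF X]] ihom_Ob[OF ih]
  let ?c = "ihom_can C M H ev ?D A A"
  have c [simp]: "iso C ?c" "?c \<in> Ar C" "Dom C ?c = ?D \<otimes>\<^bsub>C\<^esub> H A A" "Cod C ?c = H A (?D \<triangleright>\<^bsub>M\<^esub> A)"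
    using iso_ihom_can[OF ih, of ?D A A] by (auto simp: C.Hom_iff)
  have [simp]: "ihom_coev C M H ev A \<in> Ar C" "Dom C (ihom_coev C M H ev A) = Unit C" "Cod C (ihom_coev C M H ev A) = H A A"
    using ihom_coev_Hom[OF ih A] by (auto simp: C.Hom_iff)
  have cc: "(Idn C X \<otimes>\<^sub>m\<^bsub>C\<^esub> Inv C ?c) \<cdot>\<^bsub>C\<^esub> ((Idn C X \<otimes>\<^sub>m\<^bsub>C\<^esub> ?c) \<cdot>\<^bsub>C\<^esub> x) = x"
    if "x \<in> Hom C Z (X \<otimes>\<^bsub>C\<^esub> (?D \<otimes>\<^bsub>C\<^esub> H A A))" for x Z
    using that by (simp add: C.TensM_merge' C.Hom_iff)
  show ?thesis
    unfolding copairing_component_def Let_def e ihom_map_Idn[OF ih A Act_Ob[OF C.left_dualD(2)[OF C.left_dual[OF X]] A]]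
    by (simp add: cc[where Z = "Unit C"] C.Hom_iff)
qed

end

section \<open>Equivalences with the category of finite-dimensional vector spaces\<close>

text \<open>The quasi-inverse is assembled by choice: \<open>G0\<close> picks preimages of objects
  up to the isomorphisms \<open>t\<close>, and \<open>G1\<close> the unique preimage of a morphism
  conjugated by \<open>t\<close>. The two natural isomorphisms are \<open>t\<close> itself and the
  preimages of its inverses.\<close>

lemma linearly_equivalentI:
  assumes F: "linear_functor C D F0 F1"
    and ff: "\<And>A B. \<lbrakk>A \<in> Ob C; B \<in> Ob C\<rbrakk> \<Longrightarrow> bij_betw F1 (Hom C A B) (Hom D (F0 A) (F0 B))"
    and es: "\<And>B. B \<in> Ob D \<Longrightarrow> \<exists>A\<in>Ob C. isomorphic D (F0 A) B"
  shows "linearly_equivalent C D"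
proof -
  interpret F: linear_functor C D F0 F1 by (rule F)
  have F0 [simp]: "A \<in> Ob C \<Longrightarrow> F0 A \<in> Ob D" for A by (rule F.F0_Ob)
  have F1 [simp]: "f \<in> Ar C \<Longrightarrow> F1 f \<in> Ar D" "f \<in> Ar C \<Longrightarrow> Dom D (F1 f) = F0 (Dom C f)"
    "f \<in> Ar C \<Longrightarrow> Cod D (F1 f) = F0 (Cod C f)" for f
    using F.F1_Hom[of f "Dom C f" "Cod C f"] by (auto simp: F.C.Hom_iff F.D.Hom_iff)
  have F1c: "F1 (g \<cdot>\<^bsub>C\<^esub> f) = F1 g \<cdot>\<^bsub>D\<^esub> F1 f" if "f \<in> Ar C" "g \<in> Ar C" "Cod C f = Dom C g" for f g
    by (rule F.F1_Comp) (use that in \<open>auto simp: F.C.Hom_iff\<close>)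
  have inj: "f = g" if "F1 f = F1 g" "f \<in> Hom C A B" "g \<in> Hom C A B" for f g A B
    using ff[of A B] that F.C.Hom_Ob[OF that(2)] unfolding bij_betw_def inj_on_def by blast
  have "\<forall>B. \<exists>A t. B \<in> Ob D \<longrightarrow> A \<in> Ob C \<and> t \<in> Hom D (F0 A) B \<and> iso D t"
    using es unfolding isomorphic_def by blast
  then obtain G0 t where G: "\<And>B. B \<in> Ob D \<Longrightarrow> G0 B \<in> Ob C \<and> t B \<in> Hom D (F0 (G0 B)) B \<and> iso D (t B)" by metis
  have G0 [simp]: "B \<in> Ob D \<Longrightarrow> G0 B \<in> Ob C" and t [simp]: "B \<in> Ob D \<Longrightarrow> t B \<in> Ar D" "B \<in> Ob D \<Longrightarrow> iso D (t B)"
    "B \<in> Ob D \<Longrightarrow> Dom D (t B) = F0 (G0 B)" "B \<in> Ob D \<Longrightarrow> Cod D (t B) = B" for B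
    using G[of B] by (auto simp: F.D.Hom_iff)
  define c where "c g = Inv D (t (Cod D g)) \<cdot>\<^bsub>D\<^esub> (g \<cdot>\<^bsub>D\<^esub> t (Dom D g))" for g
  have cH: "c g \<in> Hom D (F0 (G0 (Dom D g))) (F0 (G0 (Cod D g)))" if "g \<in> Ar D" for g
    using that by (simp add: c_def F.D.Hom_iff)
  define G1 where "G1 g = inv_into (Hom C (G0 (Dom D g)) (G0 (Cod D g))) F1 (c g)" for g
  have G1: "G1 g \<in> Hom C (G0 (Dom D g)) (G0 (Cod D g)) \<and> F1 (G1 g) = c g" if g: "g \<in> Ar D" for g
  proof -
    have "c g \<in> F1 ` Hom C (G0 (Dom D g)) (G0 (Cod D g))"
      using ff[of "G0 (Dom D g)" "G0 (Cod D g)"] cH[OF g] g by (simp add: bij_betw_def)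
    then show ?thesis unfolding G1_def using inv_into_into f_inv_into_f by metis
  qed
  have G1' [simp]: "g \<in> Ar D \<Longrightarrow> G1 g \<in> Ar C" "g \<in> Ar D \<Longrightarrow> Dom C (G1 g) = G0 (Dom D g)"
    "g \<in> Ar D \<Longrightarrow> Cod C (G1 g) = G0 (Cod D g)" "g \<in> Ar D \<Longrightarrow> F1 (G1 g) = c g" for g
    using G1[of g] by (auto simp: F.C.Hom_iff)
  have G: "linear_functor D C G0 G1"
  proof (intro linear_functor.intro linear_functor_axioms.intro)
    show "linear_category C" "linear_category D" by unfold_locales
    show "G0 A \<in> Ob C" if "A \<in> Ob D" for A using that by simp
    show "G1 f \<in> Hom C (G0 A) (G0 B)" if "f \<in> Hom D A B" for f A B
      using that by (simp add: F.C.Hom_iff F.D.Hom_iff)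
    show "G1 (Idn D A) = Idn C (G0 A)" if "A \<in> Ob D" for A
      by (rule inj[of _ _ "G0 A" "G0 A"]) (use that in \<open>simp_all add: F.C.Hom_iff c_def F.F1_Idn\<close>)
    show "G1 (g \<cdot>\<^bsub>D\<^esub> f) = G1 g \<cdot>\<^bsub>C\<^esub> G1 f" if "f \<in> Hom D A B" "g \<in> Hom D B E" for f g A B E
    proof (rule inj[of _ _ "G0 A" "G0 E"])
      have [simp]: "f \<in> Ar D" "Dom D f = A" "Cod D f = B" "g \<in> Ar D" "Dom D g = B" "Cod D g = E"
        "A \<in> Ob D" "B \<in> Ob D" "E \<in> Ob D" using that F.D.Hom_Ob by (auto simp: F.D.Hom_iff)
      show "F1 (G1 (g \<cdot>\<^bsub>D\<^esub> f)) = F1 (G1 g \<cdot>\<^bsub>C\<^esub> G1 f)" by (simp add: F1c c_def)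
    qed (use that in \<open>simp_all add: F.C.Hom_iff F.D.Hom_iff\<close>)
    show "G1 (Add D f g) = Add C (G1 f) (G1 g)" if "f \<in> Hom D A B" "g \<in> Hom D A B" for f g A B
    proof (rule inj[of _ _ "G0 A" "G0 B"])
      have [simp]: "f \<in> Ar D" "Dom D f = A" "Cod D f = B" "g \<in> Ar D" "Dom D g = A" "Cod D g = B"
        "A \<in> Ob D" "B \<in> Ob D" using that F.D.Hom_Ob by (auto simp: F.D.Hom_iff)
      have s: "Add D f g \<in> Hom D A B" using F.D.Add_Hom that by blast
      then have [simp]: "Add D f g \<in> Ar D" "Dom D (Add D f g) = A" "Cod D (Add D f g) = B" by (auto simp: F.D.Hom_iff)
      have H: "G1 f \<in> Hom C (G0 A) (G0 B)" "G1 g \<in> Hom C (G0 A) (G0 B)" by (simp_all add: F.C.Hom_iff)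
      have tH: "t A \<in> Hom D (F0 (G0 A)) A" "Inv D (t B) \<in> Hom D B (F0 (G0 B))" by (simp_all add: F.D.Hom_iff)
      have "c (Add D f g) = Add D (c f) (c g)"
        using F.D.Add_Comp[OF tH(1) that] F.D.Comp_Add[OF F.D.Comp_Hom[OF tH(1) that(1)] F.D.Comp_Hom[OF tH(1) that(2)] tH(2)]
        by (simp add: c_def)
      then show "F1 (G1 (Add D f g)) = F1 (Add C (G1 f) (G1 g))" using F.F1_Add[OF H] by simp
      show "G1 (Add D f g) \<in> Hom C (G0 A) (G0 B)" by (simp add: F.C.Hom_iff)
      show "Add C (G1 f) (G1 g) \<in> Hom C (G0 A) (G0 B)" by (rule F.C.Add_Hom[OF H])
    qed
    show "G1 (Scale D a f) = Scale C a (G1 f)" if "f \<in> Hom D A B" for a f A B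
    proof (rule inj[of _ _ "G0 A" "G0 B"])
      have [simp]: "f \<in> Ar D" "Dom D f = A" "Cod D f = B" "A \<in> Ob D" "B \<in> Ob D"
        using that F.D.Hom_Ob by (auto simp: F.D.Hom_iff)
      have H: "G1 f \<in> Hom C (G0 A) (G0 B)" by (simp add: F.C.Hom_iff)
      have "c (Scale D a f) = Scale D a (c f)" by (simp add: c_def F.D.Scale_Comp' F.D.Comp_Scale')
      then show "F1 (G1 (Scale D a f)) = F1 (Scale C a (G1 f))" using F.F1_Scale[OF H] by simp
      show "G1 (Scale D a f) \<in> Hom C (G0 A) (G0 B)" "Scale C a (G1 f) \<in> Hom C (G0 A) (G0 B)" by (simp_all add: F.C.Hom_iff)
    qed
  qed
  have "\<exists>s s'. s \<in> Hom C A (G0 (F0 A)) \<and> F1 s = Inv D (t (F0 A)) \<and> s' \<in> Hom C (G0 (F0 A)) A \<and> F1 s' = t (F0 A)"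
    if A [simp]: "A \<in> Ob C" for A
  proof -
    have "Inv D (t (F0 A)) \<in> F1 ` Hom C A (G0 (F0 A))" "t (F0 A) \<in> F1 ` Hom C (G0 (F0 A)) A"
      using ff[of A "G0 (F0 A)"] ff[of "G0 (F0 A)" A] by (simp_all add: bij_betw_def F.D.Hom_iff)
    then obtain x y where "x \<in> Hom C A (G0 (F0 A))" "Inv D (t (F0 A)) = F1 x" "y \<in> Hom C (G0 (F0 A)) A" "t (F0 A) = F1 y"
      by (elim imageE)
    then show ?thesis by (intro exI[of _ x] exI[of _ y]) simp
  qed
  then obtain s s' where ss: "\<And>A. A \<in> Ob C \<Longrightarrow> s A \<in> Hom C A (G0 (F0 A)) \<and> F1 (s A) = Inv D (t (F0 A)) \<and>
      s' A \<in> Hom C (G0 (F0 A)) A \<and> F1 (s' A) = t (F0 A)" by metis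
  have s [simp]: "A \<in> Ob C \<Longrightarrow> s A \<in> Ar C" "A \<in> Ob C \<Longrightarrow> Dom C (s A) = A" "A \<in> Ob C \<Longrightarrow> Cod C (s A) = G0 (F0 A)"
    "A \<in> Ob C \<Longrightarrow> s' A \<in> Ar C" "A \<in> Ob C \<Longrightarrow> Cod C (s' A) = A" "A \<in> Ob C \<Longrightarrow> Dom C (s' A) = G0 (F0 A)"
    "A \<in> Ob C \<Longrightarrow> F1 (s A) = Inv D (t (F0 A))" "A \<in> Ob C \<Longrightarrow> F1 (s' A) = t (F0 A)" for A
    using ss[of A] by (auto simp: F.C.Hom_iff)
  have s_iso: "iso C (s A)" if A [simp]: "A \<in> Ob C" for A
  proof (rule F.C.isoI)
    have "s' A \<cdot>\<^bsub>C\<^esub> s A = Idn C A"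
      by (rule inj[of _ _ A A]) (simp_all add: F1c F.F1_Idn F.C.Hom_iff)
    then show "s' A \<cdot>\<^bsub>C\<^esub> s A = Idn C (Dom C (s A))" by simp
    have "s A \<cdot>\<^bsub>C\<^esub> s' A = Idn C (G0 (F0 A))"
      by (rule inj[of _ _ "G0 (F0 A)" "G0 (F0 A)"]) (simp_all add: F1c F.F1_Idn F.C.Hom_iff)
    then show "s A \<cdot>\<^bsub>C\<^esub> s' A = Idn C (Cod C (s A))" by simp
  qed simp_all
  have "natural_iso C C (\<lambda>A. A) (\<lambda>f. f) (G0 \<circ> F0) (G1 \<circ> F1) s"
    unfolding natural_iso_def
  proof (intro conjI ballI)
    show "s A \<in> Hom C A ((G0 \<circ> F0) A)" "iso C (s A)" if "A \<in> Ob C" for A using that s_iso by (simp_all add: F.C.Hom_iff)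
    fix A B f assume AB [simp]: "A \<in> Ob C" "B \<in> Ob C" and f: "f \<in> Hom C A B"
    have [simp]: "f \<in> Ar C" "Dom C f = A" "Cod C f = B" using f by (auto simp: F.C.Hom_iff)
    show "s B \<cdot>\<^bsub>C\<^esub> f = (G1 \<circ> F1) f \<cdot>\<^bsub>C\<^esub> s A"
      by (rule inj[of _ _ A "G0 (F0 B)"]) (simp_all add: F1c F.C.Hom_iff c_def)
  qed
  moreover have "natural_iso D D (F0 \<circ> G0) (F1 \<circ> G1) (\<lambda>B. B) (\<lambda>g. g) t"
    unfolding natural_iso_def
  proof (intro conjI ballI)
    show "t A \<in> Hom D ((F0 \<circ> G0) A) A" "iso D (t A)" if "A \<in> Ob D" for A using that by (simp_all add: F.D.Hom_iff)
    fix A B f assume AB [simp]: "A \<in> Ob D" "B \<in> Ob D" and f: "f \<in> Hom D A B"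
    have [simp]: "f \<in> Ar D" "Dom D f = A" "Cod D f = B" using f by (auto simp: F.D.Hom_iff)
    show "t B \<cdot>\<^bsub>D\<^esub> (F1 \<circ> G1) f = f \<cdot>\<^bsub>D\<^esub> t A" by (simp add: c_def)
  qed
  ultimately show ?thesis unfolding linearly_equivalent_def using F G by blast
qed

section \<open>The linear category of finite-dimensional vector spaces\<close>

lemma FdVec_simps [simp]:
  "Ob FdVec = {V. vector_space_struct V \<and> finite_dim V}"
  "Dom FdVec (V, W, f) = V" "Cod FdVec (V, W, f) = W"
  "Idn FdVec V = (V, V, \<lambda>x \<in> vcarrier V. x)"
  "Comp FdVec (V', W, g) (V, W', f) = (V, W, \<lambda>x \<in> vcarrier V. g (f x))"
  "Zer FdVec V W = (V, W, \<lambda>x \<in> vcarrier V. vzero W)"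
  "Add FdVec (V, W, f) (V', W', g) = (V, W, \<lambda>x \<in> vcarrier V. vadd W (f x) (g x))"
  "Scale FdVec a (V, W, f) = (V, W, \<lambda>x \<in> vcarrier V. vscale W a (f x))"
  by (simp_all add: FdVec_def)

lemma linear_maps_iff:
  "f \<in> linear_maps V W \<longleftrightarrow> vlinear V W f \<and> f \<in> extensional (vcarrier V)"
  by (auto simp: linear_maps_def vlinear_def PiE_def)

lemma restrict_linear_maps: "\<lbrakk>vlinear V W f; vector_space_struct V\<rbrakk> \<Longrightarrow> restrict f (vcarrier V) \<in> linear_maps V W"
  by (auto simp: linear_maps_iff vlinear_def vector_space_struct.add_closed vector_space_struct.scale_closed)

lemma FdVec_Hom_iff:
  "x \<in> Hom FdVec V W \<longleftrightarrow> V \<in> Ob FdVec \<and> W \<in> Ob FdVec \<and> (\<exists>f \<in> linear_maps V W. x = (V, W, f))"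
  by (auto simp: FdVec_def Hom_def)

lemma linear_maps_vs:
  assumes V: "vector_space_struct V" and W: "vector_space_struct W"
    and f: "f \<in> linear_maps V W" and g: "g \<in> linear_maps V W"
  shows "(\<lambda>x\<in>vcarrier V. vadd W (f x) (g x)) \<in> linear_maps V W"
    and "(\<lambda>x\<in>vcarrier V. vscale W a (f x)) \<in> linear_maps V W"
proof -
  interpret V: vector_space_struct V by fact
  interpret W: vector_space_struct W by fact
  have f': "vlinear V W f" and g': "vlinear V W g" using f g by (auto simp: linear_maps_iff)
  show "(\<lambda>x\<in>vcarrier V. vadd W (f x) (g x)) \<in> linear_maps V W"
    by (rule restrict_linear_maps[OF _ V]) (use f' g' in \<open>auto simp: vlinear_def W.add_ac W.scale_add\<close>)
  show "(\<lambda>x\<in>vcarrier V. vscale W a (f x)) \<in> linear_maps V W"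
    by (rule restrict_linear_maps[OF _ V]) (use f' in \<open>auto simp: vlinear_def W.scale_scale W.scale_add mult.commute\<close>)
qed

lemma FdVec_arr_cases:
  assumes "x \<in> Hom FdVec V W"
  obtains f where "x = (V, W, f)" "vector_space_struct V" "finite_dim V" "vector_space_struct W" "finite_dim W"
    "vlinear V W f" "f \<in> extensional (vcarrier V)"
  using assms by (auto simp: FdVec_Hom_iff linear_maps_iff)

lemma FdVec_HomI:
  "\<lbrakk>vector_space_struct V; finite_dim V; vector_space_struct W; finite_dim W; vlinear V W f; f \<in> extensional (vcarrier V)\<rbrakk>
    \<Longrightarrow> (V, W, f) \<in> Hom FdVec V W"
  by (auto simp: FdVec_Hom_iff linear_maps_iff)

lemma FdVec_category: "category FdVec"
proof
  fix A B D E :: "('k::field, 'v) vec_space"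
    and f g h :: "('k, 'v) vec_space \<times> ('k, 'v) vec_space \<times> ('v \<Rightarrow> 'v)"
  show "f \<in> Ar FdVec \<Longrightarrow> Dom FdVec f \<in> Ob FdVec" "f \<in> Ar FdVec \<Longrightarrow> Cod FdVec f \<in> Ob FdVec"
    by (auto simp: FdVec_def)
  show "A \<in> Ob FdVec \<Longrightarrow> Idn FdVec A \<in> Hom FdVec A A"
    by (auto intro!: FdVec_HomI simp: vlinear_def vector_space_struct.add_closed vector_space_struct.scale_closed)
  assume f: "f \<in> Hom FdVec A B"
  show "f \<cdot>\<^bsub>FdVec\<^esub> Idn FdVec A = f"
    using f by (elim FdVec_arr_cases) (auto simp: fun_eq_iff extensional_def)
  show "Idn FdVec B \<cdot>\<^bsub>FdVec\<^esub> f = f"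
    using f by (elim FdVec_arr_cases) (auto simp: fun_eq_iff extensional_def vlinear_def)
  assume g: "g \<in> Hom FdVec B D"
  show "g \<cdot>\<^bsub>FdVec\<^esub> f \<in> Hom FdVec A D"
    using f g
    by (elim FdVec_arr_cases)
      (auto intro!: FdVec_HomI simp: vlinear_def vector_space_struct.add_closed vector_space_struct.scale_closed)
  assume h: "h \<in> Hom FdVec D E"
  show "(h \<cdot>\<^bsub>FdVec\<^esub> g) \<cdot>\<^bsub>FdVec\<^esub> f = h \<cdot>\<^bsub>FdVec\<^esub> (g \<cdot>\<^bsub>FdVec\<^esub> f)"
    using f g h by (elim FdVec_arr_cases) (auto simp: fun_eq_iff vlinear_def)
qed

lemma FdVec_hom_space:
  assumes A: "A \<in> Ob FdVec" and B: "B \<in> Ob FdVec"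
  shows "vector_space_struct (hom_space FdVec A B)"
proof -
  interpret A: vector_space_struct A using A by simp
  interpret B: vector_space_struct B using B by simp
  have AB: "vector_space_struct A" "vector_space_struct B" by unfold_locales
  have H: "x \<in> Hom FdVec A B \<longleftrightarrow> (\<exists>f \<in> linear_maps A B. x = (A, B, f))" for x
    using A B by (auto simp: FdVec_Hom_iff)
  have c: "u \<in> vcarrier A \<Longrightarrow> f u \<in> vcarrier B" if "f \<in> linear_maps A B" for f u
    using that by (auto simp: linear_maps_iff vlinear_def)
  have e: "u \<notin> vcarrier A \<Longrightarrow> f u = undefined" if "f \<in> linear_maps A B" for f u
    using that by (auto simp: linear_maps_iff extensional_def)
  note lm = linear_maps_vs[OF AB]
  show ?thesis
  proof
    fix x y z a b
    show "vzero (hom_space FdVec A B) \<in> vcarrier (hom_space FdVec A B)"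
      by (auto simp: H vlinear_def B.add_zero intro!: restrict_linear_maps[OF _ AB(1)])
    assume x: "x \<in> vcarrier (hom_space FdVec A B)"
    show "vscale (hom_space FdVec A B) a x \<in> vcarrier (hom_space FdVec A B)"
      using x lm(2) by (auto simp: H)
    show "vadd (hom_space FdVec A B) (vzero (hom_space FdVec A B)) x = x"
      using x c by (auto simp: H fun_eq_iff B.add_zero) (metis e)
    show "vscale (hom_space FdVec A B) (a + b) x =
      vadd (hom_space FdVec A B) (vscale (hom_space FdVec A B) a x) (vscale (hom_space FdVec A B) b x)"
      using x c by (auto simp: H fun_eq_iff B.add_scale)
    show "vscale (hom_space FdVec A B) a (vscale (hom_space FdVec A B) b x) = vscale (hom_space FdVec A B) (a * b) x"
      using x c by (auto simp: H fun_eq_iff B.scale_scale)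
    show "vscale (hom_space FdVec A B) 1 x = x"
      using x c by (auto simp: H fun_eq_iff B.scale_one) (metis e)
    show "\<exists>y \<in> vcarrier (hom_space FdVec A B). vadd (hom_space FdVec A B) x y = vzero (hom_space FdVec A B)"
    proof (rule bexI)
      show "vadd (hom_space FdVec A B) x (Scale FdVec (-1) x) = vzero (hom_space FdVec A B)"
        using x c by (auto simp: H fun_eq_iff)
      show "Scale FdVec (-1) x \<in> vcarrier (hom_space FdVec A B)"
        using x lm(2) by (auto simp: H)
    qed
    assume y: "y \<in> vcarrier (hom_space FdVec A B)"
    show "vadd (hom_space FdVec A B) x y \<in> vcarrier (hom_space FdVec A B)"
      using x y lm(1) by (auto simp: H)
    show "vadd (hom_space FdVec A B) x y = vadd (hom_space FdVec A B) y x"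
      using x y c by (auto simp: H fun_eq_iff B.add_comm)
    show "vscale (hom_space FdVec A B) a (vadd (hom_space FdVec A B) x y) =
      vadd (hom_space FdVec A B) (vscale (hom_space FdVec A B) a x) (vscale (hom_space FdVec A B) a y)"
      using x y c by (auto simp: H fun_eq_iff B.scale_add)
    assume z: "z \<in> vcarrier (hom_space FdVec A B)"
    show "vadd (hom_space FdVec A B) (vadd (hom_space FdVec A B) x y) z =
      vadd (hom_space FdVec A B) x (vadd (hom_space FdVec A B) y z)"
      using x y z c by (auto simp: H fun_eq_iff B.add_assoc)
  qed
qed

lemma FdVec_linear_category: "linear_category FdVec"
proof (intro linear_category.intro linear_category_axioms.intro FdVec_category FdVec_hom_space)
  fix A B D f f' g g' a
  show "f \<in> Hom FdVec A B \<Longrightarrow> f' \<in> Hom FdVec A B \<Longrightarrow> g \<in> Hom FdVec B D \<Longrightarrow>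
      g \<cdot>\<^bsub>FdVec\<^esub> Add FdVec f f' = Add FdVec (g \<cdot>\<^bsub>FdVec\<^esub> f) (g \<cdot>\<^bsub>FdVec\<^esub> f')"
    "f \<in> Hom FdVec A B \<Longrightarrow> g \<in> Hom FdVec B D \<Longrightarrow> g' \<in> Hom FdVec B D \<Longrightarrow>
      Add FdVec g g' \<cdot>\<^bsub>FdVec\<^esub> f = Add FdVec (g \<cdot>\<^bsub>FdVec\<^esub> f) (g' \<cdot>\<^bsub>FdVec\<^esub> f)"
    "f \<in> Hom FdVec A B \<Longrightarrow> g \<in> Hom FdVec B D \<Longrightarrow> g \<cdot>\<^bsub>FdVec\<^esub> Scale FdVec a f = Scale FdVec a (g \<cdot>\<^bsub>FdVec\<^esub> f)"
    "f \<in> Hom FdVec A B \<Longrightarrow> g \<in> Hom FdVec B D \<Longrightarrow> Scale FdVec a g \<cdot>\<^bsub>FdVec\<^esub> f = Scale FdVec a (g \<cdot>\<^bsub>FdVec\<^esub> f)"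
    by (auto elim!: FdVec_arr_cases simp: fun_eq_iff vlinear_def)
qed

text \<open>Tuples are padded with zeros so that the spaces of all dimensions share the type
  \<open>nat \<Rightarrow> 'k\<close>, which is the one fixed in
  \<open>trivial_symmetric_center\<close>.\<close>

definition coord_space :: "nat \<Rightarrow> ('k::field, nat \<Rightarrow> 'k) vec_space" where
  "coord_space n = \<lparr>vcarrier = {c. \<forall>j\<ge>n. c j = 0}, vzero = (\<lambda>_. 0),
     vadd = (\<lambda>c d j. c j + d j), vscale = (\<lambda>a c j. a * c j)\<rparr>"

lemma coord_space_simps [simp]:
  "c \<in> vcarrier (coord_space n) \<longleftrightarrow> (\<forall>j\<ge>n. c j = 0)" "vzero (coord_space n) = (\<lambda>_. 0)"
  "vadd (coord_space n) c d = (\<lambda>j. c j + d j)" "vscale (coord_space n) a c = (\<lambda>j. a * c j)"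
  by (simp_all add: coord_space_def)

lemma coord_space_vs: "vector_space_struct (coord_space n :: ('k::field, _) vec_space)"
proof
  show "\<exists>y \<in> vcarrier (coord_space n). vadd (coord_space n) x y = vzero (coord_space n)"
    if "x \<in> vcarrier (coord_space n)" for x :: "nat \<Rightarrow> 'k"
    using that by (intro bexI[of _ "\<lambda>j. - x j"]) auto
qed (auto simp: fun_eq_iff algebra_simps)

lemma coord_space_finite_dim: "finite_dim (coord_space n :: ('k::field, _) vec_space)"
proof -
  define e :: "nat \<Rightarrow> nat \<Rightarrow> 'k" where "e i = (\<lambda>j. if j = i then 1 else 0)" for i
  have sum: "vcomb (coord_space n) c e m = (\<lambda>j. if j < m then c j else 0)" for c m
    unfolding vcomb_def by (induction m) (auto simp: e_def fun_eq_iff less_Suc_eq)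
  have span: "vcomb (coord_space n) c e m \<in> lin_span (coord_space n) (e ` {..<n})" if "m \<le> n" for c m
    using that unfolding vcomb_def
  proof (induction m)
    case (Suc m)
    have "e m \<in> lin_span (coord_space n) (e ` {..<n})" using Suc.prems by (intro lin_span.base) simp
    then show ?case unfolding vsum.simps using Suc by (intro lin_span.add lin_span.scale) simp_all
  next
    case 0
    show ?case unfolding vsum.simps by (rule lin_span.zero)
  qed
  have "c \<in> lin_span (coord_space n) (e ` {..<n})" if "c \<in> vcarrier (coord_space n)" for c
  proof -
    have "(\<lambda>j. if j < n then c j else 0) = c" using that by (auto simp: fun_eq_iff)
    then show ?thesis using span[of n c] by (simp add: sum)
  qed
  moreover have "e ` {..<n} \<subseteq> vcarrier (coord_space n)" by (auto simp: e_def)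
  ultimately show ?thesis unfolding finite_dim_def by (intro exI[of _ "e ` {..<n}"]) blast
qed

text \<open>Coefficients from \<open>n\<close> on are required to vanish; only this makes the
  coefficient function of a vector in a basis unique, as \<open>THE\<close> demands.\<close>

definition coords :: "('k::field, 'v) vec_space \<Rightarrow> nat \<Rightarrow> (nat \<Rightarrow> 'v) \<Rightarrow> 'v \<Rightarrow> nat \<Rightarrow> 'k" where
  "coords V n b x = (THE c. c \<in> vcarrier (coord_space n) \<and> vcomb V c b n = x)"

context vector_space_struct
begin

context
  fixes n b
  assumes b: "vbasis V n b"
begin

lemma coords_vcomb:
  assumes "c \<in> vcarrier (coord_space n)"
  shows "coords V n b (vcomb V c b n) = c"
  unfolding coords_def
proof (rule the_equality)
  fix d assume d: "d \<in> vcarrier (coord_space n) \<and> vcomb V d b n = vcomb V c b n"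
  then have "\<forall>i<n. d i = c i" using vcomb_eq_iff[of n b d c] b by (simp add: vbasis_def)
  moreover have "\<forall>i\<ge>n. d i = c i" using d assms by simp
  ultimately show "d = c" by (metis ext not_less)
qed (use assms in simp)

lemma vcomb_coords:
  assumes "x \<in> vcarrier V"
  shows "coords V n b x \<in> vcarrier (coord_space n)" "vcomb V (coords V n b x) b n = x"
proof -
  obtain c where c: "x = vcomb V c b n" using assms b by (auto simp: vbasis_def vspanning_def)
  have "vcomb V (\<lambda>j. if j < n then c j else 0) b n = x"
    unfolding c by (auto simp: vcomb_def intro: vsum_cong)
  then have "coords V n b x = (\<lambda>j. if j < n then c j else 0)"
    using coords_vcomb[of "\<lambda>j. if j < n then c j else 0"] by simp
  then show "coords V n b x \<in> vcarrier (coord_space n)" "vcomb V (coords V n b x) b n = x"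
    using \<open>vcomb V _ b n = x\<close> by simp_all
qed

lemma vlinear_vcomb_coord_space: "vlinear (coord_space n) V (\<lambda>c. vcomb V c b n)"
  using b by (auto simp: vlinear_def vbasis_def vindep_def vcomb_add vcomb_scale)

lemma vlinear_coords: "vlinear V (coord_space n) (coords V n b)"
proof -
  have bV: "i < n \<Longrightarrow> b i \<in> vcarrier V" for i using b by (simp add: vbasis_def vindep_def)
  have "coords V n b (vadd V x y) = vadd (coord_space n) (coords V n b x) (coords V n b y)"
    if xy: "x \<in> vcarrier V" "y \<in> vcarrier V" for x y
  proof -
    have "vcomb V (vadd (coord_space n) (coords V n b x) (coords V n b y)) b n = vadd V x y"
      using vcomb_add[where b = b and c = "coords V n b x" and d = "coords V n b y" and n = n, OF bV] vcomb_coords(2) xy by simp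
    then show ?thesis
      using coords_vcomb vcomb_coords(1) xy coord_space_vs vector_space_struct.add_closed by metis
  qed
  moreover have "coords V n b (vscale V a x) = vscale (coord_space n) a (coords V n b x)"
    if x: "x \<in> vcarrier V" for a x
  proof -
    have "vcomb V (vscale (coord_space n) a (coords V n b x)) b n = vscale V a x"
      using vcomb_scale[where b = b and c = "coords V n b x" and a = a and n = n, OF bV] vcomb_coords(2) x by simp
    then show ?thesis
      using coords_vcomb vcomb_coords(1) x coord_space_vs vector_space_struct.scale_closed by metis
  qed
  ultimately show ?thesis using vcomb_coords(1) by (simp add: vlinear_def)
qed

end

end

lemma FdVec_isomorphicI:
  assumes V: "vector_space_struct V" "finite_dim V" and W: "vector_space_struct W" "finite_dim W"
    and f: "vlinear V W f" and g: "vlinear W V g"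
    and gf: "\<And>x. x \<in> vcarrier V \<Longrightarrow> g (f x) = x" and fg: "\<And>y. y \<in> vcarrier W \<Longrightarrow> f (g y) = y"
  shows "isomorphic FdVec V W"
  unfolding isomorphic_def iso_def
proof (intro bexI exI)
  let ?f = "(V, W, restrict f (vcarrier V))" and ?g = "(W, V, restrict g (vcarrier W))"
  show f': "?f \<in> Hom FdVec V W"
    using restrict_linear_maps[OF f V(1)] V W by (auto simp: FdVec_Hom_iff)
  have g': "?g \<in> Hom FdVec W V"
    using restrict_linear_maps[OF g W(1)] V W by (auto simp: FdVec_Hom_iff)
  show "is_inverse FdVec ?f ?g"
    using f' g' f g unfolding is_inverse_def by (auto simp: Hom_def gf fg vlinear_def fun_eq_iff)
qed

lemma (in linear_category) full_subcategory_linear: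
  assumes S: "S \<subseteq> Ob C"
  shows "linear_category (full_subcategory C S)"
proof -
  have [simp]: "Ob (full_subcategory C S) = S" "Dom (full_subcategory C S) = Dom C" "Cod (full_subcategory C S) = Cod C"
    "Idn (full_subcategory C S) = Idn C" "Comp (full_subcategory C S) = Comp C" "Zer (full_subcategory C S) = Zer C"
    "Add (full_subcategory C S) = Add C" "Scale (full_subcategory C S) = Scale C"
    by (simp_all add: full_subcategory_def)
  have H: "Hom (full_subcategory C S) A B = (if A \<in> S \<and> B \<in> S then Hom C A B else {})" for A B
    by (auto simp: Hom_def full_subcategory_def)
  have Ar: "f \<in> Ar (full_subcategory C S) \<longleftrightarrow> f \<in> Ar C \<and> Dom C f \<in> S \<and> Cod C f \<in> S" for f
    by (simp add: full_subcategory_def)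
  have hs: "hom_space (full_subcategory C S) A B = hom_space C A B" if "A \<in> S" "B \<in> S" for A B
    using that by (simp add: hom_space_def H)
  show ?thesis
  proof (intro linear_category.intro category.intro linear_category_axioms.intro)
    show "A \<in> Ob (full_subcategory C S) \<Longrightarrow> B \<in> Ob (full_subcategory C S) \<Longrightarrow>
      vector_space_struct (hom_space (full_subcategory C S) A B)" for A B
      using S by (simp add: hs subset_eq)
  qed (use S in \<open>auto simp: H Comp_assoc Comp_Add Add_Comp Comp_Scale Scale_Comp Comp_Idn Idn_Comp Ar
      Idn_Hom Comp_Hom split: if_splits\<close>)
qed

section \<open>Sums of copies of one object as vector spaces\<close>

context linear_category
begin

text \<open>Composition with \<open>r a\<close> reads off the coefficient at \<open>a\<close>. On
  any \<open>x\<close> it returns a scalar endomorphism of \<open>U\<close>, and these scalars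
  rebuild \<open>x\<close> from the inclusions.\<close>

lemma unit_sum_vbasis:
  assumes X: "unit_sum U X n i r" and U: "Idn C U \<noteq> Zer C U U"
    and End: "\<And>f. f \<in> Hom C U U \<Longrightarrow> \<exists>a. f = Scale C a (Idn C U)"
  shows "vbasis (hom_space C U X) n i"
proof -
  have [simp]: "U \<in> Ob C" "X \<in> Ob C" using X by (auto simp: unit_sum_def)
  have i: "a < n \<Longrightarrow> i a \<in> Hom C U X" and r: "a < n \<Longrightarrow> r a \<in> Hom C X U" for a
    using X by (auto simp: unit_sum_def)
  have ri: "a < n \<Longrightarrow> b < n \<Longrightarrow> r a \<cdot> i b = (if a = b then Idn C U else Zer C U U)" for a b
    using X by (auto simp: unit_sum_def)
  have sum: "hsum X X (\<lambda>a. i a \<cdot> r a) n = Idn C X" using X by (auto simp: unit_sum_def)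
  have "c a = 0" if c: "vcomb (hom_space C U X) c i n = Zer C U X" and a: "a < n" for c a
  proof -
    have "r a \<cdot> hsum U X (\<lambda>b. Scale C (c b) (i b)) n = Zer C U U"
      using c r[OF a] by (simp add: vcomb_def hsum_def[symmetric] Comp_Zer Hom_iff)
    moreover have "r a \<cdot> hsum U X (\<lambda>b. Scale C (c b) (i b)) n = hsum U U (\<lambda>b. r a \<cdot> Scale C (c b) (i b)) n"
      by (rule Comp_hsum[OF r[OF a]]) (simp_all add: Scale_Hom i)
    moreover have "\<dots> = Scale C (c a) (Idn C U)"
    proof (rule hsum_delta[OF a])
      fix b assume b: "b < n"
      show "r a \<cdot> Scale C (c b) (i b) = (if b = a then Scale C (c a) (Idn C U) else Zer C U U)"
        using Comp_Scale[OF i[OF b] r[OF a], of "c b"] ri[OF a b] by (simp add: Scale_Zer)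
    qed (simp add: Scale_Hom Idn_Hom)
    ultimately show ?thesis using Scale_eq_Zer[of "c a" "Idn C U" U U] U by (simp add: Idn_Hom)
  qed
  moreover have "\<exists>c. x = vcomb (hom_space C U X) c i n" if x: "x \<in> Hom C U X" for x
  proof -
    have "\<forall>a. \<exists>c. a < n \<longrightarrow> r a \<cdot> x = Scale C c (Idn C U)" using End Comp_Hom[OF x r] by blast
    then obtain c where c: "\<And>a. a < n \<Longrightarrow> r a \<cdot> x = Scale C (c a) (Idn C U)" by metis
    have "x = hsum X X (\<lambda>a. i a \<cdot> r a) n \<cdot> x" unfolding sum by (rule Idn_Comp[OF x, symmetric])
    also have "\<dots> = hsum U X (\<lambda>a. (i a \<cdot> r a) \<cdot> x) n"
      by (rule hsum_Comp[OF x]) (auto intro: Comp_Hom i r)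
    also have "\<dots> = hsum U X (\<lambda>a. Scale C (c a) (i a)) n"
    proof (rule hsum_cong)
      fix a assume a: "a < n"
      have "(i a \<cdot> r a) \<cdot> x = i a \<cdot> (r a \<cdot> x)" by (rule Comp_assoc[OF x r[OF a] i[OF a]])
      also have "\<dots> = Scale C (c a) (i a)"
        using Comp_Scale[OF Idn_Hom i[OF a]] Comp_Idn[OF i[OF a]] by (simp add: c[OF a])
      finally show "(i a \<cdot> r a) \<cdot> x = Scale C (c a) (i a)" .
    qed
    finally show ?thesis unfolding hsum_def vcomb_def by auto
  qed
  ultimately show ?thesis using i unfolding vbasis_def vindep_def vspanning_def by simp
qed

lemma unit_sum_Comp_eqD:
  assumes X: "unit_sum U X n i r" and f: "f \<in> Hom C X Y" and g: "g \<in> Hom C X Y"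
    and eq: "\<And>a. a < n \<Longrightarrow> f \<cdot> i a = g \<cdot> i a"
  shows "f = g"
proof -
  have XO: "X \<in> Ob C" and i: "a < n \<Longrightarrow> i a \<in> Hom C U X" and r: "a < n \<Longrightarrow> r a \<in> Hom C X U" for a
    using X by (auto simp: unit_sum_def)
  have sum: "hsum X X (\<lambda>a. i a \<cdot> r a) n = Idn C X" using X by (auto simp: unit_sum_def)
  have *: "h = hsum X Y (\<lambda>a. (h \<cdot> i a) \<cdot> r a) n" if h: "h \<in> Hom C X Y" for h
  proof -
    have "h = h \<cdot> hsum X X (\<lambda>a. i a \<cdot> r a) n" unfolding sum by (rule Comp_Idn[OF h, symmetric])
    also have "\<dots> = hsum X Y (\<lambda>a. h \<cdot> (i a \<cdot> r a)) n"
      by (rule Comp_hsum[OF h XO]) (auto intro: Comp_Hom i r)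
    also have "\<dots> = hsum X Y (\<lambda>a. (h \<cdot> i a) \<cdot> r a) n"
      by (intro hsum_cong Comp_assoc[OF r i h, symmetric])
    finally show ?thesis .
  qed
  have "hsum X Y (\<lambda>a. (f \<cdot> i a) \<cdot> r a) n = hsum X Y (\<lambda>a. (g \<cdot> i a) \<cdot> r a) n"
    by (rule hsum_cong) (simp add: eq)
  then show ?thesis by (subst *[OF f], subst *[OF g])
qed

text \<open>The equivalence is \<open>Hom(U, -)\<close>, written in coordinates because objects of
  \<open>FdVec\<close> must have their carrier in \<open>nat \<Rightarrow> 'c\<close>. It is fully
  faithful since a morphism out of a sum of copies of \<open>U\<close> is determined by its values
  on the inclusions, which can be prescribed freely; \<open>ex_sum\<close> provides every
  dimension.\<close>

lemma linearly_equivalent_FdVec: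
  assumes S: "S \<subseteq> Ob C" and U: "Idn C U \<noteq> Zer C U U"
    and End: "\<And>f. f \<in> Hom C U U \<Longrightarrow> \<exists>a. f = Scale C a (Idn C U)"
    and sums: "\<And>X. X \<in> S \<Longrightarrow> \<exists>n i r. unit_sum U X n i r"
    and ex_sum: "\<And>n. \<exists>X \<in> S. \<exists>i r. unit_sum U X n i r"
  shows "linearly_equivalent (full_subcategory C S) (FdVec :: (('c, nat \<Rightarrow> 'c) vec_space, _, 'c) lin_cat)"
proof -
  let ?D = "full_subcategory C S"
  have [simp]: "Ob ?D = S" "Idn ?D = Idn C" "Comp ?D = Comp C" "Add ?D = Add C" "Scale ?D = Scale C"
    by (simp_all add: full_subcategory_def)
  have HD: "f \<in> Hom ?D A B \<longleftrightarrow> A \<in> S \<and> B \<in> S \<and> f \<in> Hom C A B" for f A B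
    by (auto simp: Hom_def full_subcategory_def)
  obtain n i r where us: "\<And>X. X \<in> S \<Longrightarrow> unit_sum U X (n X) (i X) (r X)"
    using sums by metis
  let ?K = "\<lambda>X. coord_space (n X) :: ('c, nat \<Rightarrow> 'c) vec_space"
  let ?V = "hom_space C U"
  define \<phi> where "\<phi> X c = vcomb (?V X) c (i X) (n X)" for X c
  define \<psi> where "\<psi> X = coords (?V X) (n X) (i X)" for X
  have SO: "X \<in> S \<Longrightarrow> X \<in> Ob C" for X using S by blast
  have UO: "U \<in> Ob C" using ex_sum by (auto simp: unit_sum_def)
  have V: "X \<in> S \<Longrightarrow> vector_space_struct (?V X)" for X using SO UO by simp
  have bas: "X \<in> S \<Longrightarrow> vbasis (?V X) (n X) (i X)" for X by (rule unit_sum_vbasis[OF us U End])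
  have \<phi>: "X \<in> S \<Longrightarrow> vlinear (?K X) (?V X) (\<phi> X)" for X
    unfolding \<phi>_def by (rule vector_space_struct.vlinear_vcomb_coord_space[OF V bas])
  have \<psi>: "X \<in> S \<Longrightarrow> vlinear (?V X) (?K X) (\<psi> X)" for X
    unfolding \<psi>_def by (rule vector_space_struct.vlinear_coords[OF V bas])
  have \<psi>\<phi>: "\<psi> X (\<phi> X c) = c" if "X \<in> S" "c \<in> vcarrier (?K X)" for X c
    unfolding \<phi>_def \<psi>_def by (rule vector_space_struct.coords_vcomb[OF V[OF that(1)] bas[OF that(1)] that(2)])
  have \<phi>\<psi>: "\<phi> X (\<psi> X x) = x" if "X \<in> S" "x \<in> Hom C U X" for X x
    unfolding \<phi>_def \<psi>_def
    by (rule vector_space_struct.vcomb_coords(2)[OF V[OF that(1)] bas[OF that(1)]]) (simp add: that)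
  have \<phi>_Hom: "\<phi> X c \<in> Hom C U X" if "X \<in> S" "c \<in> vcarrier (?K X)" for X c
    using \<phi>[OF that(1)] that(2) unfolding vlinear_def by simp
  have \<psi>_K: "\<psi> X x \<in> vcarrier (?K X)" if "X \<in> S" "x \<in> Hom C U X" for X x
    using \<psi>[OF that(1)] that(2) unfolding vlinear_def by simp
  define F where "F f = (?K (Dom C f), ?K (Cod C f),
      \<lambda>c \<in> vcarrier (?K (Dom C f)). \<psi> (Cod C f) (f \<cdot> \<phi> (Dom C f) c))" for f
  have F: "F f = (?K A, ?K B, \<lambda>c \<in> vcarrier (?K A). \<psi> B (f \<cdot> \<phi> A c))" if "f \<in> Hom C A B" for f A B
    using that by (auto simp: F_def Hom_iff)
  have F_lin: "vlinear (?K A) (?K B) (\<lambda>c. \<psi> B (f \<cdot> \<phi> A c))" if f: "f \<in> Hom C A B" and AB: "A \<in> S" "B \<in> S" for f A B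
    by (rule vlinear_Comp_fun[OF vlinear_Comp_fun[OF \<phi>[OF AB(1)] vlinear_Comp_left[OF f UO]] \<psi>[OF AB(2)]])
  have F_Hom: "F f \<in> Hom FdVec (?K A) (?K B)" if f: "f \<in> Hom C A B" and AB: "A \<in> S" "B \<in> S" for f A B
    unfolding F[OF f] FdVec_Hom_iff
    using coord_space_vs coord_space_finite_dim restrict_linear_maps[OF F_lin[OF f AB] coord_space_vs] by auto
  have "linear_functor ?D FdVec ?K F"
  proof (intro linear_functor.intro linear_functor_axioms.intro full_subcategory_linear[OF S] FdVec_linear_category)
    fix A B E f g a
    show "?K A \<in> Ob FdVec" by (simp add: coord_space_vs coord_space_finite_dim)
    show "F (Idn ?D A) = Idn FdVec (?K A)" if A: "A \<in> Ob ?D"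
    proof -
      have A': "A \<in> S" using A by simp
      have "Idn C A \<cdot> \<phi> A c = \<phi> A c" if "c \<in> vcarrier (?K A)" for c by (rule Idn_Comp[OF \<phi>_Hom[OF A' that]])
      then show ?thesis using F[OF Idn_Hom[OF SO[OF A']]] \<psi>\<phi>[OF A'] by (simp add: fun_eq_iff del: coord_space_simps)
    qed
    assume f0: "f \<in> Hom ?D A B"
    then have f: "f \<in> Hom C A B" and A: "A \<in> S" and B: "B \<in> S" by (auto simp: HD)
    show "F f \<in> Hom FdVec (?K A) (?K B)" by (rule F_Hom[OF f A B])
    have fH: "f \<cdot> \<phi> A c \<in> Hom C U B" if "c \<in> vcarrier (?K A)" for c by (rule Comp_Hom[OF \<phi>_Hom[OF A that] f])
    have "\<psi> B (Scale C a f \<cdot> \<phi> A c) = vscale (?K B) a (\<psi> B (f \<cdot> \<phi> A c))" if c: "c \<in> vcarrier (?K A)" for c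
      using Scale_Comp[OF \<phi>_Hom[OF A c] f, of a] \<psi>[OF B] fH[OF c] by (simp add: vlinear_def)
    then show "F (Scale ?D a f) = Scale FdVec a (F f)"
      using F[OF f] F[OF Scale_Hom[OF f]] by (simp add: fun_eq_iff del: coord_space_simps)
    show "F (g \<cdot>\<^bsub>?D\<^esub> f) = F g \<cdot>\<^bsub>FdVec\<^esub> F f" if "g \<in> Hom ?D B E"
    proof -
      have g: "g \<in> Hom C B E" and E: "E \<in> S" using that by (auto simp: HD)
      have "\<psi> E ((g \<cdot> f) \<cdot> \<phi> A c) = \<psi> E (g \<cdot> \<phi> B (\<psi> B (f \<cdot> \<phi> A c)))" if c: "c \<in> vcarrier (?K A)" for c
        using Comp_assoc[OF \<phi>_Hom[OF A c] f g] \<phi>\<psi>[OF B fH[OF c]] by simp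
      then show ?thesis
        using F[OF f] F[OF g] F[OF Comp_Hom[OF f g]] \<psi>_K[OF B fH] by (simp add: fun_eq_iff del: coord_space_simps)
    qed
    show "F (Add ?D f g) = Add FdVec (F f) (F g)" if "g \<in> Hom ?D A B"
    proof -
      have g: "g \<in> Hom C A B" using that by (auto simp: HD)
      have "\<psi> B (Add C f g \<cdot> \<phi> A c) = vadd (?K B) (\<psi> B (f \<cdot> \<phi> A c)) (\<psi> B (g \<cdot> \<phi> A c))"
        if c: "c \<in> vcarrier (?K A)" for c
        using Add_Comp[OF \<phi>_Hom[OF A c] f g] \<psi>[OF B] fH[OF c] Comp_Hom[OF \<phi>_Hom[OF A c] g] by (simp add: vlinear_def)
      then show ?thesis
        using F[OF f] F[OF g] F[OF Add_Hom[OF f g]] by (simp add: fun_eq_iff del: coord_space_simps)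
    qed
  qed
  then show ?thesis
  proof (rule linearly_equivalentI)
    fix A B assume "A \<in> Ob ?D" "B \<in> Ob ?D"
    then have A: "A \<in> S" and B: "B \<in> S" by auto
    have H: "Hom ?D A B = Hom C A B" using A B by (auto simp: HD)
    have iH: "a < n A \<Longrightarrow> i A a \<in> Hom C U A" and rH: "a < n A \<Longrightarrow> r A a \<in> Hom C A U" for a
      using us[OF A] by (auto simp: unit_sum_def)
    have ri: "a < n A \<Longrightarrow> b < n A \<Longrightarrow> r A b \<cdot> i A a = (if b = a then Idn C U else Zer C U U)" for a b
      using us[OF A] by (auto simp: unit_sum_def)
    have "inj_on F (Hom C A B)"
    proof (rule inj_onI)
      fix f g assume f: "f \<in> Hom C A B" and g: "g \<in> Hom C A B" and eq: "F f = F g"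
      show "f = g"
      proof (rule unit_sum_Comp_eqD[OF us[OF A] f g])
        fix a assume a: "a < n A"
        let ?c = "\<psi> A (i A a)"
        have c: "?c \<in> vcarrier (?K A)" by (rule \<psi>_K[OF A iH[OF a]])
        have "(\<lambda>c \<in> vcarrier (?K A). \<psi> B (f \<cdot> \<phi> A c)) = (\<lambda>c \<in> vcarrier (?K A). \<psi> B (g \<cdot> \<phi> A c))"
          using eq unfolding F[OF f] F[OF g] by (simp only: prod.inject)
        from fun_cong[OF this, of ?c] c have "\<psi> B (f \<cdot> \<phi> A ?c) = \<psi> B (g \<cdot> \<phi> A ?c)"
          by (simp only: restrict_apply if_True)
        then have "\<psi> B (f \<cdot> i A a) = \<psi> B (g \<cdot> i A a)" unfolding \<phi>\<psi>[OF A iH[OF a]] .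
        then show "f \<cdot> i A a = g \<cdot> i A a"
          using \<phi>\<psi>[OF B Comp_Hom[OF iH[OF a] f]] \<phi>\<psi>[OF B Comp_Hom[OF iH[OF a] g]] by metis
      qed
    qed
    moreover have "F ` Hom C A B = Hom FdVec (?K A) (?K B)"
    proof
      show "F ` Hom C A B \<subseteq> Hom FdVec (?K A) (?K B)" by (intro image_subsetI F_Hom A B)
      show "Hom FdVec (?K A) (?K B) \<subseteq> F ` Hom C A B"
      proof
        fix x assume "x \<in> Hom FdVec (?K A) (?K B)"
        then obtain g where x: "x = (?K A, ?K B, g)" and g: "vlinear (?K A) (?K B) g"
          and ge: "g \<in> extensional (vcarrier (?K A))" by (rule FdVec_arr_cases)
        define g' where "g' y = \<phi> B (g (\<psi> A y))" for y
        have g': "vlinear (?V A) (?V B) g'"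
          unfolding g'_def by (rule vlinear_Comp_fun[OF vlinear_Comp_fun[OF \<psi>[OF A] g] \<phi>[OF B]])
        have g'H: "a < n A \<Longrightarrow> g' (i A a) \<in> Hom C U B" for a using g' iH by (simp add: vlinear_def)
        \<comment> \<open>The projections extend the values prescribed on the inclusions to a
          morphism on \<open>A\<close>.\<close>
        define f where "f = hsum A B (\<lambda>a. g' (i A a) \<cdot> r A a) (n A)"
        have f: "f \<in> Hom C A B" unfolding f_def by (rule hsum_Hom) (auto intro: Comp_Hom rH g'H SO A B)
        have fi: "f \<cdot> i A a = g' (i A a)" if a: "a < n A" for a
        proof -
          have "f \<cdot> i A a = hsum U B (\<lambda>b. (g' (i A b) \<cdot> r A b) \<cdot> i A a) (n A)"
            unfolding f_def by (rule hsum_Comp[OF iH[OF a]]) (auto intro: Comp_Hom rH g'H SO B)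
          also have "\<dots> = g' (i A a)"
          proof (rule hsum_delta[OF a g'H[OF a]])
            fix b assume b: "b < n A"
            have "(g' (i A b) \<cdot> r A b) \<cdot> i A a = g' (i A b) \<cdot> (if b = a then Idn C U else Zer C U U)"
              using Comp_assoc[OF iH[OF a] rH[OF b] g'H[OF b]] ri[OF a b] by simp
            also have "\<dots> = (if b = a then g' (i A a) else Zer C U B)"
              using Comp_Idn[OF g'H[OF b]] Comp_Zer[of "g' (i A b)" U U] g'H[OF b] UO by (auto simp: Hom_iff)
            finally show "(g' (i A b) \<cdot> r A b) \<cdot> i A a = (if b = a then g' (i A a) else Zer C U B)" .
          qed
          finally show ?thesis .
        qed
        have f\<phi>: "f \<cdot> \<phi> A c = g' (\<phi> A c)" for c
        proof -
          have iV: "a < n A \<Longrightarrow> i A a \<in> vcarrier (?V A)" for a using iH by simp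
          have "f \<cdot> \<phi> A c = vcomb (?V B) c (\<lambda>a. f \<cdot> i A a) (n A)"
            unfolding \<phi>_def by (rule vector_space_struct.vlinear_vcomb[OF V[OF A] vlinear_Comp_left[OF f UO] V[OF B] iV])
          also have "\<dots> = vcomb (?V B) c (\<lambda>a. g' (i A a)) (n A)"
            unfolding vcomb_def by (rule vsum_cong) (simp add: fi)
          also have "\<dots> = g' (\<phi> A c)"
            unfolding \<phi>_def by (rule vector_space_struct.vlinear_vcomb[OF V[OF A] g' V[OF B] iV, symmetric])
          finally show ?thesis .
        qed
        have "\<psi> B (f \<cdot> \<phi> A c) = g c" if c: "c \<in> vcarrier (?K A)" for c
        proof -
          have "g c \<in> vcarrier (?K B)" using g c unfolding vlinear_def by blast
          then show ?thesis unfolding f\<phi> g'_def \<psi>\<phi>[OF A c] by (rule \<psi>\<phi>[OF B])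
        qed
        then have "F f = x" unfolding F[OF f] x using ge by (auto simp: fun_eq_iff extensional_def)
        then show "x \<in> F ` Hom C A B" using f by blast
      qed
    qed
    ultimately show "bij_betw F (Hom ?D A B) (Hom FdVec (?K A) (?K B))" unfolding H by (simp add: bij_betw_def)
  next
    fix W :: "('c, nat \<Rightarrow> 'c) vec_space" assume "W \<in> Ob FdVec"
    then have W: "vector_space_struct W" "finite_dim W" by auto
    interpret W: vector_space_struct W by fact
    obtain m b where b: "vbasis W m b" by (rule W.ex_vbasis[OF W(2)])
    obtain X i' r' where X: "X \<in> S" and us': "unit_sum U X m i' r'" using ex_sum by blast
    have bas': "vbasis (?V X) m i'" by (rule unit_sum_vbasis[OF us' U End])
    interpret VX: vector_space_struct "?V X" by (rule V[OF X])
    \<comment> \<open>The decomposition chosen for \<open>X\<close> need not be the one that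
      \<open>ex_sum\<close> supplies, but both numbers of summands are the dimension of
      \<open>Hom(U, X)\<close>.\<close>
    have m: "m = n X"
      using VX.vindep_le[of m i' "n X" "i X"] VX.vindep_le[of "n X" "i X" m i'] bas[OF X] bas' by (simp add: vbasis_def)
    have "isomorphic FdVec (?K X) W"
    proof (rule FdVec_isomorphicI[OF coord_space_vs coord_space_finite_dim W])
      show "vlinear (?K X) W (\<lambda>c. vcomb W c b m)" using W.vlinear_vcomb_coord_space[OF b] m by simp
      show "vlinear W (?K X) (coords W m b)" using W.vlinear_coords[OF b] m by simp
      show "coords W m b (vcomb W c b m) = c" if "c \<in> vcarrier (?K X)" for c
        by (rule W.coords_vcomb[OF b]) (use that m in simp)
      show "vcomb W (coords W m b x) b m = x" if "x \<in> vcarrier W" for x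
        by (rule W.vcomb_coords(2)[OF b that])
    qed
    then show "\<exists>A \<in> Ob ?D. isomorphic FdVec (?K A) W" using X by auto
  qed
qed

end

section \<open>The symmetric center\<close>

context braided_finite_tensor_category
begin

text \<open>Pairing with the dual of \<open>D\<close> turns the \<open>h i\<close> into morphisms
  \<open>\<phi> (h i)\<close> to the unit. The pairing is injective, so they remain independent and
  \<open>unit_Tens_indep\<close> applies; the linear map \<open>?F\<close> carries the given
  relation to the one for them.\<close>

lemma Tens_indep:
  assumes h: "vindep (hom_space C P D) n h" and P: "P \<in> Ob C" and D: "D \<in> Ob C" and Z: "Z \<in> Ob C" and B: "B \<in> Ob C"
    and w: "\<And>i. i < n \<Longrightarrow> w i \<in> Hom C Z B"
    and eq: "hsum (P \<otimes> Z) (D \<otimes> B) (\<lambda>i. h i \<otimes>\<^sub>m w i) n = Zer C (P \<otimes> Z) (D \<otimes> B)"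
  shows "\<forall>i<n. w i = Zer C Z B"
proof -
  let ?L = "LDual C D" and ?I = "Unit C"
  note d = left_dual[OF D]
  note [simp] = left_dualD(1-8)[OF d] P Z B
  have hH: "h i \<in> Hom C P D" if "i < n" for i using h that by (simp add: vindep_def)
  have [simp]: "h i \<in> Ar C" "Dom C (h i) = P" "Cod C (h i) = D" "w i \<in> Ar C" "Dom C (w i) = Z" "Cod C (w i) = B"
    if "i < n" for i using hH[OF that] w[OF that] by (auto simp: Hom_iff)
  define \<phi> where "\<phi> x = Ev C D \<cdot> (Idn C ?L \<otimes>\<^sub>m x)" for x
  have lin: "vlinear (hom_space C P D) (hom_space C (?L \<otimes> P) ?I) \<phi>"
    unfolding \<phi>_def
    by (rule vlinear_Comp_fun[OF vlinear_TensM_right vlinear_Comp_left]) (simp_all add: Hom_iff)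
  have ind: "vindep (hom_space C (?L \<otimes> P) ?I) n (\<lambda>i. \<phi> (h i))"
    unfolding vindep_def
  proof (intro conjI allI impI)
    show "\<phi> (h i) \<in> vcarrier (hom_space C (?L \<otimes> P) ?I)" if "i < n" for i
      using lin hH[OF that] by (simp add: vlinear_def)
    fix c i assume c: "vcomb (hom_space C (?L \<otimes> P) ?I) c (\<lambda>i. \<phi> (h i)) n = vzero (hom_space C (?L \<otimes> P) ?I)" and i: "i < n"
    let ?x = "vcomb (hom_space C P D) c h n"
    have x: "?x \<in> Hom C P D" using vector_space_struct.vcomb_closed[OF hom_vs, of P D n h c] hH by simp
    have "\<phi> ?x = vcomb (hom_space C (?L \<otimes> P) ?I) c (\<lambda>i. \<phi> (h i)) n"
      by (rule vector_space_struct.vlinear_vcomb[OF _ lin]) (simp_all add: hH)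
    then have "\<phi> ?x = \<phi> (Zer C P D)" using c by (simp add: \<phi>_def TensM_Zer Comp_Zer)
    then have "?x = Zer C P D" unfolding \<phi>_def by (rule pair_left_inject[where N = P, OF d]) (simp_all add: x Zer_Hom[OF P D])
    then show "c i = 0" using vindepD[OF _ h i, of c] by simp
  qed
  let ?F = "\<lambda>x. (Ev C D \<otimes>\<^sub>m Idn C B) \<cdot> Inv C (Assoc C ?L D B) \<cdot> (Idn C ?L \<otimes>\<^sub>m x) \<cdot> Assoc C ?L P Z"
  have lin': "vlinear (hom_space C (P \<otimes> Z) (D \<otimes> B)) (hom_space C ((?L \<otimes> P) \<otimes> Z) (?I \<otimes> B)) ?F"
  proof -
    let ?H = "hom_space C (P \<otimes> Z) (D \<otimes> B)"
    have "vlinear ?H (hom_space C (?L \<otimes> P \<otimes> Z) (?L \<otimes> D \<otimes> B)) (\<lambda>x. Idn C ?L \<otimes>\<^sub>m x)"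
      by (rule vlinear_TensM_right) (simp_all add: Hom_iff)
    from vlinear_Comp_fun[OF this vlinear_Comp_right[where f = "Assoc C ?L P Z"]]
    have "vlinear ?H (hom_space C ((?L \<otimes> P) \<otimes> Z) (?L \<otimes> D \<otimes> B)) (\<lambda>x. (Idn C ?L \<otimes>\<^sub>m x) \<cdot> Assoc C ?L P Z)"
      by (simp add: Hom_iff)
    from vlinear_Comp_fun[OF this vlinear_Comp_left[where g = "Inv C (Assoc C ?L D B)"]]
    have "vlinear ?H (hom_space C ((?L \<otimes> P) \<otimes> Z) ((?L \<otimes> D) \<otimes> B))
      (\<lambda>x. Inv C (Assoc C ?L D B) \<cdot> (Idn C ?L \<otimes>\<^sub>m x) \<cdot> Assoc C ?L P Z)"
      by (simp add: Hom_iff)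
    from vlinear_Comp_fun[OF this vlinear_Comp_left[where g = "Ev C D \<otimes>\<^sub>m Idn C B"]]
    show ?thesis by (simp add: Hom_iff)
  qed
  have "\<phi> (h i) \<otimes>\<^sub>m w i = ?F (h i \<otimes>\<^sub>m w i)" if i: "i < n" for i
  proof -
    have "Inv C (Assoc C ?L D B) \<cdot> (Idn C ?L \<otimes>\<^sub>m h i \<otimes>\<^sub>m w i)
        = ((Idn C ?L \<otimes>\<^sub>m h i) \<otimes>\<^sub>m w i) \<cdot> Inv C (Assoc C ?L P Z)"
      using i by (simp add: Inv_Assoc_nat)
    from arg_cong[OF this, of "\<lambda>x. (Ev C D \<otimes>\<^sub>m Idn C B) \<cdot> x \<cdot> Assoc C ?L P Z"]
    show ?thesis using i by (simp add: \<phi>_def TensM_merge)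
  qed
  then have "hsum ((?L \<otimes> P) \<otimes> Z) (?I \<otimes> B) (\<lambda>i. \<phi> (h i) \<otimes>\<^sub>m w i) n = hsum ((?L \<otimes> P) \<otimes> Z) (?I \<otimes> B) (\<lambda>i. ?F (h i \<otimes>\<^sub>m w i)) n"
    by (rule hsum_cong)
  also have "\<dots> = ?F (hsum (P \<otimes> Z) (D \<otimes> B) (\<lambda>i. h i \<otimes>\<^sub>m w i) n)"
    unfolding hsum_def
    by (rule vector_space_struct.vlinear_vsum[OF _ lin', symmetric]) (simp_all add: Hom_iff)
  also have "\<dots> = Zer C ((?L \<otimes> P) \<otimes> Z) (?I \<otimes> B)"
    unfolding eq by (simp add: TensM_Zer Comp_Zer Zer_Comp)
  finally have E: "hsum ((?L \<otimes> P) \<otimes> Z) (?I \<otimes> B) (\<lambda>i. \<phi> (h i) \<otimes>\<^sub>m w i) n = Zer C ((?L \<otimes> P) \<otimes> Z) (?I \<otimes> B)" .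
  show ?thesis
  proof (rule unit_Tens_indep[OF ind _ Z B _ E])
    show "?L \<otimes> P \<in> Ob C" by simp
    show "w i \<in> Hom C Z B" if "i < n" for i by (rule w[OF that])
  qed
qed

text \<open>The dual bases form a wedge on \<open>P \<otimes> Q\<close>, which gives a morphism
  \<open>u\<close> to \<open>EC\<close> with components \<open>?g X\<close>. Restricted along
  \<open>z\<close>, the component at the unit vanishes by \<open>kz\<close>, hence so does the one
  at \<open>D\<close>, which factors through it. Independence of the \<open>h D i\<close> then
  leaves \<open>k D i \<cdot> z = 0\<close>, and the \<open>k D i\<close> span all morphisms from
  \<open>Q\<close> to the dual of \<open>D\<close>.\<close>

lemma tensor_end_factor_kernel:
  assumes e: "is_tensor_end C EC pC" and D: "D \<in> Ob C"
    and t: "t \<in> Hom C (unit \<otimes> LDual C unit) (D \<otimes> LDual C D)" "pC D = t \<cdot> pC unit"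
    and T: "simple_object C T" and q: "proj_cover C Q q T" and z: "z \<in> Hom C Z Q"
    and kz: "\<And>k. k \<in> Hom C Q (LDual C unit) \<Longrightarrow> k \<cdot> z = Zer C Z (LDual C unit)"
    and y: "y \<in> Hom C Q (LDual C D)"
  shows "y \<cdot> z = Zer C Z (LDual C D)"
proof -
  obtain P n h k where P: "P \<in> Ob C" and h: "\<And>X i. \<lbrakk>X \<in> Ob C; i < n X\<rbrakk> \<Longrightarrow> h X i \<in> Hom C P X"
    and k: "\<And>X i. \<lbrakk>X \<in> Ob C; i < n X\<rbrakk> \<Longrightarrow> k X i \<in> Hom C Q (LDual C X)"
    and ind: "\<And>X. X \<in> Ob C \<Longrightarrow> vindep (hom_space C P X) (n X) (h X)"
    and span: "\<And>X y. \<lbrakk>X \<in> Ob C; y \<in> Hom C Q (LDual C X)\<rbrakk> \<Longrightarrow> \<exists>c. y = hsum Q (LDual C X) (\<lambda>i. Scale C (c i) (k X i)) (n X)"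
    and wedge: "is_wedge C C (\<lambda>X Y. Y \<otimes> LDual C X) (\<lambda>f g. g \<otimes>\<^sub>m dual_map C f) (P \<otimes> Q)
      (\<lambda>X. hsum (P \<otimes> Q) (X \<otimes> LDual C X) (\<lambda>i. h X i \<otimes>\<^sub>m k X i) (n X))"
    by (rule ex_dual_bases_wedge[OF T q]) (rule that)
  let ?g = "\<lambda>X. hsum (P \<otimes> Q) (X \<otimes> LDual C X) (\<lambda>i. h X i \<otimes>\<^sub>m k X i) (n X)"
  obtain u where u: "u \<in> Hom C (P \<otimes> Q) EC" and pu: "\<And>X. X \<in> Ob C \<Longrightarrow> pC X \<cdot> u = ?g X"
    using e wedge unfolding is_tensor_end_def is_end_def by blast
  have pC: "X \<in> Ob C \<Longrightarrow> pC X \<in> Hom C EC (X \<otimes> LDual C X)" for X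
    using e unfolding is_tensor_end_def is_end_def is_wedge_def by blast
  note [simp] = left_dualD(2-8)[OF left_dual] P D
  have [simp]: "z \<in> Ar C" "Dom C z = Z" "Cod C z = Q" "Z \<in> Ob C" "Q \<in> Ob C" using z Hom_Ob by (auto simp: Hom_iff)
  have Pz: "Idn C P \<otimes>\<^sub>m z \<in> Hom C (P \<otimes> Z) (P \<otimes> Q)" by (simp add: Hom_iff)
  have hk: "X \<in> Ob C \<Longrightarrow> i < n X \<Longrightarrow> h X i \<otimes>\<^sub>m k X i \<in> Hom C (P \<otimes> Q) (X \<otimes> LDual C X)" for X i
    by (rule TensM_Hom[OF h k])
  have gz: "?g X \<cdot> (Idn C P \<otimes>\<^sub>m z) = hsum (P \<otimes> Z) (X \<otimes> LDual C X) (\<lambda>i. h X i \<otimes>\<^sub>m (k X i \<cdot> z)) (n X)" if X: "X \<in> Ob C" for X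
  proof -
    have [simp]: "h X i \<in> Ar C" "Dom C (h X i) = P" "Cod C (h X i) = X" "k X i \<in> Ar C" "Dom C (k X i) = Q" "Cod C (k X i) = LDual C X"
      if "i < n X" for i using h[OF X that] k[OF X that] by (auto simp: Hom_iff)
    have "?g X \<cdot> (Idn C P \<otimes>\<^sub>m z) = hsum (P \<otimes> Z) (X \<otimes> LDual C X) (\<lambda>i. (h X i \<otimes>\<^sub>m k X i) \<cdot> (Idn C P \<otimes>\<^sub>m z)) (n X)"
      by (rule hsum_Comp[OF Pz]) (simp_all add: hk X)
    also have "\<dots> = hsum (P \<otimes> Z) (X \<otimes> LDual C X) (\<lambda>i. h X i \<otimes>\<^sub>m (k X i \<cdot> z)) (n X)"
      by (rule hsum_cong) (simp add: TensM_merge)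
    finally show ?thesis .
  qed
  have g1: "?g unit \<cdot> (Idn C P \<otimes>\<^sub>m z) = Zer C (P \<otimes> Z) (unit \<otimes> LDual C unit)"
    unfolding gz[OF Unit_Ob]
  proof (rule hsum_Zer)
    fix i assume i: "i < n unit"
    show "h unit i \<otimes>\<^sub>m (k unit i \<cdot> z) = Zer C (P \<otimes> Z) (unit \<otimes> LDual C unit)"
      using TensM_Zer[of "h unit i" Z "LDual C unit"] h[OF Unit_Ob i] by (simp add: kz[OF k[OF Unit_Ob i]] Hom_iff)
  qed simp_all
  have uz: "u \<cdot> (Idn C P \<otimes>\<^sub>m z) \<in> Hom C (P \<otimes> Z) EC" by (rule Comp_Hom[OF Pz u])
  have "?g D \<cdot> (Idn C P \<otimes>\<^sub>m z) = (t \<cdot> pC unit) \<cdot> (u \<cdot> (Idn C P \<otimes>\<^sub>m z))"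
    unfolding pu[OF D, symmetric] t(2)[symmetric] by (rule Comp_assoc[OF Pz u pC[OF D]])
  also have "\<dots> = t \<cdot> (pC unit \<cdot> (u \<cdot> (Idn C P \<otimes>\<^sub>m z)))" by (rule Comp_assoc[OF uz pC[OF Unit_Ob] t(1)])
  also have "pC unit \<cdot> (u \<cdot> (Idn C P \<otimes>\<^sub>m z)) = ?g unit \<cdot> (Idn C P \<otimes>\<^sub>m z)"
    unfolding pu[OF Unit_Ob, symmetric] by (rule Comp_assoc[OF Pz u pC[OF Unit_Ob], symmetric])
  also have "t \<cdot> (?g unit \<cdot> (Idn C P \<otimes>\<^sub>m z)) = Zer C (P \<otimes> Z) (D \<otimes> LDual C D)"
    unfolding g1 using t(1) by (simp add: Comp_Zer Hom_iff)
  finally have "\<forall>i<n D. k D i \<cdot> z = Zer C Z (LDual C D)"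
    unfolding gz[OF D] by (intro Tens_indep[OF ind[OF D] P D _ _ Comp_Hom[OF z k[OF D]]]) simp_all
  moreover obtain c where c: "y = hsum Q (LDual C D) (\<lambda>i. Scale C (c i) (k D i)) (n D)" using span[OF D y] by blast
  have "y \<cdot> z = hsum Z (LDual C D) (\<lambda>i. Scale C (c i) (k D i) \<cdot> z) (n D)"
    unfolding c by (rule hsum_Comp[OF z]) (simp_all add: Scale_Hom k)
  moreover have "Scale C (c i) (k D i) \<cdot> z = Scale C (c i) (k D i \<cdot> z)" if "i < n D" for i
    using Scale_Comp[OF z k[OF D that]] .
  ultimately show ?thesis by (simp add: hsum_Zer Scale_Zer)
qed

text \<open>Suppose a nonzero \<open>f\<close> kills all morphisms from the unit to
  \<open>Y\<close>. The cover \<open>Q\<close> of a simple quotient of the image of \<open>f\<close>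
  lifts to \<open>y : Q \<rightarrow> Y\<close>. The hypothesis forces a nonzero
  \<open>\<kappa>\<close> from \<open>Q\<close> to the unit and then a factorization of
  \<open>y\<close> through \<open>\<kappa>\<close>. So \<open>f \<cdot> y = 0\<close>, contrary to
  the choice of \<open>y\<close>.\<close>

lemma unit_sum_of_covers:
  assumes Y: "Y \<in> Ob C"
    and *: "\<And>T Q q Z z y. \<lbrakk>simple_object C T; proj_cover C Q q T; z \<in> Hom C Z Q;
      \<And>k. k \<in> Hom C Q unit \<Longrightarrow> k \<cdot> z = Zer C Z unit; y \<in> Hom C Q Y\<rbrakk> \<Longrightarrow> y \<cdot> z = Zer C Z Y"
  shows "\<exists>n i r. unit_sum unit Y n i r"
proof (rule unit_sum_of_generated[OF Y])
  fix B f assume f: "f \<in> Hom C Y B" and fi: "\<And>i. i \<in> Hom C unit Y \<Longrightarrow> f \<cdot> i = Zer C unit B"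
  show "f = Zer C Y B"
  proof (rule ccontr)
    assume nz: "f \<noteq> Zer C Y B"
    obtain I e m where e: "e \<in> Hom C Y I" "epi_arrow C e" and m: "m \<in> Hom C I B" "mono_arrow C m" and fme: "f = m \<cdot> e"
      using imageE[OF f] .
    have [simp]: "f \<in> Ar C" "Dom C f = Y" "Cod C f = B" "e \<in> Ar C" "Dom C e = Y" "Cod C e = I" "m \<in> Ar C" "Dom C m = I" "Cod C m = B"
      "Y \<in> Ob C" "B \<in> Ob C" "I \<in> Ob C"
      using f e m Hom_Ob by (auto simp: Hom_iff)
    have "\<not> is_zero_object C I"
    proof
      assume "is_zero_object C I"
      then have "e = Zer C Y I" using e(1) zero_Hom_to[of I e Y] by simp
      then show False using nz by (simp add: fme Comp_Zer)
    qed
    then obtain T g where T: "simple_object C T" and g: "g \<in> Hom C I T" "epi_arrow C g"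
      using finite_length_simple_quotient[OF all_finite_length] by (metis \<open>I \<in> Ob C\<close>)
    obtain Q q where q: "proj_cover C Q q T" using ex_proj_cover[OF T] .
    have Qp: "projective C Q" and qH: "q \<in> Hom C Q T" and q0: "q \<noteq> Zer C Q T" using q by (auto simp: proj_cover_def)
    have [simp]: "g \<in> Ar C" "Dom C g = I" "Cod C g = T" "T \<in> Ob C" "Q \<in> Ob C" "q \<in> Ar C" "Dom C q = Q" "Cod C q = T"
      using g qH Hom_Ob by (auto simp: Hom_iff)
    obtain y where y: "y \<in> Hom C Q Y" "(g \<cdot> e) \<cdot> y = q"
    proof (rule projective_lift[OF Qp _ _ qH])
      show "epi_arrow C (g \<cdot> e)" by (rule epi_Comp) (use e g in simp_all)
      show "g \<cdot> e \<in> Hom C Y T" by (simp add: Hom_iff)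
    qed
    have [simp]: "y \<in> Ar C" "Dom C y = Q" "Cod C y = Y" using y(1) by (auto simp: Hom_iff)
    have y0: "e \<cdot> y \<noteq> Zer C Q I"
    proof
      assume "e \<cdot> y = Zer C Q I"
      then have "q = Zer C Q T" using y(2) by (simp add: Comp_Zer)
      then show False using q0 by simp
    qed
    \<comment> \<open>Otherwise the hypothesis would apply with the identity of \<open>Q\<close> as
      \<open>z\<close> and make \<open>y\<close> zero.\<close>
    have "\<exists>\<kappa> \<in> Hom C Q unit. \<kappa> \<noteq> Zer C Q unit"
    proof (rule ccontr)
      assume no: "\<not> ?thesis"
      have "y \<cdot> Idn C Q = Zer C Q Y"
      proof (rule *[OF T q Idn_Hom _ y(1)])
        show "k \<cdot> Idn C Q = Zer C Q unit" if "k \<in> Hom C Q unit" for k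
          using no that Comp_Idn[OF that] by auto
      qed simp
      then show False using y0 by (simp add: Comp_Zer)
    qed
    then obtain \<kappa> where \<kappa>: "\<kappa> \<in> Hom C Q unit" "\<kappa> \<noteq> Zer C Q unit" by blast
    note \<kappa>e = Hom_Unit_epi[OF \<kappa>]
    have [simp]: "\<kappa> \<in> Ar C" "Dom C \<kappa> = Q" "Cod C \<kappa> = unit" using \<kappa>(1) by (auto simp: Hom_iff)
    obtain Z z where z: "z \<in> Hom C Z Q" and \<kappa>z: "\<kappa> \<cdot> z = Zer C Z unit"
      and z_uni: "\<And>W l. \<lbrakk>l \<in> Hom C W Q; \<kappa> \<cdot> l = Zer C W unit\<rbrakk> \<Longrightarrow> \<exists>v\<in>Hom C W Z. z \<cdot> v = l"
      using kernelE[OF \<kappa>(1)] by metis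
    have [simp]: "z \<in> Ar C" "Dom C z = Z" "Cod C z = Q" "Z \<in> Ob C" using z Hom_Ob by (auto simp: Hom_iff)
    have unz: "\<not> is_zero_object C unit" using Unit_simple by (simp add: simple_object_def)
    \<comment> \<open>Since \<open>Q\<close> covers \<open>T\<close>, the morphism \<open>q\<close>
      factors through \<open>\<kappa>\<close>, and likewise through every other nonzero
      \<open>\<kappa>'\<close>, there followed by a mono \<open>s'\<close>. Hence all
      \<open>\<kappa>'\<close> kill the kernel \<open>z\<close> of \<open>\<kappa>\<close>, and the
      hypothesis applies to \<open>z\<close>.\<close>
    obtain s where s: "s \<in> Hom C unit T" "s \<cdot> \<kappa> = q" using proj_cover_factor[OF q T \<kappa>(1) \<kappa>e unz] .
    have qz: "q \<cdot> z = Zer C Z T"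
      using Comp_assoc[OF z \<kappa>(1) s(1)] s(1) by (simp add: s(2) \<kappa>z Comp_Zer Hom_iff)
    have "y \<cdot> z = Zer C Z Y"
    proof (rule *[OF T q z _ y(1)])
      fix \<kappa>' assume \<kappa>': "\<kappa>' \<in> Hom C Q unit"
      show "\<kappa>' \<cdot> z = Zer C Z unit"
      proof (cases "\<kappa>' = Zer C Q unit")
        case True
        then show ?thesis by (simp add: Zer_Comp)
      next
        case False
        obtain s' where s': "s' \<in> Hom C unit T" "s' \<cdot> \<kappa>' = q"
          using proj_cover_factor[OF q T \<kappa>' Hom_Unit_epi[OF \<kappa>' False] unz] .
        have "s' \<noteq> Zer C unit T"
        proof
          assume "s' = Zer C unit T"
          then have "q = Zer C Q T" using s'(2) \<kappa>' by (simp add: Zer_Comp Hom_iff)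
          then show False using q0 by simp
        qed
        then have mono: "mono_arrow C s'" using Hom_simple_mono[OF Unit_simple s'(1)] by simp
        have "s' \<cdot> (\<kappa>' \<cdot> z) = Zer C Z T" using Comp_assoc[OF z \<kappa>' s'(1)] qz s'(2) by simp
        then show ?thesis
          using mono_ZerD[of s' "\<kappa>' \<cdot> z" Z] mono s'(1) Comp_Hom[OF z \<kappa>'] by (simp add: Hom_iff)
      qed
    qed
    then obtain i where i: "i \<in> Hom C unit Y" "i \<cdot> \<kappa> = y" using epi_cokernel_of_kernel[OF \<kappa>e \<kappa>(1) z z_uni y(1)] by blast
    have "f \<cdot> y = (f \<cdot> i) \<cdot> \<kappa>" unfolding i(2)[symmetric] by (rule Comp_assoc[OF \<kappa>(1) i(1) f, symmetric])
    also have "\<dots> = Zer C Q B" unfolding fi[OF i(1)] using \<kappa>(1) by (simp add: Zer_Comp Hom_iff)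
    finally have "m \<cdot> (e \<cdot> y) = Zer C Q B" by (simp add: fme)
    then have "e \<cdot> y = Zer C Q I" using mono_ZerD[of m "e \<cdot> y" Q] m by (simp add: Hom_iff)
    then show False using y0 by simp
  qed
qed

end

section \<open>From nondegeneracy to the symmetric center\<close>

context braided_module_category
begin

text \<open>Composed with \<open>g\<close>, the projections of the end form a wedge on
  \<open>W\<close>, and its mediating morphism is unique.\<close>

lemma module_end_unique:
  assumes ih: "is_internal_hom C M H ev" and e: "is_module_end C M H ev EM pM"
    and g: "g \<in> Hom C W EM" "g' \<in> Hom C W EM"
    and eq: "\<And>A. A \<in> Ob M \<Longrightarrow> pM A \<cdot>\<^bsub>C\<^esub> g = pM A \<cdot>\<^bsub>C\<^esub> g'"
  shows "g = g'"
proof -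
  have pM: "pM A \<in> Hom C EM (H A A)" if "A \<in> Ob M" for A
    using e that unfolding is_module_end_def is_end_def is_wedge_def by blast
  have W: "W \<in> Ob C" using g C.Hom_Ob by blast
  have "is_wedge M C H (ihom_map C M H ev) W (\<lambda>A. pM A \<cdot>\<^bsub>C\<^esub> g)"
    unfolding is_wedge_def
  proof (intro conjI ballI W)
    show "pM A \<cdot>\<^bsub>C\<^esub> g \<in> Hom C W (H A A)" if "A \<in> Ob M" for A by (rule C.Comp_Hom[OF g(1) pM[OF that]])
    fix A B f assume A: "A \<in> Ob M" and B: "B \<in> Ob M" and f: "f \<in> Hom M A B"
    have "ihom_map C M H ev (Idn M A) f \<cdot>\<^bsub>C\<^esub> pM A = ihom_map C M H ev f (Idn M B) \<cdot>\<^bsub>C\<^esub> pM B"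
      using e A B f unfolding is_module_end_def is_end_def is_wedge_def by blast
    then show "ihom_map C M H ev (Idn M A) f \<cdot>\<^bsub>C\<^esub> (pM A \<cdot>\<^bsub>C\<^esub> g) = ihom_map C M H ev f (Idn M B) \<cdot>\<^bsub>C\<^esub> (pM B \<cdot>\<^bsub>C\<^esub> g)"
      unfolding C.Comp_assoc[OF g(1) pM[OF A] ihom_map_Hom[OF ih M.Idn_Hom[OF A] f], symmetric]
        C.Comp_assoc[OF g(1) pM[OF B] ihom_map_Hom[OF ih f M.Idn_Hom[OF B]], symmetric] by (rule arg_cong)
  qed
  then have "\<exists>!u. u \<in> Hom C W EM \<and> (\<forall>A \<in> Ob M. pM A \<cdot>\<^bsub>C\<^esub> u = pM A \<cdot>\<^bsub>C\<^esub> g)"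
    using e unfolding is_module_end_def is_end_def by blast
  then show ?thesis using g eq by metis
qed

context
  fixes H :: "'p \<Rightarrow> 'p \<Rightarrow> 'o" and ev :: "'p \<Rightarrow> 'p \<Rightarrow> 'n" and EC EM :: 'o and pC :: "'o \<Rightarrow> 'm"
    and pM :: "'p \<Rightarrow> 'm" and w :: 'm
  assumes ih: "is_internal_hom C M H ev" and te: "is_tensor_end C EC pC" and me: "is_module_end C M H ev EM pM"
    and uc: "is_universal_copairing C M H ev EC pC EM pM w" and nd: "nondegenerate C EC EM w"
begin

text \<open>The module braiding is trivial on the duals of \<open>D\<close> and of the unit, so the
  components of \<open>w\<close> at these two objects differ only in their coevaluations, which
  \<open>?t\<close> relates. Both morphisms out of \<open>EC\<close> thus agree after
  \<open>w\<close> and every \<open>pM A\<close>, and \<open>copairing_inject\<close>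
  concludes.\<close>

lemma tensor_end_projection_trivial:
  assumes D: "D \<in> Ob C" and eD: "\<And>A. A \<in> Ob M \<Longrightarrow> MBraid M (LDual C D) A = Idn M (LDual C D \<triangleright>\<^bsub>M\<^esub> A)"
  shows "pC D = (Coev C D \<cdot>\<^bsub>C\<^esub> Inv C (Coev C (Unit C))) \<cdot>\<^bsub>C\<^esub> pC (Unit C)"
proof -
  let ?I = "Unit C" and ?t = "Coev C D \<cdot>\<^bsub>C\<^esub> Inv C (Coev C (Unit C))"
  note [simp] = C.left_dualD(2-8)[OF C.left_dual] D C.iso_Coev_Unit ihom_Ob[OF ih]
  have EC [simp]: "EC \<in> Ob C" and EM [simp]: "EM \<in> Ob C"
    using te me unfolding is_tensor_end_def is_module_end_def is_end_def is_wedge_def by blast+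
  have w: "w \<in> Hom C ?I (EC \<otimes>\<^bsub>C\<^esub> EM)" using uc unfolding is_universal_copairing_def by blast
  have [simp]: "w \<in> Ar C" "Dom C w = ?I" "Cod C w = EC \<otimes>\<^bsub>C\<^esub> EM" using w by (auto simp: C.Hom_iff)
  have pC: "pC X \<in> Hom C EC (X \<otimes>\<^bsub>C\<^esub> LDual C X)" if "X \<in> Ob C" for X
    using te that unfolding is_tensor_end_def is_end_def is_wedge_def by blast
  have [simp]: "pC X \<in> Ar C" "Dom C (pC X) = EC" "Cod C (pC X) = X \<otimes>\<^bsub>C\<^esub> LDual C X" if "X \<in> Ob C" for X
    using pC[OF that] by (auto simp: C.Hom_iff)
  have pM: "pM A \<in> Hom C EM (H A A)" if "A \<in> Ob M" for A
    using me that unfolding is_module_end_def is_end_def is_wedge_def by blast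
  have [simp]: "pM A \<in> Ar C" "Dom C (pM A) = EM" "Cod C (pM A) = H A A" if "A \<in> Ob M" for A
    using pM[OF that] by (auto simp: C.Hom_iff)
  have [simp]: "ihom_coev C M H ev A \<in> Ar C" "Dom C (ihom_coev C M H ev A) = ?I" "Cod C (ihom_coev C M H ev A) = H A A"
    if "A \<in> Ob M" for A using ihom_coev_Hom[OF ih that] by (auto simp: C.Hom_iff)
  let ?V = "D \<otimes>\<^bsub>C\<^esub> LDual C D"
  note dV = C.left_dual[of ?V]
  have uc': "(pC X \<otimes>\<^sub>m\<^bsub>C\<^esub> pM A) \<cdot>\<^bsub>C\<^esub> w = copairing_component C M H ev X A" if "X \<in> Ob C" "A \<in> Ob M" for X A
    using uc that unfolding is_universal_copairing_def by blast
  have e1: "MBraid M (LDual C ?I) A = Idn M (LDual C ?I \<triangleright>\<^bsub>M\<^esub> A)" if A: "A \<in> Ob M" for A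
  proof -
    obtain a where a: "a \<in> Hom C (LDual C ?I) ?I" "iso C a" using C.LDual_Unit .
    have [simp]: "a \<in> Ar C" "Dom C a = LDual C ?I" "Cod C a = ?I" using a by (auto simp: C.Hom_iff)
    show ?thesis
      by (rule MBraid_Idn_iso[where s = "Inv C a", OF _ _ A MBraid_Unit[OF A]]) (use a in \<open>simp_all add: C.Hom_iff\<close>)
  qed
  have tw: "((?t \<cdot>\<^bsub>C\<^esub> pC ?I) \<otimes>\<^sub>m\<^bsub>C\<^esub> pM A) \<cdot>\<^bsub>C\<^esub> w = (pC D \<otimes>\<^sub>m\<^bsub>C\<^esub> pM A) \<cdot>\<^bsub>C\<^esub> w" if A [simp]: "A \<in> Ob M" for A
  proof -
    have "((?t \<cdot>\<^bsub>C\<^esub> pC ?I) \<otimes>\<^sub>m\<^bsub>C\<^esub> pM A) \<cdot>\<^bsub>C\<^esub> w = (?t \<otimes>\<^sub>m\<^bsub>C\<^esub> Idn C (H A A)) \<cdot>\<^bsub>C\<^esub> ((pC ?I \<otimes>\<^sub>m\<^bsub>C\<^esub> pM A) \<cdot>\<^bsub>C\<^esub> w)"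
      by (simp add: C.TensM_merge')
    also have "\<dots> = (?t \<otimes>\<^sub>m\<^bsub>C\<^esub> Idn C (H A A)) \<cdot>\<^bsub>C\<^esub> ((Coev C ?I \<otimes>\<^sub>m\<^bsub>C\<^esub> ihom_coev C M H ev A) \<cdot>\<^bsub>C\<^esub> Inv C (LUnit C ?I))"
      unfolding uc'[OF C.Unit_Ob A] copairing_component_trivial[OF ih C.Unit_Ob A e1[OF A]] ..
    also have "\<dots> = (Coev C D \<otimes>\<^sub>m\<^bsub>C\<^esub> ihom_coev C M H ev A) \<cdot>\<^bsub>C\<^esub> Inv C (LUnit C ?I)"
      by (simp add: C.TensM_merge')
    also have "\<dots> = (pC D \<otimes>\<^sub>m\<^bsub>C\<^esub> pM A) \<cdot>\<^bsub>C\<^esub> w"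
      unfolding uc'[OF D A] copairing_component_trivial[OF ih D A eD[OF A]] ..
    finally show ?thesis .
  qed
  have "(pC D \<otimes>\<^sub>m\<^bsub>C\<^esub> Idn C EM) \<cdot>\<^bsub>C\<^esub> w = ((?t \<cdot>\<^bsub>C\<^esub> pC ?I) \<otimes>\<^sub>m\<^bsub>C\<^esub> Idn C EM) \<cdot>\<^bsub>C\<^esub> w" (is "?a = ?b")
  \<comment> \<open>\<open>?V \<otimes> EM\<close> is not itself given as an end. Currying
    \<open>?V\<close> away leaves morphisms into \<open>EM\<close>, which the projections
    \<open>pM A\<close> separate.\<close>
  proof (rule C.lcurry_inject[OF dV])
    show a: "?a \<in> Hom C ?I (?V \<otimes>\<^bsub>C\<^esub> EM)" and b: "?b \<in> Hom C ?I (?V \<otimes>\<^bsub>C\<^esub> EM)" by (simp_all add: C.Hom_iff)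
    let ?c = "C.lcurry ?V (LDual C ?V) (Ev C ?V)"
    have ca: "?c EM ?a \<in> Hom C (LDual C ?V \<otimes>\<^bsub>C\<^esub> ?I) EM" and cb: "?c EM ?b \<in> Hom C (LDual C ?V \<otimes>\<^bsub>C\<^esub> ?I) EM"
      using C.lcurry_Hom[OF dV a] C.lcurry_Hom[OF dV b] by simp_all
    show "?c EM ?a = ?c EM ?b"
    proof (rule module_end_unique[OF ih me ca cb])
      fix A assume A [simp]: "A \<in> Ob M"
      have "pM A \<cdot>\<^bsub>C\<^esub> ?c EM ?a = ?c (H A A) ((Idn C ?V \<otimes>\<^sub>m\<^bsub>C\<^esub> pM A) \<cdot>\<^bsub>C\<^esub> ?a)"
        by (rule C.lcurry_Tens_Comp[OF dV a pM[OF A], symmetric]) simp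
      also have "(Idn C ?V \<otimes>\<^sub>m\<^bsub>C\<^esub> pM A) \<cdot>\<^bsub>C\<^esub> ?a = (Idn C ?V \<otimes>\<^sub>m\<^bsub>C\<^esub> pM A) \<cdot>\<^bsub>C\<^esub> ?b"
        using tw[OF A] by (simp add: C.TensM_merge')
      also have "?c (H A A) ((Idn C ?V \<otimes>\<^sub>m\<^bsub>C\<^esub> pM A) \<cdot>\<^bsub>C\<^esub> ?b) = pM A \<cdot>\<^bsub>C\<^esub> ?c EM ?b"
        by (rule C.lcurry_Tens_Comp[OF dV b pM[OF A]]) simp
      finally show "pM A \<cdot>\<^bsub>C\<^esub> ?c EM ?a = pM A \<cdot>\<^bsub>C\<^esub> ?c EM ?b" .
    qed
  qed simp_all
  then show ?thesis by (rule C.copairing_inject[OF EC EM w nd pC[OF D], rotated]) (simp add: C.Hom_iff)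
qed

text \<open>The component of the copairing at \<open>D\<close> involves the module braiding on the
  left dual of \<open>D\<close>. So \<open>D\<close> is taken to be a right dual of
  \<open>Y\<close>, and the isomorphism \<open>s\<close> between \<open>Y\<close> and
  \<open>LDual C D\<close> transports the hypothesis there and the result back.\<close>

lemma unit_sum_of_trivial_braiding:
  assumes Y: "Y \<in> Ob C" and eY: "\<And>A. A \<in> Ob M \<Longrightarrow> MBraid M Y A = Idn M (Y \<triangleright>\<^bsub>M\<^esub> A)"
  shows "\<exists>n i r. C.unit_sum (Unit C) Y n i r"
proof -
  obtain D e c where d: "is_left_dual C D Y e c" using C.ex_right_dual[OF Y] by blast
  have D: "D \<in> Ob C" using C.left_dualD(1)[OF d] .
  note dD = C.left_dual[OF D]
  obtain s where s: "s \<in> Hom C Y (LDual C D)" "iso C s" using C.left_dual_unique[OF d dD] .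
  obtain a where a: "a \<in> Hom C (LDual C (Unit C)) (Unit C)" "iso C a" using C.LDual_Unit .
  have p: "pC D = (Coev C D \<cdot>\<^bsub>C\<^esub> Inv C (Coev C (Unit C))) \<cdot>\<^bsub>C\<^esub> pC (Unit C)"
    by (rule tensor_end_projection_trivial[OF D MBraid_Idn_iso[OF s _ eY]])
  note [simp] = C.left_dualD(2-8)[OF C.left_dual] D C.iso_Coev_Unit
  have t: "Coev C D \<cdot>\<^bsub>C\<^esub> Inv C (Coev C (Unit C)) \<in> Hom C (Unit C \<otimes>\<^bsub>C\<^esub> LDual C (Unit C)) (D \<otimes>\<^bsub>C\<^esub> LDual C D)"
    by (simp add: C.Hom_iff)
  have "\<exists>n i r. C.unit_sum (Unit C) (LDual C D) n i r"
  proof (rule C.unit_sum_of_covers)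
    fix T Q q Z z y
    assume T: "simple_object C T" and q: "proj_cover C Q q T" and z: "z \<in> Hom C Z Q"
      and kz: "\<And>k. k \<in> Hom C Q (Unit C) \<Longrightarrow> k \<cdot>\<^bsub>C\<^esub> z = Zer C Z (Unit C)" and y: "y \<in> Hom C Q (LDual C D)"
    show "y \<cdot>\<^bsub>C\<^esub> z = Zer C Z (LDual C D)"
    proof (rule C.tensor_end_factor_kernel[OF te D t p T q z _ y])
      fix k assume k: "k \<in> Hom C Q (LDual C (Unit C))"
      have "a \<cdot>\<^bsub>C\<^esub> (k \<cdot>\<^bsub>C\<^esub> z) = Zer C Z (Unit C)"
        using C.Comp_assoc[OF z k a(1)] kz[OF C.Comp_Hom[OF k a(1)]] by simp
      then show "k \<cdot>\<^bsub>C\<^esub> z = Zer C Z (LDual C (Unit C))"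
        using C.mono_ZerD[of a "k \<cdot>\<^bsub>C\<^esub> z" Z] C.iso_mono[OF a(2)] C.Comp_Hom[OF z k] a(1) by (simp add: C.Hom_iff)
    qed
  qed simp
  then obtain n i r where us: "C.unit_sum (Unit C) (LDual C D) n i r" by blast
  have "Inv C s \<in> Hom C (LDual C D) Y" "iso C (Inv C s)" using s by (auto simp: C.Hom_iff)
  from C.unit_sum_iso[OF us this] show ?thesis by blast
qed

lemma trivial_symmetric_center_of_nondegenerate: "trivial_symmetric_center C M"
  unfolding trivial_symmetric_center_def symmetric_center_def
proof (rule C.linearly_equivalent_FdVec[where U = "Unit C"])
  show "Idn C (Unit C) \<noteq> Zer C (Unit C) (Unit C)" by (rule C.Idn_Unit_nonzero)
  show "\<exists>a. f = Scale C a (Idn C (Unit C))" if "f \<in> Hom C (Unit C) (Unit C)" for f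
    using C.End_Unit_scalar[OF that] by metis
  show "\<exists>n i r. C.unit_sum (Unit C) X n i r" if "X \<in> {X \<in> Ob C. \<forall>A \<in> Ob M. MBraid M X A = Idn M (X \<triangleright>\<^bsub>M\<^esub> A)}" for X
    using that unit_sum_of_trivial_braiding[of X] by simp
  show "\<exists>X \<in> {X \<in> Ob C. \<forall>A \<in> Ob M. MBraid M X A = Idn M (X \<triangleright>\<^bsub>M\<^esub> A)}. \<exists>i r. C.unit_sum (Unit C) X n i r" for n
  proof -
    obtain X i r where us: "C.unit_sum (Unit C) X n i r" using C.ex_unit_sum[OF C.Unit_Ob] by metis
    then have "X \<in> Ob C" by (simp add: C.unit_sum_def)
    then show ?thesis using us MBraid_unit_sum[OF us] by blast
  qed
qed blast

end

end

theorem theorem1p5: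
  fixes C :: "('o, 'm, 'k::alg_closed_field) braided_cat"
    and M :: "('p, 'n, 'k, 'o, 'm) braided_module_cat"
    and H :: "'p \<Rightarrow> 'p \<Rightarrow> 'o" and ev :: "'p \<Rightarrow> 'p \<Rightarrow> 'n"
    and EC EM :: 'o and pC :: "'o \<Rightarrow> 'm" and pM :: "'p \<Rightarrow> 'm" and w :: 'm
  assumes "braided_finite_tensor_category C"
    and "braided_module_category C M"
    and "nonzero_category M"
    and "exact_module_category C M"
    and "indecomposable_module_category C M"
    and "is_internal_hom C M H ev"
    and "is_tensor_end C EC pC"
    and "is_module_end C M H ev EM pM"
    and "is_universal_copairing C M H ev EC pC EM pM w"
    and "nondegenerate C EC EM w"
  shows "weakly_factorizable C EC EM w \<and> trivial_symmetric_center C M"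
proof
  interpret braided_module_category C M by fact
  have "EC \<in> Ob C" "EM \<in> Ob C"
    using assms(7,8) unfolding is_tensor_end_def is_module_end_def is_end_def is_wedge_def by blast+
  then show "weakly_factorizable C EC EM w"
    using assms(9,10) unfolding is_universal_copairing_def
    by (intro C.nondegenerate_weakly_factorizable) blast+
  show "trivial_symmetric_center C M"
    by (rule trivial_symmetric_center_of_nondegenerate) fact+
qed

end
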